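(* Let $\Omega\subset\mathbb{R}^d$ be a bounded open interval when $d=1$, or a bounded connected $C^{1,1}$ open set when $d\ge2$. Let $(W_t)_{t\ge0}$ be a Brownian motion in $\mathbb{R}^d$ independent of a subordinator $(D_t)_{t\ge0}$ with Laplace exponent of the form $\phi(\lambda)=\lambda^{1/2}+\phi_1(\lambda)$, where $\phi_1$ is the Laplace exponent of a subordinator whose Lévy measure has an almost monotone density and $\phi_1$ is regularly varying at $\infty$ with index $\beta_1\in(0,\tfrac12)$. Then $$\lim_{t\downarrow0}\frac{|\Omega|-\tilde Q^{W\circ D}_\Omega(t)}{t\log(1/t)}=\frac{2|\partial\Omega|}{\pi}.$$
   Context: Brownian motion: $(W_t)$ is normalized so that $\mathbb{E}_0[e^{-i\langle\xi,W_t\rangle}]=e^{-t|\xi|^2}$ (generator $\Delta$). Under $\mathbb{P}_x$ (the product of the law of $W$ started at $x$ and the law of the independent time change) $W_0=x$. Heat content: $\tau^W_\Omega=\inf\{t>0: W_t\in\Omega^c\}$. The killed process is $W^\Omega_t=W_t$ for $t<\tau^W_\Omega$ and $W^\Omega_t=\partial$ (a cemetery state, not in $\Omega$) for $t\ge\tau^W_\Omega$. The spectral heat content of the subordinate killed process $(W^\Omega_{D_t})$ is $\tilde Q^{W\circ D}_\Omega(t)=\int_\Omega\mathbb{P}_x(\tau^{W^\Omega\circ D}_\Omega>t)\,dx$, where $\tau^{W^\Omega\circ D}_\Omega=\inf\{t>0: W^\Omega_{D_t}\notin\Omega\}$. $|\Omega|$ is $d$-dimensional Lebesgue measure and $|\partial\Omega|$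 is the $(d-1)$-dimensional measure of the boundary (number of boundary points when $d=1$). Subordinator: a subordinator $(D_t)$ with Laplace exponent $\phi$ is a strictly increasing one-dimensional Lévy process with càdlàg paths, $D_0=0$, killing rate $0$, drift $0$, and infinite Lévy measure $\nu$ ($\nu((0,\infty))=\infty$, $\int_0^\infty(y\wedge1)\,\nu(dy)<\infty$), with $\mathbb{E}[e^{-sD_t}]=e^{-t\phi(s)}$, $\phi(s)=\int_0^\infty(1-e^{-sy})\,\nu(dy)$. A function $f:(0,\infty)\to(0,\infty)$ is regularly varying at $\infty$ with index $\rho$ if $f(cs)/f(s)\to c^\rho$ as $s\to\infty$ for each $c>0$. The Lévy measure has an almost monotone density if $\nu(dx)=\nu(x)\,dx$ and there is $C\ge1$ with $\nu(y)\le C\nu(x)$ for all $0<x\le y$. *)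

theory Defs
  imports "HOL-Probability.Probability"
begin

section \<open>Levy processes, Brownian motion, subordinators\<close>

definition cadlag :: "(real \<Rightarrow> 'b::topological_space) \<Rightarrow> bool" where
  "cadlag f \<longleftrightarrow>
     (\<forall>t\<ge>0. (f \<longlongrightarrow> f t) (at_right t)) \<and> (\<forall>t>0. \<exists>l. (f \<longlongrightarrow> l) (at_left t))"

text \<open>Processes are indexed by \<^typ>\<open>real\<close>; only times \<open>t \<ge> 0\<close> are constrained. The initial value
  is left free, so that the notion applies under a law started at an arbitrary point.\<close>

definition levy_process :: "'w measure \<Rightarrow> (real \<Rightarrow> 'w \<Rightarrow> 'b::euclidean_space) \<Rightarrow> bool" where
  "levy_process M X \<longleftrightarrow>
     prob_space M \<and>
     (\<forall>t\<ge>0. X t \<in> borel_measurable M) \<and>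
     (\<forall>n (ts::nat \<Rightarrow> real). 0 \<le> ts 0 \<longrightarrow> mono ts \<longrightarrow>
        prob_space.indep_vars M (\<lambda>_. borel) (\<lambda>i \<omega>. X (ts (Suc i)) \<omega> - X (ts i) \<omega>) {..<n}) \<and>
     (\<forall>s\<ge>0. \<forall>h\<ge>0. distr M borel (\<lambda>\<omega>. X (s + h) \<omega> - X s \<omega>)
                     = distr M borel (\<lambda>\<omega>. X h \<omega> - X 0 \<omega>)) \<and>
     (\<forall>\<omega>\<in>space M. cadlag (\<lambda>t. X t \<omega>))"

text \<open>Brownian motion started at \<open>x\<close>, normalized to have generator \<open>\<Delta>\<close> (not \<open>\<Delta>/2\<close>).\<close>

definition brownian_motion ::
    "'w measure \<Rightarrow> 'a::euclidean_space \<Rightarrow> (real \<Rightarrow> 'w \<Rightarrow> 'a) \<Rightarrow> bool" where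
  "brownian_motion M x W \<longleftrightarrow>
     levy_process M W \<and>
     (AE \<omega> in M. W 0 \<omega> = x) \<and>
     (\<forall>t\<ge>0. \<forall>\<xi>. (CLINT \<omega>|M. iexp (- (\<xi> \<bullet> (W t \<omega> - x)))) = exp (- complex_of_real (t * (norm \<xi>)\<^sup>2))) \<and>
     (\<forall>\<omega>\<in>space M. continuous_on {0..} (\<lambda>t. W t \<omega>))"

definition infinite_levy_measure :: "real measure \<Rightarrow> bool" where
  "infinite_levy_measure \<nu> \<longleftrightarrow>
     sets \<nu> = sets borel \<and> emeasure \<nu> {..0} = 0 \<and> emeasure \<nu> {0<..} = \<infinity> \<and>
     (\<integral>\<^sup>+y\<in>{0<..}. ennreal (min y 1) \<partial>\<nu>) < \<infinity>"

text \<open>\<open>D\<close> is a subordinator with Laplace exponent \<open>\<phi>\<close> and Levy measure \<open>\<nu>\<close>. Killing rate zero and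
  drift zero are expressed by \<open>D\<close> being real-valued and by the integral formula for \<open>\<phi>\<close>.\<close>

definition subordinator ::
    "'w measure \<Rightarrow> (real \<Rightarrow> 'w \<Rightarrow> real) \<Rightarrow> (real \<Rightarrow> real) \<Rightarrow> real measure \<Rightarrow> bool" where
  "subordinator M D \<phi> \<nu> \<longleftrightarrow>
     levy_process M D \<and>
     (\<forall>\<omega>\<in>space M. D 0 \<omega> = 0 \<and> strict_mono_on {0..} (\<lambda>t. D t \<omega>)) \<and>
     infinite_levy_measure \<nu> \<and>
     (\<forall>s>0. \<phi> s = (LINT y:{0<..}|\<nu>. 1 - exp (- s * y))) \<and>
     (\<forall>s>0. \<forall>t\<ge>0. (LINT \<omega>|M. exp (- s * D t \<omega>)) = exp (- t * \<phi> s))"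

definition almost_monotone_density :: "real measure \<Rightarrow> bool" where
  "almost_monotone_density \<nu> \<longleftrightarrow>
     (\<exists>f C. f \<in> borel_measurable borel \<and> (\<forall>x>0. 0 \<le> f x) \<and>
        \<nu> = density lborel (\<lambda>x. ennreal (f x) * indicator {0<..} x) \<and>
        C \<ge> (1::real) \<and> (\<forall>x y. 0 < x \<longrightarrow> x \<le> y \<longrightarrow> f y \<le> C * f x))"

definition regularly_varying_at_top :: "(real \<Rightarrow> real) \<Rightarrow> real \<Rightarrow> bool" where
  "regularly_varying_at_top f \<rho> \<longleftrightarrow>
     (\<forall>s>0. 0 < f s) \<and> (\<forall>c>0. ((\<lambda>s. f (c * s) / f s) \<longlongrightarrow> c powr \<rho>) at_top)"

text \<open>The \<open>\<sigma>\<close>-algebra generated by the whole process. Independence of two processes is stated through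
  it because \<^const>\<open>prob_space.indep_var\<close> requires both variables to have the same value type.\<close>

definition process_events ::
    "'w measure \<Rightarrow> (real \<Rightarrow> 'w \<Rightarrow> 'b::topological_space) \<Rightarrow> 'w set set" where
  "process_events M X =
     sets (vimage_algebra (space M) (\<lambda>\<omega>. \<lambda>t\<in>{0..}. X t \<omega>) (\<Pi>\<^sub>M t\<in>{0..}. borel))"

definition independent_processes ::
    "'w measure \<Rightarrow> (real \<Rightarrow> 'w \<Rightarrow> 'b::topological_space) \<Rightarrow> (real \<Rightarrow> 'w \<Rightarrow> 'c::topological_space)
       \<Rightarrow> bool" where
  "independent_processes M X Y \<longleftrightarrow>
     prob_space.indep_set M (process_events M X) (process_events M Y)"


section \<open>Spectral heat content\<close>

definition exit_time :: "'b set \<Rightarrow> (real \<Rightarrow> 'b) \<Rightarrow> ereal" where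
  "exit_time B p = (INF t\<in>{t. 0 < t \<and> p t \<notin> B}. ereal t)"

text \<open>The cemetery state is \<^const>\<open>None\<close>.\<close>

definition killed_path :: "'b set \<Rightarrow> (real \<Rightarrow> 'b) \<Rightarrow> real \<Rightarrow> 'b option" where
  "killed_path B p t = (if ereal t < exit_time B p then Some (p t) else None)"

text \<open>\<open>P x\<close> is the law under which \<open>W\<close> starts at \<open>x\<close>.\<close>

definition spectral_heat_content ::
    "('a::euclidean_space \<Rightarrow> 'w measure) \<Rightarrow> (real \<Rightarrow> 'w \<Rightarrow> 'a) \<Rightarrow> (real \<Rightarrow> 'w \<Rightarrow> real)
       \<Rightarrow> 'a set \<Rightarrow> real \<Rightarrow> real" where
  "spectral_heat_content P W D \<Omega> t =
     (LINT x:\<Omega>|lborel. measure (P x)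
        {\<omega>\<in>space (P x).
           ereal t < exit_time (Some ` \<Omega>) (\<lambda>s. killed_path \<Omega> (\<lambda>u. W u \<omega>) (D s \<omega>))})"


section \<open>Geometry of the domain\<close>

text \<open>\<open>C\<^sup>1\<^sup>,\<^sup>1\<close> open sets with uniform characteristics \<open>R\<close>, \<open>L\<close>. At a boundary point \<open>z\<close> an orthonormal
  coordinate system centred at \<open>z\<close> is given, up to the choice of an orthonormal basis of the
  hyperplane orthogonal to it, by the unit vector \<open>n\<close> along its last axis. The graph function
  \<open>\<psi>\<close> lives on that hyperplane \<open>H \<cong> \<real>\<^sup>d\<^sup>-\<^sup>1\<close>, \<open>g\<close> is its gradient, and \<open>y - z\<close> has last
  coordinate \<open>(y - z) \<bullet> n\<close>.\<close>

definition C11_open_set :: "'a::euclidean_space set \<Rightarrow> bool" where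
  "C11_open_set \<Omega> \<longleftrightarrow>
     open \<Omega> \<and>
     (\<exists>R>0. \<exists>L>0. \<forall>z\<in>frontier \<Omega>. \<exists>(n::'a) (\<psi>::'a \<Rightarrow> real) (g::'a \<Rightarrow> 'a).
        norm n = 1 \<and>
        (let H = {v. v \<bullet> n = 0} in
           (\<forall>v\<in>H. g v \<in> H \<and> (\<psi> has_derivative (\<lambda>h. g v \<bullet> h)) (at v within H)) \<and>
           \<psi> 0 = 0 \<and> g 0 = 0 \<and>
           (\<forall>v\<in>H. norm (g v) \<le> L) \<and> L-lipschitz_on H g) \<and>
        ball z R \<inter> \<Omega> =
          ball z R \<inter> {y. \<psi> ((y - z) - ((y - z) \<bullet> n) *\<^sub>R n) < (y - z) \<bullet> n})"

text \<open>The \<open>s\<close>-dimensional Hausdorff measure, with the factor \<^term>\<open>unit_ball_vol (real s)\<close> that makes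
  it agree with \<open>s\<close>-dimensional Lebesgue measure (surface area on hypersurfaces, for \<open>s = d - 1\<close>).\<close>

definition hausdorff_premeasure :: "nat \<Rightarrow> real \<Rightarrow> 'a::metric_space set \<Rightarrow> ennreal" where
  "hausdorff_premeasure s \<delta> A =
     (INF U\<in>{U :: nat \<Rightarrow> 'a set. A \<subseteq> (\<Union>i. U i) \<and> (\<forall>i. bounded (U i) \<and> diameter (U i) \<le> \<delta>)}.
        \<Sum>i. if U i = {} then 0
             else ennreal (unit_ball_vol (real s) * (diameter (U i) / 2) ^ s))"

definition hausdorff_measure :: "nat \<Rightarrow> 'a::metric_space set \<Rightarrow> ennreal" where
  "hausdorff_measure s A = (SUP \<delta>\<in>{0<..}. hausdorff_premeasure s \<delta> A)"

text \<open>The Hausdorff measure below is finite for every bounded \<open>C\<^sup>1\<^sup>,\<^sup>1\<close> open set, so that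
  \<^const>\<open>enn2real\<close> loses nothing there.\<close>

definition boundary_measure :: "'a::euclidean_space set \<Rightarrow> real" where
  "boundary_measure \<Omega> =
     (if DIM('a) = 1 then real (card (frontier \<Omega>))
      else enn2real (hausdorff_measure (DIM('a) - 1) (frontier \<Omega>)))"

end

theory Submission
  imports Defs "HOL-Real_Asymp.Real_Asymp"
begin

text \<open>The subordinate killed process is alive at time \<open>t\<close> exactly when \<open>W\<close> has
  stayed in \<open>\<Omega>\<close> during \<open>(0, D t]\<close>, because \<open>D\<close> is
  right-continuous and strictly increasing. As \<open>D\<close> is independent of
  \<open>W\<close>, the missing heat is an average over the time change, \<open>|\<Omega>| - Q(t)
  = E[H(D t)]\<close>, of the heat \<open>H(u) = \<integral>\<^sub>\<Omega> P\<^sub>0(x + W leaves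
  \<Omega> during (0, u]) dx\<close> that Brownian motion killed on leaving
  \<open>\<Omega>\<close> has lost by time \<open>u\<close>
  (\<open>spectral_heat_content_eq_expectation\<close>). The different laws \<open>P x\<close> can
  be reduced to \<open>P 0\<close> because the Fourier transform of the increments determines the
  law of the path seen from its starting point, and the Laplace transform determines the law of
  \<open>D t\<close> (\<open>brownian_path_law_unique\<close>,
  \<open>laplace_transform_unique\<close>). Three asymptotic statements remain.

  Geometry: the set of points of \<open>\<Omega>\<close> at distance less than \<open>r\<close>
  from the boundary has volume \<open>V(r) ~ |\<partial>\<Omega>| r\<close>
  (\<open>inner_minkowski_content_eq_boundary_measure\<close>). The boundary is locally a graph
  that is nearly flat at small scales. Covering it by small sets bounds \<open>V(r)\<close> from
  above, where the isodiametric inequality converts diameters into areas; placing disjoint balls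
  on it bounds \<open>V(r)\<close> from below, where the Vitali covering lemma shows that the
  balls exhaust the Hausdorff measure.

  Probability: at distance \<open>\<delta>\<close> from the boundary and in time \<open>u\<close>
  only the scale \<open>sqrt u\<close> matters, at which \<open>\<Omega>\<close> looks like a
  half-space. By the reflection principle the probability of leaving a half-space is
  \<open>erfc(\<delta> / (2 sqrt u))\<close>. Integrating it over \<open>\<Omega>\<close> with the
  help of \<open>V\<close> gives \<open>H(u) ~ (2 / sqrt \<pi>) |\<partial>\<Omega>| sqrt
  u\<close> (\<open>heat_loss_asymptotics\<close>).

  Averaging: if \<open>H\<close> is bounded and \<open>H(u) ~ c sqrt u\<close>, then \<open>E[H(D
  t)] ~ (c / sqrt \<pi>) t log(1/t)\<close> (\<open>subordination_asymptotics\<close>). Here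
  \<open>\<phi>(s) ~ sqrt s\<close>, since \<open>\<phi>\<^sub>1\<close> varies regularly with an
  index below \<open>1/2\<close>. The square root is a mixture of the functions \<open>1 -
  exp(-r\<^sup>2 u)\<close>, and its cut-off at \<open>r = 1\<close> has the expectation
  \<open>\<integral> (1 - exp(-t \<phi>(r\<^sup>2))) / r\<^sup>2 dr\<close> over \<open>r >
  1\<close>. Its integrand is close to \<open>t / r\<close> up to \<open>r = 1/t\<close>, which is
  where the logarithm comes from. With \<open>c = 2 |\<partial>\<Omega>| / sqrt \<pi>\<close> the
  constant is \<open>2 |\<partial>\<Omega>| / \<pi>\<close>.\<close>

section \<open>The isodiametric inequality\<close>

text \<open>With \<open>a \<in> A\<close> and \<open>b \<in> B\<close> close to the suprema, the sets
  \<open>(A - b) / 2\<close> and \<open>(a - B) / 2\<close> lie in \<open>C\<close>, have half the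
  measure of \<open>A\<close> and \<open>B\<close>, and overlap in an interval shorter than any
  given bound. This is the Brunn-Minkowski inequality on the line, written with differences
  instead of sums because a bound on the diameter of a set is a bound on its differences.\<close>

lemma emeasure_difference_set_bounded:
  fixes A B C :: "real set"
  assumes [measurable]: "A \<in> sets borel" "B \<in> sets borel" "C \<in> sets borel"
    and ne: "A \<noteq> {}" "B \<noteq> {}" and bdd: "bdd_above A" "bdd_above B"
    and sub: "\<And>x y. x \<in> A \<Longrightarrow> y \<in> B \<Longrightarrow> (x - y) / 2 \<in> C"
  shows "emeasure lborel A + emeasure lborel B \<le> 2 * emeasure lborel C"
proof (rule ennreal_le_epsilon)
  fix e :: real assume e: "0 < e"
  obtain a where a: "a \<in> A" "Sup A - e/2 < a"
    using less_cSup_iff[OF ne(1) bdd(1), of "Sup A - e/2"] e by auto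
  obtain b where b: "b \<in> B" "Sup B - e/2 < b"
    using less_cSup_iff[OF ne(2) bdd(2), of "Sup B - e/2"] e by auto
  define A' where "A' = {c. b + 2 * c \<in> A}"
  define B' where "B' = {c. a + (-2) * c \<in> B}"
  have [measurable]: "A' \<in> sets borel" "B' \<in> sets borel"
    unfolding A'_def B'_def by measurable
  have "emeasure lborel A = (\<integral>\<^sup>+x. indicator A x \<partial>lborel)" by simp
  also have "\<dots> = 2 * (\<integral>\<^sup>+x. indicator A (b + 2 * x) \<partial>lborel)"
    by (subst nn_integral_real_affine[where c=2 and t=b]) auto
  also have "(\<integral>\<^sup>+x. indicator A (b + 2 * x) \<partial>lborel) = (\<integral>\<^sup>+x. indicator A' x \<partial>lborel)"
    by (intro nn_integral_cong) (auto simp: A'_def indicator_def)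
  finally have eA: "emeasure lborel A = 2 * emeasure lborel A'" by simp
  have "emeasure lborel B = (\<integral>\<^sup>+x. indicator B x \<partial>lborel)" by simp
  also have "\<dots> = 2 * (\<integral>\<^sup>+x. indicator B (a + (-2) * x) \<partial>lborel)"
    by (subst nn_integral_real_affine[where c="-2" and t=a]) auto
  also have "(\<integral>\<^sup>+x. indicator B (a + (-2) * x) \<partial>lborel) = (\<integral>\<^sup>+x. indicator B' x \<partial>lborel)"
    by (intro nn_integral_cong) (auto simp: B'_def indicator_def)
  finally have eB: "emeasure lborel B = 2 * emeasure lborel B'" by simp
  have "A' \<union> B' \<subseteq> C"
    using sub[OF _ b(1)] sub[OF a(1)] by (fastforce simp: A'_def B'_def)
  then have un: "emeasure lborel (A' \<union> B') \<le> emeasure lborel C"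
    by (intro emeasure_mono) auto
  have "A' \<inter> B' \<subseteq> {(a - Sup B)/2 .. (Sup A - b)/2}"
    using cSup_upper[OF _ bdd(1)] cSup_upper[OF _ bdd(2)] by (fastforce simp: A'_def B'_def)
  then have "emeasure lborel (A' \<inter> B') \<le> emeasure lborel {(a - Sup B)/2 .. (Sup A - b)/2}"
    by (intro emeasure_mono) auto
  also have "\<dots> \<le> ennreal (e/2)"
  proof -
    have "(Sup A - b) / 2 - (a - Sup B) / 2 \<le> e / 2"
      using a b by (simp add: field_simps)
    moreover have "(a - Sup B) / 2 \<le> (Sup A - b) / 2"
      using cSup_upper[OF a(1) bdd(1)] cSup_upper[OF b(1) bdd(2)] by simp
    ultimately show ?thesis by (simp add: ennreal_leI)
  qed
  finally have int: "emeasure lborel (A' \<inter> B') \<le> ennreal (e/2)" .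
  have "emeasure lborel A + emeasure lborel B = 2 * (emeasure lborel A' + emeasure lborel B')"
    by (simp add: eA eB distrib_left)
  also have "emeasure lborel A' + emeasure lborel B' = emeasure lborel (A' \<union> B') + emeasure lborel (A' \<inter> B')"
    by (intro emeasure_Un_Int) auto
  also have "2 * (emeasure lborel (A' \<union> B') + emeasure lborel (A' \<inter> B'))
      \<le> 2 * (emeasure lborel C + ennreal (e/2))"
    by (intro mult_left_mono add_mono un int) auto
  also have "\<dots> = 2 * emeasure lborel C + ennreal e"
    using e by (simp add: distrib_left ennreal_mult'[symmetric] flip: ennreal_numeral)
  finally show "emeasure lborel A + emeasure lborel B \<le> 2 * emeasure lborel C + ennreal e" .
qed

lemma emeasure_difference_set:
  fixes A B C :: "real set"
  assumes [measurable]: "A \<in> sets borel" "B \<in> sets borel" "C \<in> sets borel"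
    and ne: "A \<noteq> {}" "B \<noteq> {}"
    and sub: "\<And>x y. x \<in> A \<Longrightarrow> y \<in> B \<Longrightarrow> (x - y) / 2 \<in> C"
  shows "emeasure lborel A + emeasure lborel B \<le> 2 * emeasure lborel C"
proof -
  have lim: "(\<lambda>k. emeasure lborel (X \<inter> {..real k})) \<longlonglongrightarrow> emeasure lborel X"
    if [measurable]: "X \<in> sets borel" for X :: "real set"
  proof -
    have "(\<lambda>k. emeasure lborel (X \<inter> {..real k})) \<longlonglongrightarrow> emeasure lborel (\<Union>k. X \<inter> {..real k})"
      by (intro Lim_emeasure_incseq) (auto simp: incseq_def)
    moreover have "(\<Union>k. X \<inter> {..real k}) = X"
      using real_arch_simple by auto
    ultimately show ?thesis by simp
  qed
  obtain a b where ab: "a \<in> A" "b \<in> B" using ne by auto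
  obtain k0 :: nat where k0: "max a b \<le> real k0" using real_arch_simple by blast
  have "emeasure lborel (A \<inter> {..real k}) + emeasure lborel (B \<inter> {..real k}) \<le> 2 * emeasure lborel C"
    if "k \<ge> k0" for k
  proof (rule emeasure_difference_set_bounded)
    have "a \<in> A \<inter> {..real k}" "b \<in> B \<inter> {..real k}" using ab k0 that by auto
    then show "A \<inter> {..real k} \<noteq> {}" "B \<inter> {..real k} \<noteq> {}" by blast+
  qed (use sub in \<open>auto intro: bdd_aboveI[of _ "real k"]\<close>)
  then show ?thesis
    by (intro LIMSEQ_le_const2[OF tendsto_add[OF lim lim]]) auto
qed

lemma nn_integral_layer_cake:
  fixes f :: "real \<Rightarrow> ennreal"
  assumes [measurable]: "f \<in> borel_measurable borel"
  shows "(\<integral>\<^sup>+x. f x \<partial>lborel) = (\<integral>\<^sup>+t. indicator {0<..} t * emeasure lborel {x. ennreal t < f x} \<partial>lborel)"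
proof -
  have 1: "f x = (\<integral>\<^sup>+t. indicator {0<..} t * indicator {x. ennreal t < f x} x \<partial>lborel)" for x
  proof -
    have "(\<integral>\<^sup>+t. indicator {0<..} t * indicator {x. ennreal t < f x} x \<partial>lborel)
        = (\<integral>\<^sup>+t. indicator {t. 0 < t \<and> ennreal t < f x} t \<partial>lborel)"
      by (intro nn_integral_cong) (auto simp: indicator_def)
    also have "\<dots> = emeasure lborel {t. 0 < t \<and> ennreal t < f x}"
      by (subst nn_integral_indicator) auto
    also have "\<dots> = f x"
    proof (cases "f x")
      case (real r)
      then have "{t. 0 < t \<and> ennreal t < f x} = {0<..<r}"
        by (auto simp: ennreal_less_iff)
      then show ?thesis using real by simp
    next
      case top
      then have "{t. 0 < t \<and> ennreal t < f x} = {0<..}" by auto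
      have "emeasure lborel {0::real<..} \<ge> (SUP n::nat. emeasure lborel {0<..<real n})"
        by (rule SUP_least) (rule emeasure_mono, auto)
      then have "emeasure lborel {0::real<..} = \<top>"
        by (simp add: ennreal_SUP_of_nat_eq_top ennreal_of_nat_eq_real_of_nat[symmetric] top_unique)
      then show ?thesis using top \<open>{t. 0 < t \<and> ennreal t < f x} = {0<..}\<close> by simp
    qed
    finally show ?thesis ..
  qed
  have "(\<integral>\<^sup>+x. f x \<partial>lborel) = (\<integral>\<^sup>+x. \<integral>\<^sup>+t. indicator {0<..} t * indicator {x. ennreal t < f x} x \<partial>lborel \<partial>lborel)"
    by (subst 1) simp
  also have "\<dots> = (\<integral>\<^sup>+t. \<integral>\<^sup>+x. indicator {0<..} t * indicator {x. ennreal t < f x} x \<partial>lborel \<partial>lborel)"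
    by (rule lborel_pair.Fubini'[symmetric]) measurable
  also have "\<dots> = (\<integral>\<^sup>+t. indicator {0<..} t * emeasure lborel {x. ennreal t < f x} \<partial>lborel)"
    by (intro nn_integral_cong) (subst nn_integral_cmult, auto)
  finally show ?thesis .
qed

lemma ennreal_square_less_mult:
  fixes u x y :: ennreal
  assumes "u < x" "u < y"
  shows "u\<^sup>2 < x * y"
proof -
  obtain r where r: "u = ennreal r" "0 \<le> r" using assms by (cases u) auto
  show ?thesis
  proof (cases "x = \<top> \<or> y = \<top>")
    case True
    have "x \<noteq> 0" "y \<noteq> 0" using assms by auto
    then have "x * y = \<top>" using True by (auto simp: ennreal_top_mult ennreal_mult_top)
    then show ?thesis using r by (simp add: ennreal_power)
  next
    case False
    then obtain a b where "x = ennreal a" "y = ennreal b" "0 \<le> a" "0 \<le> b" by (cases x; cases y) auto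
    moreover from this have "r * r < a * b"
      using assms r by (intro mult_strict_mono') (auto simp: ennreal_less_iff)
    ultimately show ?thesis
      using r by (simp add: ennreal_power ennreal_mult'[symmetric] power2_eq_square ennreal_less_iff)
  qed
qed

text \<open>When both suprema are one, the superlevel sets of \<open>f\<close> and \<open>g\<close> are
  nonempty at every level between zero and one and empty above. The difference-set inequality
  therefore applies at each level, and the layer cake formula adds the levels up.\<close>

lemma prekopa_leindler_normalized:
  fixes f g h :: "real \<Rightarrow> ennreal"
  assumes [measurable]: "f \<in> borel_measurable borel" "g \<in> borel_measurable borel" "h \<in> borel_measurable borel"
    and le: "\<And>x y. f x * g y \<le> (h ((x - y) / 2))\<^sup>2"
    and f1: "(SUP x. f x) = 1" and g1: "(SUP x. g x) = 1"
  shows "(\<integral>\<^sup>+x. f x \<partial>lborel) + (\<integral>\<^sup>+x. g x \<partial>lborel) \<le> 2 * (\<integral>\<^sup>+x. h x \<partial>lborel)"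
proof -
  let ?L = "\<lambda>f t. indicator {0<..} t * emeasure lborel {x::real. ennreal t < f x}"
  have le1: "f x \<le> 1" "g x \<le> 1" for x
    using SUP_upper[of x UNIV f] SUP_upper[of x UNIV g] f1 g1 by auto
  have "(\<integral>\<^sup>+x. f x \<partial>lborel) + (\<integral>\<^sup>+x. g x \<partial>lborel) = (\<integral>\<^sup>+t. ?L f t + ?L g t \<partial>lborel)"
    unfolding nn_integral_layer_cake[OF assms(1)] nn_integral_layer_cake[OF assms(2)]
    by (subst nn_integral_add) auto
  also have "\<dots> \<le> (\<integral>\<^sup>+t. 2 * ?L h t \<partial>lborel)"
  proof (intro nn_integral_mono)
    fix t :: real
    show "?L f t + ?L g t \<le> 2 * ?L h t"
    proof (cases "0 < t \<and> t < 1")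
      case True
      then have t: "ennreal t < 1" by (simp add: ennreal_less_one_iff)
      have "emeasure lborel {x. ennreal t < f x} + emeasure lborel {x. ennreal t < g x}
          \<le> 2 * emeasure lborel {x. ennreal t < h x}"
      proof (rule emeasure_difference_set)
        show "{x. ennreal t < f x} \<noteq> {}" "{x. ennreal t < g x} \<noteq> {}"
          using t f1 g1 less_SUP_iff[of "ennreal t" f UNIV] less_SUP_iff[of "ennreal t" g UNIV] by auto
        fix x y assume "x \<in> {x. ennreal t < f x}" "y \<in> {x. ennreal t < g x}"
        then have "(ennreal t)\<^sup>2 < f x * g y"
          by (intro ennreal_square_less_mult) auto
        also have "\<dots> \<le> (h ((x - y) / 2))\<^sup>2" by (rule le)
        finally have *: "(ennreal t)\<^sup>2 < (h ((x - y) / 2))\<^sup>2" .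
        have "ennreal t < h ((x - y) / 2)"
        proof (rule ccontr)
          assume "\<not> ennreal t < h ((x - y) / 2)"
          then have "(h ((x - y) / 2))\<^sup>2 \<le> (ennreal t)\<^sup>2" by (intro power_mono) auto
          with * show False by simp
        qed
        then show "(x - y) / 2 \<in> {x. ennreal t < h x}" by simp
      qed measurable
      then show ?thesis using True by simp
    next
      case False
      have "{x. ennreal t < f x} = {}" "{x. ennreal t < g x} = {}" if "1 \<le> t"
        using le1 that by (auto simp: not_less intro: order_trans[of _ 1])
      then show ?thesis using False by (auto simp: indicator_def)
    qed
  qed
  also have "\<dots> = 2 * (\<integral>\<^sup>+t. ?L h t \<partial>lborel)"
    by (subst nn_integral_cmult) auto
  also have "\<dots> = 2 * (\<integral>\<^sup>+x. h x \<partial>lborel)"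
    unfolding nn_integral_layer_cake[OF assms(3)] ..
  finally show ?thesis .
qed

lemma ennreal_mult_le_square_of_add_le:
  fixes u v w :: ennreal
  assumes "u + v \<le> 2 * w"
  shows "u * v \<le> w\<^sup>2"
proof (cases "w = \<top>")
  case True then show ?thesis by (simp add: power2_eq_square)
next
  case False
  then obtain w' where w: "w = ennreal w'" "w' \<ge> 0" by (cases w) auto
  have "2 * w < \<top>" using False by (simp add: ennreal_mult_less_top less_top)
  then have "u < \<top>" "v < \<top>" using assms by (auto simp: less_top[symmetric] top_unique)
  then obtain u' v' where uv: "u = ennreal u'" "u' \<ge> 0" "v = ennreal v'" "v' \<ge> 0"
    by (cases u; cases v) auto
  have "u' + v' \<le> 2 * w'"
    using assms uv w by (simp add: ennreal_mult'[symmetric] flip: ennreal_numeral ennreal_plus)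
  then have "(u' + v')\<^sup>2 \<le> (2 * w')\<^sup>2" using uv by (intro power_mono) auto
  moreover have "4 * (u' * v') \<le> (u' + v')\<^sup>2"
    using zero_le_power2[of "u' - v'"] by (simp add: power2_eq_square algebra_simps)
  ultimately have "u' * v' \<le> w'\<^sup>2" by (simp add: power_mult_distrib)
  then show ?thesis using uv w by (simp add: ennreal_mult'[symmetric] ennreal_power)
qed

text \<open>Division of \<open>f\<close> and \<open>g\<close> by their suprema, and of \<open>h\<close> by the
  geometric mean of the two, leads to the normalized case; the inequality of arithmetic and
  geometric means turns its sum into a product.\<close>

lemma prekopa_leindler_bounded:
  fixes f g h :: "real \<Rightarrow> ennreal"
  assumes [measurable]: "f \<in> borel_measurable borel" "g \<in> borel_measurable borel" "h \<in> borel_measurable borel"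
    and le: "\<And>x y. f x * g y \<le> (h ((x - y) / 2))\<^sup>2"
    and bdd: "(SUP x. f x) < \<top>" "(SUP x. g x) < \<top>"
  shows "(\<integral>\<^sup>+x. f x \<partial>lborel) * (\<integral>\<^sup>+x. g x \<partial>lborel) \<le> (\<integral>\<^sup>+x. h x \<partial>lborel)\<^sup>2"
proof (cases "(SUP x. f x) = 0 \<or> (SUP x. g x) = 0")
  case True
  then have "(\<forall>x. f x = 0) \<or> (\<forall>x. g x = 0)"
    by (metis SUP_upper UNIV_I le_zero_eq)
  then show ?thesis by auto
next
  case False
  obtain a b where ab: "(SUP x. f x) = ennreal a" "(SUP x. g x) = ennreal b" "0 < a" "0 < b"
    using False bdd by (cases "SUP x. f x"; cases "SUP x. g x") (auto simp: less_le)
  define c where "c = sqrt (a * b)"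
  have c: "c > 0" "c\<^sup>2 = a * b" using ab by (auto simp: c_def)
  let ?I = "\<integral>\<^sup>+x. f x \<partial>lborel" and ?J = "\<integral>\<^sup>+x. g x \<partial>lborel" and ?K = "\<integral>\<^sup>+x. h x \<partial>lborel"
  have "(\<integral>\<^sup>+x. ennreal (1/a) * f x \<partial>lborel) + (\<integral>\<^sup>+x. ennreal (1/b) * g x \<partial>lborel)
      \<le> 2 * (\<integral>\<^sup>+x. ennreal (1/c) * h x \<partial>lborel)"
  proof (rule prekopa_leindler_normalized)
    show "(SUP x. ennreal (1/a) * f x) = 1" "(SUP x. ennreal (1/b) * g x) = 1"
      using ab by (simp_all add: SUP_mult_left_ennreal[symmetric] ennreal_mult'[symmetric])
    fix x y
    have "ennreal (1/a) * f x * (ennreal (1/b) * g y) = (ennreal (1/a) * ennreal (1/b)) * (f x * g y)"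
      by (simp add: ac_simps)
    also have "\<dots> \<le> (ennreal (1/a) * ennreal (1/b)) * (h ((x - y) / 2))\<^sup>2"
      by (intro mult_left_mono le) auto
    also have "ennreal (1/a) * ennreal (1/b) = (ennreal (1/c))\<^sup>2"
      using ab c by (simp add: ennreal_mult'[symmetric] ennreal_power power_one_over)
    finally show "ennreal (1/a) * f x * (ennreal (1/b) * g y) \<le> (ennreal (1/c) * h ((x - y) / 2))\<^sup>2"
      by (simp add: power_mult_distrib)
  qed measurable
  then have "ennreal (1/a) * ?I + ennreal (1/b) * ?J \<le> 2 * (ennreal (1/c) * ?K)"
    by (simp add: nn_integral_cmult)
  then have "(ennreal (1/a) * ?I) * (ennreal (1/b) * ?J) \<le> (ennreal (1/c) * ?K)\<^sup>2"
    by (rule ennreal_mult_le_square_of_add_le)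
  then have "(ennreal (1/a) * ennreal (1/b)) * (?I * ?J) \<le> (ennreal (1/c))\<^sup>2 * ?K\<^sup>2"
    by (simp add: ac_simps power_mult_distrib)
  also have "ennreal (1/a) * ennreal (1/b) = (ennreal (1/c))\<^sup>2"
    using ab c by (simp add: ennreal_mult'[symmetric] ennreal_power power_one_over)
  finally have "(ennreal (1/c))\<^sup>2 * (?I * ?J) \<le> (ennreal (1/c))\<^sup>2 * ?K\<^sup>2" .
  then show ?thesis using c by (subst (asm) ennreal_mult_le_mult_iff) (auto simp: ennreal_power)
qed

lemma prekopa_leindler_real:
  fixes f g h :: "real \<Rightarrow> ennreal"
  assumes [measurable]: "f \<in> borel_measurable borel" "g \<in> borel_measurable borel" "h \<in> borel_measurable borel"
    and le: "\<And>x y. f x * g y \<le> (h ((x - y) / 2))\<^sup>2"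
  shows "(\<integral>\<^sup>+x. f x \<partial>lborel) * (\<integral>\<^sup>+x. g x \<partial>lborel) \<le> (\<integral>\<^sup>+x. h x \<partial>lborel)\<^sup>2"
proof -
  have trunc: "(\<integral>\<^sup>+x. f x \<partial>lborel) = (SUP k::nat. \<integral>\<^sup>+x. min (f x) (of_nat k) \<partial>lborel)"
    if [measurable]: "f \<in> borel_measurable borel" for f :: "real \<Rightarrow> ennreal"
  proof -
    have *: "(SUP k::nat. min y (of_nat k)) = y" for y :: ennreal
    proof (rule antisym)
      show "(SUP k::nat. min y (of_nat k)) \<le> y" by (rule SUP_least) auto
      have "y = min y (SUP k::nat. of_nat k)" by (simp add: ennreal_SUP_of_nat_eq_top)
      also have "\<dots> = (SUP k::nat. min y (of_nat k))"
        by (simp add: inf_min[symmetric] inf_SUP)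
      finally show "y \<le> (SUP k::nat. min y (of_nat k))" by simp
    qed
    have "(\<integral>\<^sup>+x. f x \<partial>lborel) = (\<integral>\<^sup>+x. (SUP k::nat. min (f x) (of_nat k)) \<partial>lborel)"
      by (simp add: *)
    also have "\<dots> = (SUP k::nat. \<integral>\<^sup>+x. min (f x) (of_nat k) \<partial>lborel)"
      by (intro nn_integral_monotone_convergence_SUP)
         (auto simp: incseq_def le_fun_def intro: min.coboundedI2)
    finally show ?thesis .
  qed
  have kj: "(\<integral>\<^sup>+x. min (f x) (of_nat k) \<partial>lborel) * (\<integral>\<^sup>+x. min (g x) (of_nat j) \<partial>lborel) \<le> (\<integral>\<^sup>+x. h x \<partial>lborel)\<^sup>2"
    for k j :: nat
  proof (rule prekopa_leindler_bounded)
    fix x y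
    have "min (f x) (of_nat k) * min (g y) (of_nat j) \<le> f x * g y"
      by (intro mult_mono) auto
    then show "min (f x) (of_nat k) * min (g y) (of_nat j) \<le> (h ((x - y) / 2))\<^sup>2"
      using le order_trans by blast
  next
    have "(SUP x. min (f x) (of_nat k)) \<le> of_nat k" "(SUP x. min (g x) (of_nat j)) \<le> of_nat j"
      by (auto intro!: SUP_least)
    then show "(SUP x. min (f x) (of_nat k)) < \<top>" "(SUP x. min (g x) (of_nat j)) < \<top>"
      using of_nat_less_top by (auto intro: le_less_trans)
  qed measurable
  show ?thesis
    unfolding trunc[OF assms(1)] trunc[OF assms(2)]
    by (subst SUP_mult_right_ennreal, intro SUP_least, subst SUP_mult_left_ennreal, intro SUP_least kj)
qed

text \<open>Integrating out one coordinate of \<open>f\<close>, \<open>g\<close> and \<open>h\<close> leaves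
  three functions of the other coordinates that satisfy the hypothesis again, by the inequality on
  the line. So the dimension can be raised one at a time.\<close>

theorem prekopa_leindler:
  fixes f g h :: "('i \<Rightarrow> real) \<Rightarrow> ennreal"
  assumes "finite I"
    and "f \<in> borel_measurable (Pi\<^sub>M I (\<lambda>_. lborel))" "g \<in> borel_measurable (Pi\<^sub>M I (\<lambda>_. lborel))"
      "h \<in> borel_measurable (Pi\<^sub>M I (\<lambda>_. lborel))"
    and "\<And>x y. x \<in> extensional I \<Longrightarrow> y \<in> extensional I \<Longrightarrow> f x * g y \<le> (h (\<lambda>i\<in>I. (x i - y i) / 2))\<^sup>2"
  shows "(\<integral>\<^sup>+x. f x \<partial>Pi\<^sub>M I (\<lambda>_. lborel)) * (\<integral>\<^sup>+x. g x \<partial>Pi\<^sub>M I (\<lambda>_. lborel))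
           \<le> (\<integral>\<^sup>+x. h x \<partial>Pi\<^sub>M I (\<lambda>_. lborel))\<^sup>2"
  using assms
proof (induction I arbitrary: f g h)
  case empty
  then show ?case by (simp add: PiM_empty nn_integral_count_space_finite)
next
  case (insert i I)
  interpret product_sigma_finite "\<lambda>_. lborel :: real measure" by standard
  note [measurable] = insert.prems(1-3)
  have upd: "(\<lambda>(x, y). x(i := y)) \<in> Pi\<^sub>M I (\<lambda>_. lborel) \<Otimes>\<^sub>M lborel \<rightarrow>\<^sub>M Pi\<^sub>M (insert i I) (\<lambda>_. lborel :: real measure)"
    using measurable_add_dim[of i I "\<lambda>_. lborel :: real measure"] by simp
  have eq: "(\<integral>\<^sup>+x. f x \<partial>Pi\<^sub>M (insert i I) (\<lambda>_. lborel)) = (\<integral>\<^sup>+x. \<integral>\<^sup>+t. f (x(i := t)) \<partial>lborel \<partial>Pi\<^sub>M I (\<lambda>_. lborel))"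
    if "f \<in> borel_measurable (Pi\<^sub>M (insert i I) (\<lambda>_. lborel))" for f :: "('i \<Rightarrow> real) \<Rightarrow> ennreal"
    using insert.hyps that by (rule product_nn_integral_insert)
  have meas: "(\<lambda>x. \<integral>\<^sup>+t. f (x(i := t)) \<partial>lborel) \<in> borel_measurable (Pi\<^sub>M I (\<lambda>_. lborel))"
    if [measurable]: "f \<in> borel_measurable (Pi\<^sub>M (insert i I) (\<lambda>_. lborel))" for f :: "('i \<Rightarrow> real) \<Rightarrow> ennreal"
  proof (rule lborel.borel_measurable_nn_integral)
    show "(\<lambda>(x, t). f (x(i := t))) \<in> borel_measurable (Pi\<^sub>M I (\<lambda>_. lborel) \<Otimes>\<^sub>M lborel)"
      using measurable_compose[OF upd that] by (simp add: case_prod_unfold)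
  qed
  have sec: "(\<lambda>t. f (x(i := t))) \<in> borel_measurable borel"
    if "f \<in> borel_measurable (Pi\<^sub>M (insert i I) (\<lambda>_. lborel))" "x \<in> extensional I"
    for f :: "('i \<Rightarrow> real) \<Rightarrow> ennreal" and x
  proof -
    have "x \<in> space (Pi\<^sub>M I (\<lambda>_. lborel :: real measure))" using that by (simp add: space_PiM PiE_def)
    then have "(\<lambda>t. (x, t)) \<in> lborel \<rightarrow>\<^sub>M Pi\<^sub>M I (\<lambda>_. lborel :: real measure) \<Otimes>\<^sub>M (lborel :: real measure)"
      by simp
    from measurable_compose[OF measurable_compose[OF this upd] that(1)]
    show ?thesis by simp
  qed
  show ?case
    unfolding eq[OF insert.prems(1)] eq[OF insert.prems(2)] eq[OF insert.prems(3)]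
  proof (rule insert.IH)
    fix x y :: "'i \<Rightarrow> real" assume xy: "x \<in> extensional I" "y \<in> extensional I"
    let ?z = "\<lambda>i\<in>I. (x i - y i) / 2"
    show "(\<integral>\<^sup>+t. f (x(i := t)) \<partial>lborel) * (\<integral>\<^sup>+t. g (y(i := t)) \<partial>lborel)
        \<le> (\<integral>\<^sup>+t. h (?z(i := t)) \<partial>lborel)\<^sup>2"
    proof (rule prekopa_leindler_real)
      fix s t :: real
      have "f (x(i := s)) * g (y(i := t)) \<le> (h (\<lambda>j\<in>insert i I. ((x(i := s)) j - (y(i := t)) j) / 2))\<^sup>2"
        using xy by (intro insert.prems) (auto simp: extensional_def)
      also have "(\<lambda>j\<in>insert i I. ((x(i := s)) j - (y(i := t)) j) / 2) = ?z(i := (s - t) / 2)"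
        using insert.hyps by (auto simp: fun_eq_iff)
      finally show "f (x(i := s)) * g (y(i := t)) \<le> (h (?z(i := (s - t) / 2)))\<^sup>2" .
    qed (use xy in \<open>auto intro!: sec insert.prems\<close>)
  qed (intro meas insert.prems)+
qed

text \<open>Half of the difference of two points of \<open>S\<close> has norm at most \<open>r / 2\<close>, so
  the Prekopa-Leindler inequality applies to the indicators of \<open>S\<close>, \<open>S\<close>
  and the ball of radius \<open>r / 2\<close>.\<close>

theorem isodiametric_inequality:
  fixes S :: "('i \<Rightarrow> real) set"
  assumes I: "finite I" and S: "S \<in> sets (Pi\<^sub>M I (\<lambda>_. lborel))" and r: "0 < r"
    and diam: "\<And>x y. x \<in> S \<Longrightarrow> y \<in> S \<Longrightarrow> sqrt (\<Sum>i\<in>I. (x i - y i)\<^sup>2) \<le> r"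
  shows "emeasure (Pi\<^sub>M I (\<lambda>_. lborel)) S \<le> ennreal (unit_ball_vol (real (card I)) * (r / 2) ^ card I)"
proof -
  let ?M = "Pi\<^sub>M I (\<lambda>_. lborel :: real measure)"
  let ?B = "{f. sqrt (\<Sum>i\<in>I. (f i)\<^sup>2) \<le> r / 2} \<inter> space ?M"
  have B: "?B \<in> sets ?M" using I by measurable
  have sp: "S \<subseteq> space ?M" using S by (rule sets.sets_into_space)
  have "(\<integral>\<^sup>+x. indicator S x \<partial>?M) * (\<integral>\<^sup>+x. indicator S x \<partial>?M) \<le> (\<integral>\<^sup>+x. indicator ?B x \<partial>?M)\<^sup>2"
  proof (rule prekopa_leindler)
    fix x y :: "'i \<Rightarrow> real"
    show "indicator S x * indicator S y \<le> (indicator ?B (\<lambda>i\<in>I. (x i - y i) / 2) :: ennreal)\<^sup>2"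
    proof (cases "x \<in> S \<and> y \<in> S")
      case True
      have "(\<Sum>i\<in>I. ((x i - y i) / 2)\<^sup>2) = (\<Sum>i\<in>I. (x i - y i)\<^sup>2) / 4"
        by (simp add: power_divide sum_divide_distrib)
      then have "sqrt (\<Sum>i\<in>I. ((x i - y i) / 2)\<^sup>2) = sqrt (\<Sum>i\<in>I. (x i - y i)\<^sup>2) / 2"
        by (simp only: real_sqrt_divide real_sqrt_four)
      then have "(\<lambda>i\<in>I. (x i - y i) / 2) \<in> ?B"
        using diam[of x y] True by (auto simp: space_PiM)
      then show ?thesis using True by simp
    qed (auto simp: indicator_def)
  qed (use I B S in auto)
  then have "(emeasure ?M S)\<^sup>2 \<le> (emeasure ?M ?B)\<^sup>2"
    using S B by (simp add: power2_eq_square)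
  then have "emeasure ?M S \<le> emeasure ?M ?B"
  proof (rule contrapos_pp)
    assume "\<not> emeasure ?M S \<le> emeasure ?M ?B"
    then have "(emeasure ?M ?B)\<^sup>2 < emeasure ?M S * emeasure ?M S"
      by (intro ennreal_square_less_mult) auto
    then show "\<not> (emeasure ?M S)\<^sup>2 \<le> (emeasure ?M ?B)\<^sup>2" by (simp add: power2_eq_square)
  qed
  also have "emeasure ?M ?B = ennreal (unit_ball_vol (real (card I)) * (r / 2) ^ card I)"
    using I r by (intro emeasure_cball_aux) auto
  finally show ?thesis .
qed

section \<open>Lebesgue measure in hyperplane coordinates\<close>

lemma nn_integral_lborel_translate:
  fixes f :: "'a::euclidean_space \<Rightarrow> ennreal"
  assumes [measurable]: "f \<in> borel_measurable borel"
  shows "(\<integral>\<^sup>+x. f (c + x) \<partial>lborel) = (\<integral>\<^sup>+x. f x \<partial>lborel)"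
proof -
  have "(\<integral>\<^sup>+x. f x \<partial>lborel) = (\<integral>\<^sup>+x. f x \<partial>distr lborel borel ((+) c))"
    by (simp add: lborel_distr_plus)
  also have "\<dots> = (\<integral>\<^sup>+x. f (c + x) \<partial>lborel)" by (subst nn_integral_distr) auto
  finally show ?thesis ..
qed

lemma nn_integral_lborel_reflect:
  fixes f :: "'a::euclidean_space \<Rightarrow> ennreal"
  assumes [measurable]: "f \<in> borel_measurable borel"
  shows "(\<integral>\<^sup>+x. f (c - x) \<partial>lborel) = (\<integral>\<^sup>+x. f x \<partial>lborel)"
proof -
  have e: "(lborel::'a measure) = distr lborel borel (\<lambda>x. c + (-1) *\<^sub>R x)"
    using lborel_affine[of "-1" c] by (simp add: density_1)
  have "(\<integral>\<^sup>+x. f x \<partial>lborel) = (\<integral>\<^sup>+x. f x \<partial>distr lborel borel (\<lambda>x. c + (-1) *\<^sub>R x))"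
    using e by simp
  also have "\<dots> = (\<integral>\<^sup>+x. f (c - x) \<partial>lborel)" by (subst nn_integral_distr) auto
  finally show ?thesis ..
qed

text \<open>The argument for the uniqueness of Haar measure: the double integral over \<open>x\<close> and
  \<open>y\<close> of \<open>1\<^sub>S(T x) 1\<^sub>B(T x - y)\<close>, with \<open>B\<close> the
  unit ball, is evaluated in both orders. Since \<open>T\<close> preserves \<open>B\<close>, this
  yields the measure of \<open>B\<close> times each of the two sides.\<close>

lemma emeasure_lborel_involutive_isometry:
  fixes T :: "'a::euclidean_space \<Rightarrow> 'a"
  assumes T: "linear T" "\<And>x. norm (T x) = norm x" "\<And>x. T (T x) = x"
    and S[measurable]: "S \<in> sets borel"
  shows "emeasure lborel {x. T x \<in> S} = emeasure lborel S"
proof -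
  have [measurable]: "T \<in> borel_measurable borel"
    using T(1) by (intro borel_measurable_continuous_onI linear_continuous_on linear_conv_bounded_linear[THEN iffD1])
  let ?B = "{y::'a. norm y < 1}"
  have B: "?B = ball 0 1" by auto
  have TB: "indicator ?B (T x) = (indicator ?B x :: ennreal)" for x
    using T(2) by (auto simp: indicator_def)
  have add: "T (a + b) = T a + T b" for a b using T(1) by (rule linear_add)
  have "emeasure lborel {x. T x \<in> S} * emeasure lborel ?B
      = (\<integral>\<^sup>+x. indicator S (T x) * emeasure lborel ?B \<partial>lborel)"
  proof -
    have "(\<integral>\<^sup>+x. indicator S (T x) \<partial>lborel) = (\<integral>\<^sup>+x. indicator {x. T x \<in> S} x \<partial>lborel)"
      by (intro nn_integral_cong) (auto simp: indicator_def)
    then show ?thesis by (subst nn_integral_multc) auto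
  qed
  also have "\<dots> = (\<integral>\<^sup>+x. \<integral>\<^sup>+y. indicator S (T x) * indicator ?B (T x - y) \<partial>lborel \<partial>lborel)"
  proof (intro nn_integral_cong)
    fix x
    have mB: "(indicator ?B :: 'a \<Rightarrow> ennreal) \<in> borel_measurable borel"
      by measurable
    have m: "(\<lambda>y. indicator ?B (T x - y) :: ennreal) \<in> borel_measurable borel"
      by measurable
    show "indicator S (T x) * emeasure lborel ?B = (\<integral>\<^sup>+y. indicator S (T x) * indicator ?B (T x - y) \<partial>lborel)"
      using m nn_integral_lborel_reflect[OF mB, of "T x"] by (subst nn_integral_cmult) auto
  qed
  also have "\<dots> = (\<integral>\<^sup>+y. \<integral>\<^sup>+x. indicator S (T x) * indicator ?B (T x - y) \<partial>lborel \<partial>lborel)"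
    by (rule lborel_pair.Fubini') measurable
  also have "\<dots> = (\<integral>\<^sup>+y. \<integral>\<^sup>+x. indicator S (T (T y + x)) * indicator ?B (T (T y + x) - y) \<partial>lborel \<partial>lborel)"
    by (intro nn_integral_cong nn_integral_lborel_translate[symmetric]) measurable
  also have "\<dots> = (\<integral>\<^sup>+y. \<integral>\<^sup>+x. indicator S (T x + y) * indicator ?B x \<partial>lborel \<partial>lborel)"
    by (simp add: add T(3) TB add.commute)
  also have "\<dots> = (\<integral>\<^sup>+x. \<integral>\<^sup>+y. indicator S (T x + y) * indicator ?B x \<partial>lborel \<partial>lborel)"
    by (rule lborel_pair.Fubini') measurable
  also have "\<dots> = (\<integral>\<^sup>+x. emeasure lborel S * indicator ?B x \<partial>lborel)"
    by (intro nn_integral_cong) (subst nn_integral_multc, auto simp: nn_integral_lborel_translate)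
  also have "\<dots> = emeasure lborel S * emeasure lborel ?B"
    by (subst nn_integral_cmult) auto
  finally have "emeasure lborel ?B * emeasure lborel {x. T x \<in> S} = emeasure lborel ?B * emeasure lborel S"
    by (simp add: mult.commute)
  moreover have "emeasure lborel ?B \<noteq> 0"
    using emeasure_ball[of 1 "0::'a"] unit_ball_vol_pos[of "real DIM('a)", THEN less_imp_neq, THEN not_sym] by (simp add: B)
  moreover have "emeasure lborel ?B \<noteq> \<top>"
    using emeasure_ball[of 1 "0::'a"] by (simp add: B)
  ultimately show ?thesis by (simp add: ennreal_mult_cancel_left)
qed

text \<open>The Householder reflection in the hyperplane orthogonal to \<open>b - n\<close>.\<close>

lemma unit_vector_reflection:
  fixes b n :: "'a::euclidean_space"
  assumes "norm b = 1" "norm n = 1"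
  obtains T :: "'a \<Rightarrow> 'a" where "linear T" "\<And>x. T (T x) = x" "\<And>x y. T x \<bullet> T y = x \<bullet> y" "T b = n"
proof (cases "b = n")
  case True
  then show thesis by (intro that[of "\<lambda>x. x"]) (auto simp: linear_ident)
next
  case False
  define w where "w = b - n"
  define T where "T x = x - (2 * (x \<bullet> w) / (w \<bullet> w)) *\<^sub>R w" for x
  have ww: "w \<bullet> w \<noteq> 0" using False by (simp add: w_def)
  have bb: "b \<bullet> b = 1" "n \<bullet> n = 1" using assms by (simp_all add: dot_square_norm)
  have bw: "2 * (b \<bullet> w) = w \<bullet> w"
    using bb by (simp add: w_def inner_diff_left inner_diff_right inner_commute)
  show thesis
  proof (rule that)
    show "linear T"
      unfolding T_def by (auto intro!: linearI simp: inner_add_left add_divide_distrib algebra_simps)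
    have Tw: "T x \<bullet> w = - (x \<bullet> w)" for x
      using ww by (simp add: T_def inner_diff_left)
    show "T (T x) = x" for x
      unfolding T_def[of "T x"] Tw by (simp add: T_def)
    show "T x \<bullet> T y = x \<bullet> y" for x y
      unfolding T_def[of y] inner_diff_right inner_scaleR_right Tw
      by (simp add: T_def inner_diff_left inner_commute[of w y])
    show "T b = n" unfolding T_def bw using ww by (simp add: w_def)
  qed
qed

text \<open>A reflection that carries a vector of the standard basis to \<open>n\<close> carries the span of
  the others to the hyperplane orthogonal to \<open>n\<close>. It preserves Lebesgue measure, so
  the splitting off of one standard coordinate becomes integration along the lines of direction
  \<open>n\<close>.\<close>

theorem hyperplane_coordinates:
  fixes n :: "'a::euclidean_space"
  assumes n: "norm n = 1"
  obtains I :: "'a set" and J :: "('a \<Rightarrow> real) \<Rightarrow> 'a"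
  where "finite I" "card I = DIM('a) - 1"
    "\<And>f. J f \<bullet> n = 0"
    "\<And>f. norm (J f) = sqrt (\<Sum>i\<in>I. (f i)\<^sup>2)"
    "\<And>f g. dist (J f) (J g) = sqrt (\<Sum>i\<in>I. (f i - g i)\<^sup>2)"
    "\<And>z S. S \<in> sets borel \<Longrightarrow>
       (\<lambda>f. emeasure lborel {t. z + J f + t *\<^sub>R n \<in> S}) \<in> borel_measurable (Pi\<^sub>M I (\<lambda>_. lborel))"
    "\<And>z S. S \<in> sets borel \<Longrightarrow>
       emeasure lborel S = (\<integral>\<^sup>+f. emeasure lborel {t. z + J f + t *\<^sub>R n \<in> S} \<partial>Pi\<^sub>M I (\<lambda>_. lborel))"
proof -
  interpret product_sigma_finite "\<lambda>_. lborel :: real measure" by standard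
  obtain b :: 'a where b: "b \<in> Basis" using nonempty_Basis by blast
  define I where "I = (Basis - {b} :: 'a set)"
  have I: "finite I" "b \<notin> I" "insert b I = Basis" using b by (auto simp: I_def)
  obtain T :: "'a \<Rightarrow> 'a" where T: "linear T" "\<And>x. T (T x) = x" "\<And>x y. T x \<bullet> T y = x \<bullet> y" "T b = n"
    using unit_vector_reflection[of b n] b n by auto
  define E where "E f = (\<Sum>i\<in>I. f i *\<^sub>R i)" for f :: "'a \<Rightarrow> real"
  define J where "J f = T (E f)" for f
  have Tn: "norm (T x) = norm x" for x using T(3)[of x x] by (simp add: norm_eq_sqrt_inner)
  have Eb: "E f \<bullet> i = (if i \<in> I then f i else 0)" if "i \<in> Basis" for f i
    using that I by (auto simp: E_def inner_sum_left inner_Basis if_distrib I_def cong: if_cong)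
  have nE: "norm (E f) = sqrt (\<Sum>i\<in>I. (f i)\<^sup>2)" for f
  proof -
    have "(norm (E f))\<^sup>2 = (\<Sum>i\<in>Basis. (E f \<bullet> i)\<^sup>2)"
      unfolding power2_norm_eq_inner by (subst euclidean_inner) (simp add: power2_eq_square)
    also have "\<dots> = (\<Sum>i\<in>Basis. if i \<in> I then (f i)\<^sup>2 else 0)"
      by (intro sum.cong) (auto simp: Eb)
    also have "\<dots> = (\<Sum>i\<in>I. (f i)\<^sup>2)" using I by (simp add: sum.If_cases Int_absorb1 subset_insertI flip: I(3))
    finally show ?thesis by (metis norm_ge_zero real_sqrt_unique)
  qed
  have Ediff: "E f - E g = E (\<lambda>i. f i - g i)" for f g
    by (simp add: E_def sum_subtractf scaleR_diff_left)
  have [measurable]: "T \<in> borel_measurable borel"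
    using T(1) by (intro borel_measurable_continuous_onI linear_continuous_on linear_conv_bounded_linear[THEN iffD1])
  have Emeas: "E \<in> borel_measurable (Pi\<^sub>M I (\<lambda>_. lborel))"
    unfolding E_def by measurable
  have Jmeas[measurable]: "J \<in> borel_measurable (Pi\<^sub>M I (\<lambda>_. lborel))"
    unfolding J_def using Emeas by measurable
  show thesis
  proof (rule that)
    show "finite I" by fact
    show "card I = DIM('a) - 1" using b by (simp add: I_def)
    show "J f \<bullet> n = 0" for f
      using Eb[OF b, of f] T(3)[of "E f" b] I by (simp add: J_def T(4))
    show "norm (J f) = sqrt (\<Sum>i\<in>I. (f i)\<^sup>2)" for f by (simp add: J_def Tn nE)
    show "dist (J f) (J g) = sqrt (\<Sum>i\<in>I. (f i - g i)\<^sup>2)" for f g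
      unfolding dist_norm J_def linear_diff[OF T(1), symmetric] Tn Ediff nE ..
    fix z :: 'a and S :: "'a set" assume S[measurable]: "S \<in> sets borel"
    show "(\<lambda>f. emeasure lborel {t. z + J f + t *\<^sub>R n \<in> S}) \<in> borel_measurable (Pi\<^sub>M I (\<lambda>_. lborel))"
      by measurable
    have "emeasure lborel S = (\<integral>\<^sup>+x. indicator S x \<partial>lborel)" by simp
    also have "\<dots> = (\<integral>\<^sup>+x. indicator S (z + x) \<partial>lborel)"
      by (rule nn_integral_lborel_translate[symmetric]) simp
    also have "\<dots> = (\<integral>\<^sup>+x. indicator {x. z + x \<in> S} x \<partial>lborel)"
      by (intro nn_integral_cong) (auto simp: indicator_def)
    also have "\<dots> = emeasure lborel {x. z + x \<in> S}" by (subst nn_integral_indicator) auto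
    also have "\<dots> = emeasure lborel {x. T x \<in> {x. z + x \<in> S}}"
      by (rule emeasure_lborel_involutive_isometry[symmetric]) (use T Tn in auto)
    also have "\<dots> = emeasure (distr (Pi\<^sub>M Basis (\<lambda>_. lborel)) borel (\<lambda>f. \<Sum>b\<in>Basis. f b *\<^sub>R b)) {x. z + T x \<in> S}"
      by (subst lborel_eq) simp
    also have "\<dots> = (\<integral>\<^sup>+f. indicator {x. z + T x \<in> S} (\<Sum>b\<in>Basis. f b *\<^sub>R b) \<partial>Pi\<^sub>M Basis (\<lambda>_. lborel))"
      by (subst nn_integral_indicator[symmetric], simp, subst nn_integral_distr) auto
    also have "\<dots> = (\<integral>\<^sup>+f. \<integral>\<^sup>+t. indicator {x. z + T x \<in> S} (\<Sum>i\<in>insert b I. (f(b := t)) i *\<^sub>R i) \<partial>lborel \<partial>Pi\<^sub>M I (\<lambda>_. lborel))"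
      unfolding I(3)[symmetric]
      by (rule product_nn_integral_insert) (use I in auto)
    also have "\<dots> = (\<integral>\<^sup>+f. emeasure lborel {t. z + J f + t *\<^sub>R n \<in> S} \<partial>Pi\<^sub>M I (\<lambda>_. lborel))"
    proof (intro nn_integral_cong)
      fix f :: "'a \<Rightarrow> real"
      have s: "(\<Sum>i\<in>insert b I. (f(b := t)) i *\<^sub>R i) = t *\<^sub>R b + E f" for t
      proof -
        have "(\<Sum>i\<in>I. (f(b := t)) i *\<^sub>R i) = E f" using I(2) unfolding E_def by (intro sum.cong) auto
        then show ?thesis using I(1,2) by (subst sum.insert) auto
      qed
      have "z + T (t *\<^sub>R b + E f) = z + J f + t *\<^sub>R n" for t
        by (simp add: J_def linear_add[OF T(1)] linear_scale[OF T(1)] T(4))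
      then have "(\<integral>\<^sup>+t. indicator {x. z + T x \<in> S} (\<Sum>i\<in>insert b I. (f(b := t)) i *\<^sub>R i) \<partial>lborel)
          = (\<integral>\<^sup>+t. indicator {t. z + J f + t *\<^sub>R n \<in> S} t \<partial>lborel)"
        unfolding s by (intro nn_integral_cong) (simp add: indicator_def add.assoc)
      then show "(\<integral>\<^sup>+t. indicator {x. z + T x \<in> S} (\<Sum>i\<in>insert b I. (f(b := t)) i *\<^sub>R i) \<partial>lborel)
          = emeasure lborel {t. z + J f + t *\<^sub>R n \<in> S}"
        by simp
    qed
    finally show "emeasure lborel S = (\<integral>\<^sup>+f. emeasure lborel {t. z + J f + t *\<^sub>R n \<in> S} \<partial>Pi\<^sub>M I (\<lambda>_. lborel))" .
  qed
qed

section \<open>Boundary charts\<close>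

text \<open>A \<open>C\<^sup>1\<^sup>,\<^sup>1\<close> boundary in the form in which volumes and exit
  probabilities see it: on the ball of radius \<open>s\<close> the graph function has Lipschitz
  constant \<open>L * s\<close>, so the boundary deviates from its tangent plane at
  \<open>z\<close> by at most \<open>L * s\<^sup>2\<close>. With \<open>\<psi> = 0\<close> this
  covers the endpoints of an interval too, and both kinds of domains can be treated together.\<close>

definition graph_chart :: "'a::euclidean_space set \<Rightarrow> real \<Rightarrow> real \<Rightarrow> 'a \<Rightarrow> 'a \<Rightarrow> ('a \<Rightarrow> real) \<Rightarrow> bool" where
  "graph_chart \<Omega> R L z n \<psi> \<longleftrightarrow>
     norm n = 1 \<and> \<psi> 0 = 0 \<and>
     (\<forall>v w. v \<bullet> n = 0 \<longrightarrow> w \<bullet> n = 0 \<longrightarrow> \<bar>\<psi> v - \<psi> w\<bar> \<le> L * max (norm v) (norm w) * norm (v - w)) \<and>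
     (\<forall>y\<in>ball z R. y \<in> \<Omega> \<longleftrightarrow> \<psi> ((y - z) - ((y - z) \<bullet> n) *\<^sub>R n) < (y - z) \<bullet> n)"

text \<open>The gradient vanishes at the origin and is Lipschitz, hence is at most \<open>L\<close> times the
  larger norm on a ball that contains \<open>v\<close> and \<open>w\<close>; the rest is the mean
  value inequality on the intersection of that ball with the hyperplane.\<close>

lemma C11_open_set_charts:
  assumes "C11_open_set \<Omega>"
  obtains R L where "R > 0" "L > 0" "\<And>z. z \<in> frontier \<Omega> \<Longrightarrow> \<exists>n \<psi>. graph_chart \<Omega> R L z n \<psi>"
proof -
  define Q where "Q R L z \<longleftrightarrow> (\<exists>(n::'a) (\<psi>::'a \<Rightarrow> real) (g::'a \<Rightarrow> 'a).
        norm n = 1 \<and>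
        (let H = {v. v \<bullet> n = 0} in
           (\<forall>v\<in>H. g v \<in> H \<and> (\<psi> has_derivative (\<lambda>h. g v \<bullet> h)) (at v within H)) \<and>
           \<psi> 0 = 0 \<and> g 0 = 0 \<and>
           (\<forall>v\<in>H. norm (g v) \<le> L) \<and> L-lipschitz_on H g) \<and>
        ball z R \<inter> \<Omega> =
          ball z R \<inter> {y. \<psi> ((y - z) - ((y - z) \<bullet> n) *\<^sub>R n) < (y - z) \<bullet> n})" for R L z
  have "\<exists>R>0. \<exists>L>0. \<forall>z\<in>frontier \<Omega>. Q R L z"
    unfolding Q_def using assms unfolding C11_open_set_def by (rule conjunct2)
  then obtain R L where RL: "R > 0" "L > 0" and ch: "\<And>z. z \<in> frontier \<Omega> \<Longrightarrow> Q R L z"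
    by blast
  show thesis
  proof (rule that[OF RL])
    fix z assume "z \<in> frontier \<Omega>"
    from ch[OF this, unfolded Q_def] obtain n \<psi> g where n: "norm n = 1"
      and d: "\<And>v. v \<bullet> n = 0 \<Longrightarrow> (\<psi> has_derivative (\<lambda>h. g v \<bullet> h)) (at v within {v. v \<bullet> n = 0})"
      and 0: "\<psi> 0 = 0" "g 0 = 0" and lip: "L-lipschitz_on {v. v \<bullet> n = 0} g"
      and eq: "ball z R \<inter> \<Omega> = ball z R \<inter> {y. \<psi> ((y - z) - ((y - z) \<bullet> n) *\<^sub>R n) < (y - z) \<bullet> n}"
      by (auto simp: Let_def)
    have "\<bar>\<psi> v - \<psi> w\<bar> \<le> L * max (norm v) (norm w) * norm (v - w)" if vw: "v \<bullet> n = 0" "w \<bullet> n = 0" for v w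
    proof -
      let ?S = "{v. v \<bullet> n = 0} \<inter> cball 0 (max (norm v) (norm w))"
      have "norm (\<psi> v - \<psi> w) \<le> L * max (norm v) (norm w) * norm (v - w)"
      proof (rule differentiable_bound)
        have "{v. v \<bullet> n = 0} = {v. n \<bullet> v = 0}" by (simp add: inner_commute)
        then show "convex ?S" by (intro convex_Int convex_cball) (simp add: convex_hyperplane)
        show "(\<psi> has_derivative (\<lambda>h. g x \<bullet> h)) (at x within ?S)" if "x \<in> ?S" for x
          using that by (intro has_derivative_subset[OF d[of x]]) auto
        show "onorm (\<lambda>h. g x \<bullet> h) \<le> L * max (norm v) (norm w)" if x: "x \<in> ?S" for x
        proof (rule onorm_bound)
          have "dist (g x) (g 0) \<le> L * dist x 0" using x by (intro lipschitz_onD[OF lip]) simp_all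
          also have "\<dots> \<le> L * max (norm v) (norm w)" using x RL(2) by (intro mult_left_mono) (simp_all add: dist_norm)
          finally have gx: "norm (g x) \<le> L * max (norm v) (norm w)" using 0 by simp
          show "norm (g x \<bullet> h) \<le> L * max (norm v) (norm w) * norm h" for h
            using Cauchy_Schwarz_ineq2[of "g x" h] mult_right_mono[OF gx norm_ge_zero[of h]] by simp
        qed (use RL in \<open>auto simp: max_def\<close>)
        show "v \<in> ?S" "w \<in> ?S" using vw by auto
      qed
      then show ?thesis by simp
    qed
    moreover have "y \<in> \<Omega> \<longleftrightarrow> \<psi> ((y - z) - ((y - z) \<bullet> n) *\<^sub>R n) < (y - z) \<bullet> n" if "y \<in> ball z R" for y
      using eq that by blast
    ultimately show "\<exists>n \<psi>. graph_chart \<Omega> R L z n \<psi>"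
      using n 0 unfolding graph_chart_def by blast
  qed
qed

locale boundary_chart =
  fixes \<Omega> :: "'a::euclidean_space set" and R L :: real and z n :: 'a and \<psi> :: "'a \<Rightarrow> real"
  assumes chart: "graph_chart \<Omega> R L z n \<psi>" and RL: "R > 0" "L > 0" and op: "open \<Omega>"
begin

definition hor :: "'a \<Rightarrow> 'a" where "hor y = (y - z) - ((y - z) \<bullet> n) *\<^sub>R n"
definition ver :: "'a \<Rightarrow> real" where "ver y = (y - z) \<bullet> n"

lemma n: "norm n = 1" "n \<bullet> n = 1"
  using chart by (simp_all add: graph_chart_def dot_square_norm)

lemma psi0 [simp]: "\<psi> 0 = 0" using chart by (simp add: graph_chart_def)

lemma psi_diff: "v \<bullet> n = 0 \<Longrightarrow> w \<bullet> n = 0 \<Longrightarrow> \<bar>\<psi> v - \<psi> w\<bar> \<le> L * max (norm v) (norm w) * norm (v - w)"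
  using chart by (simp add: graph_chart_def)

lemma psi_le: "v \<bullet> n = 0 \<Longrightarrow> \<bar>\<psi> v\<bar> \<le> L * (norm v)\<^sup>2"
  using psi_diff[of v 0] by (simp add: power2_eq_square mult.assoc)

lemma mem_iff: "dist z y < R \<Longrightarrow> y \<in> \<Omega> \<longleftrightarrow> \<psi> (hor y) < ver y"
  using chart by (simp add: graph_chart_def hor_def ver_def)

lemma hor_n [simp]: "hor y \<bullet> n = 0"
  by (simp add: hor_def inner_diff_left n)

lemma decomp: "y = z + hor y + ver y *\<^sub>R n"
  by (simp add: hor_def ver_def)

lemma hor_eq [simp]: "v \<bullet> n = 0 \<Longrightarrow> hor (z + v + t *\<^sub>R n) = v"
  by (simp add: hor_def inner_add_left n)

lemma ver_eq [simp]: "v \<bullet> n = 0 \<Longrightarrow> ver (z + v + t *\<^sub>R n) = t"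
  by (simp add: ver_def inner_add_left n)

lemma norm_hor_diff: "norm (hor x - hor y) \<le> norm (x - y)"
proof -
  have e: "x - y = (hor x - hor y) + ((x - y) \<bullet> n) *\<^sub>R n"
    by (simp add: hor_def inner_diff_left algebra_simps)
  have "(norm ((hor x - hor y) + ((x - y) \<bullet> n) *\<^sub>R n))\<^sup>2
      = (norm (hor x - hor y))\<^sup>2 + (norm (((x - y) \<bullet> n) *\<^sub>R n))\<^sup>2"
    by (rule norm_add_Pythagorean) (simp add: orthogonal_def inner_diff_left)
  then have "(norm (x - y))\<^sup>2 = (norm (hor x - hor y))\<^sup>2 + (norm (((x - y) \<bullet> n) *\<^sub>R n))\<^sup>2"
    by (simp only: e[symmetric])
  then show ?thesis by (metis norm_ge_zero power2_le_imp_le le_add_same_cancel1 zero_le_power2)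
qed

lemma norm_hor: "norm (hor y) \<le> dist z y"
  using norm_hor_diff[of y z] by (simp add: hor_def dist_norm norm_minus_commute)

lemma abs_ver_diff: "\<bar>ver x - ver y\<bar> \<le> dist x y"
  using Cauchy_Schwarz_ineq2[of "x - y" n] n by (simp add: ver_def inner_diff_left[symmetric] dist_norm)

lemma height_continuous: "continuous_on UNIV (\<lambda>y. ver y - \<psi> (hor y))"
proof -
  have hc: "continuous_on UNIV hor" unfolding hor_def by (intro continuous_intros)
  have "isCont (\<lambda>y. \<psi> (hor y)) y" for y
  proof -
    have lim: "((\<lambda>x. L * max (norm (hor x)) (norm (hor y)) * norm (hor x - hor y)) \<longlongrightarrow>
        L * max (norm (hor y)) (norm (hor y)) * norm (hor y - hor y)) (at y)"
      using hc by (intro tendsto_intros) (simp_all add: continuous_on_eq_continuous_at isCont_def)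
    have "((\<lambda>x. \<psi> (hor x) - \<psi> (hor y)) \<longlongrightarrow> 0) (at y)"
      by (rule Lim_null_comparison[OF _ lim[simplified]]) (simp add: psi_diff)
    then show ?thesis unfolding isCont_def using LIM_zero_iff by blast
  qed
  then have "continuous_on UNIV (\<lambda>y. \<psi> (hor y))" by (simp add: continuous_at_imp_continuous_on)
  then show ?thesis unfolding ver_def by (intro continuous_intros)
qed

text \<open>Points strictly below the graph have a neighbourhood that misses \<open>\<Omega>\<close>, and
  points on the graph are approached from inside \<open>\<Omega>\<close> in direction
  \<open>n\<close>.\<close>

lemma frontier_iff:
  assumes "dist z y < R"
  shows "y \<in> frontier \<Omega> \<longleftrightarrow> ver y = \<psi> (hor y)"
proof
  assume y: "y \<in> frontier \<Omega>"
  then have "y \<notin> \<Omega>" using op by (simp add: frontier_def interior_open)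
  then have le: "ver y \<le> \<psi> (hor y)" using mem_iff[OF assms] by simp
  show "ver y = \<psi> (hor y)"
  proof (rule ccontr)
    assume "ver y \<noteq> \<psi> (hor y)"
    then have neg: "ver y - \<psi> (hor y) < 0" using le by simp
    let ?U = "{x. ver x - \<psi> (hor x) < 0} \<inter> ball z R"
    have "open {x. ver x - \<psi> (hor x) < 0}"
      using height_continuous by (intro open_Collect_less) (auto intro: continuous_intros)
    then have "open ?U" by auto
    moreover have "y \<in> ?U" using neg assms by simp
    moreover have "?U \<inter> \<Omega> = {}" using mem_iff by auto
    ultimately have "y \<notin> closure \<Omega>" using open_Int_closure_eq_empty[of ?U \<Omega>] by blast
    then show False using y by (simp add: frontier_def)
  qed
next
  assume eq: "ver y = \<psi> (hor y)"
  then have "y \<notin> \<Omega>" using mem_iff[OF assms] by simp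
  moreover have "y \<in> closure \<Omega>"
    unfolding closure_approachable
  proof (intro allI impI)
    fix e :: real assume e: "e > 0"
    define s where "s = min (e / 2) ((R - dist z y) / 2)"
    have s: "s > 0" "s < e" "dist z y + s < R" using e assms by (auto simp: s_def min_def field_simps)
    have d: "dist (y + s *\<^sub>R n) y = s" using n s by (simp add: dist_norm)
    have "dist z (y + s *\<^sub>R n) < R"
      using dist_triangle[of z "y + s *\<^sub>R n" y] d s by (simp add: dist_commute)
    moreover have "hor (y + s *\<^sub>R n) = hor y" "ver (y + s *\<^sub>R n) = ver y + s"
      using hor_eq[of "hor y" "ver y + s"] ver_eq[of "hor y" "ver y + s"] decomp[of y]
      by (simp_all add: algebra_simps hor_def ver_def n inner_add_left)
    ultimately have "y + s *\<^sub>R n \<in> \<Omega>" using mem_iff eq s by simp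
    then show "\<exists>x\<in>\<Omega>. dist x y < e" using d s by metis
  qed
  ultimately show "y \<in> frontier \<Omega>" using op by (simp add: frontier_def interior_open)
qed

text \<open>Over each \<open>v\<close> in the hyperplane with \<open>norm v \<le> (1 - e) * \<rho>\<close>,
  the segment of length \<open>r\<close> above the graph belongs to the tube. It stays in the ball
  of radius \<open>\<rho>\<close> because the height of the graph and the length \<open>r\<close>
  are both at most \<open>e * \<rho> / 2\<close>. The lengths of these segments are integrated
  over the base.\<close>

lemma tube_volume_lower:
  assumes e: "0 < e" "e < 1" and \<rho>: "0 < \<rho>" "\<rho> < R" "L * \<rho> \<le> e / 2" and r: "0 < r" "r \<le> e * \<rho> / 2"
  shows "ennreal (r * (unit_ball_vol (DIM('a) - 1) * ((1 - e) * \<rho>) ^ (DIM('a) - 1)))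
           \<le> emeasure lborel {x \<in> \<Omega> \<inter> ball z \<rho>. infdist x (frontier \<Omega>) < r}" (is "_ \<le> emeasure lborel ?S")
proof -
  have "open {x. infdist x (frontier \<Omega>) < r}" by (intro open_Collect_less continuous_intros)
  then have "open (\<Omega> \<inter> ball z \<rho> \<inter> {x. infdist x (frontier \<Omega>) < r})" using op by auto
  moreover have "\<Omega> \<inter> ball z \<rho> \<inter> {x. infdist x (frontier \<Omega>) < r} = ?S" by auto
  ultimately have S: "?S \<in> sets borel" by (metis borel_open)
  obtain I :: "'a set" and J where I: "finite I" "card I = DIM('a) - 1"
    and J0: "\<And>f. J f \<bullet> n = 0"
    and Jn: "\<And>f. norm (J f) = sqrt (\<Sum>i\<in>I. (f i)\<^sup>2)"
    and "\<And>f g. dist (J f) (J g) = sqrt (\<Sum>i\<in>I. (f i - g i)\<^sup>2)"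
    and "\<And>z S. S \<in> sets borel \<Longrightarrow>
       (\<lambda>f. emeasure lborel {t. z + J f + t *\<^sub>R n \<in> S}) \<in> borel_measurable (Pi\<^sub>M I (\<lambda>_. lborel))"
    and fub: "\<And>z S. S \<in> sets borel \<Longrightarrow>
       emeasure lborel S = (\<integral>\<^sup>+f. emeasure lborel {t. z + J f + t *\<^sub>R n \<in> S} \<partial>Pi\<^sub>M I (\<lambda>_. lborel))"
    by (rule hyperplane_coordinates[OF n(1)]) (rule that; assumption)
  let ?B = "{f. sqrt (\<Sum>i\<in>I. (f i)\<^sup>2) \<le> (1 - e) * \<rho>} \<inter> space (Pi\<^sub>M I (\<lambda>_. lborel :: real measure))"
  have B: "?B \<in> sets (Pi\<^sub>M I (\<lambda>_. lborel))" using I by measurable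
  have "ennreal (r * (unit_ball_vol (DIM('a) - 1) * ((1 - e) * \<rho>) ^ (DIM('a) - 1)))
      = ennreal r * ennreal (unit_ball_vol (real (card I)) * ((1 - e) * \<rho>) ^ card I)"
    using r e \<rho> I by (simp add: ennreal_mult)
  also have "ennreal (unit_ball_vol (real (card I)) * ((1 - e) * \<rho>) ^ card I) = emeasure (Pi\<^sub>M I (\<lambda>_. lborel)) ?B"
    using e \<rho> I by (intro emeasure_cball_aux[symmetric]) auto
  also have "ennreal r * \<dots> = (\<integral>\<^sup>+f. ennreal r * indicator ?B f \<partial>Pi\<^sub>M I (\<lambda>_. lborel))"
    using B by (subst nn_integral_cmult_indicator) auto
  also have "\<dots> \<le> (\<integral>\<^sup>+f. emeasure lborel {t. z + J f + t *\<^sub>R n \<in> ?S} \<partial>Pi\<^sub>M I (\<lambda>_. lborel))"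
  proof (intro nn_integral_mono)
    fix f
    show "ennreal r * indicator ?B f \<le> emeasure lborel {t. z + J f + t *\<^sub>R n \<in> ?S}"
    proof (cases "f \<in> ?B")
      case True
      define v where "v = J f"
      have v: "v \<bullet> n = 0" "norm v \<le> (1 - e) * \<rho>" using True J0 Jn by (auto simp: v_def)
      have "(1 - e) * \<rho> \<le> 1 * \<rho>" using e \<rho>(1) by (intro mult_right_mono) auto
      then have "norm v \<le> \<rho>" using v(2) by linarith
      then have "(norm v)\<^sup>2 \<le> \<rho>\<^sup>2" by (intro power_mono) auto
      then have "L * (norm v)\<^sup>2 \<le> L * \<rho>\<^sup>2" using RL by (intro mult_left_mono) auto
      also have "\<dots> \<le> e / 2 * \<rho>" using mult_right_mono[OF \<rho>(3), of \<rho>] \<rho>(1) by (simp add: power2_eq_square mult.assoc)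
      finally have psi: "\<bar>\<psi> v\<bar> \<le> e / 2 * \<rho>" using psi_le[OF v(1)] by linarith
      have "{\<psi> v<..<\<psi> v + r} \<subseteq> {t. z + v + t *\<^sub>R n \<in> ?S}"
      proof
        fix t assume t: "t \<in> {\<psi> v<..<\<psi> v + r}"
        let ?x = "z + v + t *\<^sub>R n" and ?y = "z + v + \<psi> v *\<^sub>R n"
        have dd: "dist z (z + v + s *\<^sub>R n) \<le> norm v + \<bar>s\<bar>" for s
          using norm_triangle_ineq[of v "s *\<^sub>R n"] n norm_minus_commute[of z "z + v + s *\<^sub>R n"]
          by (simp add: dist_norm)
        have "\<bar>t\<bar> < e / 2 * \<rho> + r" using t psi by auto
        then have "norm v + \<bar>t\<bar> < \<rho>" using v(2) r by (simp add: algebra_simps)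
        then have x: "dist z ?x < \<rho>" using dd[of t] by linarith
        have "norm v + \<bar>\<psi> v\<bar> < \<rho>" using v(2) psi mult_pos_pos[OF e(1) \<rho>(1)] by (simp add: algebra_simps)
        then have y: "dist z ?y < R" using dd[of "\<psi> v"] \<rho> by linarith
        have yf: "?y \<in> frontier \<Omega>" using frontier_iff[OF y] v(1) by simp
        have xO: "?x \<in> \<Omega>" using mem_iff[of ?x] x \<rho> v(1) t by simp
        have "infdist ?x (frontier \<Omega>) \<le> dist ?x ?y" by (rule infdist_le[OF yf])
        also have "\<dots> = \<bar>t - \<psi> v\<bar>"
          using n by (simp add: dist_norm scaleR_diff_left[symmetric])
        also have "\<dots> < r" using t by auto
        finally show "t \<in> {t. z + v + t *\<^sub>R n \<in> ?S}" using x xO by simp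
      qed
      moreover have "{t. z + v + t *\<^sub>R n \<in> X} \<in> sets lborel" if [measurable]: "X \<in> sets borel" for X
        by measurable
      ultimately have "emeasure lborel {\<psi> v<..<\<psi> v + r} \<le> emeasure lborel {t. z + v + t *\<^sub>R n \<in> ?S}"
        using S by (intro emeasure_mono) blast+
      then show ?thesis using True r by (simp add: v_def)
    qed simp
  qed
  also have "\<dots> = emeasure lborel ?S" by (rule fub[OF S, symmetric])
  finally show ?thesis .
qed

text \<open>A line of direction \<open>n\<close> meets \<open>S\<close> in a segment of length at most
  \<open>(1 + e) * r\<close>, since the graph changes its height by at most \<open>e * r\<close>
  over a horizontal distance \<open>r\<close>. The feet of these segments on the graph are within
  \<open>l\<close> of a boundary point whose \<open>l\<close>-ball is contained in
  \<open>U\<close>, so they lie in \<open>U\<close> and are at most \<open>\<rho>\<close> apart.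
  The isodiametric inequality bounds the measure of the base.\<close>

lemma column_volume_upper:
  assumes e: "0 < e" "e \<le> 1" and \<delta>: "0 < \<delta>" "2 * \<delta> < R" "2 * L * \<delta> \<le> e"
    and \<rho>: "0 < \<rho>" "\<rho> \<le> \<delta>" and r: "0 < r" "r \<le> \<delta>" "3 * r \<le> l"
    and U: "z \<in> U" "\<And>x y. x \<in> U \<Longrightarrow> y \<in> U \<Longrightarrow> dist x y \<le> \<rho>"
    and S: "S \<in> sets borel" "S \<subseteq> {x \<in> \<Omega>. \<exists>y\<in>frontier \<Omega>. dist x y < r \<and> ball y l \<subseteq> U}"
  shows "emeasure lborel S \<le> ennreal ((1 + e) * r * (unit_ball_vol (DIM('a) - 1) * (\<rho> / 2) ^ (DIM('a) - 1)))"
proof -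
  obtain I :: "'a set" and J where I: "finite I" "card I = DIM('a) - 1"
    and J0: "\<And>f. J f \<bullet> n = 0"
    and "\<And>f. norm (J f) = sqrt (\<Sum>i\<in>I. (f i)\<^sup>2)"
    and Jd: "\<And>f g. dist (J f) (J g) = sqrt (\<Sum>i\<in>I. (f i - g i)\<^sup>2)"
    and meas: "\<And>z S. S \<in> sets borel \<Longrightarrow>
       (\<lambda>f. emeasure lborel {t. z + J f + t *\<^sub>R n \<in> S}) \<in> borel_measurable (Pi\<^sub>M I (\<lambda>_. lborel))"
    and fub: "\<And>z S. S \<in> sets borel \<Longrightarrow>
       emeasure lborel S = (\<integral>\<^sup>+f. emeasure lborel {t. z + J f + t *\<^sub>R n \<in> S} \<partial>Pi\<^sub>M I (\<lambda>_. lborel))"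
    by (rule hyperplane_coordinates[OF n(1)]) (rule that; assumption)
  have l: "l > 0" using r by linarith
  have col: "\<psi> v < t \<and> t < \<psi> v + (1 + e) * r \<and> z + v + \<psi> v *\<^sub>R n \<in> U"
    if x: "z + v + t *\<^sub>R n \<in> S" and v: "v \<bullet> n = 0" for v t
  proof -
    let ?x = "z + v + t *\<^sub>R n" and ?f = "z + v + \<psi> v *\<^sub>R n"
    obtain y where y: "y \<in> frontier \<Omega>" "dist ?x y < r" "ball y l \<subseteq> U" and xO: "?x \<in> \<Omega>"
      using S(2) x by blast
    have "y \<in> U" using y(3) l by auto
    then have zy: "dist z y \<le> \<delta>" using U(2)[OF U(1)] \<rho> by force
    have zx: "dist z ?x < 2 * \<delta>" using dist_triangle[of z ?x y] zy y(2) r(2) by (simp add: dist_commute)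
    have ver_y: "ver y = \<psi> (hor y)" using frontier_iff[of y] y(1) zy \<delta> by simp
    have lo: "\<psi> v < t" using mem_iff[of ?x] zx \<delta> xO v by simp
    have nv: "norm v \<le> 2 * \<delta>" using norm_hor[of ?x] zx v by simp
    have ny: "norm (hor y) \<le> 2 * \<delta>" using norm_hor[of y] zy \<delta>(1) by linarith
    have dvy: "norm (v - hor y) \<le> r" using norm_hor_diff[of ?x y] y(2) v by (simp add: dist_norm)
    have "\<bar>\<psi> v - \<psi> (hor y)\<bar> \<le> L * max (norm v) (norm (hor y)) * norm (v - hor y)"
      by (rule psi_diff) (use v in auto)
    also have "\<dots> \<le> L * (2 * \<delta>) * r"
      using RL nv ny dvy \<delta>(1) by (intro mult_mono) (auto simp: le_max_iff_disj)
    also have "\<dots> \<le> e * r" using \<delta>(3) r(1) by (intro mult_right_mono) auto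
    finally have ps: "\<bar>\<psi> v - \<psi> (hor y)\<bar> \<le> e * r" .
    have "\<bar>t - ver y\<bar> < r" using abs_ver_diff[of ?x y] y(2) v by simp
    then have up: "t < \<psi> v + (1 + e) * r" using ps ver_y by (simp add: algebra_simps)
    have "e * r \<le> 1 * r" using e r by (intro mult_right_mono) auto
    moreover have "dist ?f ?x = \<bar>\<psi> v - t\<bar>"
      using n by (simp add: dist_norm scaleR_diff_left[symmetric])
    ultimately have "dist ?f ?x < 2 * r" using lo up by (simp add: distrib_right)
    then have "dist y ?f < l" using dist_triangle[of y ?f ?x] y(2) r(3) by (simp add: dist_commute)
    then have "?f \<in> U" using y(3) by auto
    with lo up show ?thesis by simp
  qed
  let ?m = "\<lambda>f. emeasure lborel {t. z + J f + t *\<^sub>R n \<in> S}"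
  let ?M = "Pi\<^sub>M I (\<lambda>_. lborel :: real measure)"
  note meas[OF S(1), of z, measurable]
  define A where "A = {f \<in> space ?M. ?m f > 0}"
  have A: "A \<in> sets ?M" unfolding A_def by measurable
  have sl: "?m f \<le> ennreal ((1 + e) * r) * indicator A f" if f: "f \<in> space ?M" for f
  proof (cases "f \<in> A")
    case True
    have "?m f \<le> emeasure lborel {\<psi> (J f)<..<\<psi> (J f) + (1 + e) * r}"
      using col[OF _ J0] by (intro emeasure_mono) auto
    then show ?thesis using True e r by simp
  next
    case False
    then show ?thesis using f by (simp add: A_def)
  qed
  have "emeasure lborel S = (\<integral>\<^sup>+f. ?m f \<partial>?M)" by (rule fub[OF S(1)])
  also have "\<dots> \<le> (\<integral>\<^sup>+f. ennreal ((1 + e) * r) * indicator A f \<partial>?M)"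
    by (intro nn_integral_mono sl)
  also have "\<dots> = ennreal ((1 + e) * r) * emeasure ?M A"
    by (rule nn_integral_cmult_indicator[OF A])
  also have "emeasure ?M A \<le> ennreal (unit_ball_vol (real (card I)) * (\<rho> / 2) ^ card I)"
  proof (rule isodiametric_inequality[OF I(1) A \<rho>(1)])
    fix f g assume fg: "f \<in> A" "g \<in> A"
    have foot: "z + J f + \<psi> (J f) *\<^sub>R n \<in> U" if "f \<in> A" for f
    proof -
      have "?m f \<noteq> 0" using that by (simp add: A_def zero_less_iff_neq_zero)
      then have "{t. z + J f + t *\<^sub>R n \<in> S} \<noteq> {}" by (metis emeasure_empty)
      then show ?thesis using col[OF _ J0] by blast
    qed
    have "dist (J f) (J g) = norm (hor (z + J f + \<psi> (J f) *\<^sub>R n) - hor (z + J g + \<psi> (J g) *\<^sub>R n))"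
      using J0 by (simp add: dist_norm)
    also have "\<dots> \<le> dist (z + J f + \<psi> (J f) *\<^sub>R n) (z + J g + \<psi> (J g) *\<^sub>R n)"
      unfolding dist_norm by (rule norm_hor_diff)
    also have "\<dots> \<le> \<rho>" using U(2) foot fg by blast
    finally show "sqrt (\<Sum>i\<in>I. (f i - g i)\<^sup>2) \<le> \<rho>" by (simp add: Jd)
  qed
  also have "ennreal ((1 + e) * r) * ennreal (unit_ball_vol (real (card I)) * (\<rho> / 2) ^ card I)
      = ennreal ((1 + e) * r * (unit_ball_vol (DIM('a) - 1) * (\<rho> / 2) ^ (DIM('a) - 1)))"
    using e r \<rho> I by (simp add: ennreal_mult)
  finally show ?thesis by (simp add: mult_left_mono)
qed

end

section \<open>Minkowski content and Hausdorff measure of the boundary\<close>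

definition inner_tube :: "'a::euclidean_space set \<Rightarrow> real \<Rightarrow> 'a set" where
  "inner_tube \<Omega> r = {x \<in> \<Omega>. infdist x (frontier \<Omega>) < r}"

locale charted_domain =
  fixes \<Omega> :: "'a::euclidean_space set" and R L :: real
  assumes op: "open \<Omega>" and bd: "bounded \<Omega>" and ne: "\<Omega> \<noteq> {}" and RL: "R > 0" "L > 0"
    and charts: "\<And>z. z \<in> frontier \<Omega> \<Longrightarrow> \<exists>n \<psi>. graph_chart \<Omega> R L z n \<psi>"
begin

lemma boundary_compact: "compact (frontier \<Omega>)"
  using bd by (rule compact_frontier_bounded)

lemma boundary_nonempty: "frontier \<Omega> \<noteq> {}"
  using frontier_eq_empty[of \<Omega>] ne bd not_bounded_UNIV by metis

lemma inner_tube_measurable [measurable]: "inner_tube \<Omega> r \<in> sets borel"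
proof -
  have "open {x. infdist x (frontier \<Omega>) < r}" by (intro open_Collect_less continuous_intros)
  then have "open (\<Omega> \<inter> {x. infdist x (frontier \<Omega>) < r})" using op by auto
  moreover have "\<Omega> \<inter> {x. infdist x (frontier \<Omega>) < r} = inner_tube \<Omega> r" by (auto simp: inner_tube_def)
  ultimately show ?thesis by (metis borel_open)
qed

text \<open>A Lebesgue number of the cover assigns each point of a thin tube to a member \<open>U i\<close>,
  and the part that belongs to one member is measured in the chart at one of its points. The bound
  \<open>\<delta>\<close> is found before the cover, so that it holds for arbitrarily fine ones.\<close>

lemma tube_volume_cover:
  assumes e: "0 < e" "e \<le> 1"
  obtains \<delta> where "\<delta> > 0" "\<And>F U \<rho>. finite F \<Longrightarrow> frontier \<Omega> \<subseteq> (\<Union>i\<in>F. U i) \<Longrightarrow>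
      (\<And>i::nat. i \<in> F \<Longrightarrow> open (U i) \<and> 0 < \<rho> i \<and> \<rho> i \<le> \<delta> \<and> (\<forall>x\<in>U i. \<forall>y\<in>U i. dist x y \<le> \<rho> i)) \<Longrightarrow>
      \<forall>\<^sub>F r in at_right 0. emeasure lborel (inner_tube \<Omega> r)
        \<le> ennreal ((1 + e) * r * (\<Sum>i\<in>F. unit_ball_vol (DIM('a) - 1) * (\<rho> i / 2) ^ (DIM('a) - 1)))"
proof -
  \<comment> \<open>points within \<open>2 * \<delta>\<close> of the centre belong to the chart, and the slope there is at most \<open>e\<close>\<close>
  define \<delta> where "\<delta> = min (R / 4) (e / (2 * L))"
  have \<delta>: "0 < \<delta>" "2 * \<delta> < R" "2 * L * \<delta> \<le> e"
    using RL e by (auto simp: \<delta>_def min_def field_simps)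
  show thesis
  proof (rule that[OF \<delta>(1)])
    fix F :: "nat set" and U :: "nat \<Rightarrow> 'a set" and \<rho> :: "nat \<Rightarrow> real"
    assume F: "finite F" and cov: "frontier \<Omega> \<subseteq> (\<Union>i\<in>F. U i)"
      and U: "\<And>i. i \<in> F \<Longrightarrow> open (U i) \<and> 0 < \<rho> i \<and> \<rho> i \<le> \<delta> \<and> (\<forall>x\<in>U i. \<forall>y\<in>U i. dist x y \<le> \<rho> i)"
    obtain l where l: "0 < l" "\<And>y. y \<in> frontier \<Omega> \<Longrightarrow> \<exists>G\<in>U ` F. ball y l \<subseteq> G"
      using Heine_Borel_lemma[OF boundary_compact, of "U ` F"] cov U by (metis imageE)
    define r0 where "r0 = min \<delta> (l / 3)"
    have r0: "r0 > 0" using \<delta> l by (simp add: r0_def)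
    let ?c = "\<lambda>i. unit_ball_vol (DIM('a) - 1) * (\<rho> i / 2) ^ (DIM('a) - 1)"
    have "emeasure lborel (inner_tube \<Omega> r) \<le> ennreal ((1 + e) * r * (\<Sum>i\<in>F. ?c i))" if r: "0 < r" "r < r0" for r
    proof -
      have r': "r \<le> \<delta>" "3 * r \<le> l" using r by (auto simp: r0_def)
      define E where "E i = \<Omega> \<inter> (\<Union>y\<in>{y \<in> frontier \<Omega>. ball y l \<subseteq> U i}. ball y r)" for i
      have E: "E i \<in> sets borel" for i
        unfolding E_def using op by (intro borel_open open_Int open_UN) auto
      have sub: "inner_tube \<Omega> r \<subseteq> (\<Union>i\<in>F. E i)"
      proof
        fix x assume x: "x \<in> inner_tube \<Omega> r"
        obtain y where y: "y \<in> frontier \<Omega>" "infdist x (frontier \<Omega>) = dist x y"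
          using infdist_attains_inf[OF frontier_closed boundary_nonempty] by blast
        obtain i where i: "i \<in> F" "ball y l \<subseteq> U i" using l(2)[OF y(1)] by blast
        have "x \<in> E i" using x y i by (auto simp: E_def inner_tube_def dist_commute)
        then show "x \<in> (\<Union>i\<in>F. E i)" using i by blast
      qed
      have Ei: "emeasure lborel (E i) \<le> ennreal ((1 + e) * r * ?c i)" if i: "i \<in> F" for i
      proof (cases "\<exists>y\<in>frontier \<Omega>. ball y l \<subseteq> U i")
        case True
        then obtain z where z: "z \<in> frontier \<Omega>" "ball z l \<subseteq> U i" by blast
        then have zU: "z \<in> U i" using l by auto
        obtain n \<psi> where "graph_chart \<Omega> R L z n \<psi>" using charts[OF z(1)] by blast
        then interpret boundary_chart \<Omega> R L z n \<psi> using RL op by unfold_locales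
        show ?thesis
        proof (rule column_volume_upper[OF e \<delta>])
          show "E i \<subseteq> {x \<in> \<Omega>. \<exists>y\<in>frontier \<Omega>. dist x y < r \<and> ball y l \<subseteq> U i}"
            by (auto simp: E_def dist_commute)
        qed (use U[OF i] r r' zU E in auto)
      next
        case False
        then have "E i = {}" by (auto simp: E_def)
        then show ?thesis by simp
      qed
      have "emeasure lborel (inner_tube \<Omega> r) \<le> emeasure lborel (\<Union>i\<in>F. E i)"
        using E F by (intro emeasure_mono sub) auto
      also have "\<dots> \<le> (\<Sum>i\<in>F. emeasure lborel (E i))"
        using E F by (intro emeasure_subadditive_finite) auto
      also have "\<dots> \<le> (\<Sum>i\<in>F. ennreal ((1 + e) * r * ?c i))" by (intro sum_mono Ei)
      also have "\<dots> = ennreal ((1 + e) * r * (\<Sum>i\<in>F. ?c i))"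
        using e r U by (subst sum_ennreal) (auto simp: sum_distrib_left less_imp_le)
      finally show ?thesis .
    qed
    then show "\<forall>\<^sub>F r in at_right 0. emeasure lborel (inner_tube \<Omega> r) \<le> ennreal ((1 + e) * r * (\<Sum>i\<in>F. ?c i))"
      using r0 by (auto simp: eventually_at_right_field)
  qed
qed

text \<open>An almost optimal countable cover is enlarged to open sets with a gain of at most \<open>h -
  s\<close> in the sum, where \<open>s < h\<close> is the sum for the cover itself; compactness
  then leaves finitely many sets.\<close>

lemma tube_volume_le_hausdorff:
  assumes e: "0 < e" "e \<le> 1" and h: "hausdorff_measure (DIM('a) - 1) (frontier \<Omega>) < ennreal h"
  shows "\<forall>\<^sub>F r in at_right 0. emeasure lborel (inner_tube \<Omega> r) \<le> ennreal ((1 + e) * r * h)"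
proof -
  define m where "m = DIM('a) - 1"
  let ?w = "unit_ball_vol (real m)"
  obtain \<delta> where \<delta>: "\<delta> > 0" and cover: "\<And>F U \<rho>. finite F \<Longrightarrow> frontier \<Omega> \<subseteq> (\<Union>i\<in>F. U i) \<Longrightarrow>
      (\<And>i::nat. i \<in> F \<Longrightarrow> open (U i) \<and> 0 < \<rho> i \<and> \<rho> i \<le> \<delta> \<and> (\<forall>x\<in>U i. \<forall>y\<in>U i. dist x y \<le> \<rho> i)) \<Longrightarrow>
      \<forall>\<^sub>F r in at_right 0. emeasure lborel (inner_tube \<Omega> r)
        \<le> ennreal ((1 + e) * r * (\<Sum>i\<in>F. ?w * (\<rho> i / 2) ^ m))"
    using tube_volume_cover[OF e] unfolding m_def by blast
  have "hausdorff_premeasure m (\<delta> / 2) (frontier \<Omega>) \<le> hausdorff_measure m (frontier \<Omega>)"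
    unfolding hausdorff_measure_def by (rule SUP_upper) (use \<delta> in simp)
  then have "hausdorff_premeasure m (\<delta> / 2) (frontier \<Omega>) < ennreal h" using h unfolding m_def by (rule le_less_trans)
  then obtain U :: "nat \<Rightarrow> 'a set" where U: "frontier \<Omega> \<subseteq> (\<Union>i. U i)" "\<And>i. bounded (U i)" "\<And>i. diameter (U i) \<le> \<delta> / 2"
    and sum: "(\<Sum>i. if U i = {} then 0 else ennreal (?w * (diameter (U i) / 2) ^ m)) < ennreal h" (is "suminf ?c < _")
    unfolding hausdorff_premeasure_def INF_less_iff by blast
  obtain s where s: "suminf ?c = ennreal s" "s \<ge> 0" "s < h"
  proof -
    have "suminf ?c < \<top>" using sum by (rule less_trans) simp
    then obtain s where "suminf ?c = ennreal s" "s \<ge> 0" by (cases "suminf ?c") auto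
    then show thesis using sum that by (simp add: ennreal_less_iff)
  qed
  define \<kappa> where "\<kappa> = h - s"
  have \<kappa>: "\<kappa> > 0" using s by (simp add: \<kappa>_def)
  have "\<exists>\<sigma>>0. \<sigma> \<le> \<delta> / 4 \<and> ?w * ((diameter (U i) + 2 * \<sigma>) / 2) ^ m \<le> ?w * (diameter (U i) / 2) ^ m + \<kappa> * (1/2) ^ Suc i" for i
  proof -
    have "((\<lambda>\<sigma>. ?w * ((diameter (U i) + 2 * \<sigma>) / 2) ^ m) \<longlongrightarrow> ?w * ((diameter (U i) + 2 * 0) / 2) ^ m) (at_right 0)"
      by (intro tendsto_intros) auto
    moreover have "?w * ((diameter (U i) + 2 * 0) / 2) ^ m < ?w * (diameter (U i) / 2) ^ m + \<kappa> * (1/2) ^ Suc i"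
      using \<kappa> by simp
    ultimately have "\<forall>\<^sub>F \<sigma> in at_right 0. ?w * ((diameter (U i) + 2 * \<sigma>) / 2) ^ m < ?w * (diameter (U i) / 2) ^ m + \<kappa> * (1/2) ^ Suc i"
      by (rule order_tendstoD)
    moreover have "\<forall>\<^sub>F \<sigma> in at_right (0::real). 0 < \<sigma> \<and> \<sigma> \<le> \<delta> / 4"
      using \<delta> by (auto simp: eventually_at_right_field intro!: exI[of _ "\<delta> / 4"])
    ultimately have "\<forall>\<^sub>F \<sigma> in at_right 0. 0 < \<sigma> \<and> \<sigma> \<le> \<delta> / 4 \<and>
        ?w * ((diameter (U i) + 2 * \<sigma>) / 2) ^ m \<le> ?w * (diameter (U i) / 2) ^ m + \<kappa> * (1/2) ^ Suc i"
      by eventually_elim auto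
    then show ?thesis by (auto dest!: eventually_happens)
  qed
  then obtain \<sigma> where \<sigma>: "\<And>i. 0 < \<sigma> i" "\<And>i. \<sigma> i \<le> \<delta> / 4"
    "\<And>i. ?w * ((diameter (U i) + 2 * \<sigma> i) / 2) ^ m \<le> ?w * (diameter (U i) / 2) ^ m + \<kappa> * (1/2) ^ Suc i"
    by metis
  define U' where "U' i = (\<Union>x\<in>U i. ball x (\<sigma> i))" for i
  define \<rho> where "\<rho> i = diameter (U i) + 2 * \<sigma> i" for i
  have U'o: "open (U' i)" for i unfolding U'_def by auto
  have "U i \<subseteq> U' i" for i unfolding U'_def using \<sigma>(1) by force
  then have "(\<Union>i. U i) \<subseteq> (\<Union>i. U' i)" by (intro UN_mono) auto
  with U(1) have "frontier \<Omega> \<subseteq> (\<Union>i\<in>UNIV. U' i)" by (rule order_trans)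
  with boundary_compact U'o
  obtain F0 where "F0 \<subseteq> UNIV" and F0: "finite F0" "frontier \<Omega> \<subseteq> (\<Union>i\<in>F0. U' i)"
    by (rule compactE_image)
  define F where "F = {i\<in>F0. U i \<noteq> {}}"
  have F: "finite F" using F0 by (simp add: F_def)
  have F': "frontier \<Omega> \<subseteq> (\<Union>i\<in>F. U' i)"
  proof
    fix x assume "x \<in> frontier \<Omega>"
    then obtain i where i: "i \<in> F0" "x \<in> U' i" using F0(2) by blast
    then have "i \<in> F" by (auto simp: F_def U'_def)
    with i show "x \<in> (\<Union>i\<in>F. U' i)" by blast
  qed
  have diam: "dist x y \<le> \<rho> i" if "x \<in> U' i" "y \<in> U' i" for x y i
  proof -
    obtain a b where ab: "a \<in> U i" "b \<in> U i" "dist a x < \<sigma> i" "dist b y < \<sigma> i"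
      using \<open>x \<in> U' i\<close> \<open>y \<in> U' i\<close> by (auto simp: U'_def)
    have "dist a b \<le> diameter (U i)" using U(2) ab(1,2) by (rule diameter_bounded_bound)
    moreover have "dist x y \<le> dist a x + dist a b + dist b y"
      using dist_triangle[of x y a] dist_triangle[of a y b] by (simp add: dist_commute)
    ultimately show ?thesis using ab by (simp add: \<rho>_def)
  qed
  have ev: "\<forall>\<^sub>F r in at_right 0. emeasure lborel (inner_tube \<Omega> r)
        \<le> ennreal ((1 + e) * r * (\<Sum>i\<in>F. ?w * (\<rho> i / 2) ^ m))"
  proof (rule cover[OF F F'])
    fix i
    have "0 < \<rho> i" unfolding \<rho>_def using \<sigma>(1)[of i] diameter_ge_0[OF U(2)[of i]] by linarith
    moreover have "\<rho> i \<le> \<delta>" unfolding \<rho>_def using U(3)[of i] \<sigma>(2)[of i] by linarith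
    ultimately show "open (U' i) \<and> 0 < \<rho> i \<and> \<rho> i \<le> \<delta> \<and> (\<forall>x\<in>U' i. \<forall>y\<in>U' i. dist x y \<le> \<rho> i)"
      using U'o diam by blast
  qed
  have total: "(\<Sum>i\<in>F. ?w * (\<rho> i / 2) ^ m) \<le> h"
  proof -
    have "ennreal (\<Sum>i\<in>F. ?w * (diameter (U i) / 2) ^ m) = (\<Sum>i\<in>F. ennreal (?w * (diameter (U i) / 2) ^ m))"
      using diameter_ge_0[OF U(2)] by (subst sum_ennreal) auto
    also have "\<dots> = (\<Sum>i\<in>F. ?c i)" by (intro sum.cong) (auto simp: F_def)
    also have "\<dots> \<le> suminf ?c" by (rule sum_le_suminf) (auto simp: F)
    finally have 1: "(\<Sum>i\<in>F. ?w * (diameter (U i) / 2) ^ m) \<le> s"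
      using s by (subst (asm) s(1)) (simp add: ennreal_le_iff)
    have "(\<Sum>i\<in>F. (1/2::real) ^ Suc i) \<le> (\<Sum>i. (1/2) ^ Suc i)"
      using power_half_series by (intro sum_le_suminf) (auto simp: F sums_iff)
    then have 2: "(\<Sum>i\<in>F. \<kappa> * (1/2::real) ^ Suc i) \<le> \<kappa> * 1"
      unfolding sum_distrib_left[symmetric] using \<kappa> power_half_series
      by (intro mult_left_mono) (auto simp: sums_iff)
    have "(\<Sum>i\<in>F. ?w * (\<rho> i / 2) ^ m) \<le> (\<Sum>i\<in>F. ?w * (diameter (U i) / 2) ^ m + \<kappa> * (1/2) ^ Suc i)"
      unfolding \<rho>_def by (intro sum_mono \<sigma>(3))
    also have "\<dots> \<le> s + \<kappa>" using 1 2 by (simp add: sum.distrib)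
    finally show ?thesis by (simp add: \<kappa>_def)
  qed
  have "\<forall>\<^sub>F r in at_right (0::real). 0 < r" by (simp add: eventually_at_right_less)
  with ev show ?thesis
  proof eventually_elim
    case (elim r)
    have "(1 + e) * r * (\<Sum>i\<in>F. ?w * (\<rho> i / 2) ^ m) \<le> (1 + e) * r * h"
      using elim e total by (intro mult_left_mono) auto
    then show ?case using elim by (meson ennreal_leI order_trans)
  qed
qed

text \<open>A crude bound from any finite cover by balls; it is what makes the Hausdorff measure of the
  boundary finite.\<close>

lemma tube_volume_linear_bound:
  obtains C where "C \<ge> 0" "\<forall>\<^sub>F r in at_right 0. emeasure lborel (inner_tube \<Omega> r) \<le> ennreal (C * r)"
proof -
  obtain \<delta> where \<delta>: "\<delta> > 0" and cover: "\<And>F U \<rho>. finite F \<Longrightarrow> frontier \<Omega> \<subseteq> (\<Union>i\<in>F. U i) \<Longrightarrow>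
      (\<And>i::nat. i \<in> F \<Longrightarrow> open (U i) \<and> 0 < \<rho> i \<and> \<rho> i \<le> \<delta> \<and> (\<forall>x\<in>U i. \<forall>y\<in>U i. dist x y \<le> \<rho> i)) \<Longrightarrow>
      \<forall>\<^sub>F r in at_right 0. emeasure lborel (inner_tube \<Omega> r)
        \<le> ennreal ((1 + 1) * r * (\<Sum>i\<in>F. unit_ball_vol (DIM('a) - 1) * (\<rho> i / 2) ^ (DIM('a) - 1)))"
    using tube_volume_cover[OF zero_less_one order_refl] by blast
  have "frontier \<Omega> \<subseteq> (\<Union>z\<in>frontier \<Omega>. ball z (\<delta> / 2))" using \<delta> by force
  from compactE_image[OF boundary_compact open_ball this]
  obtain T where T: "finite T" "frontier \<Omega> \<subseteq> (\<Union>z\<in>T. ball z (\<delta> / 2))"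
    by metis
  obtain f :: "nat \<Rightarrow> 'a" and k where f: "T = f ` {i. i < k}"
    using finite_imp_nat_seg_image_inj_on[OF T(1)] by metis
  let ?C = "2 * (\<Sum>i\<in>{i. i < k}. unit_ball_vol (DIM('a) - 1) * (\<delta> / 2) ^ (DIM('a) - 1))"
  show thesis
  proof (rule that)
    show "0 \<le> ?C" using \<delta> by (intro mult_nonneg_nonneg sum_nonneg) auto
    have "\<forall>\<^sub>F r in at_right 0. emeasure lborel (inner_tube \<Omega> r)
        \<le> ennreal ((1 + 1) * r * (\<Sum>i\<in>{i. i < k}. unit_ball_vol (DIM('a) - 1) * (\<delta> / 2) ^ (DIM('a) - 1)))"
    proof (rule cover[where U="\<lambda>i. ball (f i) (\<delta> / 2)" and \<rho>="\<lambda>_. \<delta>"])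
      show "frontier \<Omega> \<subseteq> (\<Union>i\<in>{i. i < k}. ball (f i) (\<delta> / 2))" using T(2) f by auto
      have "dist x y \<le> \<delta>" if "dist (f i) x < \<delta> / 2" "dist (f i) y < \<delta> / 2" for x y i
        using dist_triangle3[of x y "f i"] that by linarith
      then show "open (ball (f i) (\<delta> / 2)) \<and> 0 < \<delta> \<and> \<delta> \<le> \<delta> \<and>
          (\<forall>x\<in>ball (f i) (\<delta> / 2). \<forall>y\<in>ball (f i) (\<delta> / 2). dist x y \<le> \<delta>)" for i
        using \<delta> by auto
    qed simp
    then show "\<forall>\<^sub>F r in at_right 0. emeasure lborel (inner_tube \<Omega> r) \<le> ennreal (?C * r)"
      by (simp add: mult_ac)
  qed
qed

text \<open>Disjoint balls see disjoint parts of the tube, and the part in each ball has almost the volume of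
  a flat tube. One width \<open>r\<close> that is small compared with all radii is enough, which
  is why a bound along some sequence of widths suffices.\<close>

lemma disjoint_balls_sum_le:
  assumes freq: "\<exists>\<^sub>F r in at_right 0. emeasure lborel (inner_tube \<Omega> r) \<le> ennreal (c * r)" and c: "c \<ge> 0"
    and e: "0 < e" "e < 1" and F: "finite F" "F \<subseteq> {(z, \<rho>). z \<in> frontier \<Omega> \<and> 0 < \<rho> \<and> \<rho> \<le> min (R / 2) (e / (2 * L))}"
    and disj: "pairwise (\<lambda>i j. disjnt (cball (fst i) (snd i)) (cball (fst j) (snd j))) F"
  shows "(\<Sum>i\<in>F. unit_ball_vol (DIM('a) - 1) * (snd i) ^ (DIM('a) - 1)) \<le> c / (1 - e) ^ (DIM('a) - 1)"
proof -
  define m where "m = DIM('a) - 1"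
  let ?w = "unit_ball_vol (real m)"
  have "\<forall>\<^sub>F r in at_right 0. \<forall>i\<in>F. r \<le> e * snd i / 2"
    using F(1)
  proof (rule eventually_ball_finite, safe)
    fix z \<rho> assume "(z, \<rho>) \<in> F"
    then have "0 < e * \<rho> / 2" using F e by auto
    then show "\<forall>\<^sub>F r in at_right 0. r \<le> e * snd (z, \<rho>) / 2"
      by (auto simp: eventually_at_right_field intro!: exI[of _ "e * \<rho> / 2"])
  qed
  moreover have "\<forall>\<^sub>F r in at_right (0::real). 0 < r" by (simp add: eventually_at_right_less)
  ultimately have "\<forall>\<^sub>F r in at_right (0::real). 0 < r \<and> (\<forall>i\<in>F. r \<le> e * snd i / 2)"
    by eventually_elim auto
  with freq have "\<exists>\<^sub>F r in at_right 0. emeasure lborel (inner_tube \<Omega> r) \<le> ennreal (c * r) \<and> 0 < r \<and> (\<forall>i\<in>F. r \<le> e * snd i / 2)"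
    by (rule frequently_eventually_frequently)
  then obtain r where r: "emeasure lborel (inner_tube \<Omega> r) \<le> ennreal (c * r)" "0 < r" "\<And>i. i \<in> F \<Longrightarrow> r \<le> e * snd i / 2"
    by (auto dest!: frequently_ex)
  define T where "T i = {x \<in> \<Omega> \<inter> ball (fst i) (snd i). infdist x (frontier \<Omega>) < r}" for i :: "'a \<times> real"
  have Ti: "T i = inner_tube \<Omega> r \<inter> ball (fst i) (snd i)" for i by (auto simp: T_def inner_tube_def)
  have Tm: "T i \<in> sets lborel" for i unfolding Ti by auto
  have lower: "ennreal (r * (?w * ((1 - e) * snd i) ^ m)) \<le> emeasure lborel (T i)" if i: "i \<in> F" for i
  proof -
    obtain z \<rho> where zr: "i = (z, \<rho>)" by (cases i)
    with i F have z: "z \<in> frontier \<Omega>" "0 < \<rho>" "\<rho> \<le> R / 2" "\<rho> \<le> e / (2 * L)" by auto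
    obtain n \<psi> where "graph_chart \<Omega> R L z n \<psi>" using charts[OF z(1)] by blast
    then interpret boundary_chart \<Omega> R L z n \<psi> using RL op by unfold_locales
    have "\<rho> < R" using z(2,3) by linarith
    moreover have "L * \<rho> \<le> e / 2" using z(4) RL by (simp add: field_simps)
    ultimately show ?thesis
      using tube_volume_lower[OF e z(2) _ _ r(2)] r(3)[OF i] unfolding zr T_def m_def by simp
  qed
  have "disjoint_family_on T F"
    unfolding disjoint_family_on_def
  proof (intro ballI impI)
    fix i j assume "i \<in> F" "j \<in> F" "i \<noteq> j"
    then have "disjnt (cball (fst i) (snd i)) (cball (fst j) (snd j))" using disj by (simp add: pairwise_def)
    then show "T i \<inter> T j = {}" using ball_subset_cball unfolding Ti disjnt_def by blast
  qed
  then have "(\<Sum>i\<in>F. emeasure lborel (T i)) = emeasure lborel (\<Union>i\<in>F. T i)"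
    using Tm F(1) by (intro sum_emeasure) auto
  also have "\<dots> \<le> emeasure lborel (inner_tube \<Omega> r)"
    by (intro emeasure_mono) (auto simp: Ti)
  finally have "(\<Sum>i\<in>F. emeasure lborel (T i)) \<le> ennreal (c * r)" using r(1) by simp
  then have "(\<Sum>i\<in>F. ennreal (r * (?w * ((1 - e) * snd i) ^ m))) \<le> ennreal (c * r)"
    using sum_mono[of F, OF lower] by (meson order_trans)
  moreover have "0 \<le> snd i" if "i \<in> F" for i using that F by auto
  ultimately have "ennreal (\<Sum>i\<in>F. r * (?w * ((1 - e) * snd i) ^ m)) \<le> ennreal (c * r)"
    using r(2) e by (subst (asm) sum_ennreal) auto
  then have "(\<Sum>i\<in>F. r * (?w * ((1 - e) * snd i) ^ m)) \<le> c * r"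
    using c r(2) by (subst (asm) ennreal_le_iff) auto
  moreover have "(\<Sum>i\<in>F. r * (?w * ((1 - e) * snd i) ^ m)) = r * ((1 - e) ^ m * (\<Sum>i\<in>F. ?w * snd i ^ m))"
    by (simp add: sum_distrib_left power_mult_distrib mult_ac)
  ultimately have "(1 - e) ^ m * (\<Sum>i\<in>F. ?w * snd i ^ m) \<le> c"
    using r(2) by (simp add: mult.commute)
  then show ?thesis using e by (simp add: pos_le_divide_eq mult.commute m_def)
qed

text \<open>The Vitali covering lemma provides disjoint balls centred on the boundary whose fivefold
  enlargements cover it. Their sum is finite by the previous lemma, so all but finitely many balls
  \<open>F0\<close> contribute at most \<open>\<kappa>\<close>, and only these are enlarged. The
  cover persists: a boundary point outside the closed balls of \<open>F0\<close> has a small ball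
  that misses them, and the ball of the family that the lemma assigns to it is not in
  \<open>F0\<close>.\<close>

lemma hausdorff_le_tube_volume:
  assumes freq: "\<exists>\<^sub>F r in at_right 0. emeasure lborel (inner_tube \<Omega> r) \<le> ennreal (c * r)" and c: "c \<ge> 0"
  shows "hausdorff_measure (DIM('a) - 1) (frontier \<Omega>) \<le> ennreal c"
  unfolding hausdorff_measure_def
proof (rule SUP_least)
  fix \<delta> :: real assume "\<delta> \<in> {0<..}"
  then have \<delta>: "\<delta> > 0" by simp
  define m where "m = DIM('a) - 1"
  let ?w = "unit_ball_vol (real m)"
  have main: "hausdorff_premeasure m \<delta> (frontier \<Omega>) \<le> ennreal (c / (1 - e) ^ m + 5 ^ m * \<kappa>)"
    if e: "0 < e" "e < 1" and \<kappa>: "\<kappa> > 0" for e \<kappa>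
  proof -
    define B where "B = c / (1 - e) ^ m"
    \<comment> \<open>the last bound gives the enlarged balls diameter at most \<open>\<delta>\<close>\<close>
    define \<rho>0 where "\<rho>0 = min (min (R / 2) (e / (2 * L))) (\<delta> / 10)"
    have \<rho>0: "\<rho>0 > 0" using RL e \<delta> by (simp add: \<rho>0_def)
    define K where "K = {(z, \<rho>). z \<in> frontier \<Omega> \<and> 0 < \<rho> \<and> \<rho> \<le> \<rho>0}"
    have Kr: "0 < snd i \<and> snd i \<le> \<rho>0" if "i \<in> K" for i using that by (auto simp: K_def)
    obtain C where C: "countable C" "C \<subseteq> K"
      "pairwise (\<lambda>i j. disjnt (cball (fst i) (snd i)) (cball (fst j) (snd j))) C"
      "\<And>i. i \<in> K \<Longrightarrow> \<exists>j. j \<in> C \<and> \<not> disjnt (cball (fst i) (snd i)) (cball (fst j) (snd j)) \<and>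
                        cball (fst i) (snd i) \<subseteq> ball (fst j) (5 * snd j)"
      using Vitali_covering_lemma_cballs_balls[of K snd \<rho>0 fst, OF Kr] by blast
    let ?s = "\<lambda>F. \<Sum>i\<in>F. ?w * (snd i) ^ m"
    have fin: "?s F \<le> B" if F: "finite F" "F \<subseteq> C" for F
      unfolding B_def m_def
    proof (rule disjoint_balls_sum_le[OF freq c e F(1)])
      show "F \<subseteq> {(z, \<rho>). z \<in> frontier \<Omega> \<and> 0 < \<rho> \<and> \<rho> \<le> min (R / 2) (e / (2 * L))}"
        using F(2) C(2) unfolding K_def \<rho>0_def by auto
      show "pairwise (\<lambda>i j. disjnt (cball (fst i) (snd i)) (cball (fst j) (snd j))) F"
        using C(3) F(2) by (rule pairwise_subset)
    qed
    have pos: "0 < snd i" "snd i \<le> \<rho>0" "fst i \<in> frontier \<Omega>" if "i \<in> C" for i using that C(2) by (auto simp: K_def)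
    let ?Y = "?s ` {F. finite F \<and> F \<subseteq> C}"
    have Y: "?Y \<noteq> {}" "bdd_above ?Y" using fin by (auto intro!: bdd_aboveI[of _ B])
    obtain F0 where F0: "finite F0" "F0 \<subseteq> C" "Sup ?Y - \<kappa> < ?s F0"
      using less_cSup_iff[OF Y, of "Sup ?Y - \<kappa>"] \<kappa> by auto
    have tail: "?s G \<le> \<kappa>" if G: "finite G" "G \<subseteq> C" "G \<inter> F0 = {}" for G
    proof -
      have "?s G + ?s F0 = ?s (G \<union> F0)" using G F0 by (intro sum.union_disjoint[symmetric]) auto
      also have "\<dots> \<le> Sup ?Y" using G F0 by (intro cSup_upper Y) auto
      finally show ?thesis using F0(3) by linarith
    qed
    define V where "V i = (if i \<in> F0 then cball (fst i) (snd i) else cball (fst i) (5 * snd i))" for i :: "'a \<times> real"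
    have Vcover: "frontier \<Omega> \<subseteq> (\<Union>i\<in>C. V i)"
    proof
      fix x assume x: "x \<in> frontier \<Omega>"
      show "x \<in> (\<Union>i\<in>C. V i)"
      proof (cases "x \<in> (\<Union>i\<in>F0. cball (fst i) (snd i))")
        case True
        then obtain i where "i \<in> F0" "x \<in> cball (fst i) (snd i)" by blast
        then have "i \<in> C" "x \<in> V i" using F0(2) by (auto simp: V_def)
        then show ?thesis by blast
      next
        case False
        have "closed (\<Union>i\<in>F0. cball (fst i) (snd i))" using F0(1) by auto
        then have "open (- (\<Union>i\<in>F0. cball (fst i) (snd i)))" by (rule open_Compl)
        moreover have "x \<in> - (\<Union>i\<in>F0. cball (fst i) (snd i))" using False by simp
        ultimately obtain d where d: "d > 0" "ball x d \<subseteq> - (\<Union>i\<in>F0. cball (fst i) (snd i))"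
          by (rule openE)
        define \<rho> where "\<rho> = min (d / 2) \<rho>0"
        have \<rho>: "0 < \<rho>" "\<rho> \<le> \<rho>0" "\<rho> < d" using d \<rho>0 by (auto simp: \<rho>_def)
        have "(x, \<rho>) \<in> K" using x \<rho> by (simp add: K_def)
        from C(4)[OF this] obtain j where j: "j \<in> C" "\<not> disjnt (cball x \<rho>) (cball (fst j) (snd j))"
          "cball x \<rho> \<subseteq> ball (fst j) (5 * snd j)" by auto
        then obtain y where y: "dist x y \<le> \<rho>" "y \<in> cball (fst j) (snd j)" by (auto simp: disjnt_def)
        have "y \<in> ball x d" using y(1) \<rho>(3) by simp
        then have "y \<notin> (\<Union>i\<in>F0. cball (fst i) (snd i))" using d(2) by blast
        then have "j \<notin> F0" using y(2) by blast
        moreover have "x \<in> cball (fst j) (5 * snd j)" using j(3) \<rho>(1) by (auto simp: subset_eq less_imp_le)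
        ultimately have "x \<in> V j" by (simp add: V_def)
        then show ?thesis using j(1) by blast
      qed
    qed
    define U where "U k = (if k \<in> to_nat_on C ` C then V (from_nat_into C k) else {})" for k
    have Unat: "U (to_nat_on C i) = V i" if "i \<in> C" for i
      using that C(1) by (simp add: U_def)
    have UV: "U k = {} \<or> (\<exists>i\<in>C. U k = V i)" for k
      using Unat by (cases "k \<in> to_nat_on C ` C") (auto simp: U_def)
    have Vb: "bounded (V i)" "diameter (V i) = 2 * (if i \<in> F0 then snd i else 5 * snd i)" if "i \<in> C" for i
      using pos(1)[OF that] by (auto simp: V_def)
    let ?c = "\<lambda>A. if A = {} then 0 else ennreal (?w * (diameter A / 2) ^ m)"
    have "hausdorff_premeasure m \<delta> (frontier \<Omega>) \<le> (\<Sum>k. ?c (U k))"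
      unfolding hausdorff_premeasure_def
    proof (rule INF_lower, intro CollectI conjI allI)
      have "V i \<subseteq> (\<Union>k. U k)" if "i \<in> C" for i using Unat[OF that] by blast
      then have "(\<Union>i\<in>C. V i) \<subseteq> (\<Union>k. U k)" by (rule UN_least)
      with Vcover show "frontier \<Omega> \<subseteq> (\<Union>k. U k)" by (rule order_trans)
      fix k
      have "diameter (V i) \<le> \<delta>" if "i \<in> C" for i
        using Vb(2)[OF that] pos[OF that] by (auto simp: \<rho>0_def)
      then show "bounded (U k)" "diameter (U k) \<le> \<delta>" using UV[of k] Vb \<delta> by auto
    qed
    also have "\<dots> \<le> ennreal (B + 5 ^ m * \<kappa>)"
    proof (rule suminf_le_const[OF summableI])
      fix N
      define G where "G = {i \<in> C. to_nat_on C i < N}"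
      have inj: "inj_on (to_nat_on C) C" using C(1) by (rule inj_on_to_nat_on)
      have "finite (to_nat_on C ` G)" by (rule finite_subset[of _ "{..<N}"]) (auto simp: G_def)
      moreover have "G \<subseteq> C" by (auto simp: G_def)
      ultimately have Gf: "finite G" using inj_on_subset[OF inj] finite_imageD by blast
      have "(\<Sum>k<N. ?c (U k)) = (\<Sum>k\<in>to_nat_on C ` G. ?c (U k))"
        by (rule sum.mono_neutral_right) (auto simp: G_def U_def)
      also have "\<dots> = (\<Sum>i\<in>G. ?c (U (to_nat_on C i)))"
        using inj by (subst sum.reindex) (auto simp: G_def intro: inj_on_subset)
      also have "\<dots> \<le> (\<Sum>i\<in>G. ennreal (?w * (if i \<in> F0 then snd i else 5 * snd i) ^ m))"
        using Unat Vb by (intro sum_mono) (auto simp: G_def)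
      also have "\<dots> = ennreal (\<Sum>i\<in>G. ?w * (if i \<in> F0 then snd i else 5 * snd i) ^ m)"
        using pos by (intro sum_ennreal) (auto simp: G_def less_imp_le)
      also have "(\<Sum>i\<in>G. ?w * (if i \<in> F0 then snd i else 5 * snd i) ^ m)
          = (\<Sum>i\<in>G. if i \<in> F0 then ?w * snd i ^ m else 5 ^ m * (?w * snd i ^ m))"
        by (intro sum.cong) (auto simp: power_mult_distrib)
      also have "\<dots> = ?s (G \<inter> F0) + 5 ^ m * ?s (G - F0)"
      proof -
        have "G \<inter> - F0 = G - F0" by auto
        then show ?thesis using Gf by (simp add: sum.If_cases sum_distrib_left)
      qed
      also have "\<dots> \<le> B + 5 ^ m * \<kappa>"
        using Gf by (intro add_mono mult_left_mono fin tail) (auto simp: G_def)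
      finally show "(\<Sum>k<N. ?c (U k)) \<le> ennreal (B + 5 ^ m * \<kappa>)" by (simp add: ennreal_leI)
    qed
    finally show ?thesis by (simp add: B_def)
  qed
  have ev: "\<forall>\<^sub>F e in at_right (0::real). 0 < e \<and> e < 1"
    by (auto simp: eventually_at_right_field intro!: exI[of _ 1])
  have lim: "((\<lambda>e. ennreal (c / (1 - e) ^ m + 5 ^ m * e)) \<longlongrightarrow> ennreal (c / (1 - 0) ^ m + 5 ^ m * 0)) (at_right 0)"
    by (intro tendsto_ennrealI tendsto_intros) auto
  have "hausdorff_premeasure m \<delta> (frontier \<Omega>) \<le> ennreal (c / (1 - 0) ^ m + 5 ^ m * 0)"
    by (rule tendsto_lowerbound[OF lim]) (use ev in \<open>auto elim!: eventually_mono intro!: main\<close>)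
  then show "hausdorff_premeasure (DIM('a) - 1) \<delta> (frontier \<Omega>) \<le> ennreal c" by (simp add: m_def)
qed

text \<open>The covering bound controls the limit superior. The packing bound controls the limit inferior: if
  \<open>V r \<le> a * r\<close> for arbitrarily small \<open>r\<close>, the Hausdorff measure is
  at most \<open>a\<close>.\<close>

theorem inner_minkowski_content_eq_hausdorff:
  "((\<lambda>r. measure lborel (inner_tube \<Omega> r) / r)
     \<longlongrightarrow> enn2real (hausdorff_measure (DIM('a) - 1) (frontier \<Omega>))) (at_right 0)"
proof -
  let ?H = "hausdorff_measure (DIM('a) - 1) (frontier \<Omega>)"
  let ?V = "\<lambda>r. measure lborel (inner_tube \<Omega> r)"
  have finV: "emeasure lborel (inner_tube \<Omega> r) = ennreal (?V r)" for r
  proof -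
    have "bounded (inner_tube \<Omega> r)" using bd by (rule bounded_subset) (auto simp: inner_tube_def)
    then have "emeasure lborel (inner_tube \<Omega> r) < \<top>" using emeasure_bounded_finite by auto
    then show ?thesis by (simp add: emeasure_eq_ennreal_measure less_top)
  qed
  have pos: "\<forall>\<^sub>F r in at_right (0::real). 0 < r" by (simp add: eventually_at_right_less)
  obtain C where C: "C \<ge> 0" "\<forall>\<^sub>F r in at_right 0. emeasure lborel (inner_tube \<Omega> r) \<le> ennreal (C * r)"
    by (rule tube_volume_linear_bound)
  have "?H \<le> ennreal C"
    using C by (intro hausdorff_le_tube_volume eventually_frequently) auto
  then have "?H < \<top>" by (rule le_less_trans) simp
  then obtain h where h: "?H = ennreal h" "h \<ge> 0" by (cases ?H) auto
  have "((\<lambda>r. ?V r / r) \<longlongrightarrow> h) (at_right 0)"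
  proof (rule order_tendstoI)
    fix a assume a: "a < h"
    show "\<forall>\<^sub>F r in at_right 0. a < ?V r / r"
    proof (cases "a < 0")
      case True
      from pos show ?thesis
      proof eventually_elim
        case (elim r)
        then have "0 \<le> ?V r / r" by simp
        then show ?case using True by linarith
      qed
    next
      case False
      then have "\<not> (?H \<le> ennreal a)" using a h by (simp add: ennreal_le_iff2)
      then have "\<not> (\<exists>\<^sub>F r in at_right 0. emeasure lborel (inner_tube \<Omega> r) \<le> ennreal (a * r))"
        using hausdorff_le_tube_volume False by fastforce
      then have "\<forall>\<^sub>F r in at_right 0. \<not> emeasure lborel (inner_tube \<Omega> r) \<le> ennreal (a * r)"
        by (simp add: not_frequently)
      with pos show ?thesis
      proof eventually_elim
        case (elim r)
        then have "0 \<le> a * r" using False by simp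
        with elim have "a * r < ?V r" using measure_nonneg[of lborel "inner_tube \<Omega> r"]
          by (auto simp: finV ennreal_le_iff2 not_le)
        then show ?case using elim by (simp add: pos_less_divide_eq)
      qed
    qed
  next
    fix a assume a: "h < a"
    \<comment> \<open>chosen so that \<open>(1 + e) * h' < a\<close> for the midpoint \<open>h'\<close> of \<open>h\<close> and \<open>a\<close>\<close>
    define e where "e = min 1 ((a - h) / (2 * (h + a + 1)))"
    define h' where "h' = (h + a) / 2"
    have h': "h < h'" "h' < a" using a by (auto simp: h'_def)
    have e: "0 < e" "e \<le> 1" using a h by (auto simp: e_def)
    have "e * h' < a - h'"
    proof -
      have "e * h' \<le> (a - h) / (2 * (h + a + 1)) * h'" using a h h' by (intro mult_right_mono) (auto simp: e_def)
      also have "\<dots> = (a - h) / 2 * (h' / (h + a + 1))" by simp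
      also have "\<dots> < (a - h) / 2 * 1" using a h h' by (intro mult_strict_left_mono) (auto simp: h'_def)
      also have "\<dots> = a - h'" by (simp add: h'_def field_simps)
      finally show ?thesis .
    qed
    then have eh: "(1 + e) * h' < a" by (simp add: algebra_simps)
    have "?H < ennreal h'" using h h' by (simp add: ennreal_less_iff)
    from tube_volume_le_hausdorff[OF e this] pos show "\<forall>\<^sub>F r in at_right 0. ?V r / r < a"
    proof eventually_elim
      case (elim r)
      have "?V r \<le> (1 + e) * r * h'"
        using elim h h' e by (simp add: finV ennreal_le_iff)
      then have "?V r / r \<le> (1 + e) * h'" using elim by (simp add: pos_divide_le_eq mult_ac)
      then show ?case using eh by linarith
    qed
  qed
  then show ?thesis using h by simp
qed

end

text \<open>In a cover by sets of diameter less than all distances between different points of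
  \<open>S\<close>, no set contains two of them.\<close>

lemma hausdorff_measure_0_finite:
  fixes S :: "'a::metric_space set"
  assumes S: "finite S"
  shows "hausdorff_measure 0 S = of_nat (card S)"
proof (rule antisym)
  show "hausdorff_measure 0 S \<le> of_nat (card S)"
    unfolding hausdorff_measure_def
  proof (rule SUP_least)
    fix \<delta> :: real assume "\<delta> \<in> {0<..}"
    obtain f :: "nat \<Rightarrow> 'a" and n where f: "S = f ` {i. i < n}" "inj_on f {i. i < n}"
      using finite_imp_nat_seg_image_inj_on[OF S] by metis
    define U where "U i = (if i < n then {f i} else {})" for i
    have "hausdorff_premeasure 0 \<delta> S \<le> (\<Sum>i. if U i = {} then 0 else ennreal (unit_ball_vol (real 0) * (diameter (U i) / 2) ^ 0))"
      unfolding hausdorff_premeasure_def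
      by (rule INF_lower) (use f \<open>\<delta> \<in> {0<..}\<close> in \<open>auto simp: U_def\<close>)
    also have "\<dots> = (\<Sum>i<n. if U i = {} then 0 else ennreal (unit_ball_vol (real 0) * (diameter (U i) / 2) ^ 0))"
      by (rule suminf_finite) (auto simp: U_def)
    also have "\<dots> = of_nat (card S)"
      using f by (simp add: U_def card_image lessThan_def)
    finally show "hausdorff_premeasure 0 \<delta> S \<le> of_nat (card S)" .
  qed
  obtain \<delta> where \<delta>: "\<delta> > 0" "\<And>x y. x \<in> S \<Longrightarrow> y \<in> S \<Longrightarrow> x \<noteq> y \<Longrightarrow> \<delta> < dist x y"
  proof (cases "\<exists>x\<in>S. \<exists>y\<in>S. x \<noteq> y")
    case True
    let ?D = "(\<lambda>(x, y). dist x y) ` {(x, y). x \<in> S \<and> y \<in> S \<and> x \<noteq> y}"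
    have "{(x, y). x \<in> S \<and> y \<in> S \<and> x \<noteq> y} \<subseteq> S \<times> S" by auto
    then have "finite {(x, y). x \<in> S \<and> y \<in> S \<and> x \<noteq> y}" by (rule finite_subset) (use S in simp)
    then have D: "finite ?D" "?D \<noteq> {}" using True by auto
    have "0 < Min ?D" using D by (auto simp: Min_gr_iff)
    moreover have "Min ?D / 2 < dist x y" if "x \<in> S" "y \<in> S" "x \<noteq> y" for x y
    proof -
      have "Min ?D \<le> dist x y" using D(1) that by (intro Min_le) auto
      then show ?thesis using \<open>0 < Min ?D\<close> by linarith
    qed
    ultimately show thesis using that[of "Min ?D / 2"] by simp
  next
    case False
    then show thesis using that[of 1] by auto
  qed
  have "of_nat (card S) \<le> hausdorff_premeasure 0 \<delta> S"
    unfolding hausdorff_premeasure_def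
  proof (rule INF_greatest, clarify)
    fix U :: "nat \<Rightarrow> 'a set"
    assume U: "S \<subseteq> (\<Union>i. U i)" "\<forall>i. bounded (U i) \<and> diameter (U i) \<le> \<delta>"
    then have "\<forall>x\<in>S. \<exists>i. x \<in> U i" by blast
    then obtain i where i: "\<And>x. x \<in> S \<Longrightarrow> x \<in> U (i x)" by metis
    have inj: "inj_on i S"
    proof (rule inj_onI, rule ccontr)
      fix x y assume xy: "x \<in> S" "y \<in> S" "i x = i y" "x \<noteq> y"
      then have "dist x y \<le> diameter (U (i x))" using U(2) i by (intro diameter_bounded_bound) force+
      then show False using \<delta>(2)[of x y] xy U(2) by (meson leD order_trans)
    qed
    have "of_nat (card S) = (\<Sum>k\<in>i ` S. 1 :: ennreal)" using inj by (simp add: card_image)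
    also have "\<dots> \<le> (\<Sum>k\<in>i ` S. if U k = {} then 0 else ennreal (unit_ball_vol (real 0) * (diameter (U k) / 2) ^ 0))"
      using i by (intro sum_mono) auto
    also have "\<dots> \<le> (\<Sum>k. if U k = {} then 0 else ennreal (unit_ball_vol (real 0) * (diameter (U k) / 2) ^ 0))"
      using S by (intro sum_le_suminf) auto
    finally show "of_nat (card S) \<le> (\<Sum>k. if U k = {} then 0 else ennreal (unit_ball_vol (real 0) * (diameter (U k) / 2) ^ 0))" .
  qed
  also have "\<dots> \<le> hausdorff_measure 0 S"
    unfolding hausdorff_measure_def by (rule SUP_upper) (use \<delta> in simp)
  finally show "of_nat (card S) \<le> hausdorff_measure 0 S" .
qed

text \<open>Within the length of the interval, each endpoint sees a half-line, whose chart is flat.\<close>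

lemma interval_charts:
  fixes a b :: "'a::euclidean_space"
  assumes dim: "DIM('a) = 1" and ne: "box a b \<noteq> {}"
  obtains R where "R > 0" "\<And>z. z \<in> frontier (box a b) \<Longrightarrow> \<exists>n \<psi>. graph_chart (box a b) R 1 z n \<psi>"
    and "finite (frontier (box a b))"
proof -
  obtain e :: 'a where e: "Basis = {e}" using dim card_1_singletonE by metis
  have e': "e \<in> Basis" unfolding e by (rule singletonI)
  then have ee: "norm e = 1" "e \<bullet> e = 1" by (rule norm_Basis, rule inner_same_Basis)
  define R where "R = b \<bullet> e - a \<bullet> e"
  have R: "R > 0" using ne e' by (auto simp: box_ne_empty R_def)
  have rep: "x = (x \<bullet> e) *\<^sub>R e" for x :: 'a using euclidean_representation[of x] unfolding e by simp
  have mem: "x \<in> box a b \<longleftrightarrow> a \<bullet> e < x \<bullet> e \<and> x \<bullet> e < b \<bullet> e" for x unfolding mem_box e by simp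
  have fr: "z \<bullet> e = a \<bullet> e \<or> z \<bullet> e = b \<bullet> e" if "z \<in> frontier (box a b)" for z
  proof -
    have "z \<in> cbox a b" "z \<notin> box a b"
      using that ne by (auto simp: frontier_def interior_open open_box closure_box)
    then show ?thesis unfolding mem_box e by auto
  qed
  show thesis
  proof (rule that[OF R])
    have "frontier (box a b) \<subseteq> {(a \<bullet> e) *\<^sub>R e, (b \<bullet> e) *\<^sub>R e}"
      using fr rep by (metis insertI1 insertI2 subsetI)
    then show "finite (frontier (box a b))" by (rule finite_subset) simp
    fix z assume z: "z \<in> frontier (box a b)"
    have close: "\<bar>y \<bullet> e - z \<bullet> e\<bar> < R" if "y \<in> ball z R" for y
      using that Cauchy_Schwarz_ineq2[of "y - z" e] ee by (simp add: dist_norm norm_minus_commute inner_diff_left)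
    show "\<exists>n \<psi>. graph_chart (box a b) R 1 z n \<psi>"
    proof (cases "z \<bullet> e = a \<bullet> e")
      case True
      have "graph_chart (box a b) R 1 z e (\<lambda>_. 0)"
        unfolding graph_chart_def
      proof (intro conjI ballI allI impI)
        show "y \<in> box a b \<longleftrightarrow> 0 < (y - z) \<bullet> e" if "y \<in> ball z R" for y
          using close[OF that] True by (auto simp: mem inner_diff_left R_def)
      qed (use ee in \<open>auto simp: le_max_iff_disj intro!: mult_nonneg_nonneg\<close>)
      then show ?thesis by blast
    next
      case False
      then have "z \<bullet> e = b \<bullet> e" using fr[OF z] by simp
      have "graph_chart (box a b) R 1 z (- e) (\<lambda>_. 0)"
        unfolding graph_chart_def
      proof (intro conjI ballI allI impI)
        show "y \<in> box a b \<longleftrightarrow> 0 < (y - z) \<bullet> (- e)" if "y \<in> ball z R" for y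
          using close[OF that] \<open>z \<bullet> e = b \<bullet> e\<close> by (auto simp: mem inner_diff_left R_def)
      qed (use ee in \<open>auto simp: le_max_iff_disj intro!: mult_nonneg_nonneg\<close>)
      then show ?thesis by blast
    qed
  qed
qed

text \<open>In dimension one the boundary measure is the number of endpoints, which is their zero-dimensional
  Hausdorff measure; so the content is computed by the same theorem in all dimensions.\<close>

theorem inner_minkowski_content_eq_boundary_measure:
  fixes \<Omega> :: "'a::euclidean_space set"
  assumes domain: "if DIM('a) = 1 then \<exists>a b. \<Omega> = box a b
                   else bounded \<Omega> \<and> connected \<Omega> \<and> C11_open_set \<Omega>"
    and ne: "\<Omega> \<noteq> {}"
  obtains R L where "charted_domain \<Omega> R L"
    "((\<lambda>r. measure lborel (inner_tube \<Omega> r) / r) \<longlongrightarrow> boundary_measure \<Omega>) (at_right 0)"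
proof (cases "DIM('a) = 1")
  case True
  then obtain a b where ab: "\<Omega> = box a b" using domain by auto
  obtain R where R: "R > 0" "\<And>z. z \<in> frontier \<Omega> \<Longrightarrow> \<exists>n \<psi>. graph_chart \<Omega> R 1 z n \<psi>"
    and fin: "finite (frontier \<Omega>)"
    using interval_charts[OF True, of a b] ne unfolding ab by metis
  interpret charted_domain \<Omega> R 1
    using R ne by unfold_locales (auto simp: ab open_box)
  have "enn2real (hausdorff_measure (DIM('a) - 1) (frontier \<Omega>)) = boundary_measure \<Omega>"
    using True fin by (simp add: boundary_measure_def hausdorff_measure_0_finite ennreal_of_nat_eq_real_of_nat)
  then show thesis using that[of R 1] inner_minkowski_content_eq_hausdorff charted_domain_axioms by simp
next
  case False
  then have dom: "bounded \<Omega>" "C11_open_set \<Omega>" using domain by auto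
  obtain R L where RL: "R > 0" "L > 0" "\<And>z. z \<in> frontier \<Omega> \<Longrightarrow> \<exists>n \<psi>. graph_chart \<Omega> R L z n \<psi>"
    using C11_open_set_charts[OF dom(2)] by metis
  interpret charted_domain \<Omega> R L
    using RL ne dom by unfold_locales (auto simp: C11_open_set_def)
  have "enn2real (hausdorff_measure (DIM('a) - 1) (frontier \<Omega>)) = boundary_measure \<Omega>"
    using False by (simp add: boundary_measure_def)
  then show thesis using that[of R L] inner_minkowski_content_eq_hausdorff charted_domain_axioms by simp
qed

section \<open>Laplace transforms and subordinators\<close>

text \<open>The values of the transform at the positive integers are the moments of \<open>exp (- X)\<close>,
  a variable with values in the unit interval, where polynomials approximate \<open>k\<close>
  uniformly.\<close>

lemma expectation_continuous_eq_of_laplace_eq: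
  fixes X :: "'m \<Rightarrow> real" and Y :: "'n \<Rightarrow> real"
  assumes "prob_space M" "prob_space N"
    and [measurable]: "X \<in> borel_measurable M" "Y \<in> borel_measurable N"
    and X0: "\<And>\<omega>. \<omega> \<in> space M \<Longrightarrow> 0 \<le> X \<omega>" and Y0: "\<And>\<omega>. \<omega> \<in> space N \<Longrightarrow> 0 \<le> Y \<omega>"
    and eq: "\<And>s. s > 0 \<Longrightarrow> (LINT \<omega>|M. exp (- s * X \<omega>)) = (LINT \<omega>|N. exp (- s * Y \<omega>))"
    and k: "continuous_on UNIV k"
  shows "(LINT \<omega>|M. k (exp (- X \<omega>))) = (LINT \<omega>|N. (k (exp (- Y \<omega>)) :: real))"
proof -
  interpret M: prob_space M by fact
  interpret N: prob_space N by fact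
  have [measurable]: "k \<in> borel_measurable borel" using k by (rule borel_measurable_continuous_onI)
  have k01: "continuous_on {0..1::real} k" using k continuous_on_subset by blast
  have "bounded (k ` {0..1})"
    using compact_imp_bounded[OF compact_continuous_image[OF k01]] by simp
  then obtain B where B: "\<And>x. x \<in> {0..1} \<Longrightarrow> \<bar>k x\<bar> \<le> B"
    unfolding bounded_iff by (metis imageI real_norm_def)
  have int: "integrable M (\<lambda>\<omega>. k (exp (- X \<omega>)))" "integrable N (\<lambda>\<omega>. k (exp (- Y \<omega>)))"
    using X0 Y0 B by (auto intro!: M.integrable_const_bound[where B=B] N.integrable_const_bound[where B=B] AE_I2)
  have "\<bar>(LINT \<omega>|M. k (exp (- X \<omega>))) - (LINT \<omega>|N. k (exp (- Y \<omega>)))\<bar> \<le> 2 * e" if e: "e > 0" for e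
  proof -
    obtain g where g: "real_polynomial_function g" "\<And>x. x \<in> {0..1} \<Longrightarrow> \<bar>k x - g x\<bar> < e"
      using Stone_Weierstrass_real_polynomial_function[of "{0..1::real}" k e] k01 e by auto
    then obtain a n where gs: "g = (\<lambda>x. \<Sum>i\<le>n. a i * x^i)"
      by (auto simp: real_polynomial_function_iff_sum)
    have pow: "(LINT \<omega>|M. exp (- X \<omega>) ^ i) = (LINT \<omega>|N. exp (- Y \<omega>) ^ i)" for i
    proof (cases "i = 0")
      case False
      then show ?thesis using eq[of "real i"] by (simp flip: exp_of_nat_mult)
    qed (simp add: M.prob_space N.prob_space)
    have ip: "integrable M (\<lambda>\<omega>. exp (- X \<omega>) ^ i)" "integrable N (\<lambda>\<omega>. exp (- Y \<omega>) ^ i)" for i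
      using X0 Y0 by (auto intro!: M.integrable_const_bound[where B=1] N.integrable_const_bound[where B=1]
          simp: power_le_one)
    have gi: "integrable M (\<lambda>\<omega>. g (exp (- X \<omega>)))" "integrable N (\<lambda>\<omega>. g (exp (- Y \<omega>)))"
      unfolding gs using ip by auto
    have geq: "(LINT \<omega>|M. g (exp (- X \<omega>))) = (LINT \<omega>|N. g (exp (- Y \<omega>)))"
      unfolding gs using ip by (simp add: pow)
    have "\<bar>(LINT \<omega>|M. k (exp (- X \<omega>))) - (LINT \<omega>|M. g (exp (- X \<omega>)))\<bar>
        = \<bar>LINT \<omega>|M. k (exp (- X \<omega>)) - g (exp (- X \<omega>))\<bar>"
      using int gi by simp
    also have "\<dots> \<le> (LINT \<omega>|M. \<bar>k (exp (- X \<omega>)) - g (exp (- X \<omega>))\<bar>)"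
      by (rule integral_abs_bound)
    also have "\<dots> \<le> (LINT \<omega>|M. e)"
      using int gi X0 g(2) by (intro integral_mono) (auto intro!: less_imp_le)
    finally have 1: "\<bar>(LINT \<omega>|M. k (exp (- X \<omega>))) - (LINT \<omega>|M. g (exp (- X \<omega>)))\<bar> \<le> e"
      by (simp add: M.prob_space)
    have "\<bar>(LINT \<omega>|N. k (exp (- Y \<omega>))) - (LINT \<omega>|N. g (exp (- Y \<omega>)))\<bar>
        = \<bar>LINT \<omega>|N. k (exp (- Y \<omega>)) - g (exp (- Y \<omega>))\<bar>"
      using int gi by simp
    also have "\<dots> \<le> (LINT \<omega>|N. \<bar>k (exp (- Y \<omega>)) - g (exp (- Y \<omega>))\<bar>)"
      by (rule integral_abs_bound)
    also have "\<dots> \<le> (LINT \<omega>|N. e)"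
      using int gi Y0 g(2) by (intro integral_mono) (auto intro!: less_imp_le)
    finally have 2: "\<bar>(LINT \<omega>|N. k (exp (- Y \<omega>))) - (LINT \<omega>|N. g (exp (- Y \<omega>)))\<bar> \<le> e"
      by (simp add: N.prob_space)
    show ?thesis using 1 2 geq by linarith
  qed
  from this[of "\<bar>(LINT \<omega>|M. k (exp (- X \<omega>))) - (LINT \<omega>|N. k (exp (- Y \<omega>)))\<bar> / 4"]
  show ?thesis by fastforce
qed

text \<open>The distribution function at \<open>c\<close> is the probability of \<open>exp (- X) \<ge> exp (-
  c)\<close>, which is the limit of expectations of piecewise linear functions of \<open>exp (-
  X)\<close>.\<close>

theorem laplace_transform_unique:
  fixes X :: "'m \<Rightarrow> real" and Y :: "'n \<Rightarrow> real"
  assumes M: "prob_space M" and N: "prob_space N"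
    and X[measurable]: "X \<in> borel_measurable M" and Y[measurable]: "Y \<in> borel_measurable N"
    and X0: "\<And>\<omega>. \<omega> \<in> space M \<Longrightarrow> 0 \<le> X \<omega>" and Y0: "\<And>\<omega>. \<omega> \<in> space N \<Longrightarrow> 0 \<le> Y \<omega>"
    and eq: "\<And>s. s > 0 \<Longrightarrow> (LINT \<omega>|M. exp (- s * X \<omega>)) = (LINT \<omega>|N. exp (- s * Y \<omega>))"
  shows "distr M borel X = distr N borel Y"
proof (rule cdf_unique)
  interpret M: prob_space M by fact
  interpret N: prob_space N by fact
  show "real_distribution (distr M borel X)" "real_distribution (distr N borel Y)"
    by (simp_all add: M.real_distribution_distr N.real_distribution_distr)
  show "cdf (distr M borel X) = cdf (distr N borel Y)"
  proof
    fix c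
    define k where "k n y = max 0 (min 1 (1 + real n * (y - exp (- c))))" for n y
    have kc: "continuous_on UNIV (k n)" for n
      unfolding k_def by (intro continuous_intros)
    have [measurable]: "k n \<in> borel_measurable borel" for n
      using kc by (rule borel_measurable_continuous_onI)
    have kl: "(\<lambda>n. k n y) \<longlonglongrightarrow> (if exp (- c) \<le> y then 1 else 0)" for y
    proof (cases "exp (- c) \<le> y")
      case True
      then have "k n y = 1" for n by (simp add: k_def min_def max_def)
      then show ?thesis using True by simp
    next
      case False
      obtain n0 :: nat where n0: "1 / (exp (- c) - y) \<le> real n0" using real_arch_simple by blast
      have "k n y = 0" if "n \<ge> n0" for n
      proof -
        have "1 / (exp (- c) - y) \<le> real n" using n0 that by linarith
        then have "1 \<le> real n * (exp (- c) - y)" using False by (simp add: pos_divide_le_eq)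
        then show ?thesis by (simp add: k_def algebra_simps)
      qed
      then show ?thesis using False
        by (intro tendsto_eventually) (auto simp: eventually_sequentially)
    qed
    have kl_abs: "\<bar>k n y\<bar> \<le> 1" for n y by (simp add: k_def)
    have *: "(\<lambda>n. LINT \<omega>|L. k n (exp (- Z \<omega>))) \<longlonglongrightarrow> cdf (distr L borel Z) c"
      if L: "prob_space L" and [measurable]: "Z \<in> borel_measurable L" for L :: "'l measure" and Z
    proof -
      interpret L: prob_space L by fact
      have "(\<lambda>n. LINT \<omega>|L. k n (exp (- Z \<omega>)))
          \<longlonglongrightarrow> (LINT \<omega>|L. (if exp (- c) \<le> exp (- Z \<omega>) then 1 else 0))"
      proof (rule integral_dominated_convergence[where w="\<lambda>_. 1"])
        show "AE \<omega> in L. (\<lambda>n. k n (exp (- Z \<omega>))) \<longlonglongrightarrow> (if exp (- c) \<le> exp (- Z \<omega>) then 1 else 0)"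
          by (intro AE_I2 kl)
      qed (simp_all add: kl_abs)
      also have "(LINT \<omega>|L. (if exp (- c) \<le> exp (- Z \<omega>) then 1 else 0))
          = (LINT \<omega>|L. indicator {\<omega>\<in>space L. Z \<omega> \<le> c} \<omega>)"
        by (intro Bochner_Integration.integral_cong) (auto simp: indicator_def)
      also have "\<dots> = measure L {\<omega>\<in>space L. Z \<omega> \<le> c}"
        by (subst Bochner_Integration.integral_indicator) (auto intro: arg_cong[where f="measure L"])
      also have "\<dots> = cdf (distr L borel Z) c"
        by (auto simp: cdf_def measure_distr intro!: arg_cong[where f="measure L"])
      finally show ?thesis .
    qed
    have "(\<lambda>n. LINT \<omega>|N. k n (exp (- Y \<omega>))) \<longlonglongrightarrow> cdf (distr M borel X) c"
      using *[OF M X] expectation_continuous_eq_of_laplace_eq[OF M N X Y X0 Y0 eq kc] by simp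
    then show "cdf (distr M borel X) c = cdf (distr N borel Y) c"
      using LIMSEQ_unique *[OF N Y] by blast
  qed
qed

lemma subordinator_prob_space: "subordinator M D \<phi> \<nu> \<Longrightarrow> prob_space M"
  by (simp add: subordinator_def levy_process_def)

lemma subordinator_measurable: "subordinator M D \<phi> \<nu> \<Longrightarrow> t \<ge> 0 \<Longrightarrow> D t \<in> borel_measurable M"
  by (simp add: subordinator_def levy_process_def)

lemma subordinator_pos:
  "subordinator M D \<phi> \<nu> \<Longrightarrow> t > 0 \<Longrightarrow> \<omega> \<in> space M \<Longrightarrow> 0 < D t \<omega>"
  unfolding subordinator_def
  by (metis atLeast_iff less_eq_real_def order_refl strict_mono_onD)

lemma subordinator_laplace:
  "subordinator M D \<phi> \<nu> \<Longrightarrow> s > 0 \<Longrightarrow> t \<ge> 0 \<Longrightarrow> (LINT \<omega>|M. exp (- s * D t \<omega>)) = exp (- t * \<phi> s)"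
  by (simp add: subordinator_def)

lemma subordinator_exponent_mono:
  assumes S: "subordinator M D \<phi> \<nu>" and s: "0 < s" "s \<le> s'"
  shows "\<phi> s \<le> \<phi> s'"
proof -
  interpret prob_space M using S by (rule subordinator_prob_space)
  note [measurable] = subordinator_measurable[OF S, of 1]
  have i: "integrable M (\<lambda>\<omega>. exp (- r * D 1 \<omega>))" if "r > 0" for r
    using that subordinator_pos[OF S, of 1]
    by (auto intro!: integrable_const_bound[where B=1] AE_I2 mult_nonneg_nonneg less_imp_le)
  have "exp (- \<phi> s') = (LINT \<omega>|M. exp (- s' * D 1 \<omega>))"
    using subordinator_laplace[OF S, of s' 1] s by simp
  also have "\<dots> \<le> (LINT \<omega>|M. exp (- s * D 1 \<omega>))"
    using s subordinator_pos[OF S, of 1]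
    by (intro integral_mono i) (auto intro!: mult_right_mono less_imp_le)
  also have "\<dots> = exp (- \<phi> s)"
    using subordinator_laplace[OF S, of s 1] s by simp
  finally show ?thesis by simp
qed

lemma subordinator_law_unique:
  assumes S: "subordinator M D \<phi> \<nu>" and S': "subordinator N D' \<phi> \<nu>'" and t: "t > 0"
  shows "distr M borel (D t) = distr N borel (D' t)"
proof (rule laplace_transform_unique)
  show "prob_space M" "prob_space N"
    using S S' by (auto intro: subordinator_prob_space)
  show "D t \<in> borel_measurable M" "D' t \<in> borel_measurable N"
    using S S' t by (auto intro: subordinator_measurable)
  show "(LINT \<omega>|M. exp (- s * D t \<omega>)) = (LINT \<omega>|N. exp (- s * D' t \<omega>))" if "s > 0" for s
    using subordinator_laplace[OF S that, of t] subordinator_laplace[OF S' that, of t] t by simp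
qed (use S S' t in \<open>auto intro: less_imp_le subordinator_pos\<close>)

text \<open>For \<open>\<gamma>\<close> between \<open>\<beta>\<close> and \<open>\<rho>\<close>, doubling the
  argument eventually multiplies \<open>f\<close> by at most \<open>2 powr \<gamma>\<close>.
  Iteration bounds \<open>f\<close> by a multiple of \<open>s powr \<gamma>\<close>, with
  monotonicity bridging the interval between \<open>S\<close> and \<open>2 * S\<close>.\<close>

lemma regularly_varying_less_power:
  assumes rv: "regularly_varying_at_top f \<beta>" and \<beta>: "\<beta> < \<rho>"
    and mono: "\<And>s s'. 0 < s \<Longrightarrow> s \<le> s' \<Longrightarrow> f s \<le> f s'"
  shows "((\<lambda>s. f s / s powr \<rho>) \<longlongrightarrow> 0) at_top"
proof -
  define \<gamma> where "\<gamma> = (\<beta> + \<rho>) / 2"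
  have \<gamma>: "\<beta> < \<gamma>" "\<gamma> < \<rho>" using \<beta> by (auto simp: \<gamma>_def)
  have pos: "f s > 0" if "s > 0" for s using rv that by (simp add: regularly_varying_at_top_def)
  have "((\<lambda>s. f (2 * s) / f s) \<longlongrightarrow> 2 powr \<beta>) at_top"
    using rv by (simp add: regularly_varying_at_top_def)
  moreover have "2 powr \<beta> < (2::real) powr \<gamma>" using \<gamma> by simp
  ultimately have "eventually (\<lambda>s. f (2 * s) / f s < 2 powr \<gamma>) at_top"
    by (rule order_tendstoD)
  then obtain S0 where S0: "\<And>s. s \<ge> S0 \<Longrightarrow> f (2 * s) / f s < 2 powr \<gamma>"
    by (auto simp: eventually_at_top_linorder)
  define S where "S = max S0 1"
  have S: "S \<ge> 1" "\<And>s. s \<ge> S \<Longrightarrow> f (2 * s) \<le> 2 powr \<gamma> * f s"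
  proof -
    fix s assume "s \<ge> S"
    then have "f (2 * s) / f s < 2 powr \<gamma>" "0 < f s" using S0 pos by (auto simp: S_def)
    then show "f (2 * s) \<le> 2 powr \<gamma> * f s" by (simp add: pos_divide_less_eq)
  qed (simp add: S_def)
  \<comment> \<open>the minimum bounds \<open>s powr \<gamma>\<close> on the first interval whatever the sign of \<open>\<gamma>\<close>\<close>
  define A where "A = f (2 * S) / min (S powr \<gamma>) ((2 * S) powr \<gamma>)"
  have "min (S powr \<gamma>) ((2 * S) powr \<gamma>) > 0" using S(1) by simp
  then have A: "A > 0" "A * min (S powr \<gamma>) ((2 * S) powr \<gamma>) = f (2 * S)"
    using pos S(1) unfolding A_def by (auto simp del: min_less_iff_conj)
  have pw: "min (S powr \<gamma>) ((2 * S) powr \<gamma>) \<le> s powr \<gamma>" if "S \<le> s" "s \<le> 2 * S" for s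
  proof (cases "\<gamma> \<ge> 0")
    case True
    then have "S powr \<gamma> \<le> s powr \<gamma>" using that S(1) by (intro powr_mono2) auto
    then show ?thesis by simp
  next
    case False
    then have "(2 * S) powr \<gamma> \<le> s powr \<gamma>" using that S(1) by (intro powr_mono2') auto
    then show ?thesis by simp
  qed
  have bound: "f s \<le> A * s powr \<gamma>" if "S \<le> s" "s \<le> 2 ^ Suc n * S" for n s
    using that
  proof (induction n arbitrary: s)
    case 0
    have "f s \<le> f (2 * S)" using 0 S(1) by (intro mono) auto
    also have "\<dots> = A * min (S powr \<gamma>) ((2 * S) powr \<gamma>)" using A(2) by simp
    also have "\<dots> \<le> A * s powr \<gamma>" using pw[of s] 0 A by (intro mult_left_mono) auto
    finally show ?case .
  next
    case (Suc n)
    show ?case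
    proof (cases "s \<le> 2 * S")
      case True
      have "f s \<le> f (2 * S)" using Suc.prems True S(1) by (intro mono) auto
      also have "\<dots> = A * min (S powr \<gamma>) ((2 * S) powr \<gamma>)" using A(2) by simp
      also have "\<dots> \<le> A * s powr \<gamma>" using pw[of s] Suc.prems True A by (intro mult_left_mono) auto
      finally show ?thesis .
    next
      case False
      have "f s = f (2 * (s / 2))" by simp
      also have "\<dots> \<le> 2 powr \<gamma> * f (s / 2)" using False by (intro S(2)) auto
      also have "\<dots> \<le> 2 powr \<gamma> * (A * (s / 2) powr \<gamma>)"
        using False Suc.prems by (intro mult_left_mono Suc.IH) auto
      also have "\<dots> = A * s powr \<gamma>" using S(1) False by (simp add: powr_divide)
      finally show ?thesis .
    qed
  qed
  have bound': "f s \<le> A * s powr \<gamma>" if "S \<le> s" for s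
  proof -
    obtain n where "s / S < 2 ^ n" using real_arch_pow[of 2 "s / S"] by auto
    then have "s < 2 ^ n * S" using S(1) by (simp add: pos_divide_less_eq)
    also have "\<dots> \<le> 2 ^ Suc n * S" using S(1) by simp
    finally show ?thesis using bound[of s n] that by simp
  qed
  have lim: "((\<lambda>s. A * s powr (\<gamma> - \<rho>)) \<longlongrightarrow> 0) at_top"
    using \<gamma> by (intro tendsto_mult_right_zero tendsto_neg_powr filterlim_ident) auto
  show ?thesis
  proof (rule tendsto_sandwich[OF _ _ tendsto_const lim])
    show "eventually (\<lambda>s. 0 \<le> f s / s powr \<rho>) at_top"
      using eventually_gt_at_top[of 0] by eventually_elim (simp add: pos less_imp_le)
    show "eventually (\<lambda>s. f s / s powr \<rho> \<le> A * s powr (\<gamma> - \<rho>)) at_top"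
      using eventually_ge_at_top[of S] eventually_gt_at_top[of 0]
      by eventually_elim (auto simp: powr_diff divide_right_mono bound')
  qed
qed

section \<open>Averaging a square root over a subordinator\<close>

text \<open>The integral over all \<open>r > 0\<close> is \<open>sqrt (pi * u)\<close>. It represents the
  square root by functions whose expectation at \<open>u = D t\<close> is given by the Laplace
  exponent. Without \<open>r < 1\<close> the integral is bounded in \<open>u\<close>, and it
  changes by at most \<open>u\<close>, which is negligible near zero.\<close>

definition truncated_sqrt :: "real \<Rightarrow> ennreal" where
  "truncated_sqrt u = (\<integral>\<^sup>+r. ennreal ((1 - exp (- (r\<^sup>2 * u))) / r\<^sup>2) * indicator {1..} r \<partial>lborel)"

lemma truncated_sqrt_measurable [measurable]: "truncated_sqrt \<in> borel_measurable borel"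
proof -
  have "(\<lambda>u. \<integral>\<^sup>+r. ennreal ((1 - exp (- (r\<^sup>2 * u))) / r\<^sup>2) * indicator {1..} r \<partial>lborel)
      \<in> borel_measurable borel"
    by (intro lborel.borel_measurable_nn_integral) measurable
  then show ?thesis by (simp add: truncated_sqrt_def[abs_def])
qed

lemma nn_integral_inverse_square: "a > 0 \<Longrightarrow> (\<integral>\<^sup>+r. ennreal (1 / r\<^sup>2) * indicator {a..} r \<partial>lborel) = ennreal (1 / a)"
proof -
  assume a: "a > 0"
  have "(\<integral>\<^sup>+r. ennreal (1 / r\<^sup>2) * indicator {a..} r \<partial>lborel) = ennreal (0 - (- 1 / a))"
  proof (rule nn_integral_FTC_atLeast)
    show "DERIV (\<lambda>x. - 1 / x) x :> 1 / x\<^sup>2" if "a \<le> x" for x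
      using that a by (auto intro!: derivative_eq_intros simp: power2_eq_square)
    show "((\<lambda>x::real. - 1 / x) \<longlongrightarrow> 0) at_top" by real_asymp
  qed auto
  then show ?thesis by simp
qed

lemma truncated_sqrt_le_1: "u \<ge> 0 \<Longrightarrow> truncated_sqrt u \<le> 1"
proof -
  assume u: "u \<ge> 0"
  have "truncated_sqrt u \<le> (\<integral>\<^sup>+r. ennreal (1 / r\<^sup>2) * indicator {1..} r \<partial>lborel)"
    unfolding truncated_sqrt_def
    by (intro nn_integral_mono mult_right_mono ennreal_leI divide_right_mono) auto
  then show ?thesis by (simp add: nn_integral_inverse_square)
qed

text \<open>The integrand is itself an integral, of \<open>2 w exp(-(r w)\<^sup>2)\<close> over
  \<open>w\<close> from zero to \<open>sqrt u\<close>. In the other order of integration the inner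
  integral is the Gaussian one and equals \<open>sqrt pi\<close> for every \<open>w\<close>.\<close>

lemma sqrt_as_exponential_mixture:
  assumes u: "u \<ge> 0"
  shows "(\<integral>\<^sup>+r. ennreal ((1 - exp (- (r\<^sup>2 * u))) / r\<^sup>2) * indicator {0..} r \<partial>lborel) = ennreal (sqrt (pi * u))"
proof -
  let ?K = "\<lambda>r w. ennreal (2 * w * exp (- (r * w)\<^sup>2)) * indicator {0..sqrt u} w * indicator {0..} r :: ennreal"
  have "(\<integral>\<^sup>+r. ennreal ((1 - exp (- (r\<^sup>2 * u))) / r\<^sup>2) * indicator {0..} r \<partial>lborel)
      = (\<integral>\<^sup>+r. \<integral>\<^sup>+w. ?K r w \<partial>lborel \<partial>lborel)"
  proof (intro nn_integral_cong_AE)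
    have "AE r in lborel. r \<noteq> (0::real)" by (rule AE_lborel_singleton)
    then show "AE r in lborel. ennreal ((1 - exp (- (r\<^sup>2 * u))) / r\<^sup>2) * indicator {0..} r
        = (\<integral>\<^sup>+w. ?K r w \<partial>lborel)"
    proof eventually_elim
      case (elim r)
      have "(\<integral>\<^sup>+w. ennreal (2 * w * exp (- (r * w)\<^sup>2)) * indicator {0..sqrt u} w \<partial>lborel)
          = ennreal (- exp (- (r * sqrt u)\<^sup>2) / r\<^sup>2 - (- exp (- (r * 0)\<^sup>2) / r\<^sup>2))"
      proof (rule nn_integral_FTC_Icc)
        show "((\<lambda>w. - exp (- (r * w)\<^sup>2) / r\<^sup>2) has_real_derivative 2 * x * exp (- (r * x)\<^sup>2)) (at x)" for x
          using elim by (auto intro!: derivative_eq_intros simp: power2_eq_square field_simps)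
      qed (use u in auto)
      also have "- exp (- (r * sqrt u)\<^sup>2) / r\<^sup>2 - (- exp (- (r * 0)\<^sup>2) / r\<^sup>2) = (1 - exp (- (r\<^sup>2 * u))) / r\<^sup>2"
        using u by (simp add: power_mult_distrib diff_divide_distrib)
      finally show ?case by (simp add: nn_integral_multc)
    qed
  qed
  also have "\<dots> = (\<integral>\<^sup>+w. \<integral>\<^sup>+r. ?K r w \<partial>lborel \<partial>lborel)"
    by (rule lborel_pair.Fubini'[symmetric]) measurable
  also have "\<dots> = (\<integral>\<^sup>+w. ennreal (sqrt pi) * indicator {0..sqrt u} w \<partial>lborel)"
  proof (intro nn_integral_cong_AE)
    have "AE w in lborel. w \<noteq> (0::real)" by (rule AE_lborel_singleton)
    then show "AE w in lborel. (\<integral>\<^sup>+r. ?K r w \<partial>lborel) = ennreal (sqrt pi) * indicator {0..sqrt u} w"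
    proof eventually_elim
      case (elim w)
      show ?case
      proof (cases "0 \<le> w \<and> w \<le> sqrt u")
        case True
        with elim have w: "w > 0" by simp
        have g: "has_bochner_integral lborel (\<lambda>x::real. indicator {0..} x *\<^sub>R exp (- x\<^sup>2)) (sqrt pi / 2)"
          by (rule gaussian_moment_0)
        have "(\<integral>\<^sup>+r. ?K r w \<partial>lborel) = (\<integral>\<^sup>+r. ennreal (2 * w * exp (- (r * w)\<^sup>2)) * indicator {0..} r \<partial>lborel)"
          using True by simp
        also have "\<dots> = ennreal (1 / w) * (\<integral>\<^sup>+r. ennreal (2 * w * exp (- ((0 + 1 / w * r) * w)\<^sup>2)) * indicator {0..} (0 + 1 / w * r) \<partial>lborel)"
          using w by (subst nn_integral_real_affine[where c="1/w" and t=0]) auto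
        also have "\<dots> = ennreal (1 / w) * (\<integral>\<^sup>+r. ennreal (2 * w) * ennreal (indicator {0..} r *\<^sub>R exp (- r\<^sup>2)) \<partial>lborel)"
        proof -
          have "ennreal (2 * w * exp (- ((0 + 1 / w * r) * w)\<^sup>2)) * indicator {0..} (0 + 1 / w * r)
              = ennreal (2 * w) * ennreal (indicator {0..} r *\<^sub>R exp (- r\<^sup>2))" for r
          proof -
            have "(0 + 1 / w * r) * w = r" "0 \<le> 0 + 1 / w * r \<longleftrightarrow> 0 \<le> r"
              using w by (simp_all add: zero_le_divide_iff)
            then show ?thesis using w by (simp add: indicator_def ennreal_mult'[symmetric])
          qed
          then show ?thesis by simp
        qed
        also have "\<dots> = ennreal (1 / w) * (ennreal (2 * w) * (\<integral>\<^sup>+r. ennreal (indicator {0..} r *\<^sub>R exp (- r\<^sup>2)) \<partial>lborel))"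
          by (subst nn_integral_cmult) auto
        also have "(\<integral>\<^sup>+r. ennreal (indicator {0..} r *\<^sub>R exp (- r\<^sup>2)) \<partial>lborel) = ennreal (sqrt pi / 2)"
          using has_bochner_integral_integrable[of lborel] g
          by (subst nn_integral_eq_integral) (auto simp: has_bochner_integral_iff)
        also have "ennreal (1 / w) * (ennreal (2 * w) * ennreal (sqrt pi / 2)) = ennreal (sqrt pi)"
          using w by (simp add: ennreal_mult'[symmetric])
        finally show ?thesis using True by simp
      qed auto
    qed
  qed
  also have "\<dots> = ennreal (sqrt pi) * ennreal (sqrt u)"
    using u by (subst nn_integral_cmult_indicator) auto
  also have "\<dots> = ennreal (sqrt (pi * u))"
    by (simp add: ennreal_mult'[symmetric] real_sqrt_mult)
  finally show ?thesis .
qed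

lemma truncated_sqrt_bounds:
  assumes u: "u \<ge> 0"
  shows "enn2real (truncated_sqrt u) \<le> sqrt (pi * u)" "sqrt (pi * u) - u \<le> enn2real (truncated_sqrt u)"
proof -
  let ?f = "\<lambda>r. ennreal ((1 - exp (- (r\<^sup>2 * u))) / r\<^sup>2)"
  have "truncated_sqrt u \<le> (\<integral>\<^sup>+r. ?f r * indicator {0..} r \<partial>lborel)"
    unfolding truncated_sqrt_def by (intro nn_integral_mono mult_left_mono) (auto simp: indicator_def)
  then have le: "truncated_sqrt u \<le> ennreal (sqrt (pi * u))"
    by (simp add: sqrt_as_exponential_mixture[OF u])
  then show "enn2real (truncated_sqrt u) \<le> sqrt (pi * u)"
    using u by (metis enn2real_leI real_sqrt_ge_zero mult_nonneg_nonneg pi_ge_zero)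
  have fin: "truncated_sqrt u = ennreal (enn2real (truncated_sqrt u))"
    using le by (intro ennreal_enn2real[symmetric] le_less_trans[OF le]) simp
  have fu: "?f r \<le> ennreal u" for r
  proof (intro ennreal_leI)
    have "1 - exp (- (r\<^sup>2 * u)) \<le> r\<^sup>2 * u" using exp_ge_add_one_self[of "- (r\<^sup>2 * u)"] by linarith
    then show "(1 - exp (- (r\<^sup>2 * u))) / r\<^sup>2 \<le> u"
      using u by (cases "r = 0") (auto simp: divide_le_eq mult.commute)
  qed
  have "ennreal (sqrt (pi * u)) = (\<integral>\<^sup>+r. ?f r * indicator {0..} r \<partial>lborel)"
    by (simp add: sqrt_as_exponential_mixture[OF u])
  also have "\<dots> \<le> (\<integral>\<^sup>+r. ennreal u * indicator {0..1} r + ?f r * indicator {1..} r \<partial>lborel)"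
    by (intro nn_integral_mono) (use fu in \<open>auto simp: indicator_def\<close>)
  also have "\<dots> = ennreal u + truncated_sqrt u"
    unfolding truncated_sqrt_def by (subst nn_integral_add) (auto simp: nn_integral_cmult_indicator)
  also have "\<dots> = ennreal (u + enn2real (truncated_sqrt u))"
    using u by (subst fin) simp
  finally show "sqrt (pi * u) - u \<le> enn2real (truncated_sqrt u)"
    using u by (subst (asm) ennreal_le_iff) auto
qed

lemma expectation_truncated_sqrt:
  assumes S: "subordinator M D \<phi> \<nu>" and t: "t > 0"
  shows "(\<integral>\<^sup>+\<omega>. truncated_sqrt (D t \<omega>) \<partial>M)
    = (\<integral>\<^sup>+r. ennreal ((1 - exp (- t * \<phi> (r\<^sup>2))) / r\<^sup>2) * indicator {1..} r \<partial>lborel)"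
proof -
  interpret M: prob_space M using S by (rule subordinator_prob_space)
  interpret P: pair_sigma_finite M "lborel :: real measure" ..
  have [measurable]: "D t \<in> borel_measurable M" using S t by (auto intro: subordinator_measurable)
  have pos: "\<omega> \<in> space M \<Longrightarrow> 0 < D t \<omega>" for \<omega> using subordinator_pos[OF S t] .
  have "(\<integral>\<^sup>+\<omega>. truncated_sqrt (D t \<omega>) \<partial>M)
      = (\<integral>\<^sup>+r. \<integral>\<^sup>+\<omega>. ennreal ((1 - exp (- (r\<^sup>2 * D t \<omega>))) / r\<^sup>2) * indicator {1..} r \<partial>M \<partial>lborel)"
    unfolding truncated_sqrt_def by (rule P.Fubini'[symmetric]) measurable
  also have "\<dots> = (\<integral>\<^sup>+r. ennreal ((1 - exp (- t * \<phi> (r\<^sup>2))) / r\<^sup>2) * indicator {1..} r \<partial>lborel)"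
  proof (intro nn_integral_cong)
    fix r :: real
    have nn: "\<omega> \<in> space M \<Longrightarrow> 0 \<le> r\<^sup>2 * D t \<omega>" for \<omega> using pos[of \<omega>] by simp
    show "(\<integral>\<^sup>+\<omega>. ennreal ((1 - exp (- (r\<^sup>2 * D t \<omega>))) / r\<^sup>2) * indicator {1..} r \<partial>M)
        = ennreal ((1 - exp (- t * \<phi> (r\<^sup>2))) / r\<^sup>2) * indicator {1..} r"
    proof (cases "r \<ge> 1")
      case True
      have i: "integrable M (\<lambda>\<omega>. exp (- (r\<^sup>2 * D t \<omega>)))"
        using nn by (intro M.integrable_const_bound[where B=1] AE_I2) auto
      have "(\<integral>\<^sup>+\<omega>. ennreal ((1 - exp (- (r\<^sup>2 * D t \<omega>))) / r\<^sup>2) \<partial>M)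
          = ennreal (LINT \<omega>|M. (1 - exp (- (r\<^sup>2 * D t \<omega>))) / r\<^sup>2)"
        using i nn by (intro nn_integral_eq_integral AE_I2 divide_nonneg_nonneg) auto
      also have "(LINT \<omega>|M. (1 - exp (- (r\<^sup>2 * D t \<omega>))) / r\<^sup>2) = (1 - exp (- t * \<phi> (r\<^sup>2))) / r\<^sup>2"
        using i True subordinator_laplace[OF S, of "r\<^sup>2" t] t by (simp add: M.prob_space)
      finally show ?thesis using True by simp
    qed simp
  qed
  finally show ?thesis .
qed

lemma exp_neg_quadratic_bound:
  fixes x :: real
  assumes "x \<ge> 0"
  shows "x - x\<^sup>2 / 2 \<le> 1 - exp (- x)"
proof -
  have e: "1 + x + x\<^sup>2 / 2 \<le> exp x" using assms by (rule exp_lower_Taylor_quadratic)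
  have "(1 - x + x\<^sup>2 / 2) * (1 + x + x\<^sup>2 / 2) = 1 + (x\<^sup>2 / 2)\<^sup>2"
    by (simp add: power2_eq_square field_simps)
  then have "1 \<le> (1 - x + x\<^sup>2 / 2) * (1 + x + x\<^sup>2 / 2)" by simp
  also have "\<dots> \<le> (1 - x + x\<^sup>2 / 2) * exp x"
  proof (intro mult_left_mono e)
    have "1 - x + x\<^sup>2 / 2 = (1 + (x - 1)\<^sup>2) / 2" by (simp add: power2_eq_square field_simps)
    also have "\<dots> \<ge> 0" by (intro divide_nonneg_nonneg add_nonneg_nonneg) auto
    finally show "0 \<le> 1 - x + x\<^sup>2 / 2" .
  qed
  finally show ?thesis by (simp add: exp_minus field_simps)
qed

text \<open>The second-order bound for the exponential and \<open>\<phi> (r\<^sup>2) \<ge> r\<close> make the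
  integrand at least \<open>t / r - t\<^sup>2 / 2\<close>. Over \<open>r\<close> from
  \<open>1\<close> to \<open>1 / t\<close> the first term contributes \<open>t * ln (1 /
  t)\<close>.\<close>

lemma expectation_truncated_sqrt_lower:
  assumes S: "subordinator M D \<phi> \<nu>" and t: "0 < t" "t < 1"
    and lower: "\<And>r. r \<ge> 1 \<Longrightarrow> r \<le> \<phi> (r\<^sup>2)"
  shows "t * ln (1 / t) - t \<le> (LINT \<omega>|M. enn2real (truncated_sqrt (D t \<omega>)))"
    and "integrable M (\<lambda>\<omega>. enn2real (truncated_sqrt (D t \<omega>)))"
    and "ennreal (LINT \<omega>|M. enn2real (truncated_sqrt (D t \<omega>)))
           = (\<integral>\<^sup>+r. ennreal ((1 - exp (- t * \<phi> (r\<^sup>2))) / r\<^sup>2) * indicator {1..} r \<partial>lborel)"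
proof -
  interpret M: prob_space M using S by (rule subordinator_prob_space)
  have [measurable]: "D t \<in> borel_measurable M" using S t by (auto intro: subordinator_measurable)
  have pos: "\<omega> \<in> space M \<Longrightarrow> 0 \<le> D t \<omega>" for \<omega> using subordinator_pos[OF S t(1)] less_imp_le by blast
  have le1: "enn2real (truncated_sqrt u) \<le> 1" if "u \<ge> 0" for u
    using truncated_sqrt_le_1[OF that] by (intro enn2real_leI) auto
  show int: "integrable M (\<lambda>\<omega>. enn2real (truncated_sqrt (D t \<omega>)))"
    using pos le1 by (auto intro!: M.integrable_const_bound[where B=1] AE_I2)
  have "ennreal (LINT \<omega>|M. enn2real (truncated_sqrt (D t \<omega>)))
      = (\<integral>\<^sup>+\<omega>. ennreal (enn2real (truncated_sqrt (D t \<omega>))) \<partial>M)"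
    using int by (intro nn_integral_eq_integral[symmetric]) auto
  also have "\<dots> = (\<integral>\<^sup>+\<omega>. truncated_sqrt (D t \<omega>) \<partial>M)"
  proof (intro nn_integral_cong)
    fix \<omega> assume "\<omega> \<in> space M"
    then have "truncated_sqrt (D t \<omega>) \<le> 1" using pos truncated_sqrt_le_1 by blast
    then show "ennreal (enn2real (truncated_sqrt (D t \<omega>))) = truncated_sqrt (D t \<omega>)"
      by (intro ennreal_enn2real) (rule le_less_trans, auto)
  qed
  finally show eq: "ennreal (LINT \<omega>|M. enn2real (truncated_sqrt (D t \<omega>)))
      = (\<integral>\<^sup>+r. ennreal ((1 - exp (- t * \<phi> (r\<^sup>2))) / r\<^sup>2) * indicator {1..} r \<partial>lborel)"
    by (simp add: expectation_truncated_sqrt[OF S t(1)])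
  have "ennreal (t * ln (1 / t) - t) \<le> (\<integral>\<^sup>+r. ennreal (t / r - t\<^sup>2 / 2) * indicator {1..1/t} r \<partial>lborel)"
  proof -
    have "(\<integral>\<^sup>+r. ennreal (t / r - t\<^sup>2 / 2) * indicator {1..1/t} r \<partial>lborel)
        = ennreal ((t * ln (1/t) - t\<^sup>2 / 2 * (1/t)) - (t * ln 1 - t\<^sup>2 / 2 * 1))"
    proof (rule nn_integral_FTC_Icc)
      fix x assume x: "x \<in> {1..1/t}"
      show "((\<lambda>r. t * ln r - t\<^sup>2 / 2 * r) has_real_derivative (t / x - t\<^sup>2 / 2)) (at x)"
        using x by (auto intro!: derivative_eq_intros)
      have "t * x \<le> 1" using x t by (simp add: field_simps)
      then have "t * (t * x) \<le> t * 1" using t by (intro mult_left_mono) auto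
      then have "t\<^sup>2 * x \<le> t" by (simp add: power2_eq_square)
      then show "0 \<le> t / x - t\<^sup>2 / 2" using x t by (simp add: field_simps)
    qed (use t in auto)
    also have "(t * ln (1/t) - t\<^sup>2 / 2 * (1/t)) - (t * ln 1 - t\<^sup>2 / 2 * 1) = t * ln (1/t) - t / 2 + t\<^sup>2 / 2"
      using t by (simp add: power2_eq_square)
    finally have "(\<integral>\<^sup>+r. ennreal (t / r - t\<^sup>2 / 2) * indicator {1..1/t} r \<partial>lborel)
        = ennreal (t * ln (1/t) - t / 2 + t\<^sup>2 / 2)" .
    moreover have "t * ln (1/t) - t \<le> t * ln (1/t) - t / 2 + t\<^sup>2 / 2"
      using t zero_le_power2[of t] by linarith
    ultimately show ?thesis by (simp only: ennreal_leI)
  qed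
  also have "\<dots> \<le> (\<integral>\<^sup>+r. ennreal ((1 - exp (- t * \<phi> (r\<^sup>2))) / r\<^sup>2) * indicator {1..} r \<partial>lborel)"
  proof (intro nn_integral_mono)
    fix r :: real
    show "ennreal (t / r - t\<^sup>2 / 2) * indicator {1..1/t} r
        \<le> ennreal ((1 - exp (- t * \<phi> (r\<^sup>2))) / r\<^sup>2) * indicator {1..} r"
    proof (cases "r \<in> {1..1/t}")
      case True
      then have r: "1 \<le> r" by simp
      have "t * r - (t * r)\<^sup>2 / 2 \<le> 1 - exp (- (t * r))"
        using t r by (intro exp_neg_quadratic_bound) auto
      also have "\<dots> \<le> 1 - exp (- t * \<phi> (r\<^sup>2))" using lower[OF r] t by simp
      finally have "(t * r - (t * r)\<^sup>2 / 2) / r\<^sup>2 \<le> (1 - exp (- t * \<phi> (r\<^sup>2))) / r\<^sup>2"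
        by (rule divide_right_mono) simp
      moreover have "(t * r - (t * r)\<^sup>2 / 2) / r\<^sup>2 = t / r - t\<^sup>2 / 2"
        using r by (simp add: power2_eq_square field_simps)
      ultimately show ?thesis using True by (simp add: ennreal_leI)
    qed simp
  qed
  finally show "t * ln (1 / t) - t \<le> (LINT \<omega>|M. enn2real (truncated_sqrt (D t \<omega>)))"
    unfolding eq[symmetric] by (subst (asm) ennreal_le_iff) (auto intro!: integral_nonneg)
qed

text \<open>The range of integration is split in three. Up to a constant \<open>R\<close>, the exponent is
  bounded and the contribution is of order \<open>t\<close>; from \<open>R\<close> to \<open>1 /
  t\<close>, the bound \<open>\<phi> (r\<^sup>2) \<le> (1 + e) * r\<close> gives the main term;
  beyond \<open>1 / t\<close>, the numerator is replaced by one, which contributes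
  \<open>t\<close>.\<close>

lemma expectation_truncated_sqrt_upper:
  assumes S: "subordinator M D \<phi> \<nu>"
    and lower: "\<And>r. r \<ge> 1 \<Longrightarrow> r \<le> \<phi> (r\<^sup>2)"
    and lim: "((\<lambda>s. \<phi> s / sqrt s) \<longlongrightarrow> 1) at_top" and e: "0 < e"
  obtains C where "\<And>t. 0 < t \<Longrightarrow> t < 1 \<Longrightarrow>
    (LINT \<omega>|M. enn2real (truncated_sqrt (D t \<omega>))) \<le> (1 + e) * (t * ln (1 / t)) + C * t"
proof -
  have "eventually (\<lambda>s. \<phi> s / sqrt s < 1 + e) at_top"
    using order_tendstoD(2)[OF lim] e by simp
  then obtain R0 where R0: "\<And>s. s \<ge> R0 \<Longrightarrow> \<phi> s / sqrt s < 1 + e"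
    by (auto simp: eventually_at_top_linorder)
  define R where "R = max R0 1"
  have R: "R \<ge> 1" "R0 \<le> R" by (auto simp: R_def)
  have up: "\<phi> (r\<^sup>2) \<le> (1 + e) * r" if "r \<ge> R" for r
  proof -
    have "R * 1 \<le> r * r" using that R by (intro mult_mono) auto
    then have "\<phi> (r\<^sup>2) / sqrt (r\<^sup>2) < 1 + e" using R by (intro R0) (simp add: power2_eq_square)
    then show ?thesis using that R by (simp add: pos_divide_less_eq)
  qed
  have up': "\<phi> (r\<^sup>2) \<le> \<phi> (R\<^sup>2)" if "1 \<le> r" "r \<le> R" for r
    using that by (intro subordinator_exponent_mono[OF S] power_mono) auto
  have pR: "0 \<le> \<phi> (R\<^sup>2)" using lower[OF R(1)] R(1) by linarith
  show thesis
  proof (rule that)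
    fix t :: real assume t: "0 < t" "t < 1"
    let ?a = "\<lambda>r. ennreal (t * \<phi> (R\<^sup>2)) * (ennreal (1 / r\<^sup>2) * indicator {1..} r)"
    let ?b = "\<lambda>r. ennreal (t * (1 + e)) * (ennreal (1 / r) * indicator {1..1/t} r)"
    let ?c = "\<lambda>r. ennreal (1 / r\<^sup>2) * indicator {1/t..} r"
    have t1: "1 \<le> 1 / t" using t by simp
    have "ennreal (LINT \<omega>|M. enn2real (truncated_sqrt (D t \<omega>)))
        = (\<integral>\<^sup>+r. ennreal ((1 - exp (- t * \<phi> (r\<^sup>2))) / r\<^sup>2) * indicator {1..} r \<partial>lborel)"
      by (rule expectation_truncated_sqrt_lower(3)[OF S t lower])
    also have "\<dots> \<le> (\<integral>\<^sup>+r. ?a r + ?b r + ?c r \<partial>lborel)"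
    proof (intro nn_integral_mono)
      fix r :: real
      show "ennreal ((1 - exp (- t * \<phi> (r\<^sup>2))) / r\<^sup>2) * indicator {1..} r \<le> ?a r + ?b r + ?c r"
      proof (cases "r \<ge> 1")
        case True
        have ex: "1 - exp (- t * \<phi> (r\<^sup>2)) \<le> t * \<phi> (r\<^sup>2)"
          using exp_ge_add_one_self[of "- t * \<phi> (r\<^sup>2)"] by linarith
        consider "r \<le> R" | "R \<le> r" "r \<le> 1 / t" | "r \<ge> 1 / t" by linarith
        then show ?thesis
        proof cases
          case 1
          have "1 - exp (- t * \<phi> (r\<^sup>2)) \<le> t * \<phi> (R\<^sup>2)"
            using ex up'[OF True 1] t mult_left_mono[of "\<phi> (r\<^sup>2)" "\<phi> (R\<^sup>2)" t] by linarith
          then have "(1 - exp (- t * \<phi> (r\<^sup>2))) / r\<^sup>2 \<le> t * \<phi> (R\<^sup>2) * (1 / r\<^sup>2)"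
            using divide_right_mono by fastforce
          then have "ennreal ((1 - exp (- t * \<phi> (r\<^sup>2))) / r\<^sup>2) * indicator {1..} r \<le> ?a r"
            using True t pR by (simp add: ennreal_mult'[symmetric] ennreal_leI)
          then show ?thesis by (simp add: add.assoc add_increasing2)
        next
          case 2
          have "1 - exp (- t * \<phi> (r\<^sup>2)) \<le> t * ((1 + e) * r)"
            using ex up[OF 2(1)] t mult_left_mono[of "\<phi> (r\<^sup>2)" "(1 + e) * r" t] by linarith
          then have "(1 - exp (- t * \<phi> (r\<^sup>2))) / r\<^sup>2 \<le> t * ((1 + e) * r) / r\<^sup>2"
            by (rule divide_right_mono) simp
          also have "\<dots> = t * (1 + e) * (1 / r)" using True by (simp add: power2_eq_square)
          finally have "ennreal ((1 - exp (- t * \<phi> (r\<^sup>2))) / r\<^sup>2) * indicator {1..} r \<le> ?b r"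
            using True 2 t e by (simp add: ennreal_mult'[symmetric] ennreal_leI)
          then show ?thesis by (meson add_increasing add_increasing2 zero_le)
        next
          case 3
          have "(1 - exp (- t * \<phi> (r\<^sup>2))) / r\<^sup>2 \<le> 1 / r\<^sup>2" by (intro divide_right_mono) auto
          then have "ennreal ((1 - exp (- t * \<phi> (r\<^sup>2))) / r\<^sup>2) * indicator {1..} r \<le> ?c r"
            using True 3 by (simp add: ennreal_leI)
          then show ?thesis by (meson add_increasing zero_le)
        qed
      qed simp
    qed
    also have "\<dots> = (\<integral>\<^sup>+r. ?a r \<partial>lborel) + (\<integral>\<^sup>+r. ?b r \<partial>lborel) + (\<integral>\<^sup>+r. ?c r \<partial>lborel)"
      by (subst nn_integral_add, simp, simp, subst nn_integral_add, simp, simp, rule refl)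
    also have "(\<integral>\<^sup>+r. ?a r \<partial>lborel) = ennreal (t * \<phi> (R\<^sup>2))"
      by (subst nn_integral_cmult, simp, subst nn_integral_inverse_square) auto
    also have "(\<integral>\<^sup>+r. ?c r \<partial>lborel) = ennreal t"
      using t by (subst nn_integral_inverse_square) auto
    also have "(\<integral>\<^sup>+r. ?b r \<partial>lborel) = ennreal (t * (1 + e)) * ennreal (ln (1 / t) - ln 1)"
    proof (subst nn_integral_cmult, simp, subst nn_integral_FTC_Icc)
      show "(ln has_real_derivative 1 / x) (at x)" if "x \<in> {1..1/t}" for x :: real
        using that by (auto intro!: derivative_eq_intros)
    qed (use t in auto)
    also have "\<dots> = ennreal ((1 + e) * (t * ln (1 / t)))"
      using t e by (simp add: ennreal_mult'[symmetric] mult_ac)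
    also have "ennreal (t * \<phi> (R\<^sup>2)) + ennreal ((1 + e) * (t * ln (1 / t))) + ennreal t
        = ennreal ((1 + e) * (t * ln (1 / t)) + (\<phi> (R\<^sup>2) + 1) * t)"
      using t e pR t1 by (subst ennreal_plus[symmetric], simp, simp, subst ennreal_plus[symmetric])
        (auto simp: algebra_simps intro!: mult_nonneg_nonneg add_nonneg_nonneg simp del: ln_div)
    finally show "(LINT \<omega>|M. enn2real (truncated_sqrt (D t \<omega>)))
        \<le> (1 + e) * (t * ln (1 / t)) + (\<phi> (R\<^sup>2) + 1) * t"
      using t e pR t1 by (subst (asm) ennreal_le_iff) (auto intro!: add_nonneg_nonneg mult_nonneg_nonneg)
  qed
qed

lemma expectation_truncated_sqrt_asymptotics:
  assumes S: "subordinator M D \<phi> \<nu>"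
    and lower: "\<And>r. r \<ge> 1 \<Longrightarrow> r \<le> \<phi> (r\<^sup>2)"
    and lim: "((\<lambda>s. \<phi> s / sqrt s) \<longlongrightarrow> 1) at_top"
  shows "((\<lambda>t. (LINT \<omega>|M. enn2real (truncated_sqrt (D t \<omega>))) / (t * ln (1 / t))) \<longlongrightarrow> 1) (at_right 0)"
proof (rule order_tendstoI)
  let ?E = "\<lambda>t. LINT \<omega>|M. enn2real (truncated_sqrt (D t \<omega>))"
  have ev: "eventually (\<lambda>t::real. 0 < t \<and> t < 1) (at_right 0)"
    by (auto simp: eventually_at_right_field intro: exI[of _ 1])
  fix a :: real
  {
    assume a: "a < 1"
    have "((\<lambda>t::real. 1 - 1 / ln (1 / t)) \<longlongrightarrow> 1) (at_right 0)" by real_asymp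
    then have "eventually (\<lambda>t. a < 1 - 1 / ln (1 / t)) (at_right 0)" using a by (rule order_tendstoD)
    with ev show "eventually (\<lambda>t. a < ?E t / (t * ln (1 / t))) (at_right 0)"
    proof eventually_elim
      case (elim t)
      then have L: "ln (1 / t) > 0" by (simp add: ln_gt_zero)
      have "1 - 1 / ln (1 / t) = (t * ln (1 / t) - t) / (t * ln (1 / t))"
        using elim L by (simp add: diff_divide_distrib del: ln_div)
      also have "\<dots> \<le> ?E t / (t * ln (1 / t))"
        using elim L expectation_truncated_sqrt_lower(1)[OF S _ _ lower, of t]
        by (intro divide_right_mono) auto
      finally show ?case using elim by linarith
    qed
  next
    assume a: "1 < a"
    define e where "e = (a - 1) / 2"
    have e: "0 < e" "1 + e < a" using a by (auto simp: e_def field_simps)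
    obtain C where C: "\<And>t. 0 < t \<Longrightarrow> t < 1 \<Longrightarrow> ?E t \<le> (1 + e) * (t * ln (1 / t)) + C * t"
      using expectation_truncated_sqrt_upper[OF S lower lim e(1)] by blast
    have "((\<lambda>t::real. (1 + e) + C * (1 / ln (1 / t))) \<longlongrightarrow> (1 + e) + C * 0) (at_right 0)"
      by (intro tendsto_intros) real_asymp
    then have "eventually (\<lambda>t. (1 + e) + C * (1 / ln (1 / t)) < a) (at_right 0)"
      by (rule order_tendstoD) (use e in simp)
    with ev show "eventually (\<lambda>t. ?E t / (t * ln (1 / t)) < a) (at_right 0)"
    proof eventually_elim
      case (elim t)
      then have L: "ln (1 / t) > 0" by (simp add: ln_gt_zero)
      have "?E t / (t * ln (1 / t)) \<le> ((1 + e) * (t * ln (1 / t)) + C * t) / (t * ln (1 / t))"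
        using elim L C[of t] by (intro divide_right_mono) auto
      also have "\<dots> = (1 + e) + C * (1 / ln (1 / t))"
        using elim L by (simp add: add_divide_distrib del: ln_div)
      finally show ?case using elim by linarith
    qed
  }
qed

text \<open>For small \<open>u\<close>, the function \<open>H\<close> agrees with \<open>c / sqrt pi\<close>
  times the truncated square root, up to a small fraction of the latter. For \<open>u \<ge>
  d\<close> both are bounded, and the probability of \<open>D t \<ge> d\<close> is of order
  \<open>t\<close> since \<open>1 - E[exp (- D t / d)] \<le> t * \<phi> (1 / d)\<close>; this is
  negligible against \<open>t * ln (1 / t)\<close>.\<close>

theorem subordination_asymptotics:
  assumes S: "subordinator M D \<phi> \<nu>"
    and lower: "\<And>r. r \<ge> 1 \<Longrightarrow> r \<le> \<phi> (r\<^sup>2)"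
    and lim: "((\<lambda>s. \<phi> s / sqrt s) \<longlongrightarrow> 1) at_top"
    and H[measurable]: "H \<in> borel_measurable borel"
    and bdd: "\<And>u. u > 0 \<Longrightarrow> \<bar>H u\<bar> \<le> A"
    and Hlim: "((\<lambda>u. H u / sqrt u) \<longlongrightarrow> c) (at_right 0)"
  shows "((\<lambda>t. (LINT \<omega>|M. H (D t \<omega>)) / (t * ln (1 / t))) \<longlongrightarrow> c / sqrt pi) (at_right 0)"
proof -
  interpret M: prob_space M using S by (rule subordinator_prob_space)
  let ?g = "\<lambda>u. enn2real (truncated_sqrt u)"
  let ?E = "\<lambda>t. LINT \<omega>|M. ?g (D t \<omega>)" and ?H = "\<lambda>t. LINT \<omega>|M. H (D t \<omega>)"
  define c' where "c' = c / sqrt pi"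
  have ev: "eventually (\<lambda>t::real. 0 < t \<and> t < 1) (at_right 0)"
    by (auto simp: eventually_at_right_field intro: exI[of _ 1])
  have g1: "?g u \<le> 1" if "u > 0" for u
    using truncated_sqrt_le_1[of u] that by (intro enn2real_leI) auto
  have A: "0 \<le> A" using bdd[of 1] by simp
  have glim: "((\<lambda>u. ?g u / sqrt u) \<longlongrightarrow> sqrt pi) (at_right 0)"
  proof (rule tendsto_sandwich)
    have *: "((\<lambda>u. sqrt u) \<longlongrightarrow> 0) (at_right (0::real))" by real_asymp
    show "((\<lambda>u. sqrt pi - sqrt u) \<longlongrightarrow> sqrt pi) (at_right 0)"
      using tendsto_diff[OF tendsto_const[of "sqrt pi"] *] by simp
    show "((\<lambda>u. sqrt pi) \<longlongrightarrow> sqrt pi) (at_right 0)" by simp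
    show "eventually (\<lambda>u. sqrt pi - sqrt u \<le> ?g u / sqrt u) (at_right 0)"
      using ev
    proof eventually_elim
      case (elim u)
      have "(sqrt pi - sqrt u) * sqrt u \<le> ?g u"
        using truncated_sqrt_bounds(2)[of u] elim by (simp add: real_sqrt_mult algebra_simps)
      then show ?case using elim by (simp add: pos_le_divide_eq)
    qed
    show "eventually (\<lambda>u. ?g u / sqrt u \<le> sqrt pi) (at_right 0)"
      using ev
    proof eventually_elim
      case (elim u)
      then show ?case using truncated_sqrt_bounds(1)[of u] by (simp add: real_sqrt_mult pos_divide_le_eq)
    qed
  qed
  have "((\<lambda>u. (H u / sqrt u) / (?g u / sqrt u)) \<longlongrightarrow> c / sqrt pi) (at_right 0)"
    by (intro tendsto_divide Hlim glim) simp
  then have ratio: "((\<lambda>u. H u / ?g u) \<longlongrightarrow> c') (at_right 0)"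
    unfolding c'_def
    by (rule Lim_transform_eventually) (use ev in eventually_elim, auto)
  have gpos: "eventually (\<lambda>u. 0 < ?g u) (at_right 0)"
  proof -
    have "eventually (\<lambda>u. 0 < ?g u / sqrt u) (at_right 0)"
      using order_tendstoD(1)[OF glim, of 0] by simp
    then show ?thesis using ev by eventually_elim (auto simp: zero_less_divide_iff)
  qed
  have diff0: "((\<lambda>t. ?H t / (t * ln (1 / t)) - c' * (?E t / (t * ln (1 / t)))) \<longlongrightarrow> 0) (at_right 0)"
  proof (rule tendstoI)
    fix e :: real assume e: "0 < e"
    have "eventually (\<lambda>u. dist (H u / ?g u) c' < e / 4) (at_right 0)"
      using tendstoD[OF ratio, of "e/4"] e by simp
    then have "eventually (\<lambda>u. \<bar>H u - c' * ?g u\<bar> \<le> e / 4 * ?g u) (at_right 0)"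
      using gpos
    proof eventually_elim
      case (elim u)
      have "\<bar>H u - c' * ?g u\<bar> = \<bar>H u / ?g u - c'\<bar> * ?g u"
      proof -
        have "H u - c' * ?g u = (H u / ?g u - c') * ?g u" using elim by (simp add: field_simps)
        then show ?thesis using elim by (simp only: abs_mult abs_of_pos)
      qed
      also have "\<dots> \<le> e / 4 * ?g u" using elim by (intro mult_right_mono) (auto simp: dist_real_def)
      finally show ?case .
    qed
    then obtain d where d: "d > 0" "\<And>u. 0 < u \<Longrightarrow> u < d \<Longrightarrow> \<bar>H u - c' * ?g u\<bar> \<le> e / 4 * ?g u"
      by (auto simp: eventually_at_right_field)
    \<comment> \<open>makes \<open>B * (1 - exp (- u / d))\<close> at least \<open>A + \<bar>c'\<bar>\<close> for all \<open>u \<ge> d\<close>\<close>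
    define B where "B = (A + \<bar>c'\<bar>) / (1 - exp (- 1))"
    have B: "B \<ge> 0" "B * (1 - exp (- 1)) = A + \<bar>c'\<bar>" using A by (auto simp: B_def)
    have pt: "\<bar>H u - c' * ?g u\<bar> \<le> e / 4 * ?g u + B * (1 - exp (- (1 / d) * u))" if u: "u > 0" for u
    proof (cases "u < d")
      case True
      have "0 \<le> B * (1 - exp (- (1 / d) * u))" using B d u by (intro mult_nonneg_nonneg) auto
      then show ?thesis using d(2)[OF u True] by linarith
    next
      case False
      have "\<bar>H u - c' * ?g u\<bar> \<le> \<bar>H u\<bar> + \<bar>c'\<bar> * ?g u" by (metis abs_mult abs_of_nonneg abs_triangle_ineq4 enn2real_nonneg)
      also have "\<dots> \<le> A + \<bar>c'\<bar> * 1" using bdd[OF u] g1[OF u] by (intro add_mono mult_left_mono) auto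
      also have "\<dots> = B * (1 - exp (- 1))" using B by simp
      also have "\<dots> \<le> B * (1 - exp (- (1 / d) * u))"
        using B False d(1) by (intro mult_left_mono) (auto simp: field_simps)
      finally show ?thesis using e by (simp add: add_increasing)
    qed
    define K where "K = B * \<bar>\<phi> (1 / d)\<bar>"
    have diff: "\<bar>?H t - c' * ?E t\<bar> \<le> e / 4 * ?E t + K * t" if t: "0 < t" "t < 1" for t
    proof -
      have [measurable]: "D t \<in> borel_measurable M" using S t by (auto intro: subordinator_measurable)
      have pos: "\<omega> \<in> space M \<Longrightarrow> 0 < D t \<omega>" for \<omega> using subordinator_pos[OF S t(1)] .
      have iH: "integrable M (\<lambda>\<omega>. H (D t \<omega>))"
        using bdd pos by (intro M.integrable_const_bound[where B=A] AE_I2) auto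
      have ig: "integrable M (\<lambda>\<omega>. ?g (D t \<omega>))" by (rule expectation_truncated_sqrt_lower(2)[OF S t lower])
      have ie: "integrable M (\<lambda>\<omega>. exp (- (1 / d) * D t \<omega>))"
        using pos d by (intro M.integrable_const_bound[where B=1] AE_I2) (auto simp: less_imp_le)
      have "\<bar>?H t - c' * ?E t\<bar> = \<bar>LINT \<omega>|M. H (D t \<omega>) - c' * ?g (D t \<omega>)\<bar>"
        using iH ig by simp
      also have "\<dots> \<le> (LINT \<omega>|M. \<bar>H (D t \<omega>) - c' * ?g (D t \<omega>)\<bar>)" by (rule integral_abs_bound)
      also have "\<dots> \<le> (LINT \<omega>|M. e / 4 * ?g (D t \<omega>) + B * (1 - exp (- (1 / d) * D t \<omega>)))"
        by (intro integral_mono pt) (use iH ig ie pos in auto)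
      also have "\<dots> = e / 4 * ?E t + B * (1 - (LINT \<omega>|M. exp (- (1 / d) * D t \<omega>)))"
      proof -
        have "integrable M (\<lambda>\<omega>. e / 4 * ?g (D t \<omega>))" using ig by simp
        moreover have "integrable M (\<lambda>\<omega>. B * (1 - exp (- (1 / d) * D t \<omega>)))"
          using ie by (intro integrable_mult_right Bochner_Integration.integrable_diff) auto
        moreover have "(LINT \<omega>|M. B * (1 - exp (- (1 / d) * D t \<omega>))) = B * (1 - (LINT \<omega>|M. exp (- (1 / d) * D t \<omega>)))"
          using ie by (subst integral_mult_right_zero, subst Bochner_Integration.integral_diff) (auto simp: M.prob_space)
        ultimately show ?thesis by simp
      qed
      also have "(LINT \<omega>|M. exp (- (1 / d) * D t \<omega>)) = exp (- t * \<phi> (1 / d))"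
        using d t by (intro subordinator_laplace[OF S]) auto
      also have "B * (1 - exp (- t * \<phi> (1 / d))) \<le> B * (\<bar>\<phi> (1 / d)\<bar> * t)"
      proof (intro mult_left_mono B)
        have "1 - exp (- t * \<phi> (1 / d)) \<le> t * \<phi> (1 / d)"
          using exp_ge_add_one_self[of "- t * \<phi> (1 / d)"] by linarith
        also have "\<dots> \<le> t * \<bar>\<phi> (1 / d)\<bar>" using t by (intro mult_left_mono) auto
        finally show "1 - exp (- t * \<phi> (1 / d)) \<le> \<bar>\<phi> (1 / d)\<bar> * t" by (simp add: mult.commute)
      qed
      finally show ?thesis by (simp add: K_def mult.assoc)
    qed
    have E1: "((\<lambda>t. ?E t / (t * ln (1 / t))) \<longlongrightarrow> 1) (at_right 0)"
      by (rule expectation_truncated_sqrt_asymptotics[OF S lower lim])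
    have "((\<lambda>t. e / 4 * (?E t / (t * ln (1 / t))) + K * (1 / ln (1 / t))) \<longlongrightarrow> e / 4 * 1 + K * 0) (at_right 0)"
      by (intro tendsto_add tendsto_mult tendsto_const E1) real_asymp
    then have "eventually (\<lambda>t. e / 4 * (?E t / (t * ln (1 / t))) + K * (1 / ln (1 / t)) < e) (at_right 0)"
      by (rule order_tendstoD) (use e in simp)
    with ev show "eventually (\<lambda>t. dist (?H t / (t * ln (1 / t)) - c' * (?E t / (t * ln (1 / t)))) 0 < e) (at_right 0)"
    proof eventually_elim
      case (elim t)
      then have L: "ln (1 / t) > 0" "t * ln (1 / t) > 0" by (simp_all add: ln_gt_zero del: ln_div)
      have "\<bar>?H t / (t * ln (1 / t)) - c' * (?E t / (t * ln (1 / t)))\<bar> = \<bar>?H t - c' * ?E t\<bar> / (t * ln (1 / t))"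
        using L by (simp add: diff_divide_distrib[symmetric] del: ln_div)
      also have "\<dots> \<le> (e / 4 * ?E t + K * t) / (t * ln (1 / t))"
        using elim L by (intro divide_right_mono diff) auto
      also have "\<dots> = e / 4 * (?E t / (t * ln (1 / t))) + K * (1 / ln (1 / t))"
        using elim L by (simp add: add_divide_distrib del: ln_div)
      also have "\<dots> < e" using elim by simp
      finally show ?case by (simp add: dist_real_def)
    qed
  qed
  have "((\<lambda>t. (?H t / (t * ln (1 / t)) - c' * (?E t / (t * ln (1 / t)))) + c' * (?E t / (t * ln (1 / t))))
      \<longlongrightarrow> 0 + c' * 1) (at_right 0)"
    by (intro tendsto_add tendsto_mult tendsto_const diff0 expectation_truncated_sqrt_asymptotics[OF S lower lim])
  then show ?thesis by (simp add: c'_def)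
qed

section \<open>Uniqueness of finite-dimensional laws\<close>

text \<open>Levy's uniqueness theorem for the laws with densities \<open>Z / m\<close> and \<open>Z' /
  m\<close>. The phases \<open>0\<close> and \<open>- pi / 2\<close> give the real and the
  imaginary part of the characteristic function.\<close>

lemma weighted_law_unique:
  fixes X :: "'m \<Rightarrow> real" and Y :: "'n \<Rightarrow> real"
  assumes "prob_space M" "prob_space N"
    and [measurable]: "X \<in> borel_measurable M" "Y \<in> borel_measurable N"
    and [measurable]: "Z \<in> borel_measurable M" "Z' \<in> borel_measurable N"
    and Z: "\<And>\<omega>. 0 \<le> Z \<omega>" "\<And>\<omega>. Z \<omega> \<le> (B::real)" and Z': "\<And>\<omega>. 0 \<le> Z' \<omega>" "\<And>\<omega>. Z' \<omega> \<le> B"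
    and eq: "\<And>\<alpha> t. (LINT \<omega>|M. Z \<omega> * cos (\<alpha> + t * X \<omega>)) = (LINT \<omega>|N. Z' \<omega> * cos (\<alpha> + t * Y \<omega>))"
    and A[measurable]: "A \<in> sets borel"
  shows "(LINT \<omega>|M. Z \<omega> * indicator A (X \<omega>)) = (LINT \<omega>|N. Z' \<omega> * indicator A (Y \<omega>))"
proof -
  define m where "m = (LINT \<omega>|M. Z \<omega>)"
  have m': "m = (LINT \<omega>|N. Z' \<omega>)" using eq[of 0 0] by (simp add: m_def)
  have aux: "integrable L (\<lambda>\<omega>. V \<omega> * g \<omega>)"
    if "prob_space L" "V \<in> borel_measurable L" "\<And>\<omega>. 0 \<le> V \<omega>" "\<And>\<omega>. V \<omega> \<le> B" "g \<in> borel_measurable L" "\<And>\<omega>. \<bar>g \<omega>\<bar> \<le> 1"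
    for L :: "'l measure" and V g
  proof -
    interpret prob_space L by fact
    have "\<bar>V \<omega> * g \<omega>\<bar> \<le> B" for \<omega>
      using mult_mono[of "V \<omega>" B "\<bar>g \<omega>\<bar>" 1] that(3)[of \<omega>] that(4)[of \<omega>] that(6)[of \<omega>] by (simp add: abs_mult)
    then show ?thesis using that by (intro integrable_const_bound[where B=B]) auto
  qed
  show ?thesis
  proof (cases "m = 0")
    case True
    have "(LINT \<omega>|L. V \<omega> * g \<omega>) = 0"
      if L: "prob_space L" "V \<in> borel_measurable L" "\<And>\<omega>. 0 \<le> V \<omega>" "\<And>\<omega>. V \<omega> \<le> B" and "(LINT \<omega>|L. V \<omega>) = 0"
      for L :: "'l measure" and V g
    proof -
      have "integrable L V" using aux[OF L, of "\<lambda>_. 1"] by simp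
      then have "AE \<omega> in L. V \<omega> = 0" using that by (subst (asm) integral_nonneg_eq_0_iff_AE) auto
      then have "AE \<omega> in L. V \<omega> * g \<omega> = 0" by eventually_elim simp
      then show ?thesis by (rule integral_eq_zero_AE)
    qed
    then show ?thesis using assms(1-6) Z Z' True m_def m' by metis
  next
    case False
    have mpos: "m > 0" using False Z unfolding m_def by (simp add: integral_nonneg less_le)
    have main: "real_distribution (distr (density L (\<lambda>\<omega>. ennreal (V \<omega> / m))) borel U) \<and>
        (\<forall>t. char (distr (density L (\<lambda>\<omega>. ennreal (V \<omega> / m))) borel U) t
          = complex_of_real ((LINT \<omega>|L. V \<omega> * cos (0 + t * U \<omega>)) / m) +
            \<i> * complex_of_real ((LINT \<omega>|L. V \<omega> * cos (- (pi / 2) + t * U \<omega>)) / m)) \<and>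
        measure (distr (density L (\<lambda>\<omega>. ennreal (V \<omega> / m))) borel U) A = (LINT \<omega>|L. V \<omega> * indicator A (U \<omega>)) / m"
      if L: "prob_space L" and V[measurable]: "V \<in> borel_measurable L" and V0: "\<And>\<omega>. 0 \<le> V \<omega>" "\<And>\<omega>. V \<omega> \<le> B"
        and U[measurable]: "U \<in> borel_measurable L" and Lm: "(LINT \<omega>|L. V \<omega>) = m"
      for L :: "'l measure" and V U
    proof -
      interpret L: prob_space L by fact
      let ?D = "density L (\<lambda>\<omega>. ennreal (V \<omega> / m))"
      have int: "integrable L (\<lambda>\<omega>. V \<omega> * g \<omega>)" if "g \<in> borel_measurable L" "\<And>\<omega>. \<bar>g \<omega>\<bar> \<le> 1" for g
        by (rule aux[OF L V V0 that])
      have i1: "integrable L V" using int[of "\<lambda>_. 1"] by simp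
      have "emeasure ?D (space ?D) = (\<integral>\<^sup>+\<omega>. ennreal (V \<omega> / m) \<partial>L)"
        by (subst emeasure_density) (auto intro!: nn_integral_cong)
      also have "\<dots> = ennreal (LINT \<omega>|L. V \<omega> / m)"
        using i1 V0 mpos by (intro nn_integral_eq_integral) auto
      also have "\<dots> = 1" using Lm mpos by simp
      finally interpret D: prob_space ?D by (rule prob_spaceI)
      have r: "real_distribution (distr ?D borel U)"
        by (rule D.real_distribution_distr) simp
      have c: "char (distr ?D borel U) t
          = complex_of_real ((LINT \<omega>|L. V \<omega> * cos (0 + t * U \<omega>)) / m) +
            \<i> * complex_of_real ((LINT \<omega>|L. V \<omega> * cos (- (pi / 2) + t * U \<omega>)) / m)" for t
      proof -
        have "char (distr ?D borel U) t = (CLINT \<omega>|L. (V \<omega> / m) *\<^sub>R iexp (t * U \<omega>))"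
          unfolding char_def using V0 mpos by (subst integral_distr, simp, simp, subst integral_density) auto
        also have "\<dots> = (CLINT \<omega>|L. complex_of_real (V \<omega> * cos (0 + t * U \<omega>) / m) +
             \<i> * complex_of_real (V \<omega> * cos (- (pi / 2) + t * U \<omega>) / m))"
        proof (intro Bochner_Integration.integral_cong refl)
          fix \<omega>
          have "cos (- (pi / 2) + t * U \<omega>) = sin (t * U \<omega>)" by (simp add: cos_diff)
          then show "(V \<omega> / m) *\<^sub>R iexp (t * U \<omega>) = complex_of_real (V \<omega> * cos (0 + t * U \<omega>) / m) +
             \<i> * complex_of_real (V \<omega> * cos (- (pi / 2) + t * U \<omega>) / m)"
            by (simp add: complex_eq_iff cis_conv_exp[symmetric] Re_exp Im_exp)
        qed
        also have "\<dots> = (CLINT \<omega>|L. complex_of_real (V \<omega> * cos (0 + t * U \<omega>) / m)) +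
            (CLINT \<omega>|L. \<i> * complex_of_real (V \<omega> * cos (- (pi / 2) + t * U \<omega>) / m))"
          by (intro Bochner_Integration.integral_add integrable_mult_right integrable_of_real
              integrable_divide int) simp_all
        also have "\<dots> = complex_of_real ((LINT \<omega>|L. V \<omega> * cos (0 + t * U \<omega>)) / m) +
            \<i> * complex_of_real ((LINT \<omega>|L. V \<omega> * cos (- (pi / 2) + t * U \<omega>)) / m)"
          by (simp only: integral_mult_right_zero integral_complex_of_real integral_divide_zero)
        finally show ?thesis .
      qed
      have "measure (distr ?D borel U) A = (LINT \<omega>|?D. indicator A (U \<omega>))"
        by (subst integral_distr[symmetric, of U _ borel "indicator A"]) auto
      also have "\<dots> = (LINT \<omega>|L. (V \<omega> / m) *\<^sub>R indicator A (U \<omega>))"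
        using V0 mpos by (subst integral_density) auto
      also have "\<dots> = (LINT \<omega>|L. V \<omega> * indicator A (U \<omega>)) / m"
        by (simp add: times_divide_eq_left)
      finally show ?thesis using r c by blast
    qed
    note M = main[OF assms(1) assms(5) Z assms(3) m_def[symmetric]]
    note N = main[OF assms(2) assms(6) Z' assms(4) m'[symmetric]]
    have "distr (density M (\<lambda>\<omega>. ennreal (Z \<omega> / m))) borel X = distr (density N (\<lambda>\<omega>. ennreal (Z' \<omega> / m))) borel Y"
    proof (rule Levy_uniqueness)
      show "char (distr (density M (\<lambda>\<omega>. ennreal (Z \<omega> / m))) borel X) = char (distr (density N (\<lambda>\<omega>. ennreal (Z' \<omega> / m))) borel Y)"
        using M N eq by (intro ext) presburger
    qed (use M N in blast)+
    then have "(LINT \<omega>|M. Z \<omega> * indicator A (X \<omega>)) / m = (LINT \<omega>|N. Z' \<omega> * indicator A (Y \<omega>)) / m"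
      using M[THEN conjunct2, THEN conjunct2] N[THEN conjunct2, THEN conjunct2] by metis
    then show ?thesis using mpos by simp
  qed
qed

text \<open>The coordinates are restricted to their sets \<open>A i\<close> one at a time. With
  \<open>J\<close> the coordinates already restricted, the indicator of their event times \<open>1
  + cos\<close> of a linear form in the others is a nonnegative weight. Its products with cosines
  of the next coordinate are sums of cosines of linear forms, so the weighted uniqueness theorem
  applies to that coordinate.\<close>

theorem cramer_wold:
  fixes X :: "'i \<Rightarrow> 'm \<Rightarrow> real" and Y :: "'i \<Rightarrow> 'n \<Rightarrow> real"
  assumes M: "prob_space M" and N: "prob_space N" and I: "finite I"
    and X[measurable]: "\<And>i. i \<in> I \<Longrightarrow> X i \<in> borel_measurable M"
    and Y[measurable]: "\<And>i. i \<in> I \<Longrightarrow> Y i \<in> borel_measurable N"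
    and eq: "\<And>c \<theta>. (LINT \<omega>|M. cos (\<theta> + (\<Sum>i\<in>I. c i * X i \<omega>))) = (LINT \<omega>|N. cos (\<theta> + (\<Sum>i\<in>I. c i * Y i \<omega>)))"
    and A[measurable]: "\<And>i. i \<in> I \<Longrightarrow> A i \<in> sets borel"
  shows "measure M {\<omega>\<in>space M. \<forall>i\<in>I. X i \<omega> \<in> A i} = measure N {\<omega>\<in>space N. \<forall>i\<in>I. Y i \<omega> \<in> A i}"
proof -
  interpret M: prob_space M by fact
  interpret N: prob_space N by fact
  let ?P = "\<lambda>J \<omega>. indicator {\<omega>. \<forall>i\<in>J. X i \<omega> \<in> A i} \<omega> :: real"
  let ?Q = "\<lambda>J \<omega>. indicator {\<omega>. \<forall>i\<in>J. Y i \<omega> \<in> A i} \<omega> :: real"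
  let ?S = "\<lambda>c \<omega>. \<Sum>i\<in>I. c i * X i \<omega>" and ?T = "\<lambda>c \<omega>. \<Sum>i\<in>I. c i * Y i \<omega>"
  have PM: "?P J \<in> borel_measurable M" if "J \<subseteq> I" for J
  proof -
    have "finite J" using I that by (rule finite_subset[rotated])
    moreover have "{\<omega> \<in> space M. X i \<omega> \<in> A i} \<in> sets M" if "i \<in> J" for i
    proof -
      have [measurable]: "X i \<in> borel_measurable M" "A i \<in> sets borel" using that \<open>J \<subseteq> I\<close> by auto
      show ?thesis by measurable
    qed
    ultimately have "Measurable.pred M (\<lambda>\<omega>. \<forall>i\<in>J. X i \<omega> \<in> A i)"
      unfolding pred_def by (rule sets.sets_Collect_finite_All[rotated])
    then show ?thesis by simp
  qed
  have QM: "?Q J \<in> borel_measurable N" if "J \<subseteq> I" for J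
  proof -
    have "finite J" using I that by (rule finite_subset[rotated])
    moreover have "{\<omega> \<in> space N. Y i \<omega> \<in> A i} \<in> sets N" if "i \<in> J" for i
    proof -
      have [measurable]: "Y i \<in> borel_measurable N" "A i \<in> sets borel" using that \<open>J \<subseteq> I\<close> by auto
      show ?thesis by measurable
    qed
    ultimately have "Measurable.pred N (\<lambda>\<omega>. \<forall>i\<in>J. Y i \<omega> \<in> A i)"
      unfolding pred_def by (rule sets.sets_Collect_finite_All[rotated])
    then show ?thesis by simp
  qed
  have iM: "integrable M (\<lambda>\<omega>. ?P J \<omega> * (cos (\<alpha> + ?S c \<omega>)))" if "J \<subseteq> I" for J c \<alpha>
    using PM[OF that] by (intro M.integrable_const_bound[where B=1]) (auto simp: indicator_def)
  have iN: "integrable N (\<lambda>\<omega>. ?Q J \<omega> * (cos (\<alpha> + ?T c \<omega>)))" if "J \<subseteq> I" for J c \<alpha>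
    using QM[OF that] by (intro N.integrable_const_bound[where B=1]) (auto simp: indicator_def)
  have "(LINT \<omega>|M. ?P J \<omega> * cos (\<theta> + ?S c \<omega>)) = (LINT \<omega>|N. ?Q J \<omega> * cos (\<theta> + ?T c \<omega>))"
    if "J \<subseteq> I" "\<forall>i\<in>J. c i = 0" for J c \<theta>
    using finite_subset[OF that(1) I] that
  proof (induction J arbitrary: c \<theta> rule: finite_induct)
    case empty
    then show ?case using eq by simp
  next
    case (insert j J)
    have J: "J \<subseteq> I" "j \<in> I" "j \<notin> J" using insert by auto
    have [measurable]: "?P J \<in> borel_measurable M" "?Q J \<in> borel_measurable N" using J PM QM by auto
    have [measurable]: "X j \<in> borel_measurable M" "Y j \<in> borel_measurable N" "A j \<in> sets borel" using J X Y A by auto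
    have upd: "?S (c(j := t)) \<omega> = ?S c \<omega> + t * X j \<omega>" "?T (c(j := t)) \<omega>' = ?T c \<omega>' + t * Y j \<omega>'"
      if "c j = 0" for c :: "'i \<Rightarrow> real" and t \<omega> \<omega>'
    proof -
      have "?S (c(j := t)) \<omega> = t * X j \<omega> + (\<Sum>i\<in>I - {j}. c i * X i \<omega>)"
        using J I by (subst sum.remove[of I j]) (auto intro!: sum.cong)
      also have "(\<Sum>i\<in>I - {j}. c i * X i \<omega>) = ?S c \<omega>" using J I that by (subst sum.remove[of I j]) auto
      finally show "?S (c(j := t)) \<omega> = ?S c \<omega> + t * X j \<omega>" by simp
      have "?T (c(j := t)) \<omega>' = t * Y j \<omega>' + (\<Sum>i\<in>I - {j}. c i * Y i \<omega>')"
        using J I by (subst sum.remove[of I j]) (auto intro!: sum.cong)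
      also have "(\<Sum>i\<in>I - {j}. c i * Y i \<omega>') = ?T c \<omega>'" using J I that by (subst sum.remove[of I j]) auto
      finally show "?T (c(j := t)) \<omega>' = ?T c \<omega>' + t * Y j \<omega>'" by simp
    qed
    have trig: "p * (1 + cos a) * cos b = p * cos b + (1/2) * (p * cos (a - b) + p * cos (a + b))" for p a b :: real
      by (simp add: cos_add cos_diff algebra_simps)
    have cos01: "0 \<le> 1 + cos x" "1 + cos x \<le> 2" for x :: real
      using cos_ge_minus_one[of x] cos_le_one[of x] by linarith+
    have weight: "(LINT \<omega>|M. (?P J \<omega> * (1 + cos (\<theta> + ?S c \<omega>))) * indicator (A j) (X j \<omega>))
        = (LINT \<omega>|N. (?Q J \<omega> * (1 + cos (\<theta> + ?T c \<omega>))) * indicator (A j) (Y j \<omega>))"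
      if c: "\<forall>i\<in>insert j J. c i = 0" for c \<theta>
    proof (rule weighted_law_unique[OF M N, where B=2])
      show "0 \<le> ?P J \<omega> * (1 + cos (\<theta> + ?S c \<omega>))" "?P J \<omega> * (1 + cos (\<theta> + ?S c \<omega>)) \<le> 2" for \<omega>
        using cos01[of "\<theta> + ?S c \<omega>"] by (auto simp: indicator_def)
      show "0 \<le> ?Q J \<omega> * (1 + cos (\<theta> + ?T c \<omega>))" "?Q J \<omega> * (1 + cos (\<theta> + ?T c \<omega>)) \<le> 2" for \<omega>
        using cos01[of "\<theta> + ?T c \<omega>"] by (auto simp: indicator_def)
      fix \<alpha> t
      have cj: "c j = 0" using c by simp
      have c1: "\<forall>i\<in>J. (c(j := s)) i = 0" "\<forall>i\<in>J. ((\<lambda>_. 0)(j := s)) i = 0" for s using c J(3) by auto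
      have "(LINT \<omega>|M. ?P J \<omega> * (1 + cos (\<theta> + ?S c \<omega>)) * cos (\<alpha> + t * X j \<omega>))
        = (LINT \<omega>|M. ?P J \<omega> * cos (\<alpha> + ?S ((\<lambda>_. 0)(j := t)) \<omega>) +
            (1/2) * (?P J \<omega> * cos ((\<theta> - \<alpha>) + ?S (c(j := - t)) \<omega>) + ?P J \<omega> * cos ((\<theta> + \<alpha>) + ?S (c(j := t)) \<omega>)))"
      proof (intro Bochner_Integration.integral_cong refl)
        fix \<omega>
        have "(\<theta> - \<alpha>) + ?S (c(j := - t)) \<omega> = (\<theta> + ?S c \<omega>) - (\<alpha> + t * X j \<omega>)"
          "(\<theta> + \<alpha>) + ?S (c(j := t)) \<omega> = (\<theta> + ?S c \<omega>) + (\<alpha> + t * X j \<omega>)"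
          unfolding upd(1)[of c, OF cj] by simp_all
        moreover have "?S ((\<lambda>_. 0)(j := t)) \<omega> = t * X j \<omega>"
          by (subst upd(1)) simp_all
        ultimately show "?P J \<omega> * (1 + cos (\<theta> + ?S c \<omega>)) * cos (\<alpha> + t * X j \<omega>) = ?P J \<omega> * cos (\<alpha> + ?S ((\<lambda>_. 0)(j := t)) \<omega>) +
            (1/2) * (?P J \<omega> * cos ((\<theta> - \<alpha>) + ?S (c(j := - t)) \<omega>) + ?P J \<omega> * cos ((\<theta> + \<alpha>) + ?S (c(j := t)) \<omega>))"
          by (simp only: trig)
      qed
      also have "\<dots> = (LINT \<omega>|M. ?P J \<omega> * cos (\<alpha> + ?S ((\<lambda>_. 0)(j := t)) \<omega>)) +
            (1/2) * ((LINT \<omega>|M. ?P J \<omega> * cos ((\<theta> - \<alpha>) + ?S (c(j := - t)) \<omega>)) +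
                     (LINT \<omega>|M. ?P J \<omega> * cos ((\<theta> + \<alpha>) + ?S (c(j := t)) \<omega>)))"
        using iM[OF J(1)]
        by (simp only: Bochner_Integration.integral_add integral_mult_right_zero integrable_mult_right Bochner_Integration.integrable_add)
      also have "\<dots> = (LINT \<omega>|N. ?Q J \<omega> * cos (\<alpha> + ?T ((\<lambda>_. 0)(j := t)) \<omega>)) +
            (1/2) * ((LINT \<omega>|N. ?Q J \<omega> * cos ((\<theta> - \<alpha>) + ?T (c(j := - t)) \<omega>)) +
                     (LINT \<omega>|N. ?Q J \<omega> * cos ((\<theta> + \<alpha>) + ?T (c(j := t)) \<omega>)))"
        using insert.IH[OF J(1) c1(2)[of t]] insert.IH[OF J(1) c1(1)[of t]] insert.IH[OF J(1) c1(1)[of "-t"]] by presburger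
      also have "\<dots> = (LINT \<omega>|N. ?Q J \<omega> * cos (\<alpha> + ?T ((\<lambda>_. 0)(j := t)) \<omega>) +
            (1/2) * (?Q J \<omega> * cos ((\<theta> - \<alpha>) + ?T (c(j := - t)) \<omega>) + ?Q J \<omega> * cos ((\<theta> + \<alpha>) + ?T (c(j := t)) \<omega>)))"
        using iN[OF J(1)]
        by (simp only: Bochner_Integration.integral_add integral_mult_right_zero integrable_mult_right Bochner_Integration.integrable_add)
      also have "\<dots> = (LINT \<omega>|N. ?Q J \<omega> * (1 + cos (\<theta> + ?T c \<omega>)) * cos (\<alpha> + t * Y j \<omega>))"
      proof (intro Bochner_Integration.integral_cong refl)
        fix \<omega>
        have "(\<theta> - \<alpha>) + ?T (c(j := - t)) \<omega> = (\<theta> + ?T c \<omega>) - (\<alpha> + t * Y j \<omega>)"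
          "(\<theta> + \<alpha>) + ?T (c(j := t)) \<omega> = (\<theta> + ?T c \<omega>) + (\<alpha> + t * Y j \<omega>)"
          unfolding upd(2)[of c, OF cj] by simp_all
        moreover have "?T ((\<lambda>_. 0)(j := t)) \<omega> = t * Y j \<omega>"
          by (subst upd(2)) simp_all
        ultimately show "?Q J \<omega> * cos (\<alpha> + ?T ((\<lambda>_. 0)(j := t)) \<omega>) +
            (1/2) * (?Q J \<omega> * cos ((\<theta> - \<alpha>) + ?T (c(j := - t)) \<omega>) + ?Q J \<omega> * cos ((\<theta> + \<alpha>) + ?T (c(j := t)) \<omega>)) = ?Q J \<omega> * (1 + cos (\<theta> + ?T c \<omega>)) * cos (\<alpha> + t * Y j \<omega>)"
          by (simp only: trig)
      qed
      finally show "(LINT \<omega>|M. ?P J \<omega> * (1 + cos (\<theta> + ?S c \<omega>)) * cos (\<alpha> + t * X j \<omega>))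
        = (LINT \<omega>|N. ?Q J \<omega> * (1 + cos (\<theta> + ?T c \<omega>)) * cos (\<alpha> + t * Y j \<omega>))" .
    qed simp_all
    \<comment> \<open>a cosine is \<open>(1 + cos) - 1\<close>, and the constant \<open>1\<close> is half of the weight with zero coefficients\<close>
    have splitM: "?P (insert j J) \<omega> * cos (\<theta> + ?S c \<omega>) =
        (?P J \<omega> * (1 + cos (\<theta> + ?S c \<omega>))) * indicator (A j) (X j \<omega>)
         - (1/2) * ((?P J \<omega> * (1 + cos (0 + ?S (\<lambda>_. 0) \<omega>))) * indicator (A j) (X j \<omega>))" for \<omega>
      by (simp add: indicator_def)
    have splitN: "?Q (insert j J) \<omega> * cos (\<theta> + ?T c \<omega>) =
        (?Q J \<omega> * (1 + cos (\<theta> + ?T c \<omega>))) * indicator (A j) (Y j \<omega>)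
         - (1/2) * ((?Q J \<omega> * (1 + cos (0 + ?T (\<lambda>_. 0) \<omega>))) * indicator (A j) (Y j \<omega>))" for \<omega>
      by (simp add: indicator_def)
    have iM2: "integrable M (\<lambda>\<omega>. (?P J \<omega> * (1 + cos (\<theta> + ?S c \<omega>))) * indicator (A j) (X j \<omega>))" for c \<theta>
    proof (rule M.integrable_const_bound[where B=2])
      have "\<bar>1 + cos x\<bar> \<le> 2" for x :: real using cos_ge_minus_one[of x] cos_le_one[of x] by linarith
      then show "AE \<omega> in M. norm (?P J \<omega> * (1 + cos (\<theta> + ?S c \<omega>)) * indicator (A j) (X j \<omega>)) \<le> 2"
        by (auto simp: indicator_def)
    qed simp
    have iN2: "integrable N (\<lambda>\<omega>. (?Q J \<omega> * (1 + cos (\<theta> + ?T c \<omega>))) * indicator (A j) (Y j \<omega>))" for c \<theta>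
    proof (rule N.integrable_const_bound[where B=2])
      have "\<bar>1 + cos x\<bar> \<le> 2" for x :: real using cos_ge_minus_one[of x] cos_le_one[of x] by linarith
      then show "AE \<omega> in N. norm (?Q J \<omega> * (1 + cos (\<theta> + ?T c \<omega>)) * indicator (A j) (Y j \<omega>)) \<le> 2"
        by (auto simp: indicator_def)
    qed simp
    show ?case
      unfolding splitM splitN
      using iM2 iN2 weight[OF insert.prems(2)] weight[of "\<lambda>_. 0" 0]
      by (simp only: Bochner_Integration.integral_diff integral_mult_right_zero integrable_mult_right ball_simps)
         simp
  qed
  from this[of I "\<lambda>_. 0" 0] have e: "(LINT \<omega>|M. ?P I \<omega>) = (LINT \<omega>|N. ?Q I \<omega>)" by simp
  have "(LINT \<omega>|M. ?P I \<omega>) = (LINT \<omega>|M. indicator {\<omega>\<in>space M. \<forall>i\<in>I. X i \<omega> \<in> A i} \<omega>)"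
    by (intro Bochner_Integration.integral_cong) (auto simp: indicator_def)
  moreover have "(LINT \<omega>|N. ?Q I \<omega>) = (LINT \<omega>|N. indicator {\<omega>\<in>space N. \<forall>i\<in>I. Y i \<omega> \<in> A i} \<omega>)"
    by (intro Bochner_Integration.integral_cong) (auto simp: indicator_def)
  moreover have "{\<omega>\<in>space M. \<forall>i\<in>I. X i \<omega> \<in> A i} \<subseteq> space M" "{\<omega>\<in>space N. \<forall>i\<in>I. Y i \<omega> \<in> A i} \<subseteq> space N" by auto
  ultimately show ?thesis using e by (simp add: Int_absorb2)
qed

section \<open>The law of Brownian paths\<close>

lemma brownian_prob_space: "brownian_motion M x W \<Longrightarrow> prob_space M"
  by (simp add: brownian_motion_def levy_process_def)

lemma brownian_measurable: "brownian_motion M x W \<Longrightarrow> t \<ge> 0 \<Longrightarrow> W t \<in> borel_measurable M"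
  by (simp add: brownian_motion_def levy_process_def)

lemma brownian_continuous: "brownian_motion M x W \<Longrightarrow> \<omega> \<in> space M \<Longrightarrow> continuous_on {0..} (\<lambda>t. W t \<omega>)"
  by (simp add: brownian_motion_def)

lemma brownian_increment_distr:
  "brownian_motion M x W \<Longrightarrow> s \<ge> 0 \<Longrightarrow> h \<ge> 0 \<Longrightarrow>
     distr M borel (\<lambda>\<omega>. W (s + h) \<omega> - W s \<omega>) = distr M borel (\<lambda>\<omega>. W h \<omega> - W 0 \<omega>)"
  by (simp add: brownian_motion_def levy_process_def)

lemma brownian_indep_increments:
  "brownian_motion M x W \<Longrightarrow> 0 \<le> ts 0 \<Longrightarrow> mono ts \<Longrightarrow>
     prob_space.indep_vars M (\<lambda>_. borel) (\<lambda>i \<omega>. W (ts (Suc i)) \<omega> - W (ts i) \<omega>) {..<n::nat}"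
  by (simp add: brownian_motion_def levy_process_def)

lemma brownian_char_increment:
  fixes x :: "'a::euclidean_space"
  assumes B: "brownian_motion M x W" and s: "s \<ge> 0" and h: "h \<ge> 0"
  shows "(CLINT \<omega>|M. iexp (\<xi> \<bullet> (W (s + h) \<omega> - W s \<omega>))) = exp (- complex_of_real (h * (norm \<xi>)\<^sup>2))"
proof -
  have [measurable]: "W (s + h) \<in> borel_measurable M" "W s \<in> borel_measurable M"
    "W h \<in> borel_measurable M" "W 0 \<in> borel_measurable M"
    using s h by (auto intro: brownian_measurable[OF B])
  have "(CLINT \<omega>|M. iexp (\<xi> \<bullet> (W (s + h) \<omega> - W s \<omega>)))
      = (CLINT v|distr M borel (\<lambda>\<omega>. W (s + h) \<omega> - W s \<omega>). iexp (\<xi> \<bullet> v))"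
    by (subst integral_distr) auto
  also have "\<dots> = (CLINT v|distr M borel (\<lambda>\<omega>. W h \<omega> - W 0 \<omega>). iexp (\<xi> \<bullet> v))"
    by (simp only: brownian_increment_distr[OF B s h])
  also have "\<dots> = (CLINT \<omega>|M. iexp (\<xi> \<bullet> (W h \<omega> - W 0 \<omega>)))"
    by (subst integral_distr) auto
  also have "\<dots> = (CLINT \<omega>|M. iexp (- ((- \<xi>) \<bullet> (W h \<omega> - x))))"
  proof (rule integral_cong_AE)
    have "AE \<omega> in M. W 0 \<omega> = x" using B by (simp add: brownian_motion_def)
    then show "AE \<omega> in M. iexp (\<xi> \<bullet> (W h \<omega> - W 0 \<omega>)) = iexp (- ((- \<xi>) \<bullet> (W h \<omega> - x)))"
      by eventually_elim simp
  qed simp_all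
  also have "\<dots> = exp (- complex_of_real (h * (norm (- \<xi>))\<^sup>2))"
    using B h unfolding brownian_motion_def by blast
  finally show ?thesis by simp
qed

lemma brownian_char_increments:
  fixes x :: "'a::euclidean_space" and ts :: "nat \<Rightarrow> real"
  assumes B: "brownian_motion M x W" and ts: "0 \<le> ts 0" "mono ts"
  shows "(CLINT \<omega>|M. iexp (\<Sum>k<n. \<eta> k \<bullet> (W (ts (Suc k)) \<omega> - W (ts k) \<omega>)))
    = (\<Prod>k<n. exp (- complex_of_real ((ts (Suc k) - ts k) * (norm (\<eta> k))\<^sup>2)))"
proof -
  interpret prob_space M using B by (rule brownian_prob_space)
  have t0: "0 \<le> ts k" "ts k \<le> ts (Suc k)" for k
    using ts monoD[OF ts(2), of 0 k] monoD[OF ts(2), of k "Suc k"] by auto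
  have [measurable]: "W (ts k) \<in> borel_measurable M" for k
    using t0 by (auto intro: brownian_measurable[OF B])
  have iv: "indep_vars (\<lambda>_. borel) (\<lambda>k \<omega>. iexp (\<eta> k \<bullet> (W (ts (Suc k)) \<omega> - W (ts k) \<omega>))) {..<n}"
    by (rule indep_vars_compose2[OF brownian_indep_increments[OF B ts]]) simp
  have "(CLINT \<omega>|M. iexp (\<Sum>k<n. \<eta> k \<bullet> (W (ts (Suc k)) \<omega> - W (ts k) \<omega>)))
      = (CLINT \<omega>|M. (\<Prod>k<n. iexp (\<eta> k \<bullet> (W (ts (Suc k)) \<omega> - W (ts k) \<omega>))))"
    by (simp add: exp_sum[symmetric] sum_distrib_left)
  also have "\<dots> = (\<Prod>k<n. CLINT \<omega>|M. iexp (\<eta> k \<bullet> (W (ts (Suc k)) \<omega> - W (ts k) \<omega>)))"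
    by (rule indep_vars_lebesgue_integral[OF _ iv]) (auto intro!: integrable_const_bound[where B=1])
  also have "\<dots> = (\<Prod>k<n. exp (- complex_of_real ((ts (Suc k) - ts k) * (norm (\<eta> k))\<^sup>2)))"
  proof (intro prod.cong refl)
    fix k
    show "(CLINT \<omega>|M. iexp (\<eta> k \<bullet> (W (ts (Suc k)) \<omega> - W (ts k) \<omega>))) = exp (- complex_of_real ((ts (Suc k) - ts k) * (norm (\<eta> k))\<^sup>2))"
      using brownian_char_increment[OF B t0(1)[of k], of "ts (Suc k) - ts k" "\<eta> k"] t0(2)[of k] by simp
  qed
  finally show ?thesis .
qed

text \<open>Countably many times decide whether a continuous path has stayed in an open set, so the path is
  recorded at dyadic times only. Seen from its starting point and split into real coordinates, it
  is an element of a countable product of real lines.\<close>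

definition dyadic :: "nat \<times> nat \<Rightarrow> real" where
  "dyadic q = real (fst q) / 2 ^ snd q"

lemma dyadic_nonneg [simp]: "0 \<le> dyadic q" by (simp add: dyadic_def)

definition path_coordinates ::
    "(real \<Rightarrow> 'w \<Rightarrow> 'a::euclidean_space) \<Rightarrow> 'a \<Rightarrow> 'w \<Rightarrow> (nat \<times> nat) \<times> 'a \<Rightarrow> real" where
  "path_coordinates W x \<omega> = (\<lambda>(q, b)\<in>UNIV \<times> Basis. (W (dyadic q) \<omega> - x) \<bullet> b)"

abbreviation path_space :: "((nat \<times> nat) \<times> 'a::euclidean_space \<Rightarrow> real) measure" where
  "path_space \<equiv> \<Pi>\<^sub>M i\<in>UNIV \<times> Basis. borel"

lemma path_coordinates_measurable:
  fixes x :: "'a::euclidean_space"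
  assumes B: "brownian_motion M x' W"
  shows "path_coordinates W x \<in> M \<rightarrow>\<^sub>M path_space"
  unfolding path_coordinates_def
proof (rule measurable_restrict, clarify)
  fix i j :: nat and b :: 'a assume "b \<in> Basis"
  have [measurable]: "W (dyadic (i, j)) \<in> borel_measurable M" by (rule brownian_measurable[OF B]) simp
  show "(\<lambda>\<omega>. (W (dyadic (i, j)) \<omega> - x) \<bullet> b) \<in> borel_measurable M" by measurable
qed

text \<open>On a common grid of dyadic times, a linear combination of the coordinates is a linear combination
  of independent increments, whose characteristic functions are prescribed; they depend neither on
  the starting point nor on the probability space.\<close>

lemma brownian_cos_coordinates:
  fixes x :: "'a::euclidean_space" and I :: "((nat \<times> nat) \<times> 'a) set"
  assumes B: "brownian_motion M x W" and B': "brownian_motion M' x' W'" and I: "finite I" 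
  shows "(LINT \<omega>|M. cos (\<theta> + (\<Sum>i\<in>I. c i * ((W (dyadic (fst i)) \<omega> - x) \<bullet> snd i))))
       = (LINT \<omega>|M'. cos (\<theta> + (\<Sum>i\<in>I. c i * ((W' (dyadic (fst i)) \<omega> - x') \<bullet> snd i))))"
proof -
  \<comment> \<open>the grid with mesh \<open>1 / 2 ^ m\<close> contains all times that occur\<close>
  define m where "m = Max (insert 0 ((\<lambda>i. snd (fst i)) ` I))"
  have m: "snd (fst i) \<le> m" if "i \<in> I" for i using I that by (auto simp: m_def)
  define K where "K i = fst (fst i) * 2 ^ (m - snd (fst i))" for i :: "(nat \<times> nat) \<times> 'a"
  define n where "n = Max (insert 0 (K ` I))"
  have n: "K i \<le> n" if "i \<in> I" for i using I that by (auto simp: n_def)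
  define ts where "ts k = real k / 2 ^ m" for k
  have ts: "0 \<le> ts 0" "mono ts" by (auto simp: ts_def mono_def divide_right_mono)
  have dy: "dyadic (fst i) = ts (K i)" if "i \<in> I" for i
  proof -
    have "(2::real) ^ m = 2 ^ (m - snd (fst i)) * 2 ^ snd (fst i)"
      using m[OF that] by (simp flip: power_add)
    then show ?thesis by (simp add: dyadic_def ts_def K_def)
  qed
  define \<eta> where "\<eta> k = (\<Sum>i\<in>{i\<in>I. k < K i}. c i *\<^sub>R snd i)" for k
  have id: "(\<Sum>i\<in>I. c i * ((W (dyadic (fst i)) \<omega> - W 0 \<omega>) \<bullet> snd i)) = (\<Sum>k<n. \<eta> k \<bullet> (W (ts (Suc k)) \<omega> - W (ts k) \<omega>))"
    for W :: "real \<Rightarrow> 'z \<Rightarrow> 'a" and \<omega>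
  proof -
    have "(\<Sum>i\<in>I. c i * ((W (dyadic (fst i)) \<omega> - W 0 \<omega>) \<bullet> snd i))
        = (\<Sum>i\<in>I. \<Sum>k<n. if k < K i then c i * ((W (ts (Suc k)) \<omega> - W (ts k) \<omega>) \<bullet> snd i) else 0)"
    proof (intro sum.cong refl)
      fix i assume i: "i \<in> I"
      have "W (dyadic (fst i)) \<omega> - W 0 \<omega> = (\<Sum>k<K i. W (ts (Suc k)) \<omega> - W (ts k) \<omega>)"
        unfolding dy[OF i] by (subst sum_lessThan_telescope) (simp add: ts_def)
      then have "c i * ((W (dyadic (fst i)) \<omega> - W 0 \<omega>) \<bullet> snd i)
          = (\<Sum>k<K i. c i * ((W (ts (Suc k)) \<omega> - W (ts k) \<omega>) \<bullet> snd i))"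
        by (simp add: inner_sum_left sum_distrib_left)
      also have "\<dots> = (\<Sum>k<n. if k < K i then c i * ((W (ts (Suc k)) \<omega> - W (ts k) \<omega>) \<bullet> snd i) else 0)"
        using n[OF i] by (intro sum.mono_neutral_cong_left) auto
      finally show "c i * ((W (dyadic (fst i)) \<omega> - W 0 \<omega>) \<bullet> snd i)
          = (\<Sum>k<n. if k < K i then c i * ((W (ts (Suc k)) \<omega> - W (ts k) \<omega>) \<bullet> snd i) else 0)" .
    qed
    also have "\<dots> = (\<Sum>k<n. \<Sum>i\<in>I. if k < K i then c i * ((W (ts (Suc k)) \<omega> - W (ts k) \<omega>) \<bullet> snd i) else 0)"
      by (rule sum.swap)
    also have "\<dots> = (\<Sum>k<n. \<eta> k \<bullet> (W (ts (Suc k)) \<omega> - W (ts k) \<omega>))"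
    proof (intro sum.cong refl)
      fix k
      show "(\<Sum>i\<in>I. if k < K i then c i * ((W (ts (Suc k)) \<omega> - W (ts k) \<omega>) \<bullet> snd i) else 0)
          = \<eta> k \<bullet> (W (ts (Suc k)) \<omega> - W (ts k) \<omega>)"
        using I by (simp add: \<eta>_def inner_sum_left sum.inter_filter[symmetric]
            inner_commute[of "W (ts (Suc k)) \<omega> - W (ts k) \<omega>"])
    qed
    finally show ?thesis .
  qed
  have val: "(LINT \<omega>|L. cos (\<theta> + (\<Sum>i\<in>I. c i * ((V (dyadic (fst i)) \<omega> - y) \<bullet> snd i))))
      = Re (iexp \<theta> * (\<Prod>k<n. exp (- complex_of_real ((ts (Suc k) - ts k) * (norm (\<eta> k))\<^sup>2))))"
    if L: "brownian_motion L y V" for L :: "'l measure" and y V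
  proof -
    interpret L: prob_space L using L by (rule brownian_prob_space)
    have [measurable]: "V (dyadic q) \<in> borel_measurable L" "V 0 \<in> borel_measurable L" "V (ts k) \<in> borel_measurable L" for q k
      by (auto intro!: brownian_measurable[OF L] simp: ts_def)
    have "AE \<omega> in L. V 0 \<omega> = y" using L by (simp add: brownian_motion_def)
    then have "(LINT \<omega>|L. cos (\<theta> + (\<Sum>i\<in>I. c i * ((V (dyadic (fst i)) \<omega> - y) \<bullet> snd i))))
        = (LINT \<omega>|L. cos (\<theta> + (\<Sum>i\<in>I. c i * ((V (dyadic (fst i)) \<omega> - V 0 \<omega>) \<bullet> snd i))))"
      by (intro integral_cong_AE) auto
    also have "\<dots> = (LINT \<omega>|L. Re (iexp \<theta> * iexp (\<Sum>k<n. \<eta> k \<bullet> (V (ts (Suc k)) \<omega> - V (ts k) \<omega>))))"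
      unfolding id by (intro Bochner_Integration.integral_cong refl) (simp add: exp_add[symmetric] distrib_left[symmetric] Re_exp)
    also have "\<dots> = Re (CLINT \<omega>|L. iexp \<theta> * iexp (\<Sum>k<n. \<eta> k \<bullet> (V (ts (Suc k)) \<omega> - V (ts k) \<omega>)))"
      by (rule integral_Re) (auto intro!: L.integrable_const_bound[where B=1] simp: norm_mult)
    also have "\<dots> = Re (iexp \<theta> * (CLINT \<omega>|L. iexp (\<Sum>k<n. \<eta> k \<bullet> (V (ts (Suc k)) \<omega> - V (ts k) \<omega>))))"
      by simp
    finally show ?thesis unfolding brownian_char_increments[OF L ts] .
  qed
  show ?thesis by (simp only: val[OF B] val[OF B'])
qed

text \<open>Finite-dimensional events determine a law on the product space, and their probabilities are
  determined by the characteristic functions of linear combinations.\<close>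

theorem brownian_path_law_unique:
  fixes x :: "'a::euclidean_space"
  assumes B: "brownian_motion M x W" and B': "brownian_motion M' x' W'"
  shows "distr M path_space (path_coordinates W x) = distr M' path_space (path_coordinates W' x')"
proof (rule measure_eqI_PiM_infinite)
  interpret M: prob_space M using B by (rule brownian_prob_space)
  interpret M': prob_space M' using B' by (rule brownian_prob_space)
  note meas = path_coordinates_measurable[OF B, of x] path_coordinates_measurable[OF B', of x']
  interpret D: prob_space "distr M path_space (path_coordinates W x)"
    by (rule M.prob_space_distr[OF meas(1)])
  show "finite_measure (distr M path_space (path_coordinates W x))" by unfold_locales
  fix A :: "(nat \<times> nat) \<times> 'a \<Rightarrow> real set" and J :: "((nat \<times> nat) \<times> 'a) set"
  assume J: "finite J" "J \<subseteq> UNIV \<times> Basis" and A: "\<And>i. i \<in> J \<Longrightarrow> A i \<in> sets borel"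
  let ?E = "prod_emb (UNIV \<times> Basis) (\<lambda>_. borel :: real measure) J (Pi\<^sub>E J A)"
  have E: "?E \<in> sets path_space" using J A by (intro sets_PiM_I) auto
  have pre: "path_coordinates V y -` ?E \<inter> space L
      = {\<omega>\<in>space L. \<forall>i\<in>J. (V (dyadic (fst i)) \<omega> - y) \<bullet> snd i \<in> A i}"
    for V :: "real \<Rightarrow> 'l \<Rightarrow> 'a" and y and L :: "'l measure"
  proof -
    have ext: "path_coordinates V y \<omega> \<in> extensional (UNIV \<times> Basis)" for \<omega> by (simp add: path_coordinates_def)
    have c: "path_coordinates V y \<omega> i = (V (dyadic (fst i)) \<omega> - y) \<bullet> snd i" if "i \<in> J" for \<omega> i
      using that J by (auto simp: path_coordinates_def case_prod_beta)
    have "path_coordinates V y \<omega> \<in> ?E \<longleftrightarrow> (\<forall>i\<in>J. path_coordinates V y \<omega> i \<in> A i)" for \<omega>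
      using ext by (simp add: prod_emb_def PiE_iff)
    then show ?thesis using c by auto
  qed
  have "measure M {\<omega>\<in>space M. \<forall>i\<in>J. (W (dyadic (fst i)) \<omega> - x) \<bullet> snd i \<in> A i}
      = measure M' {\<omega>\<in>space M'. \<forall>i\<in>J. (W' (dyadic (fst i)) \<omega> - x') \<bullet> snd i \<in> A i}"
  proof (rule cramer_wold[OF M.prob_space_axioms M'.prob_space_axioms J(1)])
    fix i :: "(nat \<times> nat) \<times> 'a"
    have [measurable]: "W (dyadic (fst i)) \<in> borel_measurable M" "W' (dyadic (fst i)) \<in> borel_measurable M'"
      by (auto intro!: brownian_measurable[OF B] brownian_measurable[OF B'])
    show "(\<lambda>\<omega>. (W (dyadic (fst i)) \<omega> - x) \<bullet> snd i) \<in> borel_measurable M"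
      "(\<lambda>\<omega>. (W' (dyadic (fst i)) \<omega> - x') \<bullet> snd i) \<in> borel_measurable M'" by measurable
  qed (use A brownian_cos_coordinates[OF B B' J(1)] in auto)
  then show "emeasure (distr M path_space (path_coordinates W x)) ?E = emeasure (distr M' path_space (path_coordinates W' x')) ?E"
    using E meas by (simp add: emeasure_distr pre M.emeasure_eq_measure M'.emeasure_eq_measure)
qed auto

section \<open>Survival events\<close>

text \<open>On \<open>[1 / (j + 1), u]\<close> the distance of the path to the complement of
  \<open>\<Omega>\<close> attains its minimum, and lower bounds for this distance at dyadic times
  extend to all times by continuity. The time \<open>0\<close> is left out because a path may
  start on the boundary.\<close>

lemma path_stays_iff_dyadic:
  fixes w :: "real \<Rightarrow> 'a::euclidean_space"
  assumes w: "continuous_on {0..} w" and O: "open \<Omega>" "\<Omega> \<noteq> UNIV"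
  shows "(\<forall>s\<in>{0<..u}. w s \<in> \<Omega>) \<longleftrightarrow>
    (\<forall>j::nat. \<exists>k::nat. \<forall>q. 1 / real (Suc j) \<le> dyadic q \<longrightarrow> dyadic q \<le> u \<longrightarrow> 1 / real (Suc k) \<le> infdist (w (dyadic q)) (- \<Omega>))"
    (is "?L \<longleftrightarrow> ?R")
proof
  have cl: "closed (- \<Omega>)" "- \<Omega> \<noteq> {}" using O by auto
  have pos: "0 < infdist y (- \<Omega>) \<longleftrightarrow> y \<in> \<Omega>" for y
    using in_closed_iff_infdist_zero[OF cl, of y] infdist_nonneg[of y "- \<Omega>"] by auto
  {
    assume L: ?L
    show ?R
    proof
      fix j
      let ?S = "{1 / real (Suc j)..u}"
      show "\<exists>k. \<forall>q. 1 / real (Suc j) \<le> dyadic q \<longrightarrow> dyadic q \<le> u \<longrightarrow> 1 / real (Suc k) \<le> infdist (w (dyadic q)) (- \<Omega>)"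
      proof (cases "?S = {}")
        case True
        then show ?thesis by auto
      next
        case False
        have j: "0 < 1 / real (Suc j)" by simp
        have "continuous_on ?S w" using j by (intro continuous_on_subset[OF w]) auto
        then have "continuous_on ?S (\<lambda>s. infdist (w s) (- \<Omega>))" by (intro continuous_intros)
        then obtain s where s: "s \<in> ?S" "\<And>t. t \<in> ?S \<Longrightarrow> infdist (w s) (- \<Omega>) \<le> infdist (w t) (- \<Omega>)"
          using continuous_attains_inf[of ?S] False by (metis compact_Icc)
        have "0 < s" using s(1) j by (meson atLeastAtMost_iff less_le_trans)
        then have "0 < infdist (w s) (- \<Omega>)" using L s(1) pos by auto
        then obtain k where "inverse (real (Suc k)) < infdist (w s) (- \<Omega>)" using reals_Archimedean by blast
        then show ?thesis using s(2) by (intro exI[of _ k]) (auto simp: inverse_eq_divide intro: less_imp_le less_le_trans)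
      qed
    qed
  next
    assume R: ?R
    show ?L
    proof
      fix s assume s: "s \<in> {0<..u}"
      obtain j where j: "inverse (real (Suc j)) < s" using reals_Archimedean[of s] s by auto
      obtain k where k: "\<And>q. 1 / real (Suc j) \<le> dyadic q \<Longrightarrow> dyadic q \<le> u \<Longrightarrow> 1 / real (Suc k) \<le> infdist (w (dyadic q)) (- \<Omega>)"
        using R by blast
      define d where "d n = dyadic (nat \<lfloor>s * 2 ^ n\<rfloor>, n)" for n
      have d1: "d n \<le> s" "s - 1 / 2 ^ n \<le> d n" for n
      proof -
        have e: "real (nat \<lfloor>s * 2 ^ n\<rfloor>) = real_of_int \<lfloor>s * 2 ^ n\<rfloor>" using s by (intro of_nat_nat) simp
        have "real_of_int \<lfloor>s * 2 ^ n\<rfloor> \<le> s * 2 ^ n" "s * 2 ^ n - 1 \<le> real_of_int \<lfloor>s * 2 ^ n\<rfloor>" by linarith+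
        then have "real_of_int \<lfloor>s * 2 ^ n\<rfloor> / 2 ^ n \<le> s * 2 ^ n / 2 ^ n"
          "(s * 2 ^ n - 1) / 2 ^ n \<le> real_of_int \<lfloor>s * 2 ^ n\<rfloor> / 2 ^ n"
          by (intro divide_right_mono; simp)+
        then show "d n \<le> s" "s - 1 / 2 ^ n \<le> d n"
          unfolding d_def dyadic_def fst_conv snd_conv e by (simp_all add: diff_divide_distrib)
      qed
      have lim: "d \<longlonglongrightarrow> s"
      proof (rule tendsto_sandwich)
        have "(\<lambda>n. s - (1 / 2) ^ n) \<longlonglongrightarrow> s - 0" by (intro tendsto_intros LIMSEQ_power_zero) simp
        then show "(\<lambda>n. s - 1 / 2 ^ n) \<longlonglongrightarrow> s" by (simp add: power_one_over)
      qed (use d1 in auto)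
      have "(\<lambda>n. w (d n)) \<longlonglongrightarrow> w s"
        using s by (intro continuous_on_tendsto_compose[OF w lim]) (auto simp: d_def)
      then have "(\<lambda>n. infdist (w (d n)) (- \<Omega>)) \<longlonglongrightarrow> infdist (w s) (- \<Omega>)"
        by (rule tendsto_infdist)
      moreover have "\<forall>\<^sub>F n in sequentially. 1 / real (Suc k) \<le> infdist (w (d n)) (- \<Omega>)"
        using order_tendstoD(1)[OF lim j]
      proof eventually_elim
        case (elim n)
        then show ?case using k[of "(nat \<lfloor>s * 2 ^ n\<rfloor>, n)"] d1[of n] s by (simp add: d_def inverse_eq_divide)
      qed
      ultimately have "1 / real (Suc k) \<le> infdist (w s) (- \<Omega>)"
        by (intro tendsto_lowerbound) auto
      moreover have "0 < 1 / real (Suc k)" by simp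
      ultimately show "w s \<in> \<Omega>" using pos by (metis less_le_trans)
    qed
  }
qed

text \<open>A path that is in \<open>\<Omega>\<close> at time \<open>u\<close> stays there for a while, as
  \<open>\<Omega>\<close> is open; so the exit time exceeds \<open>u\<close> strictly.\<close>

lemma less_exit_time_iff:
  fixes w :: "real \<Rightarrow> 'a::euclidean_space"
  assumes w: "continuous_on {0..} w" and O: "open \<Omega>" and u: "u > 0"
  shows "ereal u < exit_time \<Omega> w \<longleftrightarrow> (\<forall>s\<in>{0<..u}. w s \<in> \<Omega>)"
proof
  assume lt: "ereal u < exit_time \<Omega> w"
  show "\<forall>s\<in>{0<..u}. w s \<in> \<Omega>"
  proof (rule ballI, rule ccontr)
    fix s assume "s \<in> {0<..u}" "w s \<notin> \<Omega>"
    then have "exit_time \<Omega> w \<le> ereal s" unfolding exit_time_def by (intro INF_lower) auto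
    then show False using lt \<open>s \<in> {0<..u}\<close> by (meson ereal_less_eq(3) greaterThanAtMost_iff leD order_trans)
  qed
next
  assume st: "\<forall>s\<in>{0<..u}. w s \<in> \<Omega>"
  have "isCont w u" using u by (intro continuous_on_interior[OF w]) (simp add: interior_real_atLeast)
  then have "(w \<longlongrightarrow> w u) (at u)" by (simp add: isCont_def)
  then have "\<forall>\<^sub>F s in at u. w s \<in> \<Omega>" using O st u by (intro topological_tendstoD) auto
  then obtain d where d: "d > 0" "\<And>s. s \<noteq> u \<Longrightarrow> dist s u < d \<Longrightarrow> w s \<in> \<Omega>"
    unfolding eventually_at by auto
  have "ereal (u + d) \<le> exit_time \<Omega> w"
    unfolding exit_time_def
  proof (rule INF_greatest, clarify)
    fix s assume s: "0 < s" "w s \<notin> \<Omega>"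
    then have "u < s" using st by force
    then show "ereal (u + d) \<le> ereal s" using d(2)[of s] s by (force simp: dist_real_def)
  qed
  then show "ereal u < exit_time \<Omega> w" using d(1) by (meson ereal_less(2) ereal_less_eq(3) less_add_same_cancel1 less_ereal.simps(1) less_le_trans)
qed

text \<open>The time-changed killed path is alive at time \<open>s\<close> iff \<open>D s\<close> is less than
  the exit time of \<open>w\<close>. This property passes from \<open>t\<close> to all earlier
  times by monotonicity of \<open>D\<close>, and to slightly later ones by right-continuity, which
  makes the inequality strict.\<close>

lemma killed_subordinate_survival:
  fixes w :: "real \<Rightarrow> 'a::euclidean_space" and D :: "real \<Rightarrow> real"
  assumes w: "continuous_on {0..} w" and O: "open \<Omega>" and D: "cadlag D" "D 0 = 0" "strict_mono_on {0..} D" and t: "t > 0"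
  shows "ereal t < exit_time (Some ` \<Omega>) (\<lambda>s. killed_path \<Omega> w (D s)) \<longleftrightarrow> (\<forall>s\<in>{0<..D t}. w s \<in> \<Omega>)"
proof -
  let ?\<tau> = "exit_time \<Omega> w"
  have Dpos: "0 < D s" if "s > 0" for s using D that strict_mono_onD[OF D(3), of 0 s] by simp
  have killed: "killed_path \<Omega> w (D s) \<in> Some ` \<Omega> \<longleftrightarrow> ereal (D s) < ?\<tau>" if "s > 0" for s
    using less_exit_time_iff[OF w O Dpos[OF that]] Dpos[OF that] by (auto simp: killed_path_def)
  have "ereal t < exit_time (Some ` \<Omega>) (\<lambda>s. killed_path \<Omega> w (D s)) \<longleftrightarrow> ereal (D t) < ?\<tau>"
  proof
    assume lt: "ereal t < exit_time (Some ` \<Omega>) (\<lambda>s. killed_path \<Omega> w (D s))"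
    show "ereal (D t) < ?\<tau>"
    proof (rule ccontr)
      assume "\<not> ereal (D t) < ?\<tau>"
      then have "exit_time (Some ` \<Omega>) (\<lambda>s. killed_path \<Omega> w (D s)) \<le> ereal t"
        unfolding exit_time_def[of "Some ` \<Omega>"] using killed[OF t] t by (intro INF_lower) auto
      then show False using lt by simp
    qed
  next
    assume lt: "ereal (D t) < ?\<tau>"
    have "((\<lambda>s. ereal (D s)) \<longlongrightarrow> ereal (D t)) (at_right t)"
      using D(1) t by (auto simp: cadlag_def)
    then have "\<forall>\<^sub>F s in at_right t. ereal (D s) < ?\<tau>" using lt by (rule order_tendstoD)
    then obtain b where b: "b > t" "\<And>s. t < s \<Longrightarrow> s < b \<Longrightarrow> ereal (D s) < ?\<tau>"
      by (auto simp: eventually_at_right_field)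
    have "ereal b \<le> exit_time (Some ` \<Omega>) (\<lambda>s. killed_path \<Omega> w (D s))"
      unfolding exit_time_def[of "Some ` \<Omega>"]
    proof (rule INF_greatest, clarify)
      fix s assume s: "0 < s" "killed_path \<Omega> w (D s) \<notin> Some ` \<Omega>"
      then have n: "\<not> ereal (D s) < ?\<tau>" using killed by simp
      have "t < s"
      proof (rule ccontr)
        assume "\<not> t < s"
        then have "D s \<le> D t" using strict_mono_on_leD[OF D(3), of s t] s by simp
        then show False using n lt by (meson ereal_less_eq(3) le_less_trans)
      qed
      then show "ereal b \<le> ereal s" using n b(2) by force
    qed
    then show "ereal t < exit_time (Some ` \<Omega>) (\<lambda>s. killed_path \<Omega> w (D s))"
      using b(1) by (meson less_ereal.simps(1) less_le_trans)
  qed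
  also have "\<dots> \<longleftrightarrow> (\<forall>s\<in>{0<..D t}. w s \<in> \<Omega>)" by (rule less_exit_time_iff[OF w O Dpos[OF t]])
  finally show ?thesis .
qed

section \<open>Spectral heat content as an expectation\<close>

text \<open>The condition that the path \<open>x + y\<close> stays in \<open>\<Omega>\<close> up to time
  \<open>u\<close>, in terms of its coordinates at dyadic times; in this form it is visibly
  measurable in \<open>x\<close>, \<open>y\<close> and \<open>u\<close> together.\<close>

definition survives :: "'a::euclidean_space set \<Rightarrow> 'a \<Rightarrow> ((nat \<times> nat) \<times> 'a \<Rightarrow> real) \<Rightarrow> real \<Rightarrow> bool" where
  "survives \<Omega> x y u \<longleftrightarrow>
    (\<forall>j::nat. \<exists>k::nat. \<forall>q. 1 / real (Suc j) \<le> dyadic q \<longrightarrow> dyadic q \<le> u \<longrightarrow>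
       1 / real (Suc k) \<le> infdist (x + (\<Sum>b\<in>Basis. y (q, b) *\<^sub>R b)) (- \<Omega>))"

lemma survives_path_coordinates:
  fixes \<Omega> :: "'a::euclidean_space set"
  assumes W: "continuous_on {0..} (\<lambda>s. W s \<omega>)" and O: "open \<Omega>" "\<Omega> \<noteq> UNIV"
  shows "survives \<Omega> x (path_coordinates W x' \<omega>) u \<longleftrightarrow> (\<forall>s\<in>{0<..u}. x - x' + W s \<omega> \<in> \<Omega>)"
proof -
  have "(\<Sum>b\<in>Basis. path_coordinates W x' \<omega> (q, b) *\<^sub>R b) = W (dyadic q) \<omega> - x'" for q
  proof -
    have "(\<Sum>b\<in>Basis. path_coordinates W x' \<omega> (q, b) *\<^sub>R b) = (\<Sum>b\<in>Basis. ((W (dyadic q) \<omega> - x') \<bullet> b) *\<^sub>R b)"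
      by (intro sum.cong) (auto simp: path_coordinates_def)
    then show ?thesis by (simp only: euclidean_representation)
  qed
  then have "x + (\<Sum>b\<in>Basis. path_coordinates W x' \<omega> (q, b) *\<^sub>R b) = x - x' + W (dyadic q) \<omega>" for q by simp
  moreover have "continuous_on {0..} (\<lambda>s. x - x' + W s \<omega>)" using W by (intro continuous_intros)
  ultimately show ?thesis
    unfolding survives_def using path_stays_iff_dyadic[OF _ O, of "\<lambda>s. x - x' + W s \<omega>" u] by presburger
qed

lemma survives_measurable [measurable]:
  fixes \<Omega> :: "'a::euclidean_space set"
  assumes [measurable]: "f \<in> L \<rightarrow>\<^sub>M borel" "g \<in> L \<rightarrow>\<^sub>M path_space" "h \<in> L \<rightarrow>\<^sub>M borel"
  shows "Measurable.pred L (\<lambda>p. survives \<Omega> (f p) (g p) (h p))"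
proof -
  have inf[measurable]: "(\<lambda>x. infdist x (- \<Omega>)) \<in> borel_measurable borel"
    by (intro borel_measurable_continuous_onI continuous_intros)
  have co[measurable]: "(\<lambda>p. g p (q, b)) \<in> borel_measurable L" if "b \<in> Basis" for q b
    using that by (intro measurable_compose[OF assms(2)] measurable_component_singleton) auto
  have su[measurable]: "(\<lambda>p. \<Sum>b\<in>Basis. g p (q, b) *\<^sub>R b) \<in> borel_measurable L" for q
    by (intro borel_measurable_sum borel_measurable_scaleR co) auto
  show ?thesis unfolding survives_def by measurable
qed

lemma path_coordinates_process_event:
  fixes x :: "'a::euclidean_space"
  assumes A: "A \<in> sets path_space"
  shows "path_coordinates W x -` A \<inter> space M \<in> process_events M W"
proof -
  define g :: "(real \<Rightarrow> 'a) \<Rightarrow> (nat \<times> nat) \<times> 'a \<Rightarrow> real"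
    where "g f = (\<lambda>(q, b)\<in>UNIV \<times> Basis. (f (dyadic q) - x) \<bullet> b)" for f
  have g: "g \<in> (\<Pi>\<^sub>M t\<in>{0..}. borel) \<rightarrow>\<^sub>M path_space"
    unfolding g_def
  proof (rule measurable_restrict, clarify)
    fix i j :: nat and b :: 'a assume "b \<in> Basis"
    have [measurable]: "(\<lambda>f. f (dyadic (i, j))) \<in> (\<Pi>\<^sub>M t\<in>{0..}. borel) \<rightarrow>\<^sub>M (borel :: 'a measure)"
      by (rule measurable_component_singleton) simp
    show "(\<lambda>f. (f (dyadic (i, j)) - x) \<bullet> b) \<in> borel_measurable (\<Pi>\<^sub>M t\<in>{0..}. (borel :: 'a measure))" by measurable
  qed
  have eq: "path_coordinates W x \<omega> = g (\<lambda>t\<in>{0..}. W t \<omega>)" for \<omega>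
    by (auto simp: g_def path_coordinates_def fun_eq_iff)
  have sp: "(\<lambda>t\<in>{0..}. W t \<omega>) \<in> space (\<Pi>\<^sub>M t\<in>{0..}. (borel :: 'a measure))" for \<omega>
    by (simp add: space_PiM)
  have "(\<lambda>\<omega>. \<lambda>t\<in>{0..}. W t \<omega>) -` (g -` A \<inter> space (\<Pi>\<^sub>M t\<in>{0..}. borel)) \<inter> space M \<in> process_events M W"
    unfolding process_events_def by (rule in_vimage_algebra) (rule measurable_sets[OF g A])
  moreover have "(\<lambda>\<omega>. \<lambda>t\<in>{0..}. W t \<omega>) -` (g -` A \<inter> space (\<Pi>\<^sub>M t\<in>{0..}. borel)) \<inter> space M
      = path_coordinates W x -` A \<inter> space M"
    using sp by (auto simp: eq)
  ultimately show ?thesis by simp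
qed

lemma value_process_event:
  fixes D :: "real \<Rightarrow> 'w \<Rightarrow> real"
  assumes t: "t \<ge> 0" and A: "A \<in> sets borel"
  shows "D t -` A \<inter> space M \<in> process_events M D"
proof -
  have c: "(\<lambda>f. f t) \<in> (\<Pi>\<^sub>M t\<in>{0..}. borel) \<rightarrow>\<^sub>M (borel :: real measure)"
    using t by (intro measurable_component_singleton) simp
  have sp: "(\<lambda>t\<in>{0..}. D t \<omega>) \<in> space (\<Pi>\<^sub>M t\<in>{0..}. (borel :: real measure))" for \<omega>
    by (simp add: space_PiM)
  have "(\<lambda>\<omega>. \<lambda>t\<in>{0..}. D t \<omega>) -` ((\<lambda>f. f t) -` A \<inter> space (\<Pi>\<^sub>M t\<in>{0..}. borel)) \<inter> space M \<in> process_events M D"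
    unfolding process_events_def by (rule in_vimage_algebra) (rule measurable_sets[OF c A])
  moreover have "(\<lambda>\<omega>. \<lambda>t\<in>{0..}. D t \<omega>) -` ((\<lambda>f. f t) -` A \<inter> space (\<Pi>\<^sub>M t\<in>{0..}. borel)) \<inter> space M = D t -` A \<inter> space M"
    using sp t by auto
  ultimately show ?thesis by simp
qed

lemma joint_law_product:
  fixes x :: "'a::euclidean_space"
  assumes B: "brownian_motion M x' W" and S: "subordinator M D \<phi> \<nu>" and ind: "independent_processes M W D"
    and t: "t \<ge> 0"
  shows "distr M (path_space \<Otimes>\<^sub>M borel) (\<lambda>\<omega>. (path_coordinates W x \<omega>, D t \<omega>))
    = distr M path_space (path_coordinates W x) \<Otimes>\<^sub>M distr M borel (D t)"
proof (rule pair_measure_eqI[symmetric])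
  interpret M: prob_space M using B by (rule brownian_prob_space)
  have [measurable]: "path_coordinates W x \<in> M \<rightarrow>\<^sub>M path_space" by (rule path_coordinates_measurable[OF B])
  have [measurable]: "D t \<in> borel_measurable M" by (rule subordinator_measurable[OF S t])
  show "sigma_finite_measure (distr M path_space (path_coordinates W x))"
    by (intro prob_space_imp_sigma_finite M.prob_space_distr) simp
  show "sigma_finite_measure (distr M borel (D t))"
    by (intro prob_space_imp_sigma_finite M.prob_space_distr) simp
  show "sets (distr M path_space (path_coordinates W x) \<Otimes>\<^sub>M distr M borel (D t))
      = sets (distr M (path_space \<Otimes>\<^sub>M borel) (\<lambda>\<omega>. (path_coordinates W x \<omega>, D t \<omega>)))"
    by (simp cong: sets_pair_measure_cong)
  fix A B assume "A \<in> sets (distr M path_space (path_coordinates W x))" "B \<in> sets (distr M borel (D t))"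
  then have AB[measurable]: "A \<in> sets path_space" "B \<in> sets borel" by simp_all
  have "measure M ((path_coordinates W x -` A \<inter> space M) \<inter> (D t -` B \<inter> space M))
      = measure M (path_coordinates W x -` A \<inter> space M) * measure M (D t -` B \<inter> space M)"
    using ind unfolding independent_processes_def
    by (rule M.indep_setD[OF _ path_coordinates_process_event[OF AB(1)] value_process_event[OF t AB(2)]])
  moreover have "(\<lambda>\<omega>. (path_coordinates W x \<omega>, D t \<omega>)) -` (A \<times> B) \<inter> space M
      = (path_coordinates W x -` A \<inter> space M) \<inter> (D t -` B \<inter> space M)" by auto
  ultimately show "emeasure (distr M path_space (path_coordinates W x)) A * emeasure (distr M borel (D t)) B
      = emeasure (distr M (path_space \<Otimes>\<^sub>M borel) (\<lambda>\<omega>. (path_coordinates W x \<omega>, D t \<omega>))) (A \<times> B)"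
    by (simp add: emeasure_distr M.emeasure_eq_measure ennreal_mult)
qed

definition exit_probability ::
    "'w measure \<Rightarrow> (real \<Rightarrow> 'w \<Rightarrow> 'a::euclidean_space) \<Rightarrow> 'a set \<Rightarrow> real \<Rightarrow> 'a \<Rightarrow> real" where
  "exit_probability M W \<Omega> u x = measure M {\<omega>\<in>space M. \<exists>s\<in>{0<..u}. x + W s \<omega> \<notin> \<Omega>}"

text \<open>With unit initial temperature and the boundary kept at temperature zero, this is the heat that has
  left \<open>\<Omega>\<close> by time \<open>u\<close>.\<close>

definition heat_loss ::
    "'w measure \<Rightarrow> (real \<Rightarrow> 'w \<Rightarrow> 'a::euclidean_space) \<Rightarrow> 'a set \<Rightarrow> real \<Rightarrow> real" where
  "heat_loss M W \<Omega> u = (LINT x:\<Omega>|lborel. exit_probability M W \<Omega> u x)"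

locale brownian_exit =
  fixes M :: "'w measure" and W :: "real \<Rightarrow> 'w \<Rightarrow> 'a::euclidean_space" and \<Omega> :: "'a set"
  assumes B: "brownian_motion M 0 W" and op: "open \<Omega>" and bd: "bounded \<Omega>"
begin

sublocale prob_space M using B by (rule brownian_prob_space)

abbreviation "\<mu> \<equiv> distr M path_space (path_coordinates W 0)"

lemma nUNIV: "\<Omega> \<noteq> UNIV" using bd not_bounded_UNIV by metis

lemma coord [measurable]: "path_coordinates W 0 \<in> M \<rightarrow>\<^sub>M path_space"
  by (rule path_coordinates_measurable[OF B])

lemma prob_mu: "prob_space \<mu>" by (rule prob_space_distr) simp

lemma exit_iff:
  "\<omega> \<in> space M \<Longrightarrow> (\<exists>s\<in>{0<..u}. x + W s \<omega> \<notin> \<Omega>) \<longleftrightarrow> \<not> survives \<Omega> x (path_coordinates W 0 \<omega>) u"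
  using survives_path_coordinates[where W=W and \<omega>=\<omega> and x=x and x'=0 and u=u, OF brownian_continuous[OF B] op nUNIV] by simp

lemma exit_event [measurable]: "{\<omega>\<in>space M. \<exists>s\<in>{0<..u}. x + W s \<omega> \<notin> \<Omega>} \<in> sets M"
proof -
  have "{\<omega>\<in>space M. \<not> survives \<Omega> x (path_coordinates W 0 \<omega>) u} \<in> sets M" by measurable
  then show ?thesis using exit_iff by (simp cong: conj_cong)
qed

lemma exit_emeasure:
  "ennreal (exit_probability M W \<Omega> u x) = emeasure \<mu> {y \<in> space path_space. \<not> survives \<Omega> x y u}"
proof -
  have "{y \<in> space path_space. \<not> survives \<Omega> x y u} \<in> sets path_space" by measurable
  then have "emeasure \<mu> {y \<in> space path_space. \<not> survives \<Omega> x y u}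
      = emeasure M (path_coordinates W 0 -` {y \<in> space path_space. \<not> survives \<Omega> x y u} \<inter> space M)"
    by (simp add: emeasure_distr)
  also have "path_coordinates W 0 -` {y \<in> space path_space. \<not> survives \<Omega> x y u} \<inter> space M
      = {\<omega>\<in>space M. \<exists>s\<in>{0<..u}. x + W s \<omega> \<notin> \<Omega>}"
    using exit_iff measurable_space[OF coord] by auto
  finally show ?thesis by (simp add: exit_probability_def emeasure_eq_measure)
qed

lemma exit_emeasure_measurable:
  "(\<lambda>(x, u). emeasure \<mu> {y \<in> space path_space. \<not> survives \<Omega> x y u}) \<in> borel_measurable (borel \<Otimes>\<^sub>M borel)"
proof -
  interpret mu: prob_space \<mu> by (rule prob_mu)
  have "{p \<in> space ((borel \<Otimes>\<^sub>M borel) \<Otimes>\<^sub>M path_space). \<not> survives \<Omega> (fst (fst p)) (snd p) (snd (fst p))}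
      \<in> sets ((borel \<Otimes>\<^sub>M borel) \<Otimes>\<^sub>M path_space)"
    by measurable
  then have "{p \<in> space ((borel \<Otimes>\<^sub>M borel) \<Otimes>\<^sub>M path_space). \<not> survives \<Omega> (fst (fst p)) (snd p) (snd (fst p))}
      \<in> sets ((borel \<Otimes>\<^sub>M borel) \<Otimes>\<^sub>M \<mu>)"
    by (simp cong: sets_pair_measure_cong)
  from mu.measurable_emeasure_Pair[OF this]
  show ?thesis
    by (rule measurable_cong[THEN iffD1, rotated])
       (auto simp: space_pair_measure intro!: arg_cong[where f="emeasure \<mu>"])
qed

lemma exit_probability_jointly_measurable:
  "(\<lambda>(x, u). exit_probability M W \<Omega> u x) \<in> borel_measurable (borel \<Otimes>\<^sub>M borel)"
proof -
  have "(\<lambda>p. enn2real ((\<lambda>(x, u). emeasure \<mu> {y \<in> space path_space. \<not> survives \<Omega> x y u}) p)) \<in> borel_measurable (borel \<Otimes>\<^sub>M borel)"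
    using exit_emeasure_measurable by measurable
  moreover have "(\<lambda>p. enn2real ((\<lambda>(x, u). emeasure \<mu> {y \<in> space path_space. \<not> survives \<Omega> x y u}) p)) = (\<lambda>(x, u). exit_probability M W \<Omega> u x)"
    by (rule ext) (simp add: exit_emeasure[symmetric] exit_probability_def case_prod_beta)
  ultimately show ?thesis by (simp only:)
qed

lemma exit_probability_measurable [measurable]: "exit_probability M W \<Omega> u \<in> borel_measurable borel"
proof -
  have "(\<lambda>x. (x, u)) \<in> borel \<rightarrow>\<^sub>M borel \<Otimes>\<^sub>M borel" by measurable
  from measurable_compose[OF this exit_probability_jointly_measurable] show ?thesis by simp
qed

lemma exit_probability_01: "0 \<le> exit_probability M W \<Omega> u x" "exit_probability M W \<Omega> u x \<le> 1"
  by (auto simp: exit_probability_def)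

lemma volume_finite: "emeasure lborel \<Omega> < \<top>" using emeasure_bounded_finite[OF bd] by auto

lemma open_meas [measurable]: "\<Omega> \<in> sets borel" using op by simp

lemma set_integrable_bounded:
  fixes f :: "'a \<Rightarrow> real"
  assumes [measurable]: "f \<in> borel_measurable borel" and f: "\<And>x. \<bar>f x\<bar> \<le> C"
  shows "set_integrable lborel \<Omega> f"
  unfolding set_integrable_def
proof (rule Bochner_Integration.integrable_bound)
  show "integrable lborel (\<lambda>x. C * indicator \<Omega> x)"
    using volume_finite by (intro integrable_mult_right integrable_real_indicator) auto
  show "AE x in lborel. norm (indicator \<Omega> x *\<^sub>R f x) \<le> norm (C * indicator \<Omega> x)"
    using f order_trans[OF abs_ge_zero f] by (auto simp: indicator_def)
qed simp

lemma heat_loss_bounds: "0 \<le> heat_loss M W \<Omega> u" "heat_loss M W \<Omega> u \<le> measure lborel \<Omega>"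
proof -
  show "0 \<le> heat_loss M W \<Omega> u"
    unfolding heat_loss_def set_lebesgue_integral_def
    by (intro Bochner_Integration.integral_nonneg) (auto simp: exit_probability_01)
  have "heat_loss M W \<Omega> u \<le> (LINT x:\<Omega>|lborel. 1)"
    unfolding heat_loss_def
    by (intro set_integral_mono set_integrable_bounded[where C=1]) (auto simp: exit_probability_01)
  then show "heat_loss M W \<Omega> u \<le> measure lborel \<Omega>"
    by (simp add: set_lebesgue_integral_def)
qed

lemma heat_loss_ennreal:
  "ennreal (heat_loss M W \<Omega> u) = (\<integral>\<^sup>+x. indicator \<Omega> x * ennreal (exit_probability M W \<Omega> u x) \<partial>lborel)"
proof -
  have "(\<integral>\<^sup>+x. ennreal (indicator \<Omega> x *\<^sub>R exit_probability M W \<Omega> u x) \<partial>lborel) = ennreal (heat_loss M W \<Omega> u)"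
    unfolding heat_loss_def set_lebesgue_integral_def
    using set_integrable_bounded[of "exit_probability M W \<Omega> u" 1]
    by (intro nn_integral_eq_integral) (auto simp: exit_probability_01 set_integrable_def)
  also have "(\<integral>\<^sup>+x. ennreal (indicator \<Omega> x *\<^sub>R exit_probability M W \<Omega> u x) \<partial>lborel)
      = (\<integral>\<^sup>+x. indicator \<Omega> x * ennreal (exit_probability M W \<Omega> u x) \<partial>lborel)"
    by (intro nn_integral_cong) (simp add: indicator_def)
  finally show ?thesis ..
qed

lemma heat_loss_measurable [measurable]: "heat_loss M W \<Omega> \<in> borel_measurable borel"
proof -
  have "(\<lambda>(u, x). exit_probability M W \<Omega> u x) \<in> borel_measurable (borel \<Otimes>\<^sub>M lborel)"
    using measurable_compose[OF measurable_pair_swap' exit_probability_jointly_measurable]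
    by (simp add: case_prod_beta cong: measurable_cong_sets sets_pair_measure_cong)
  then have "(\<lambda>(u, x). indicator \<Omega> x * ennreal (exit_probability M W \<Omega> u x)) \<in> borel_measurable (borel \<Otimes>\<^sub>M lborel)"
    unfolding case_prod_beta by measurable
  then have "(\<lambda>u. \<integral>\<^sup>+x. indicator \<Omega> x * ennreal (exit_probability M W \<Omega> u x) \<partial>lborel) \<in> borel_measurable borel"
    by (intro lborel.borel_measurable_nn_integral) 
  then have "(\<lambda>u. enn2real (ennreal (heat_loss M W \<Omega> u))) \<in> borel_measurable borel"
    unfolding heat_loss_ennreal by measurable
  then show ?thesis by (simp add: heat_loss_bounds)
qed

end

text \<open>Under every \<open>P x\<close>, the path seen from \<open>x\<close> and the variable \<open>D
  t\<close> have the same product law. The probability of extinction by time \<open>t\<close> is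
  thus the average, over the law of \<open>D t\<close>, of the probability that Brownian motion
  from \<open>x\<close> leaves \<open>\<Omega>\<close> by a fixed time. Integration over
  \<open>x\<close> and over the law of \<open>D t\<close> can be exchanged.\<close>

theorem spectral_heat_content_eq_expectation:
  fixes \<Omega> :: "'a::euclidean_space set" and P :: "'a \<Rightarrow> 'w measure"
  assumes W: "\<And>x. brownian_motion (P x) x W" and D: "\<And>x. subordinator (P x) D \<phi> \<nu>"
    and ind: "\<And>x. independent_processes (P x) W D"
    and O: "open \<Omega>" "bounded \<Omega>" and t: "t > 0"
  shows "measure lborel \<Omega> - spectral_heat_content P W D \<Omega> t = (LINT \<omega>|P 0. heat_loss (P 0) W \<Omega> (D t \<omega>))"
proof -
  interpret brownian_exit "P 0" W \<Omega> by unfold_locales (fact W O)+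
  interpret mu: prob_space \<mu> by (rule prob_mu)
  define \<delta> where "\<delta> = distr (P 0) borel (D t)"
  have Dm[measurable]: "D t \<in> borel_measurable (P x)" for x by (rule subordinator_measurable[OF D]) (use t in simp)
  interpret de: prob_space \<delta> unfolding \<delta>_def by (rule prob_space_distr) simp
  have sd: "sets \<delta> = sets borel" "space \<delta> = UNIV" by (simp_all add: \<delta>_def)
  interpret pr: pair_prob_space \<mu> \<delta> ..
  let ?N = "\<lambda>x. {p \<in> space (path_space \<Otimes>\<^sub>M borel). \<not> survives \<Omega> x (fst p) (snd p)}"
  have N: "?N x \<in> sets (path_space \<Otimes>\<^sub>M borel)" for x by measurable
  have sets_pr: "sets (\<mu> \<Otimes>\<^sub>M \<delta>) = sets (path_space \<Otimes>\<^sub>M borel)"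
    by (simp add: sd cong: sets_pair_measure_cong)
  have sp_pr: "space (\<mu> \<Otimes>\<^sub>M \<delta>) = space (path_space \<Otimes>\<^sub>M borel)" by (simp add: space_pair_measure sd)
  define r where "r x = measure (\<mu> \<Otimes>\<^sub>M \<delta>) (?N x)" for x
  have prob: "measure (P x) {\<omega>\<in>space (P x). ereal t < exit_time (Some ` \<Omega>) (\<lambda>s. killed_path \<Omega> (\<lambda>u. W u \<omega>) (D s \<omega>))} = 1 - r x" for x
  proof -
    interpret Px: prob_space "P x" using W by (rule brownian_prob_space)
    have [measurable]: "path_coordinates W x \<in> P x \<rightarrow>\<^sub>M path_space" by (rule path_coordinates_measurable[OF W])
    let ?J = "\<lambda>\<omega>. (path_coordinates W x \<omega>, D t \<omega>)"
    have J: "?J \<in> P x \<rightarrow>\<^sub>M path_space \<Otimes>\<^sub>M borel" by measurable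
    have law: "distr (P x) (path_space \<Otimes>\<^sub>M borel) ?J = \<mu> \<Otimes>\<^sub>M \<delta>"
      unfolding joint_law_product[OF W D ind less_imp_le[OF t]] \<delta>_def
      by (simp only: brownian_path_law_unique[OF W[of x] W[of 0]] subordinator_law_unique[OF D[of x] D[of 0] t])
    have "{\<omega>\<in>space (P x). ereal t < exit_time (Some ` \<Omega>) (\<lambda>s. killed_path \<Omega> (\<lambda>u. W u \<omega>) (D s \<omega>))}
        = space (P x) - (?J -` ?N x \<inter> space (P x))"
    proof (intro set_eqI)
      fix \<omega>
      have "ereal t < exit_time (Some ` \<Omega>) (\<lambda>s. killed_path \<Omega> (\<lambda>u. W u \<omega>) (D s \<omega>))
          \<longleftrightarrow> survives \<Omega> x (path_coordinates W x \<omega>) (D t \<omega>)" if "\<omega> \<in> space (P x)"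
      proof -
        have c: "continuous_on {0..} (\<lambda>u. W u \<omega>)" by (rule brownian_continuous[OF W that])
        have d: "cadlag (\<lambda>s. D s \<omega>)" "D 0 \<omega> = 0" "strict_mono_on {0..} (\<lambda>s. D s \<omega>)"
          using D[of x] that by (auto simp: subordinator_def levy_process_def)
        show ?thesis
          using killed_subordinate_survival[OF c O(1) d t] survives_path_coordinates[where W=W and \<omega>=\<omega> and x=x and x'=x and u="D t \<omega>", OF c O(1) nUNIV]
          by simp
      qed
      then show "\<omega> \<in> {\<omega>\<in>space (P x). ereal t < exit_time (Some ` \<Omega>) (\<lambda>s. killed_path \<Omega> (\<lambda>u. W u \<omega>) (D s \<omega>))}
          \<longleftrightarrow> \<omega> \<in> space (P x) - (?J -` ?N x \<inter> space (P x))"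
        using measurable_space[OF J] by auto
    qed
    also have "measure (P x) \<dots> = 1 - measure (P x) (?J -` ?N x \<inter> space (P x))"
      by (rule Px.prob_compl) (rule measurable_sets[OF J N])
    also have "measure (P x) (?J -` ?N x \<inter> space (P x)) = r x"
      unfolding r_def law[symmetric] using J N by (subst measure_distr) auto
    finally show ?thesis .
  qed
  have slice: "ennreal (r x) = (\<integral>\<^sup>+u. ennreal (exit_probability (P 0) W \<Omega> u x) \<partial>\<delta>)" for x
  proof -
    have "ennreal (r x) = emeasure (\<mu> \<Otimes>\<^sub>M \<delta>) (?N x)" by (simp add: r_def pr.emeasure_eq_measure)
    also have "\<dots> = (\<integral>\<^sup>+u. emeasure \<mu> ((\<lambda>y. (y, u)) -` ?N x) \<partial>\<delta>)"
      by (rule pr.emeasure_pair_measure_alt2) (simp only: sets_pr, rule N)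
    also have "\<dots> = (\<integral>\<^sup>+u. ennreal (exit_probability (P 0) W \<Omega> u x) \<partial>\<delta>)"
      unfolding exit_emeasure
      by (intro nn_integral_cong arg_cong[where f="emeasure \<mu>"]) (auto simp: space_pair_measure)
    finally show ?thesis .
  qed
  have ex2: "(\<lambda>(x, u). exit_probability (P 0) W \<Omega> u x) \<in> borel_measurable (lborel \<Otimes>\<^sub>M \<delta>)"
    using exit_probability_jointly_measurable by (simp add: sd cong: measurable_cong_sets sets_pair_measure_cong)
  have "(\<lambda>(x, u). ennreal (exit_probability (P 0) W \<Omega> u x)) \<in> borel_measurable (lborel \<Otimes>\<^sub>M \<delta>)"
    using ex2 unfolding case_prod_beta by measurable
  then have "(\<lambda>x. ennreal (r x)) \<in> borel_measurable lborel"
    unfolding slice by (intro de.borel_measurable_nn_integral)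
  then have "(\<lambda>x. enn2real (ennreal (r x))) \<in> borel_measurable lborel" by measurable
  moreover have "(\<lambda>x. enn2real (ennreal (r x))) = r" by (auto simp: r_def)
  ultimately have rm[measurable]: "r \<in> borel_measurable borel" by simp
  have r01: "0 \<le> r x" "r x \<le> 1" for x by (auto simp: r_def)
  have ri: "set_integrable lborel \<Omega> r" by (rule set_integrable_bounded[where C=1]) (auto simp: r01 abs_le_iff intro: order_trans[OF _ r01(1)])
  have "spectral_heat_content P W D \<Omega> t = (LINT x:\<Omega>|lborel. 1 - r x)"
    by (simp add: spectral_heat_content_def prob)
  also have "\<dots> = (LINT x:\<Omega>|lborel. 1) - (LINT x:\<Omega>|lborel. r x)"
    using ri set_integrable_bounded[of "\<lambda>_. 1" 1] by (intro set_integral_diff) auto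
  also have "(LINT x:\<Omega>|lborel. 1) = measure lborel \<Omega>" by (simp add: set_lebesgue_integral_def)
  finally have 1: "measure lborel \<Omega> - spectral_heat_content P W D \<Omega> t = (LINT x:\<Omega>|lborel. r x)" by simp
  have "ennreal (LINT x:\<Omega>|lborel. r x) = (\<integral>\<^sup>+x. ennreal (indicator \<Omega> x *\<^sub>R r x) \<partial>lborel)"
    using ri r01 unfolding set_lebesgue_integral_def set_integrable_def
    by (intro nn_integral_eq_integral[symmetric]) auto
  also have "\<dots> = (\<integral>\<^sup>+x. \<integral>\<^sup>+u. indicator \<Omega> x * ennreal (exit_probability (P 0) W \<Omega> u x) \<partial>\<delta> \<partial>lborel)"
  proof (intro nn_integral_cong)
    fix x
    have [measurable]: "(\<lambda>u. exit_probability (P 0) W \<Omega> u x) \<in> borel_measurable \<delta>"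
      using measurable_compose[OF measurable_Pair1' ex2, of x] by simp
    have "(\<integral>\<^sup>+u. indicator \<Omega> x * ennreal (exit_probability (P 0) W \<Omega> u x) \<partial>\<delta>)
        = indicator \<Omega> x * (\<integral>\<^sup>+u. ennreal (exit_probability (P 0) W \<Omega> u x) \<partial>\<delta>)"
      by (rule nn_integral_cmult) measurable
    then show "ennreal (indicator \<Omega> x *\<^sub>R r x) = (\<integral>\<^sup>+u. indicator \<Omega> x * ennreal (exit_probability (P 0) W \<Omega> u x) \<partial>\<delta>)"
      by (simp add: slice[symmetric] indicator_def)
  qed
  also have "\<dots> = (\<integral>\<^sup>+u. \<integral>\<^sup>+x. indicator \<Omega> x * ennreal (exit_probability (P 0) W \<Omega> u x) \<partial>lborel \<partial>\<delta>)"
  proof -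
    interpret pl: pair_sigma_finite "lborel :: 'a measure" \<delta> ..
    have "(\<lambda>(x, u). indicator \<Omega> x * ennreal (exit_probability (P 0) W \<Omega> u x)) \<in> borel_measurable (lborel \<Otimes>\<^sub>M \<delta>)"
      using ex2 unfolding case_prod_beta by measurable
    then show ?thesis by (rule pl.Fubini'[symmetric])
  qed
  also have "\<dots> = (\<integral>\<^sup>+u. ennreal (heat_loss (P 0) W \<Omega> u) \<partial>\<delta>)" by (simp add: heat_loss_ennreal)
  also have "\<dots> = (\<integral>\<^sup>+\<omega>. ennreal (heat_loss (P 0) W \<Omega> (D t \<omega>)) \<partial>P 0)"
    unfolding \<delta>_def by (subst nn_integral_distr) auto
  also have "\<dots> = ennreal (LINT \<omega>|P 0. heat_loss (P 0) W \<Omega> (D t \<omega>))"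
    using heat_loss_bounds
    by (intro nn_integral_eq_integral integrable_const_bound[where B="measure lborel \<Omega>"]) auto
  finally have "(LINT x:\<Omega>|lborel. r x) = (LINT \<omega>|P 0. heat_loss (P 0) W \<Omega> (D t \<omega>))"
    using heat_loss_bounds r01 by (subst (asm) ennreal_inj)
      (auto intro!: Bochner_Integration.integral_nonneg simp: set_lebesgue_integral_def)
  then show ?thesis using 1 by simp
qed

section \<open>The running maximum of Brownian motion\<close>

text \<open>The integral of \<open>exp(-s\<^sup>2/4) / sqrt pi\<close> over \<open>s \<ge> r\<close>, that is
  \<open>erfc(r / 2)\<close>: twice the probability that a coordinate of \<open>W\<close> has
  gained at least \<open>r\<close> by time one, when it has variance \<open>2\<close>.\<close>

definition gauss_tail :: "real \<Rightarrow> real" where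
  "gauss_tail r = 2 * measure std_normal_distribution {r / sqrt 2..}"

lemma gauss_tail_antimono: "r \<le> r' \<Longrightarrow> gauss_tail r' \<le> gauss_tail r"
proof -
  interpret real_distribution std_normal_distribution by (rule real_dist_normal_dist)
  assume "r \<le> r'"
  then show ?thesis
    unfolding gauss_tail_def by (intro mult_left_mono finite_measure_mono) (auto simp: divide_right_mono)
qed

lemma gauss_tail_nonneg: "0 \<le> gauss_tail r" by (simp add: gauss_tail_def)

lemma gauss_tail_le_2: "gauss_tail r \<le> 2"
proof -
  interpret real_distribution std_normal_distribution by (rule real_dist_normal_dist)
  show ?thesis by (simp add: gauss_tail_def)
qed

lemma gauss_tail_eq_nn_integral:
  "ennreal (gauss_tail r) = (\<integral>\<^sup>+s. ennreal (exp (- s\<^sup>2 / 4) / sqrt pi) * indicator {r..} s \<partial>lborel)"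
proof -
  interpret real_distribution std_normal_distribution by (rule real_dist_normal_dist)
  have "ennreal (measure std_normal_distribution {r / sqrt 2..}) = emeasure std_normal_distribution {r / sqrt 2..}"
    by (simp add: emeasure_eq_measure)
  also have "\<dots> = (\<integral>\<^sup>+x. ennreal (std_normal_density x) * indicator {r / sqrt 2..} x \<partial>lborel)"
    by (subst emeasure_density) auto
  also have "\<dots> = ennreal (1 / sqrt 2) * (\<integral>\<^sup>+s. ennreal (std_normal_density (0 + 1 / sqrt 2 * s)) * indicator {r / sqrt 2..} (0 + 1 / sqrt 2 * s) \<partial>lborel)"
    by (subst nn_integral_real_affine[where c="1 / sqrt 2" and t=0]) auto
  also have "\<dots> = ennreal (1 / sqrt 2) * (\<integral>\<^sup>+s. ennreal (1 / sqrt 2) * (ennreal (exp (- s\<^sup>2 / 4) / sqrt pi) * indicator {r..} s) \<partial>lborel)"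
  proof -
    have "ennreal (std_normal_density (0 + 1 / sqrt 2 * s)) * indicator {r / sqrt 2..} (0 + 1 / sqrt 2 * s)
        = ennreal (1 / sqrt 2) * (ennreal (exp (- s\<^sup>2 / 4) / sqrt pi) * indicator {r..} s)" for s
      by (auto simp: std_normal_density_def indicator_def power_mult_distrib power_divide real_sqrt_mult
          divide_right_mono ennreal_mult'[symmetric] divide_le_cancel)
    then show ?thesis by presburger
  qed
  also have "\<dots> = ennreal (1 / 2) * (\<integral>\<^sup>+s. ennreal (exp (- s\<^sup>2 / 4) / sqrt pi) * indicator {r..} s \<partial>lborel)"
  proof -
    have "ennreal (1 / sqrt 2) * ennreal (1 / sqrt 2) = ennreal (1 / 2)"
      by (subst ennreal_mult'[symmetric]) (auto simp: real_sqrt_mult_self)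
    then show ?thesis by (subst nn_integral_cmult) (auto simp: mult.assoc[symmetric])
  qed
  finally have h: "ennreal (measure std_normal_distribution {r / sqrt 2..})
      = ennreal (1 / 2) * (\<integral>\<^sup>+s. ennreal (exp (- s\<^sup>2 / 4) / sqrt pi) * indicator {r..} s \<partial>lborel)" .
  have "ennreal (gauss_tail r) = ennreal 2 * ennreal (measure std_normal_distribution {r / sqrt 2..})"
    by (simp add: gauss_tail_def ennreal_mult)
  also have "\<dots> = (ennreal 2 * ennreal (1 / 2)) * (\<integral>\<^sup>+s. ennreal (exp (- s\<^sup>2 / 4) / sqrt pi) * indicator {r..} s \<partial>lborel)"
    by (simp only: h mult.assoc)
  also have "ennreal 2 * ennreal (1 / 2) = 1" by (subst ennreal_mult'[symmetric]) auto
  finally show ?thesis by simp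
qed

lemma gauss_tail_lipschitz:
  assumes "r \<le> r'"
  shows "gauss_tail r \<le> gauss_tail r' + (r' - r)"
proof -
  have "ennreal (gauss_tail r) \<le> (\<integral>\<^sup>+s. ennreal (exp (- s\<^sup>2 / 4) / sqrt pi) * indicator {r'..} s + ennreal 1 * indicator {r..r'} s \<partial>lborel)"
    unfolding gauss_tail_eq_nn_integral
  proof (rule nn_integral_mono)
    fix s :: real
    have "1 \<le> sqrt pi" using pi_gt3 by simp
    moreover have "exp (- s\<^sup>2 / 4) \<le> 1" by simp
    ultimately have "exp (- s\<^sup>2 / 4) \<le> sqrt pi" by linarith
    then have "exp (- s\<^sup>2 / 4) / sqrt pi \<le> 1" by simp
    then have "ennreal (exp (- s\<^sup>2 / 4) / sqrt pi) \<le> 1" by simp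
    then show "ennreal (exp (- s\<^sup>2 / 4) / sqrt pi) * indicator {r..} s
        \<le> ennreal (exp (- s\<^sup>2 / 4) / sqrt pi) * indicator {r'..} s + ennreal 1 * indicator {r..r'} s"
      by (auto simp: indicator_def)
  qed
  also have "\<dots> = ennreal (gauss_tail r') + ennreal (r' - r)"
    unfolding gauss_tail_eq_nn_integral using assms
    by (subst nn_integral_add) (auto simp: nn_integral_cmult_indicator)
  also have "\<dots> = ennreal (gauss_tail r' + (r' - r))" using assms gauss_tail_nonneg by simp
  finally show ?thesis using assms gauss_tail_nonneg[of r'] by (subst (asm) ennreal_le_iff) auto
qed

lemma gauss_tail_exp_bound:
  assumes r: "0 < r"
  shows "gauss_tail r \<le> 2 / r * exp (- r\<^sup>2 / 4)"
proof -
  have "ennreal (gauss_tail r) \<le> (\<integral>\<^sup>+s. ennreal (s / r * exp (- s\<^sup>2 / 4)) * indicator {r..} s \<partial>lborel)"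
    unfolding gauss_tail_eq_nn_integral
  proof (rule nn_integral_mono)
    fix s :: real
    show "ennreal (exp (- s\<^sup>2 / 4) / sqrt pi) * indicator {r..} s \<le> ennreal (s / r * exp (- s\<^sup>2 / 4)) * indicator {r..} s"
    proof (cases "r \<le> s")
      case True
      have "1 / sqrt pi \<le> 1" using pi_gt3 by simp
      also have "1 \<le> s / r" using True r by simp
      finally have "1 / sqrt pi * exp (- s\<^sup>2 / 4) \<le> s / r * exp (- s\<^sup>2 / 4)" by (rule mult_right_mono) simp
      then show ?thesis using True by (simp add: ennreal_leI)
    qed simp
  qed
  also have "\<dots> = ennreal (0 - (- 2 / r * exp (- r\<^sup>2 / 4)))"
  proof (rule nn_integral_FTC_atLeast[where F="\<lambda>s. - 2 / r * exp (- s\<^sup>2 / 4)"])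
    show "((\<lambda>s. - 2 / r * exp (- s\<^sup>2 / 4)) has_real_derivative s / r * exp (- s\<^sup>2 / 4)) (at s)" for s
      using r by (auto intro!: derivative_eq_intros simp: field_simps)
    have "((\<lambda>s::real. exp (- s\<^sup>2 / 4)) \<longlongrightarrow> 0) at_top" by real_asymp
    then show "((\<lambda>s. - 2 / r * exp (- s\<^sup>2 / 4)) \<longlongrightarrow> 0) at_top" by (rule tendsto_mult_right_zero)
  qed (use r in auto)
  finally show ?thesis using r by (subst (asm) ennreal_le_iff) auto
qed

locale brownian_direction =
  fixes M :: "'w measure" and x :: "'a::euclidean_space" and W :: "real \<Rightarrow> 'w \<Rightarrow> 'a" and e :: 'a
  assumes B: "brownian_motion M x W" and e: "norm e = 1"
begin

sublocale prob_space M using B by (rule brownian_prob_space)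

definition pos :: "real \<Rightarrow> 'w \<Rightarrow> real" where "pos s \<omega> = (W s \<omega> - W 0 \<omega>) \<bullet> e"

lemma W_meas: "s \<ge> 0 \<Longrightarrow> W s \<in> borel_measurable M" by (rule brownian_measurable[OF B])

lemma pos_measurable [measurable]: "s \<ge> 0 \<Longrightarrow> pos s \<in> borel_measurable M"
  unfolding pos_def using W_meas[of s] W_meas[of 0] by simp

lemma pos_0 [simp]: "pos 0 \<omega> = 0" by (simp add: pos_def)

lemma pos_continuous: "\<omega> \<in> space M \<Longrightarrow> continuous_on {0..} (\<lambda>s. pos s \<omega>)"
  unfolding pos_def by (intro continuous_intros brownian_continuous[OF B])

lemma increment_law:
  assumes s: "s \<ge> 0" and h: "h > 0"
  shows "distr M borel (\<lambda>\<omega>. (pos (s + h) \<omega> - pos s \<omega>) / sqrt (2 * h)) = std_normal_distribution"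
proof (rule Levy_uniqueness)
  have [measurable]: "pos (s + h) \<in> borel_measurable M" "pos s \<in> borel_measurable M" using s h by auto
  show "real_distribution (distr M borel (\<lambda>\<omega>. (pos (s + h) \<omega> - pos s \<omega>) / sqrt (2 * h)))"
    by (rule real_distribution_distr) measurable
  show "char (distr M borel (\<lambda>\<omega>. (pos (s + h) \<omega> - pos s \<omega>) / sqrt (2 * h))) = char std_normal_distribution"
  proof
    fix t
    have "char (distr M borel (\<lambda>\<omega>. (pos (s + h) \<omega> - pos s \<omega>) / sqrt (2 * h))) t
        = (CLINT \<omega>|M. iexp (t * ((pos (s + h) \<omega> - pos s \<omega>) / sqrt (2 * h))))"
      unfolding char_def by (subst integral_distr) auto
    also have "\<dots> = (CLINT \<omega>|M. iexp (((t / sqrt (2 * h)) *\<^sub>R e) \<bullet> (W (s + h) \<omega> - W s \<omega>)))"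
      by (simp add: pos_def inner_diff_left inner_diff_right inner_commute[of e] algebra_simps diff_divide_distrib)
    also have "\<dots> = exp (- complex_of_real (h * (norm ((t / sqrt (2 * h)) *\<^sub>R e))\<^sup>2))"
      using h by (intro brownian_char_increment[OF B s]) simp
    also have "h * (norm ((t / sqrt (2 * h)) *\<^sub>R e))\<^sup>2 = t\<^sup>2 / 2"
      using h e by (simp add: power_divide)
    finally show "char (distr M borel (\<lambda>\<omega>. (pos (s + h) \<omega> - pos s \<omega>) / sqrt (2 * h))) t = char std_normal_distribution t"
      by (simp add: char_std_normal_distribution exp_of_real[symmetric])
  qed
qed (rule real_dist_normal_dist)

lemma increment_tail:
  assumes s: "s \<ge> 0" and h: "h > 0"
  shows "prob {\<omega>\<in>space M. a \<le> pos (s + h) \<omega> - pos s \<omega>} = gauss_tail (a / sqrt h) / 2"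
    and "prob {\<omega>\<in>space M. a < pos (s + h) \<omega> - pos s \<omega>} = gauss_tail (a / sqrt h) / 2"
proof -
  have [measurable]: "pos (s + h) \<in> borel_measurable M" "pos s \<in> borel_measurable M" using s h by auto
  let ?X = "\<lambda>\<omega>. (pos (s + h) \<omega> - pos s \<omega>) / sqrt (2 * h)"
  have sq: "sqrt (2 * h) > 0" using h by simp
  have r: "a / sqrt h / sqrt 2 = a / sqrt (2 * h)" by (simp add: real_sqrt_mult mult.commute)
  have "measure std_normal_distribution {a / sqrt (2 * h)..} = measure (distr M borel ?X) {a / sqrt (2 * h)..}"
    by (simp only: increment_law[OF s h])
  also have "\<dots> = prob (?X -` {a / sqrt (2 * h)..} \<inter> space M)" by (subst measure_distr) auto
  also have "?X -` {a / sqrt (2 * h)..} \<inter> space M = {\<omega>\<in>space M. a \<le> pos (s + h) \<omega> - pos s \<omega>}"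
    using sq by (auto simp: divide_le_cancel)
  finally show 1: "prob {\<omega>\<in>space M. a \<le> pos (s + h) \<omega> - pos s \<omega>} = gauss_tail (a / sqrt h) / 2"
    unfolding gauss_tail_def r by simp
  interpret N: real_distribution std_normal_distribution by (rule real_dist_normal_dist)
  have "emeasure std_normal_distribution {a / sqrt (2 * h)} = 0"
    by (subst emeasure_density) (auto simp: nn_integral_0_iff_AE intro!: AE_I[where N="{a / sqrt (2 * h)}"])
  then have n0: "{a / sqrt (2 * h)} \<in> null_sets std_normal_distribution" by auto
  have "measure std_normal_distribution {a / sqrt (2 * h)..} = measure std_normal_distribution ({a / sqrt (2 * h)<..} \<union> {a / sqrt (2 * h)})"
    by (intro arg_cong[where f="measure std_normal_distribution"]) auto
  also have "\<dots> = measure std_normal_distribution {a / sqrt (2 * h)<..}"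
    using n0 by (intro measure_Un_null_set) auto
  also have "\<dots> = measure (distr M borel ?X) {a / sqrt (2 * h)<..}"
    by (simp only: increment_law[OF s h])
  also have "\<dots> = prob (?X -` {a / sqrt (2 * h)<..} \<inter> space M)" by (subst measure_distr) auto
  also have "?X -` {a / sqrt (2 * h)<..} \<inter> space M = {\<omega>\<in>space M. a < pos (s + h) \<omega> - pos s \<omega>}"
    using sq by (auto simp: divide_less_cancel)
  finally show "prob {\<omega>\<in>space M. a < pos (s + h) \<omega> - pos s \<omega>} = gauss_tail (a / sqrt h) / 2"
    unfolding gauss_tail_def r by simp
qed

end

text \<open>The displacements in the directions \<open>e\<close> and \<open>- e\<close> have the same law, so
  each is positive with probability one half.\<close>

lemma gauss_tail_0_by_symmetry:
  assumes "brownian_direction M x W e"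
  shows "gauss_tail 0 = 1"
proof -
  interpret p: brownian_direction M x W e by fact
  interpret m: brownian_direction M x W "- e" using p.B p.e by unfold_locales auto
  have [measurable]: "p.pos 1 \<in> borel_measurable M" by simp
  have 1: "p.prob {\<omega>\<in>space M. 0 \<le> p.pos 1 \<omega>} = gauss_tail 0 / 2" using p.increment_tail(1)[of 0 1 0] by simp
  have "measure M {\<omega>\<in>space M. 0 < m.pos 1 \<omega>} = gauss_tail 0 / 2" using m.increment_tail(2)[of 0 1 0] by simp
  moreover have "{\<omega>\<in>space M. 0 < m.pos 1 \<omega>} = space M - {\<omega>\<in>space M. 0 \<le> p.pos 1 \<omega>}"
    by (auto simp: p.pos_def m.pos_def)
  moreover have "p.prob (space M - {\<omega>\<in>space M. 0 \<le> p.pos 1 \<omega>}) = 1 - p.prob {\<omega>\<in>space M. 0 \<le> p.pos 1 \<omega>}"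
    by (rule p.prob_compl) measurable
  ultimately show ?thesis using 1 by simp
qed

context brownian_direction
begin

lemma gauss_tail_0: "gauss_tail 0 = 1" by (rule gauss_tail_0_by_symmetry) unfold_locales

context
  fixes u :: real and n :: nat
  assumes u: "u > 0" and n: "n > 0"
begin

definition grid :: "nat \<Rightarrow> 'w \<Rightarrow> real" where "grid k = pos (real k * u / real n)"

lemma grid_measurable [measurable]: "grid k \<in> borel_measurable M"
  unfolding grid_def using u by (intro pos_measurable) simp

lemma grid_0 [simp]: "grid 0 \<omega> = 0" by (simp add: grid_def)

lemma grid_n: "grid n = pos u" using n by (simp add: grid_def)

definition first_passage :: "real \<Rightarrow> nat \<Rightarrow> 'w set" where
  "first_passage a k = {\<omega>\<in>space M. (\<forall>j<k. grid j \<omega> \<le> a) \<and> a < grid k \<omega>}"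

lemma first_passage_sets [measurable]: "first_passage a k \<in> sets M"
  unfolding first_passage_def by measurable

lemma first_passage_disjoint: "disjoint_family_on (first_passage a) A"
proof -
  have "first_passage a j \<inter> first_passage a k = {}" if "j < k" for j k
    using that by (fastforce simp: first_passage_def)
  then show ?thesis unfolding disjoint_family_on_def by (metis Int_commute linorder_neqE_nat)
qed

lemma first_passage_Union: "(\<Union>k\<le>n. first_passage a k) = {\<omega>\<in>space M. \<exists>k\<le>n. a < grid k \<omega>}"
proof (intro set_eqI iffI)
  fix \<omega> assume "\<omega> \<in> {\<omega>\<in>space M. \<exists>k\<le>n. a < grid k \<omega>}"
  then obtain k where k: "\<omega> \<in> space M" "k \<le> n" "a < grid k \<omega>" by auto
  define m where "m = (LEAST k. a < grid k \<omega>)"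
  have "a < grid m \<omega>" "m \<le> k" unfolding m_def using k by (auto intro: LeastI Least_le)
  moreover have "grid j \<omega> \<le> a" if "j < m" for j using not_less_Least[OF that[unfolded m_def]] by simp
  ultimately show "\<omega> \<in> (\<Union>k\<le>n. first_passage a k)"
    using k by (auto simp: first_passage_def intro!: exI[of _ m] bexI[of _ m])
qed (auto simp: first_passage_def)

text \<open>The first passage at index \<open>k\<close> is an event of the first \<open>k\<close> grid
  increments, which are independent of the increment from grid time \<open>k\<close> to the final
  time.\<close>

lemma first_passage_indep:
  assumes k: "k \<le> n" and C[measurable]: "C \<in> sets borel"
  shows "prob (first_passage a k \<inter> {\<omega>\<in>space M. grid n \<omega> - grid k \<omega> \<in> C})
    = prob (first_passage a k) * prob {\<omega>\<in>space M. grid n \<omega> - grid k \<omega> \<in> C}"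
proof -
  define ts where "ts i = (if i \<le> k then real i * u / real n else u)" for i
  have ts: "0 \<le> ts 0" "mono ts"
  proof -
    have "real i * u / real n \<le> u" if "i \<le> k" for i
    proof -
      have "real i * u \<le> real n * u" using that k u by (intro mult_right_mono) auto
      then show ?thesis using n by (simp add: divide_le_eq mult.commute)
    qed
    then show "mono ts" using u by (auto simp: mono_def ts_def divide_right_mono mult_right_mono)
  qed (simp add: ts_def)
  let ?X = "\<lambda>i \<omega>. W (ts (Suc i)) \<omega> - W (ts i) \<omega>"
  have iv: "indep_vars (\<lambda>_. borel) ?X {..<Suc k}" by (rule brownian_indep_increments[OF B ts])
  let ?P = "Pi\<^sub>M {..<k} (\<lambda>_. borel :: 'a measure)" and ?Q = "Pi\<^sub>M {k} (\<lambda>_. borel :: 'a measure)"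
  let ?A = "{f \<in> space ?P. (\<forall>j<k. (\<Sum>i<j. f i) \<bullet> e \<le> a) \<and> a < (\<Sum>i<k. f i) \<bullet> e}"
  let ?C = "{f \<in> space ?Q. f k \<bullet> e \<in> C}"
  have A: "?A \<in> sets ?P"
  proof -
    have [measurable]: "(\<lambda>f. (\<Sum>i<j. f i) \<bullet> e) \<in> borel_measurable ?P" if "j \<le> k" for j
      using that by (intro borel_measurable_inner borel_measurable_sum measurable_component_singleton) auto
    have "{f \<in> space ?P. \<forall>j\<in>{..<k}. (\<Sum>i<j. f i) \<bullet> e \<le> a} \<in> sets ?P"
    proof (rule sets.sets_Collect_finite_All)
      fix j assume "j \<in> {..<k}"
      then have [measurable]: "(\<lambda>f. (\<Sum>i<j. f i) \<bullet> e) \<in> borel_measurable ?P" by (intro \<open>\<And>j. j \<le> k \<Longrightarrow> _\<close>) simp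
      show "{f \<in> space ?P. (\<Sum>i<j. f i) \<bullet> e \<le> a} \<in> sets ?P" by measurable
    qed simp
    moreover have "{f \<in> space ?P. a < (\<Sum>i<k. f i) \<bullet> e} \<in> sets ?P" by measurable
    ultimately have "{f \<in> space ?P. \<forall>j\<in>{..<k}. (\<Sum>i<j. f i) \<bullet> e \<le> a} \<inter> {f \<in> space ?P. a < (\<Sum>i<k. f i) \<bullet> e} \<in> sets ?P"
      by (rule sets.Int)
    moreover have "?A = {f \<in> space ?P. \<forall>j\<in>{..<k}. (\<Sum>i<j. f i) \<bullet> e \<le> a} \<inter> {f \<in> space ?P. a < (\<Sum>i<k. f i) \<bullet> e}" by auto
    ultimately show ?thesis by simp
  qed
  have C': "?C \<in> sets ?Q"
  proof -
    have [measurable]: "(\<lambda>f. f k \<bullet> e) \<in> borel_measurable ?Q"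
      by (intro borel_measurable_inner measurable_component_singleton) auto
    show ?thesis by measurable
  qed
  have tele: "(\<Sum>i<j. ?X i \<omega>) \<bullet> e = grid j \<omega>" if "j \<le> k" for j \<omega>
  proof -
    have "(\<Sum>i<j. ?X i \<omega>) = W (ts j) \<omega> - W (ts 0) \<omega>" by (rule sum_lessThan_telescope)
    then show ?thesis using that by (simp add: grid_def pos_def ts_def)
  qed
  have last: "?X k \<omega> \<bullet> e = grid n \<omega> - grid k \<omega>" for \<omega>
    using n by (simp add: grid_def pos_def ts_def inner_diff_left)
  let ?rP = "\<lambda>\<omega>. restrict (\<lambda>i. ?X i \<omega>) {..<k}" and ?rQ = "\<lambda>\<omega>. restrict (\<lambda>i. ?X i \<omega>) {k}"
  have "prob ((\<lambda>\<omega>. (?rP \<omega>, ?rQ \<omega>)) -` (?A \<times> ?C) \<inter> space M) = prob (?rP -` ?A \<inter> space M) * prob (?rQ -` ?C \<inter> space M)"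
    by (rule indep_varD[OF indep_var_restrict[OF iv] A C']) auto
  moreover have "?rP -` ?A \<inter> space M = first_passage a k"
  proof -
    have "(\<Sum>i<j. restrict (\<lambda>i. ?X i \<omega>) {..<k} i) \<bullet> e = grid j \<omega>" if "j \<le> k" for j \<omega>
    proof -
      have "(\<Sum>i<j. restrict (\<lambda>i. ?X i \<omega>) {..<k} i) = (\<Sum>i<j. ?X i \<omega>)" using that by (intro sum.cong) auto
      then show ?thesis by (simp only: tele[OF that])
    qed
    moreover have "restrict (\<lambda>i. ?X i \<omega>) {..<k} \<in> space ?P" for \<omega> by (simp add: space_PiM)
    ultimately show ?thesis unfolding first_passage_def by (simp add: vimage_def Int_def conj_commute cong: conj_cong)
  qed
  moreover have "?rQ -` ?C \<inter> space M = {\<omega>\<in>space M. grid n \<omega> - grid k \<omega> \<in> C}"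
  proof -
    have "restrict (\<lambda>i. ?X i \<omega>) {k} \<in> space ?Q" for \<omega> by (simp add: space_PiM)
    then show ?thesis using last by auto
  qed
  moreover have "(\<lambda>\<omega>. (?rP \<omega>, ?rQ \<omega>)) -` (?A \<times> ?C) \<inter> space M = (?rP -` ?A \<inter> space M) \<inter> (?rQ -` ?C \<inter> space M)"
    by auto
  ultimately show ?thesis by simp
qed

lemma remaining_increment:
  assumes k: "k \<le> n"
  shows "1/2 \<le> prob {\<omega>\<in>space M. grid n \<omega> - grid k \<omega> \<in> {0..}}"
    and "prob {\<omega>\<in>space M. grid n \<omega> - grid k \<omega> \<in> {0<..}} \<le> 1/2"
proof -
  have "1/2 \<le> prob {\<omega>\<in>space M. grid n \<omega> - grid k \<omega> \<in> {0..}} \<and> prob {\<omega>\<in>space M. grid n \<omega> - grid k \<omega> \<in> {0<..}} \<le> 1/2"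
  proof (cases "k = n")
    case True
    then show ?thesis by (simp add: prob_space)
  next
    case False
    define s where "s = real k * u / real n"
    have s: "s \<ge> 0" using u by (simp add: s_def)
    have "real k * u < real n * u" using False k u by (intro mult_strict_right_mono) auto
    then have h: "u - s > 0" using n by (simp add: s_def divide_less_eq mult.commute)
    have g: "grid k = pos s" by (simp add: grid_def s_def)
    show ?thesis using increment_tail[OF s h, of 0] by (simp add: grid_n g gauss_tail_0)
  qed
  then show "1/2 \<le> prob {\<omega>\<in>space M. grid n \<omega> - grid k \<omega> \<in> {0..}}"
    "prob {\<omega>\<in>space M. grid n \<omega> - grid k \<omega> \<in> {0<..}} \<le> 1/2" by auto
qed

text \<open>One half of the reflection principle on a finite grid: from the first passage above
  \<open>a\<close>, the process ends above \<open>a\<close> whenever the remaining increment is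
  nonnegative, which is independent of the past and has probability at least one half.\<close>

lemma grid_max_upper: "prob {\<omega>\<in>space M. \<exists>k\<le>n. a < grid k \<omega>} \<le> gauss_tail (a / sqrt u)"
proof -
  let ?U = "\<lambda>k. first_passage a k \<inter> {\<omega>\<in>space M. grid n \<omega> - grid k \<omega> \<in> {0..}}"
  have [measurable]: "?U k \<in> sets M" for k by measurable
  have "prob {\<omega>\<in>space M. \<exists>k\<le>n. a < grid k \<omega>} = (\<Sum>k\<le>n. prob (first_passage a k))"
    unfolding first_passage_Union[symmetric]
    by (intro finite_measure_finite_Union first_passage_disjoint) auto
  also have "\<dots> \<le> (\<Sum>k\<le>n. 2 * prob (?U k))"
  proof (rule sum_mono)
    fix k assume "k \<in> {..n}"
    then have k: "k \<le> n" by simp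
    have "prob (first_passage a k) * (1/2) \<le> prob (first_passage a k) * prob {\<omega>\<in>space M. grid n \<omega> - grid k \<omega> \<in> {0..}}"
      by (intro mult_left_mono remaining_increment(1)[OF k]) simp
    also have "\<dots> = prob (?U k)" by (rule first_passage_indep[OF k, symmetric]) simp
    finally have "prob (first_passage a k) * (1/2) \<le> prob (?U k)" .
    then show "prob (first_passage a k) \<le> 2 * prob (?U k)" by simp
  qed
  also have "\<dots> = 2 * prob (\<Union>k\<le>n. ?U k)"
  proof -
    have "disjoint_family_on ?U {..n}"
      using first_passage_disjoint[of a "{..n}"] by (auto simp: disjoint_family_on_def)
    then show ?thesis by (subst finite_measure_finite_Union) (auto simp: sum_distrib_left)
  qed
  also have "\<dots> \<le> 2 * prob {\<omega>\<in>space M. a < pos (0 + u) \<omega> - pos 0 \<omega>}"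
  proof (intro mult_left_mono finite_measure_mono)
    have [measurable]: "pos (0 + u) \<in> borel_measurable M" "pos 0 \<in> borel_measurable M" using u by auto
    show "{\<omega>\<in>space M. a < pos (0 + u) \<omega> - pos 0 \<omega>} \<in> sets M" by measurable
    show "(\<Union>k\<le>n. ?U k) \<subseteq> {\<omega>\<in>space M. a < pos (0 + u) \<omega> - pos 0 \<omega>}"
      by (auto simp: first_passage_def grid_n)
  qed simp
  also have "\<dots> = gauss_tail (a / sqrt u)" using increment_tail(2)[OF order_refl u, of a] by simp
  finally show ?thesis .
qed

text \<open>The other half: unless some grid step exceeds \<open>d\<close>, the process is at most at \<open>a
  + d\<close> at its first passage above \<open>a\<close>. To end above \<open>a + d\<close> it
  needs a positive remaining increment, which has probability at most one half.\<close>

lemma grid_max_lower: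
  assumes a: "a \<ge> 0" and d: "d > 0"
  shows "gauss_tail ((a + d) / sqrt u) \<le> prob {\<omega>\<in>space M. \<exists>k\<le>n. a < grid k \<omega>}
    + 2 * prob {\<omega>\<in>space M. \<exists>k<n. d < grid (Suc k) \<omega> - grid k \<omega>}"
proof -
  let ?V = "\<lambda>k. first_passage a k \<inter> {\<omega>\<in>space M. grid n \<omega> - grid k \<omega> \<in> {0<..}}"
  let ?J = "{\<omega>\<in>space M. \<exists>k<n. d < grid (Suc k) \<omega> - grid k \<omega>}"
  have [measurable]: "?V k \<in> sets M" for k by measurable
  have Jm[measurable]: "?J \<in> sets M" by measurable
  have "gauss_tail ((a + d) / sqrt u) / 2 = prob {\<omega>\<in>space M. a + d < grid n \<omega>}"
    using increment_tail(2)[OF order_refl u, of "a + d"] by (simp add: grid_n)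
  also have "\<dots> \<le> prob ((\<Union>k\<le>n. ?V k) \<union> ?J)"
  proof (intro finite_measure_mono)
    show "{\<omega>\<in>space M. a + d < grid n \<omega>} \<subseteq> (\<Union>k\<le>n. ?V k) \<union> ?J"
    proof
      fix \<omega> assume w: "\<omega> \<in> {\<omega>\<in>space M. a + d < grid n \<omega>}"
      then have "\<omega> \<in> (\<Union>k\<le>n. first_passage a k)" unfolding first_passage_Union using d by (auto intro!: exI[of _ n])
      then obtain k where k: "k \<le> n" "\<omega> \<in> first_passage a k" by blast
      show "\<omega> \<in> (\<Union>k\<le>n. ?V k) \<union> ?J"
      proof (cases "\<omega> \<in> ?J")
        case False
        \<comment> \<open>as \<open>a \<ge> 0\<close>, the first passage does not happen at the start, so a step precedes it\<close>
        have "k \<noteq> 0"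
        proof
          assume "k = 0"
          then have "a < grid 0 \<omega>" using k(2) by (simp add: first_passage_def)
          then show False using a by simp
        qed
        then obtain j where j: "k = Suc j" by (cases k) auto
        have "grid j \<omega> \<le> a" using k(2) j by (auto simp: first_passage_def)
        moreover have "j < n" using k(1) j by simp
        then have "grid (Suc j) \<omega> - grid j \<omega> \<le> d" using False w by force
        ultimately have "grid k \<omega> \<le> a + d" using j by simp
        then have "\<omega> \<in> ?V k" using k(2) w by auto
        then show ?thesis using k(1) by blast
      qed simp
    qed
  qed measurable
  also have "\<dots> \<le> prob (\<Union>k\<le>n. ?V k) + prob ?J" by (rule measure_Un_le) measurable
  also have "prob (\<Union>k\<le>n. ?V k) \<le> (\<Sum>k\<le>n. prob (?V k))"
    by (rule measure_UNION_le) auto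
  also have "(\<Sum>k\<le>n. prob (?V k)) \<le> (\<Sum>k\<le>n. prob (first_passage a k) * (1/2))"
  proof (rule sum_mono)
    fix k assume "k \<in> {..n}"
    then have k: "k \<le> n" by simp
    have "prob (?V k) = prob (first_passage a k) * prob {\<omega>\<in>space M. grid n \<omega> - grid k \<omega> \<in> {0<..}}"
      by (rule first_passage_indep[OF k]) simp
    also have "\<dots> \<le> prob (first_passage a k) * (1/2)"
      by (intro mult_left_mono remaining_increment(2)[OF k]) simp
    finally show "prob (?V k) \<le> prob (first_passage a k) * (1/2)" .
  qed
  also have "\<dots> = prob {\<omega>\<in>space M. \<exists>k\<le>n. a < grid k \<omega>} / 2"
    unfolding first_passage_Union[symmetric]
    by (subst finite_measure_finite_Union) (auto simp: first_passage_disjoint sum_divide_distrib)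
  finally show ?thesis by simp
qed

end

end

lemma (in prob_space) prob_tendsto_of_eventually_eq:
  assumes [measurable]: "\<And>n. A n \<in> sets M" "B \<in> sets M"
    and ev: "\<And>\<omega>. \<omega> \<in> space M \<Longrightarrow> \<forall>\<^sub>F n in sequentially. \<omega> \<in> A n \<longleftrightarrow> \<omega> \<in> B"
  shows "(\<lambda>n. prob (A n)) \<longlonglongrightarrow> prob B"
proof -
  have "(\<lambda>n. LINT \<omega>|M. indicator (A n) \<omega>) \<longlonglongrightarrow> (LINT \<omega>|M. indicator B \<omega> :: real)"
  proof (rule integral_dominated_convergence[where w="\<lambda>_. 1"])
    show "AE \<omega> in M. (\<lambda>n. indicator (A n) \<omega> :: real) \<longlonglongrightarrow> indicator B \<omega>"
    proof (rule AE_I2)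
      fix \<omega> assume "\<omega> \<in> space M"
      from ev[OF this] have "\<forall>\<^sub>F n in sequentially. indicator (A n) \<omega> = (indicator B \<omega> :: real)"
        by eventually_elim (simp add: indicator_def)
      then show "(\<lambda>n. indicator (A n) \<omega> :: real) \<longlonglongrightarrow> indicator B \<omega>" by (rule tendsto_eventually)
    qed
  qed (auto simp: indicator_def)
  then show ?thesis by simp
qed

context brownian_direction
begin

context
  fixes u :: real
  assumes u: "u > 0"
begin

lemma grid_event_sets [measurable]: "{\<omega>\<in>space M. \<exists>k\<le>Suc n. a < grid u (Suc n) k \<omega>} \<in> sets M"
proof -
  have [measurable]: "grid u (Suc n) k \<in> borel_measurable M" for k by (rule grid_measurable[OF u]) simp
  show ?thesis by measurable
qed

lemma grid_point_near:
  assumes s: "s \<in> {0..u}"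
  obtains k where "k \<le> Suc n" "\<bar>real k * u / real (Suc n) - s\<bar> \<le> u / real (Suc n)"
proof -
  define k where "k = nat \<lfloor>s * real (Suc n) / u\<rfloor>"
  have p: "0 \<le> s * real (Suc n) / u" using s u by simp
  have k1: "real k \<le> s * real (Suc n) / u" "s * real (Suc n) / u \<le> real k + 1"
    using p unfolding k_def by linarith+
  have "s * real (Suc n) / u \<le> real (Suc n)" using s u by (simp add: divide_le_eq mult.commute)
  then have "k \<le> Suc n" using k1(1) by linarith
  moreover have "real k * u \<le> s * real (Suc n)" "s * real (Suc n) \<le> (real k + 1) * u"
    using k1 u by (simp_all add: pos_le_divide_eq pos_divide_le_eq)
  then have "real k * u / real (Suc n) \<le> s" "s \<le> (real k + 1) * u / real (Suc n)"
    by (simp_all only: pos_le_divide_eq[OF of_nat_0_less_iff[THEN iffD2, OF zero_less_Suc]]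
        pos_divide_le_eq[OF of_nat_0_less_iff[THEN iffD2, OF zero_less_Suc]] )
  then have "\<bar>real k * u / real (Suc n) - s\<bar> \<le> u / real (Suc n)"
    by (simp add: distrib_right add_divide_distrib)
  ultimately show thesis by (rule that)
qed

lemma grid_detects_max:
  assumes w: "\<omega> \<in> space M" and s: "s \<in> {0..u}" "a < pos s \<omega>"
  shows "\<forall>\<^sub>F n in sequentially. \<exists>k\<le>Suc n. a < grid u (Suc n) k \<omega>"
proof -
  have "continuous (at s within {0..}) (\<lambda>s. pos s \<omega>)"
    using pos_continuous[OF w] s by (simp add: continuous_on_eq_continuous_within)
  then obtain d where d: "d > 0" "\<And>r. r \<ge> 0 \<Longrightarrow> dist r s < d \<Longrightarrow> dist (pos r \<omega>) (pos s \<omega>) < pos s \<omega> - a"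
    using s(2) unfolding continuous_within_eps_delta by (metis atLeast_iff diff_gt_0_iff_gt)
  have "(\<lambda>n. u / real (Suc n)) \<longlonglongrightarrow> 0" by real_asymp
  then have "\<forall>\<^sub>F n in sequentially. u / real (Suc n) < d" using d(1) by (rule order_tendstoD)
  then show ?thesis
  proof eventually_elim
    case (elim n)
    obtain k where k: "k \<le> Suc n" "\<bar>real k * u / real (Suc n) - s\<bar> \<le> u / real (Suc n)"
      by (rule grid_point_near[OF s(1)])
    have "dist (pos (real k * u / real (Suc n)) \<omega>) (pos s \<omega>) < pos s \<omega> - a"
      using k(2) elim u by (intro d(2)) (auto simp: dist_real_def)
    then have "a < grid u (Suc n) k \<omega>" by (simp add: grid_def[OF u] dist_real_def abs_if split: if_splits)
    then show ?case using k(1) by blast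
  qed
qed

lemma grid_max_subset:
  "{\<omega>\<in>space M. \<exists>k\<le>Suc n. a < grid u (Suc n) k \<omega>} \<subseteq> {\<omega>\<in>space M. \<exists>s\<in>{0..u}. a < pos s \<omega>}"
proof clarify
  fix \<omega> k assume "k \<le> Suc n" "a < grid u (Suc n) k \<omega>" "\<omega> \<in> space M"
  moreover have "real k * u \<le> real (Suc n) * u" using \<open>k \<le> Suc n\<close> u by (intro mult_right_mono) auto
  then have "real k * u / real (Suc n) \<le> u" by (simp add: pos_divide_le_eq mult.commute del: of_nat_Suc)
  ultimately show "\<exists>s\<in>{0..u}. a < pos s \<omega>"
    using u by (intro bexI[of _ "real k * u / real (Suc n)"]) (auto simp: grid_def[OF u])
qed

lemma running_max_sets [measurable]: "{\<omega>\<in>space M. \<exists>s\<in>{0..u}. a < pos s \<omega>} \<in> sets M"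
proof -
  have "{\<omega>\<in>space M. \<exists>s\<in>{0..u}. a < pos s \<omega>} = (\<Union>n. {\<omega>\<in>space M. \<exists>k\<le>Suc n. a < grid u (Suc n) k \<omega>})"
  proof (intro equalityI subsetI)
    fix \<omega> assume "\<omega> \<in> {\<omega>\<in>space M. \<exists>s\<in>{0..u}. a < pos s \<omega>}"
    then obtain s where "\<omega> \<in> space M" "s \<in> {0..u}" "a < pos s \<omega>" by blast
    then show "\<omega> \<in> (\<Union>n. {\<omega>\<in>space M. \<exists>k\<le>Suc n. a < grid u (Suc n) k \<omega>})"
      using eventually_happens[OF grid_detects_max] by auto
  next
    fix \<omega> assume "\<omega> \<in> (\<Union>n. {\<omega>\<in>space M. \<exists>k\<le>Suc n. a < grid u (Suc n) k \<omega>})"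
    then show "\<omega> \<in> {\<omega>\<in>space M. \<exists>s\<in>{0..u}. a < pos s \<omega>}" using grid_max_subset by blast
  qed
  moreover have "(\<Union>n. {\<omega>\<in>space M. \<exists>k\<le>Suc n. a < grid u (Suc n) k \<omega>}) \<in> sets M"
    by (intro sets.countable_UN image_subsetI grid_event_sets)
  ultimately show ?thesis by (simp only:)
qed

lemma grid_prob_tendsto:
  "(\<lambda>n. prob {\<omega>\<in>space M. \<exists>k\<le>Suc n. a < grid u (Suc n) k \<omega>}) \<longlonglongrightarrow> prob {\<omega>\<in>space M. \<exists>s\<in>{0..u}. a < pos s \<omega>}"
proof (rule prob_tendsto_of_eventually_eq)
  fix \<omega> assume w: "\<omega> \<in> space M"
  show "\<forall>\<^sub>F n in sequentially. \<omega> \<in> {\<omega>\<in>space M. \<exists>k\<le>Suc n. a < grid u (Suc n) k \<omega>} \<longleftrightarrow> \<omega> \<in> {\<omega>\<in>space M. \<exists>s\<in>{0..u}. a < pos s \<omega>}"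
  proof (cases "\<exists>s\<in>{0..u}. a < pos s \<omega>")
    case True
    then obtain s where "s \<in> {0..u}" "a < pos s \<omega>" by blast
    from grid_detects_max[OF w this] show ?thesis
    proof eventually_elim
      case (elim n)
      have "\<omega> \<in> {\<omega>\<in>space M. \<exists>k\<le>Suc n. a < grid u (Suc n) k \<omega>}" by (rule CollectI, rule conjI[OF w elim])
      moreover have "\<omega> \<in> {\<omega>\<in>space M. \<exists>s\<in>{0..u}. a < pos s \<omega>}" by (rule CollectI, rule conjI[OF w True])
      ultimately show ?case by (simp only:)
    qed
  next
    case False
    then have "\<omega> \<notin> {\<omega>\<in>space M. \<exists>k\<le>Suc n. a < grid u (Suc n) k \<omega>}" for n using False grid_max_subset[where a=a and n=n] by blast
    moreover have "\<omega> \<notin> {\<omega>\<in>space M. \<exists>s\<in>{0..u}. a < pos s \<omega>}" using False by (rule contrapos_nn) (erule CollectE, erule conjunct2)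
    ultimately show ?thesis by (intro always_eventually allI) (simp only:)
  qed
qed (rule grid_event_sets running_max_sets)+

theorem running_max_upper: "prob {\<omega>\<in>space M. \<exists>s\<in>{0..u}. a < pos s \<omega>} \<le> gauss_tail (a / sqrt u)"
  by (rule LIMSEQ_le_const2[OF grid_prob_tendsto]) (auto intro!: grid_max_upper[OF u])

lemma jump_prob_tendsto:
  assumes d: "d > 0"
  shows "(\<lambda>n. prob {\<omega>\<in>space M. \<exists>k<Suc n. d < grid u (Suc n) (Suc k) \<omega> - grid u (Suc n) k \<omega>}) \<longlonglongrightarrow> 0"
proof -
  have [measurable]: "grid u (Suc n) k \<in> borel_measurable M" for n k by (rule grid_measurable[OF u]) simp
  have "(\<lambda>n. prob {\<omega>\<in>space M. \<exists>k<Suc n. d < grid u (Suc n) (Suc k) \<omega> - grid u (Suc n) k \<omega>}) \<longlonglongrightarrow> prob {}"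
  proof (rule prob_tendsto_of_eventually_eq)
    fix \<omega> assume w: "\<omega> \<in> space M"
    have "uniformly_continuous_on {0..u} (\<lambda>s. pos s \<omega>)"
      by (intro compact_uniformly_continuous continuous_on_subset[OF pos_continuous[OF w]]) auto
    then obtain c where c: "c > 0" "\<And>r s. r \<in> {0..u} \<Longrightarrow> s \<in> {0..u} \<Longrightarrow> dist s r < c \<Longrightarrow> dist (pos s \<omega>) (pos r \<omega>) < d"
      unfolding uniformly_continuous_on_def using d by metis
    have "(\<lambda>n. u / real (Suc n)) \<longlonglongrightarrow> 0" by real_asymp
    then have "\<forall>\<^sub>F n in sequentially. u / real (Suc n) < c" using c(1) by (rule order_tendstoD)
    then show "\<forall>\<^sub>F n in sequentially. \<omega> \<in> {\<omega>\<in>space M. \<exists>k<Suc n. d < grid u (Suc n) (Suc k) \<omega> - grid u (Suc n) k \<omega>} \<longleftrightarrow> \<omega> \<in> {}"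
    proof eventually_elim
      case (elim n)
      have "grid u (Suc n) (Suc k) \<omega> - grid u (Suc n) k \<omega> \<le> d" if k: "k < Suc n" for k
      proof -
        have in01: "real j * u / real (Suc n) \<in> {0..u}" if "j \<le> Suc n" for j
        proof -
          have "real j * u \<le> real (Suc n) * u" using that u by (intro mult_right_mono) auto
          then show ?thesis using u by (simp add: pos_divide_le_eq mult.commute del: of_nat_Suc)
        qed
        have "real (Suc k) * u / real (Suc n) - real k * u / real (Suc n) = u / real (Suc n)"
          by (simp add: distrib_right add_divide_distrib)
        then have "dist (real (Suc k) * u / real (Suc n)) (real k * u / real (Suc n)) < c"
          using elim u by (simp add: dist_real_def del: of_nat_Suc)
        then have "dist (pos (real (Suc k) * u / real (Suc n)) \<omega>) (pos (real k * u / real (Suc n)) \<omega>) < d"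
          using k by (intro c(2) in01) auto
        then show ?thesis by (simp add: grid_def[OF u] dist_real_def abs_if split: if_splits)
      qed
      then have "\<not> (\<exists>k<Suc n. d < grid u (Suc n) (Suc k) \<omega> - grid u (Suc n) k \<omega>)" by (meson not_less)
      then show ?case by blast
    qed
  qed measurable
  then show ?thesis by simp
qed

text \<open>By uniform continuity of the paths, steps larger than \<open>d\<close> disappear as the grid is
  refined. The level \<open>a + d\<close> can then be lowered to \<open>a\<close>, as the tail
  function is Lipschitz.\<close>

theorem running_max_lower:
  assumes a: "a \<ge> 0"
  shows "gauss_tail (a / sqrt u) \<le> prob {\<omega>\<in>space M. \<exists>s\<in>{0..u}. a < pos s \<omega>}"
proof (rule field_le_epsilon)
  fix c :: real assume c: "c > 0"
  define d where "d = c * sqrt u"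
  have d: "d > 0" using c u by (simp add: d_def)
  have lim: "(\<lambda>n. prob {\<omega>\<in>space M. \<exists>k\<le>Suc n. a < grid u (Suc n) k \<omega>}
      + 2 * prob {\<omega>\<in>space M. \<exists>k<Suc n. d < grid u (Suc n) (Suc k) \<omega> - grid u (Suc n) k \<omega>})
      \<longlonglongrightarrow> prob {\<omega>\<in>space M. \<exists>s\<in>{0..u}. a < pos s \<omega>} + 2 * 0"
    by (intro tendsto_add tendsto_mult tendsto_const grid_prob_tendsto jump_prob_tendsto d)
  have "gauss_tail ((a + d) / sqrt u) \<le> prob {\<omega>\<in>space M. \<exists>s\<in>{0..u}. a < pos s \<omega>} + 2 * 0"
    by (rule LIMSEQ_le_const[OF lim]) (use grid_max_lower[OF u _ a d] in auto)
  moreover have "a / sqrt u \<le> (a + d) / sqrt u" using d u by (intro divide_right_mono) auto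
  then have "gauss_tail (a / sqrt u) \<le> gauss_tail ((a + d) / sqrt u) + ((a + d) / sqrt u - a / sqrt u)"
    by (rule gauss_tail_lipschitz)
  moreover have "(a + d) / sqrt u - a / sqrt u = c" using u by (simp add: d_def add_divide_distrib)
  ultimately show "gauss_tail (a / sqrt u) \<le> prob {\<omega>\<in>space M. \<exists>s\<in>{0..u}. a < pos s \<omega>} + c" by simp
qed

end

end

section \<open>Exit probabilities near the boundary\<close>

locale charted_exit = charted_domain \<Omega> R L + brownian_exit M W \<Omega>
  for \<Omega> :: "'a::euclidean_space set" and R L :: real and M :: "'w measure" and W :: "real \<Rightarrow> 'w \<Rightarrow> 'a"
begin

definition max_exceeds :: "real \<Rightarrow> 'a \<Rightarrow> real \<Rightarrow> 'w set" where
  "max_exceeds u e a = {\<omega>\<in>space M. \<exists>s\<in>{0..u}. a < (W s \<omega> - W 0 \<omega>) \<bullet> e}"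

lemma max_exceeds_props:
  assumes "norm e = 1" "u > 0"
  shows "max_exceeds u e a \<in> sets M" "prob (max_exceeds u e a) \<le> gauss_tail (a / sqrt u)"
    "a \<ge> 0 \<Longrightarrow> gauss_tail (a / sqrt u) \<le> prob (max_exceeds u e a)"
proof -
  interpret d: brownian_direction M 0 W e using B assms by unfold_locales
  show "max_exceeds u e a \<in> sets M" using d.running_max_sets[OF assms(2)] by (simp add: max_exceeds_def d.pos_def)
  show "prob (max_exceeds u e a) \<le> gauss_tail (a / sqrt u)"
    using d.running_max_upper[OF assms(2)] by (simp add: max_exceeds_def d.pos_def)
  show "a \<ge> 0 \<Longrightarrow> gauss_tail (a / sqrt u) \<le> prob (max_exceeds u e a)"
    using d.running_max_lower[OF assms(2)] by (simp add: max_exceeds_def d.pos_def)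
qed

text \<open>Off this event no coordinate has moved by more than \<open>\<rho> / (2 d)\<close> in dimension
  \<open>d\<close>, so the path is within \<open>\<rho>\<close> of its starting point.\<close>

definition excursion :: "real \<Rightarrow> real \<Rightarrow> 'w set" where
  "excursion u \<rho> = (\<Union>b\<in>Basis. max_exceeds u b (\<rho> / (2 * real DIM('a))) \<union> max_exceeds u (- b) (\<rho> / (2 * real DIM('a))))"

lemma excursion_sets: "u > 0 \<Longrightarrow> excursion u \<rho> \<in> sets M"
  unfolding excursion_def by (intro sets.finite_UN sets.Un max_exceeds_props(1)) auto

lemma excursion_prob:
  assumes u: "u > 0"
  shows "prob (excursion u \<rho>) \<le> 2 * real DIM('a) * gauss_tail (\<rho> / (2 * real DIM('a)) / sqrt u)"
proof -
  let ?F = "gauss_tail (\<rho> / (2 * real DIM('a)) / sqrt u)"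
  have b: "norm b = 1" "norm (- b) = 1" if "b \<in> Basis" for b :: 'a using that by auto
  have "prob (excursion u \<rho>) \<le> (\<Sum>b\<in>Basis. prob (max_exceeds u b (\<rho> / (2 * real DIM('a))) \<union> max_exceeds u (- b) (\<rho> / (2 * real DIM('a)))))"
    unfolding excursion_def using max_exceeds_props(1)[OF _ u] b
    by (intro measure_UNION_le) auto
  also have "\<dots> \<le> (\<Sum>b\<in>(Basis::'a set). ?F + ?F)"
  proof (rule sum_mono)
    fix b :: 'a assume "b \<in> Basis"
    note b = b[OF this]
    have "prob (max_exceeds u b (\<rho> / (2 * real DIM('a))) \<union> max_exceeds u (- b) (\<rho> / (2 * real DIM('a))))
        \<le> prob (max_exceeds u b (\<rho> / (2 * real DIM('a)))) + prob (max_exceeds u (- b) (\<rho> / (2 * real DIM('a))))"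
      by (intro measure_Un_le max_exceeds_props(1) b u)
    also have "\<dots> \<le> ?F + ?F" by (intro add_mono max_exceeds_props(2) b u)
    finally show "prob (max_exceeds u b (\<rho> / (2 * real DIM('a))) \<union> max_exceeds u (- b) (\<rho> / (2 * real DIM('a)))) \<le> ?F + ?F" .
  qed
  also have "\<dots> = 2 * real DIM('a) * ?F" by simp
  finally show ?thesis .
qed

lemma no_excursion:
  assumes w: "\<omega> \<in> space M" "W 0 \<omega> = 0" "\<omega> \<notin> excursion u \<rho>" and s: "s \<in> {0..u}" and \<rho>: "\<rho> > 0"
  shows "norm (W s \<omega>) < \<rho>"
proof -
  have "\<bar>W s \<omega> \<bullet> b\<bar> \<le> \<rho> / (2 * real DIM('a))" if "b \<in> Basis" for b
  proof -
    have "\<omega> \<notin> max_exceeds u b (\<rho> / (2 * real DIM('a)))" "\<omega> \<notin> max_exceeds u (- b) (\<rho> / (2 * real DIM('a)))"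
      using w(3) that by (auto simp: excursion_def)
    then have "\<not> \<rho> / (2 * real DIM('a)) < W s \<omega> \<bullet> b" "\<not> \<rho> / (2 * real DIM('a)) < W s \<omega> \<bullet> (- b)"
      using w(1,2) s unfolding max_exceeds_def by force+
    then show ?thesis by (simp add: abs_le_iff)
  qed
  then have "(\<Sum>b\<in>Basis. \<bar>W s \<omega> \<bullet> b\<bar>) \<le> (\<Sum>b\<in>(Basis::'a set). \<rho> / (2 * real DIM('a)))" by (rule sum_mono)
  also have "\<dots> = \<rho> / 2" by simp
  finally show ?thesis using norm_le_l1[of "W s \<omega>"] \<rho> by linarith
qed

lemma start_0: "AE \<omega> in M. W 0 \<omega> = 0"
  using B by (simp add: brownian_motion_def)

lemma boundary_dist_pos: "x \<in> \<Omega> \<Longrightarrow> 0 < infdist x (frontier \<Omega>)"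
proof -
  assume "x \<in> \<Omega>"
  then have "x \<notin> frontier \<Omega>" using op by (simp add: frontier_def interior_open)
  then have "infdist x (frontier \<Omega>) \<noteq> 0"
    using in_closed_iff_infdist_zero[OF frontier_closed boundary_nonempty] by blast
  then show ?thesis using infdist_nonneg[of x "frontier \<Omega>"] by linarith
qed

lemma mem_of_dist_less:
  assumes x: "x \<in> \<Omega>" and d: "dist x y < infdist x (frontier \<Omega>)"
  shows "y \<in> \<Omega>"
proof (rule ccontr)
  assume y: "y \<notin> \<Omega>"
  have "closed_segment x y \<inter> frontier \<Omega> \<noteq> {}"
    by (rule connected_Int_frontier) (use x y in auto)
  then obtain z where z: "z \<in> closed_segment x y" "z \<in> frontier \<Omega>" by blast
  have "infdist x (frontier \<Omega>) \<le> dist x z" by (rule infdist_le[OF z(2)])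
  also have "\<dots> \<le> dist x y" using dist_in_closed_segment[OF z(1)] by (simp add: dist_commute)
  finally show False using d by simp
qed

lemma exit_probability_far:
  assumes u: "u > 0" and x: "x \<in> \<Omega>"
  shows "exit_probability M W \<Omega> u x \<le> 2 * real DIM('a) * gauss_tail (infdist x (frontier \<Omega>) / (2 * real DIM('a)) / sqrt u)"
proof -
  let ?\<delta> = "infdist x (frontier \<Omega>)"
  have "exit_probability M W \<Omega> u x \<le> prob (excursion u ?\<delta>)"
    unfolding exit_probability_def
  proof (rule finite_measure_mono_AE)
    show "AE \<omega> in M. \<omega> \<in> {\<omega>\<in>space M. \<exists>s\<in>{0<..u}. x + W s \<omega> \<notin> \<Omega>} \<longrightarrow> \<omega> \<in> excursion u ?\<delta>"
      using start_0
    proof eventually_elim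
      case (elim \<omega>)
      show ?case
      proof (intro impI, rule ccontr)
        assume "\<omega> \<in> {\<omega>\<in>space M. \<exists>s\<in>{0<..u}. x + W s \<omega> \<notin> \<Omega>}" and n: "\<omega> \<notin> excursion u ?\<delta>"
        then obtain s where s: "s \<in> {0<..u}" "x + W s \<omega> \<notin> \<Omega>" and w: "\<omega> \<in> space M" by blast
        have "norm (W s \<omega>) < ?\<delta>"
          by (rule no_excursion[OF w elim n]) (use s boundary_dist_pos[OF x] in auto)
        then have "dist x (x + W s \<omega>) < ?\<delta>" by (simp add: dist_norm)
        then show False using mem_of_dist_less[OF x] s(2) by blast
      qed
    qed
  qed (rule excursion_sets[OF u])
  also have "\<dots> \<le> 2 * real DIM('a) * gauss_tail (?\<delta> / (2 * real DIM('a)) / sqrt u)" by (rule excursion_prob[OF u])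
  finally show ?thesis .
qed

text \<open>With \<open>r = K * sqrt u\<close> and up to an excursion of size \<open>r\<close>, the path stays
  in the chart at a boundary point closest to \<open>x\<close>, where the boundary deviates from
  its tangent plane by at most \<open>4 * L * r\<^sup>2\<close>. Leaving \<open>\<Omega>\<close>
  is thus compared with the running maximum in the outward normal direction \<open>- n\<close>
  exceeding levels within a multiple of \<open>L * r\<^sup>2\<close> of the distance of
  \<open>x\<close> to the boundary. The tail function is Lipschitz, so the shift of the level
  costs \<open>L * r\<^sup>2 / sqrt u\<close>.\<close>

lemma exit_probability_near:
  assumes u: "u > 0" and x: "x \<in> \<Omega>" and K: "K > 0"
    and \<rho>: "infdist x (frontier \<Omega>) \<le> K * sqrt u" "2 * (K * sqrt u) < R" "L * (K * sqrt u) \<le> 1"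
  shows "\<bar>exit_probability M W \<Omega> u x - gauss_tail (infdist x (frontier \<Omega>) / sqrt u)\<bar>
     \<le> 2 * real DIM('a) * gauss_tail (K / (2 * real DIM('a))) + 6 * L * K\<^sup>2 * sqrt u"
proof -
  define \<delta> where "\<delta> = infdist x (frontier \<Omega>)"
  define r where "r = K * sqrt u"
  have r: "r > 0" "\<delta> \<le> r" "2 * r < R" "L * r \<le> 1" using u K \<rho> by (auto simp: r_def \<delta>_def)
  have \<delta>: "\<delta> > 0" unfolding \<delta>_def by (rule boundary_dist_pos[OF x])
  obtain z where z: "z \<in> frontier \<Omega>" "dist x z = \<delta>"
    using infdist_attains_inf[OF frontier_closed boundary_nonempty, of x] unfolding \<delta>_def by metis
  obtain n \<psi> where "graph_chart \<Omega> R L z n \<psi>" using charts[OF z(1)] by blast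
  then interpret c: boundary_chart \<Omega> R L z n \<psi> using RL op by unfold_locales
  have xR: "dist z x < R" using z(2) r by (simp add: dist_commute)
  have sq: "a\<^sup>2 \<le> r\<^sup>2" if "0 \<le> a" "a \<le> r" for a using that by (intro power_mono) auto
  have psi_bd: "\<bar>\<psi> v\<bar> \<le> L * a\<^sup>2" if "v \<bullet> n = 0" "norm v \<le> a" for v a
  proof -
    have "(norm v)\<^sup>2 \<le> a\<^sup>2" using that by (intro power_mono) auto
    then show ?thesis using c.psi_le[OF that(1)] RL mult_left_mono[of "(norm v)\<^sup>2" "a\<^sup>2" L] by linarith
  qed
  have t_up: "c.ver x \<le> \<delta>" using c.abs_ver_diff[of x z] z(2) by (simp add: c.ver_def)
  have t_lo: "\<delta> - L * r\<^sup>2 \<le> c.ver x"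
  proof -
    let ?f = "z + c.hor x + \<psi> (c.hor x) *\<^sub>R n"
    have hx: "norm (c.hor x) \<le> \<delta>" using c.norm_hor[of x] z(2) by (simp add: dist_commute)
    have px: "\<bar>\<psi> (c.hor x)\<bar> \<le> L * r\<^sup>2" using psi_bd[OF c.hor_n, of x r] hx r by simp
    have "L * r\<^sup>2 \<le> 1 * r" using mult_right_mono[OF r(4), of r] r(1) by (simp add: power2_eq_square mult.assoc)
    moreover have "dist z ?f \<le> norm (c.hor x) + \<bar>\<psi> (c.hor x)\<bar>"
      using norm_triangle_ineq[of "c.hor x" "\<psi> (c.hor x) *\<^sub>R n"] c.n norm_minus_commute[of z ?f]
      by (simp add: dist_norm)
    ultimately have "dist z ?f < R" using hx px r by linarith
    then have "?f \<in> frontier \<Omega>" by (subst c.frontier_iff) simp_all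
    then have "\<delta> \<le> dist x ?f" unfolding \<delta>_def by (rule infdist_le)
    also have "dist x ?f = \<bar>c.ver x - \<psi> (c.hor x)\<bar>"
    proof -
      have "x - ?f = (c.ver x - \<psi> (c.hor x)) *\<^sub>R n"
        using c.decomp[of x] by (simp add: algebra_simps)
      then show ?thesis using c.n by (simp add: dist_norm)
    qed
    also have "\<dots> = c.ver x - \<psi> (c.hor x)" using c.mem_iff[OF xR] x by simp
    finally show ?thesis using px by linarith
  qed
  have ynear: "dist z (x + v) < 2 * r" if "norm v < r" for v
    using dist_triangle[of z "x + v" x] that z(2) r(2) by (simp add: dist_norm norm_minus_commute)
  have psi_y: "\<bar>\<psi> (c.hor (x + v))\<bar> \<le> 4 * L * r\<^sup>2" if "norm v < r" for v
  proof -
    have "norm (c.hor (x + v)) \<le> 2 * r" using c.norm_hor[of "x + v"] ynear[OF that] by linarith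
    then show ?thesis using psi_bd[OF c.hor_n, of "x + v" "2 * r"] by (simp add: power_mult_distrib)
  qed
  have ver_y: "c.ver (x + v) = c.ver x + v \<bullet> n" for v
    by (simp add: c.ver_def inner_diff_left inner_add_left)
  have nn: "norm (- n) = 1" using c.n by simp
  have Lr: "L * r\<^sup>2 > 0" using RL r by simp
  have exc: "prob (excursion u r) \<le> 2 * real DIM('a) * gauss_tail (K / (2 * real DIM('a)))"
  proof -
    have "r / (2 * real DIM('a)) / sqrt u = K / (2 * real DIM('a))" using u by (simp add: r_def)
    then show ?thesis using excursion_prob[OF u, of r] by simp
  qed
  \<comment> \<open>the graph contributes \<open>4 * L * r\<^sup>2\<close> and the height of \<open>x\<close> another \<open>L * r\<^sup>2\<close>; the sixth makes the inequality strict\<close>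
  have "exit_probability M W \<Omega> u x \<le> prob (excursion u r \<union> max_exceeds u (- n) (\<delta> - 6 * L * r\<^sup>2))"
    unfolding exit_probability_def
  proof (rule finite_measure_mono_AE)
    show "AE \<omega> in M. \<omega> \<in> {\<omega>\<in>space M. \<exists>s\<in>{0<..u}. x + W s \<omega> \<notin> \<Omega>}
        \<longrightarrow> \<omega> \<in> excursion u r \<union> max_exceeds u (- n) (\<delta> - 6 * L * r\<^sup>2)"
      using start_0
    proof eventually_elim
      case (elim \<omega>)
      show ?case
      proof (intro impI)
        assume "\<omega> \<in> {\<omega>\<in>space M. \<exists>s\<in>{0<..u}. x + W s \<omega> \<notin> \<Omega>}"
        then obtain s where s: "s \<in> {0<..u}" "x + W s \<omega> \<notin> \<Omega>" and w: "\<omega> \<in> space M" by blast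
        show "\<omega> \<in> excursion u r \<union> max_exceeds u (- n) (\<delta> - 6 * L * r\<^sup>2)"
        proof (cases "\<omega> \<in> excursion u r")
          case False
          have v: "norm (W s \<omega>) < r" by (rule no_excursion[OF w elim False]) (use s r in auto)
          have "c.ver (x + W s \<omega>) \<le> \<psi> (c.hor (x + W s \<omega>))"
            using c.mem_iff[of "x + W s \<omega>"] ynear[OF v] r(3) s(2) by simp
          then have "\<delta> - 6 * L * r\<^sup>2 < (W s \<omega> - W 0 \<omega>) \<bullet> (- n)"
            using psi_y[OF v] ver_y[of "W s \<omega>"] t_lo Lr elim by simp
          moreover have "s \<in> {0..u}" using s by auto
          ultimately show ?thesis using w unfolding max_exceeds_def by blast
        qed simp
      qed
    qed
    show "excursion u r \<union> max_exceeds u (- n) (\<delta> - 6 * L * r\<^sup>2) \<in> sets M"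
      by (intro sets.Un excursion_sets max_exceeds_props(1) u nn)
  qed
  also have "\<dots> \<le> prob (excursion u r) + prob (max_exceeds u (- n) (\<delta> - 6 * L * r\<^sup>2))"
    by (intro measure_Un_le excursion_sets max_exceeds_props(1) u nn)
  also have "\<dots> \<le> 2 * real DIM('a) * gauss_tail (K / (2 * real DIM('a))) + gauss_tail ((\<delta> - 6 * L * r\<^sup>2) / sqrt u)"
    by (intro add_mono exc max_exceeds_props(2) nn u)
  also have "gauss_tail ((\<delta> - 6 * L * r\<^sup>2) / sqrt u) \<le> gauss_tail (\<delta> / sqrt u) + (\<delta> / sqrt u - (\<delta> - 6 * L * r\<^sup>2) / sqrt u)"
    using Lr u by (intro gauss_tail_lipschitz divide_right_mono) auto
  also have "\<delta> / sqrt u - (\<delta> - 6 * L * r\<^sup>2) / sqrt u = 6 * L * K\<^sup>2 * sqrt u"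
    using u by (simp add: diff_divide_distrib[symmetric] r_def power_mult_distrib real_div_sqrt field_simps)
  finally have upper: "exit_probability M W \<Omega> u x
      \<le> gauss_tail (\<delta> / sqrt u) + (2 * real DIM('a) * gauss_tail (K / (2 * real DIM('a))) + 6 * L * K\<^sup>2 * sqrt u)" by simp
  have a4: "0 \<le> \<delta> + 4 * L * r\<^sup>2" using \<delta> Lr by simp
  have "gauss_tail ((\<delta> + 4 * L * r\<^sup>2) / sqrt u) \<le> prob (max_exceeds u (- n) (\<delta> + 4 * L * r\<^sup>2))"
    by (rule max_exceeds_props(3)[OF nn u a4])
  also have "\<dots> \<le> prob ({\<omega>\<in>space M. \<exists>s\<in>{0<..u}. x + W s \<omega> \<notin> \<Omega>} \<union> excursion u r)"
  proof (rule finite_measure_mono_AE)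
    show "AE \<omega> in M. \<omega> \<in> max_exceeds u (- n) (\<delta> + 4 * L * r\<^sup>2)
        \<longrightarrow> \<omega> \<in> {\<omega>\<in>space M. \<exists>s\<in>{0<..u}. x + W s \<omega> \<notin> \<Omega>} \<union> excursion u r"
      using start_0
    proof eventually_elim
      case (elim \<omega>)
      show ?case
      proof (intro impI)
        assume "\<omega> \<in> max_exceeds u (- n) (\<delta> + 4 * L * r\<^sup>2)"
        then obtain s where w: "\<omega> \<in> space M" and s: "s \<in> {0..u}" "\<delta> + 4 * L * r\<^sup>2 < (W s \<omega> - W 0 \<omega>) \<bullet> (- n)"
          unfolding max_exceeds_def by blast
        show "\<omega> \<in> {\<omega>\<in>space M. \<exists>s\<in>{0<..u}. x + W s \<omega> \<notin> \<Omega>} \<union> excursion u r"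
        proof (cases "\<omega> \<in> excursion u r")
          case False
          have v: "norm (W s \<omega>) < r" by (rule no_excursion[OF w elim False s(1) r(1)])
          have "s \<noteq> 0" using s(2) a4 by auto
          then have s': "s \<in> {0<..u}" using s(1) by auto
          have "c.ver (x + W s \<omega>) < - (4 * L * r\<^sup>2)" using s(2) elim t_up ver_y[of "W s \<omega>"] by simp
          then have "\<not> \<psi> (c.hor (x + W s \<omega>)) < c.ver (x + W s \<omega>)" using psi_y[OF v] by linarith
          then have "x + W s \<omega> \<notin> \<Omega>" using c.mem_iff[of "x + W s \<omega>"] ynear[OF v] r(3) by simp
          then show ?thesis using w s' by blast
        qed simp
      qed
    qed
    show "{\<omega>\<in>space M. \<exists>s\<in>{0<..u}. x + W s \<omega> \<notin> \<Omega>} \<union> excursion u r \<in> sets M"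
      by (intro sets.Un exit_event excursion_sets u)
  qed
  also have "\<dots> \<le> exit_probability M W \<Omega> u x + prob (excursion u r)"
    unfolding exit_probability_def by (intro measure_Un_le exit_event excursion_sets u)
  finally have "gauss_tail ((\<delta> + 4 * L * r\<^sup>2) / sqrt u) \<le> exit_probability M W \<Omega> u x + 2 * real DIM('a) * gauss_tail (K / (2 * real DIM('a)))"
    using exc by linarith
  moreover have "gauss_tail (\<delta> / sqrt u) \<le> gauss_tail ((\<delta> + 4 * L * r\<^sup>2) / sqrt u) + ((\<delta> + 4 * L * r\<^sup>2) / sqrt u - \<delta> / sqrt u)"
    using Lr u by (intro gauss_tail_lipschitz divide_right_mono) auto
  moreover have "(\<delta> + 4 * L * r\<^sup>2) / sqrt u - \<delta> / sqrt u = 4 * L * K\<^sup>2 * sqrt u"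
    using u by (simp add: diff_divide_distrib[symmetric] r_def power_mult_distrib real_div_sqrt field_simps)
  moreover have "4 * L * K\<^sup>2 * sqrt u \<le> 6 * L * K\<^sup>2 * sqrt u" using RL u by (intro mult_right_mono) auto
  ultimately show ?thesis using upper unfolding \<delta>_def[symmetric] abs_le_iff by linarith
qed

end

section \<open>Small-time heat loss\<close>

lemma gauss_tail_first_moment:
  "(\<integral>\<^sup>+s. ennreal (s * (exp (- s\<^sup>2 / 4) / sqrt pi)) * indicator {0..} s \<partial>lborel) = ennreal (2 / sqrt pi)"
proof -
  have "(\<integral>\<^sup>+s. ennreal (s * (exp (- s\<^sup>2 / 4) / sqrt pi)) * indicator {0..} s \<partial>lborel)
      = ennreal (0 - (- 2 / sqrt pi * exp (- 0\<^sup>2 / 4)))"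
  proof (rule nn_integral_FTC_atLeast[where F="\<lambda>s. - 2 / sqrt pi * exp (- s\<^sup>2 / 4)"])
    show "((\<lambda>s. - 2 / sqrt pi * exp (- s\<^sup>2 / 4)) has_real_derivative s * (exp (- s\<^sup>2 / 4) / sqrt pi)) (at s)" for s
      by (auto intro!: derivative_eq_intros simp: field_simps)
    have "((\<lambda>s::real. exp (- s\<^sup>2 / 4)) \<longlongrightarrow> 0) at_top" by real_asymp
    then show "((\<lambda>s. - 2 / sqrt pi * exp (- s\<^sup>2 / 4)) \<longlongrightarrow> 0) at_top" by (rule tendsto_mult_right_zero)
  qed auto
  then show ?thesis by simp
qed

lemma gauss_tail_measurable [measurable]: "gauss_tail \<in> borel_measurable borel"
proof -
  have "mono (\<lambda>r. - gauss_tail r)" by (auto simp: mono_def gauss_tail_antimono)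
  then have "(\<lambda>r. - gauss_tail r) \<in> borel_measurable borel" by (rule borel_measurable_mono)
  then have "(\<lambda>r. - (- gauss_tail r)) \<in> borel_measurable borel" by (rule borel_measurable_uminus)
  then show ?thesis by simp
qed

context charted_exit
begin

abbreviation tube_vol :: "real \<Rightarrow> real" where "tube_vol r \<equiv> measure lborel (inner_tube \<Omega> r)"

lemma infdist_boundary_measurable [measurable]: "(\<lambda>x. infdist x (frontier \<Omega>)) \<in> borel_measurable borel"
  by (intro borel_measurable_continuous_onI continuous_intros)

lemma tube_vol_le: "tube_vol r \<le> measure lborel \<Omega>"
  using volume_finite by (intro measure_mono_fmeasurable fmeasurableI) (auto simp: inner_tube_def)

lemma tube_emeasure: "emeasure lborel (inner_tube \<Omega> r) = ennreal (tube_vol r)"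
proof -
  have "emeasure lborel (inner_tube \<Omega> r) \<le> emeasure lborel \<Omega>"
    by (intro emeasure_mono) (auto simp: inner_tube_def)
  then show ?thesis using volume_finite by (intro emeasure_eq_ennreal_measure) (auto simp: less_top)
qed

lemma tube_vol_nonpos: "r \<le> 0 \<Longrightarrow> tube_vol r = 0"
proof -
  assume "r \<le> 0"
  then have "\<not> infdist x (frontier \<Omega>) < r" for x using infdist_nonneg[of x "frontier \<Omega>"] by linarith
  then have "inner_tube \<Omega> r = {}" by (simp add: inner_tube_def)
  then show ?thesis by simp
qed

lemma tube_vol_mono: "mono tube_vol"
proof (rule monoI)
  fix r s :: real assume "r \<le> s"
  then have "emeasure lborel (inner_tube \<Omega> r) \<le> emeasure lborel (inner_tube \<Omega> s)"
    by (intro emeasure_mono) (auto simp: inner_tube_def)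
  then show "tube_vol r \<le> tube_vol s" by (simp add: tube_emeasure)
qed

lemma tube_vol_measurable [measurable]: "tube_vol \<in> borel_measurable borel"
  by (rule borel_measurable_mono[OF tube_vol_mono])

lemma tube_vol_linear:
  assumes lim: "((\<lambda>r. tube_vol r / r) \<longlongrightarrow> m) (at_right 0)"
  obtains C where "C \<ge> 0" "\<And>r. r \<ge> 0 \<Longrightarrow> tube_vol r \<le> C * r"
proof -
  have "\<forall>\<^sub>F r in at_right 0. tube_vol r / r < m + 1" by (rule order_tendstoD(2)[OF lim]) simp
  then obtain b where b: "b > 0" "\<And>r. 0 < r \<Longrightarrow> r < b \<Longrightarrow> tube_vol r / r < m + 1"
    by (auto simp: eventually_at_right_field)
  define C where "C = max \<bar>m + 1\<bar> (measure lborel \<Omega> / b)"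
  show thesis
  proof (rule that)
    show "C \<ge> 0" by (simp add: C_def le_max_iff_disj)
    fix r :: real assume r: "r \<ge> 0"
    show "tube_vol r \<le> C * r"
    proof (cases "r = 0")
      case True then show ?thesis using tube_vol_nonpos[of 0] by simp
    next
      case False
      with r have r: "r > 0" by simp
      show ?thesis
      proof (cases "r < b")
        case True
        have "tube_vol r / r \<le> C" using b(2)[OF r True] by (simp add: C_def)
        then show ?thesis using r by (simp add: pos_divide_le_eq)
      next
        case False
        have "measure lborel \<Omega> = measure lborel \<Omega> / b * b" using b by simp
        also have "\<dots> \<le> C * r" using False b r by (intro mult_mono) (auto simp: C_def le_max_iff_disj)
        finally show ?thesis using tube_vol_le[of r] by linarith
      qed
    qed
  qed
qed

text \<open>The tail function is an integral over the levels \<open>s\<close> that exceed \<open>\<delta> /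
  sqrt u\<close>, and a level \<open>s\<close> counts exactly for the points of the tube of width
  \<open>s * sqrt u\<close>.\<close>

lemma gauss_tail_volume:
  assumes u: "u > 0"
  shows "ennreal (LINT x:\<Omega>|lborel. gauss_tail (infdist x (frontier \<Omega>) / sqrt u))
    = (\<integral>\<^sup>+s. ennreal (exp (- s\<^sup>2 / 4) / sqrt pi * tube_vol (s * sqrt u)) \<partial>lborel)"
proof -
  let ?f = "\<lambda>s::real. ennreal (exp (- s\<^sup>2 / 4) / sqrt pi)"
  let ?d = "\<lambda>x. infdist x (frontier \<Omega>)"
  have si: "set_integrable lborel \<Omega> (\<lambda>x. gauss_tail (?d x / sqrt u))"
    by (rule set_integrable_bounded[where C=2]) (auto simp: gauss_tail_nonneg gauss_tail_le_2)
  have "ennreal (LINT x:\<Omega>|lborel. gauss_tail (?d x / sqrt u)) = (\<integral>\<^sup>+x. ennreal (indicator \<Omega> x *\<^sub>R gauss_tail (?d x / sqrt u)) \<partial>lborel)"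
    using si unfolding set_lebesgue_integral_def set_integrable_def
    by (intro nn_integral_eq_integral[symmetric]) (auto simp: gauss_tail_nonneg)
  also have "\<dots> = (\<integral>\<^sup>+x. \<integral>\<^sup>+s. ?f s * indicator (inner_tube \<Omega> (s * sqrt u)) x \<partial>lborel \<partial>lborel)"
  proof (intro nn_integral_cong)
    fix x
    show "ennreal (indicator \<Omega> x *\<^sub>R gauss_tail (?d x / sqrt u)) = (\<integral>\<^sup>+s. ?f s * indicator (inner_tube \<Omega> (s * sqrt u)) x \<partial>lborel)"
    proof (cases "x \<in> \<Omega>")
      case True
      have "ennreal (gauss_tail (?d x / sqrt u)) = (\<integral>\<^sup>+s. ?f s * indicator (inner_tube \<Omega> (s * sqrt u)) x \<partial>lborel)"
        unfolding gauss_tail_eq_nn_integral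
      proof (rule nn_integral_cong_AE)
        have "AE s in lborel. s \<noteq> ?d x / sqrt u" by (rule AE_lborel_singleton)
        then show "AE s in lborel. ?f s * indicator {?d x / sqrt u..} s = ?f s * indicator (inner_tube \<Omega> (s * sqrt u)) x"
        proof eventually_elim
          case (elim s)
          have "?d x / sqrt u \<le> s \<longleftrightarrow> ?d x < s * sqrt u"
            using elim u by (auto simp: field_simps)
          then show ?case using True by (simp add: indicator_def inner_tube_def)
        qed
      qed
      then show ?thesis using True by simp
    qed (simp add: inner_tube_def)
  qed
  also have "\<dots> = (\<integral>\<^sup>+s. \<integral>\<^sup>+x. ?f s * indicator (inner_tube \<Omega> (s * sqrt u)) x \<partial>lborel \<partial>lborel)"
  proof (rule lborel_pair.Fubini'[symmetric])
    have "(\<lambda>(x, s). ?f s * indicator (inner_tube \<Omega> (s * sqrt u)) x)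
        = (\<lambda>p. ?f (snd p) * indicator {p. fst p \<in> \<Omega> \<and> infdist (fst p) (frontier \<Omega>) < snd p * sqrt u} p)"
      by (auto simp: fun_eq_iff inner_tube_def indicator_def)
    also have "\<dots> \<in> borel_measurable (lborel \<Otimes>\<^sub>M lborel)"
    proof -
      have [measurable]: "(\<lambda>p. infdist (fst p) (frontier \<Omega>)) \<in> borel_measurable (lborel \<Otimes>\<^sub>M (lborel :: real measure))"
        by (rule measurable_compose[OF measurable_fst]) simp
      have "Measurable.pred (lborel \<Otimes>\<^sub>M (lborel :: real measure)) (\<lambda>p. fst p \<in> \<Omega> \<and> infdist (fst p) (frontier \<Omega>) < snd p * sqrt u)"
        by measurable
      then show ?thesis by measurable
    qed
    finally show "(\<lambda>(x, s). ?f s * indicator (inner_tube \<Omega> (s * sqrt u)) x) \<in> borel_measurable (lborel \<Otimes>\<^sub>M lborel)" .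
  qed
  also have "\<dots> = (\<integral>\<^sup>+s. ennreal (exp (- s\<^sup>2 / 4) / sqrt pi * tube_vol (s * sqrt u)) \<partial>lborel)"
  proof (intro nn_integral_cong)
    fix s :: real
    have "(\<integral>\<^sup>+x. ?f s * indicator (inner_tube \<Omega> (s * sqrt u)) x \<partial>lborel) = ?f s * ennreal (tube_vol (s * sqrt u))"
      by (simp only: nn_integral_cmult_indicator tube_emeasure sets_lborel inner_tube_measurable)
    also have "\<dots> = ennreal (exp (- s\<^sup>2 / 4) / sqrt pi * tube_vol (s * sqrt u))"
      by (rule ennreal_mult'[symmetric]) simp
    finally show "(\<integral>\<^sup>+x. ?f s * indicator (inner_tube \<Omega> (s * sqrt u)) x \<partial>lborel)
        = ennreal (exp (- s\<^sup>2 / 4) / sqrt pi * tube_vol (s * sqrt u))" .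
  qed
  finally show ?thesis .
qed

text \<open>The integrand of the preceding formula, divided by \<open>sqrt u\<close>, tends to
  \<open>m\<close> times the integrand of the first moment, and the linear bound on the volume of
  tubes dominates it.\<close>

lemma gauss_tail_volume_asymptotics:
  assumes lim: "((\<lambda>r. tube_vol r / r) \<longlongrightarrow> m) (at_right 0)"
  shows "((\<lambda>u. (LINT x:\<Omega>|lborel. gauss_tail (infdist x (frontier \<Omega>) / sqrt u)) / sqrt u) \<longlongrightarrow> m * (2 / sqrt pi)) (at_right 0)"
proof (rule tendsto_at_right_sequentially[of 0 1])
  fix U :: "nat \<Rightarrow> real" assume U: "\<And>n. 0 < U n" "U \<longlonglongrightarrow> 0"
  let ?f = "\<lambda>s::real. exp (- s\<^sup>2 / 4) / sqrt pi"
  obtain C where C: "C \<ge> 0" "\<And>r. r \<ge> 0 \<Longrightarrow> tube_vol r \<le> C * r" using tube_vol_linear[OF lim] by blast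
  let ?w = "\<lambda>s::real. s * ?f s * indicator {0..} s"
  have wnn: "(\<integral>\<^sup>+s. ennreal (?w s) \<partial>lborel) = ennreal (2 / sqrt pi)"
  proof -
    have "(\<integral>\<^sup>+s. ennreal (?w s) \<partial>lborel) = (\<integral>\<^sup>+s. ennreal (s * ?f s) * indicator {0..} s \<partial>lborel)"
      by (intro nn_integral_cong) (auto simp: indicator_def)
    then show ?thesis by (simp only: gauss_tail_first_moment)
  qed
  have w0: "0 \<le> ?w s" for s by (auto simp: indicator_def)
  have wi: "integrable lborel ?w"
    using wnn w0 by (intro integrableI_nonneg) auto
  have wv: "(LINT s|lborel. ?w s) = 2 / sqrt pi"
    using w0 wnn by (subst integral_eq_nn_integral) auto
  have sq: "0 < sqrt (U n)" for n using U by simp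
  let ?g = "\<lambda>n s. ?f s * tube_vol (s * sqrt (U n)) / sqrt (U n)"
  have bd: "norm (?g n s) \<le> C * ?w s" for n s
  proof (cases "s \<ge> 0")
    case True
    have "tube_vol (s * sqrt (U n)) / sqrt (U n) \<le> C * s"
      using C(2)[of "s * sqrt (U n)"] True sq[of n] by (simp add: pos_divide_le_eq mult.assoc less_imp_le)
    then have "?f s * (tube_vol (s * sqrt (U n)) / sqrt (U n)) \<le> ?f s * (C * s)"
      by (intro mult_left_mono) auto
    then show ?thesis using True sq[of n] by (simp add: mult_ac)
  next
    case False
    then have "s * sqrt (U n) \<le> 0" using sq[of n] by (simp add: mult_nonpos_nonneg)
    then show ?thesis using False by (simp add: tube_vol_nonpos)
  qed
  have "(\<lambda>n. LINT s|lborel. ?g n s) \<longlonglongrightarrow> (LINT s|lborel. m * ?w s)"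
  proof (rule integral_dominated_convergence[where w="\<lambda>s. C * ?w s"])
    show "integrable lborel (\<lambda>s. C * ?w s)" using wi by (rule integrable_mult_right)
    show "AE s in lborel. (\<lambda>n. ?g n s) \<longlonglongrightarrow> m * ?w s"
    proof (rule AE_I2)
      fix s :: real
      show "(\<lambda>n. ?g n s) \<longlonglongrightarrow> m * ?w s"
      proof (cases "s > 0")
        case True
        have "(\<lambda>n. s * sqrt (U n)) \<longlonglongrightarrow> s * sqrt 0" by (intro tendsto_intros U)
        then have "filterlim (\<lambda>n. s * sqrt (U n)) (at_right 0) sequentially"
          using True sq by (intro tendsto_imp_filterlim_at_right) auto
        from filterlim_compose[OF lim this]
        have "(\<lambda>n. s * ?f s * (tube_vol (s * sqrt (U n)) / (s * sqrt (U n)))) \<longlonglongrightarrow> s * ?f s * m"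
          by (intro tendsto_intros)
        moreover have "s * ?f s * (tube_vol (s * sqrt (U n)) / (s * sqrt (U n))) = ?g n s" for n
          using True by simp
        moreover have "s * ?f s * m = m * ?w s" using True by (simp add: mult_ac)
        ultimately show ?thesis by (simp only:)
      next
        case False
        then have "s * sqrt (U n) \<le> 0" for n using sq[of n] by (simp add: mult_nonpos_nonneg)
        then show ?thesis using False by (simp add: tube_vol_nonpos indicator_def)
      qed
    qed
  qed (use bd in \<open>auto\<close>)
  also have "(LINT s|lborel. m * ?w s) = m * (2 / sqrt pi)" by (simp only: integral_mult_right_zero wv)
  also have "(\<lambda>n. LINT s|lborel. ?g n s) = (\<lambda>n. (LINT x:\<Omega>|lborel. gauss_tail (infdist x (frontier \<Omega>) / sqrt (U n))) / sqrt (U n))"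
  proof
    fix n
    have "(LINT s|lborel. ?f s * tube_vol (s * sqrt (U n))) = (LINT x:\<Omega>|lborel. gauss_tail (infdist x (frontier \<Omega>) / sqrt (U n)))"
    proof -
      have "(LINT s|lborel. ?f s * tube_vol (s * sqrt (U n))) = enn2real (\<integral>\<^sup>+s. ennreal (?f s * tube_vol (s * sqrt (U n))) \<partial>lborel)"
        by (rule integral_eq_nn_integral) auto
      also have "\<dots> = (LINT x:\<Omega>|lborel. gauss_tail (infdist x (frontier \<Omega>) / sqrt (U n)))"
        unfolding gauss_tail_volume[OF U(1), symmetric] set_lebesgue_integral_def
        by (intro enn2real_ennreal Bochner_Integration.integral_nonneg) (auto simp: gauss_tail_nonneg)
      finally show ?thesis .
    qed
    then show "(LINT s|lborel. ?g n s) = (LINT x:\<Omega>|lborel. gauss_tail (infdist x (frontier \<Omega>) / sqrt (U n))) / sqrt (U n)"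
      by (simp only: integral_divide_zero)
  qed
  finally show "(\<lambda>n. (LINT x:\<Omega>|lborel. gauss_tail (infdist x (frontier \<Omega>) / sqrt (U n))) / sqrt (U n)) \<longlonglongrightarrow> m * (2 / sqrt pi)" .
qed simp

text \<open>Points within \<open>K * sqrt u\<close> of the boundary are covered by the comparison with a
  half-space. For the others, both the exit probability and its approximation are at most a
  multiple of \<open>A\<close>.\<close>

lemma heat_loss_error:
  assumes u: "u > 0" and K: "K > 0" and \<rho>: "2 * (K * sqrt u) < R" "L * (K * sqrt u) \<le> 1"
  defines "A \<equiv> gauss_tail (K / (2 * real DIM('a)))"
  shows "\<bar>heat_loss M W \<Omega> u - (LINT x:\<Omega>|lborel. gauss_tail (infdist x (frontier \<Omega>) / sqrt u))\<bar>
    \<le> tube_vol (K * sqrt u) * (2 * real DIM('a) * A + 6 * L * K\<^sup>2 * sqrt u) + measure lborel \<Omega> * ((2 * real DIM('a) + 1) * A)"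
proof -
  let ?d = "\<lambda>x. infdist x (frontier \<Omega>)"
  let ?T = "inner_tube \<Omega> (K * sqrt u)"
  let ?p = "exit_probability M W \<Omega> u" and ?q = "\<lambda>x. gauss_tail (?d x / sqrt u)"
  define c1 where "c1 = 2 * real DIM('a) * A + 6 * L * K\<^sup>2 * sqrt u"
  define c2 where "c2 = (2 * real DIM('a) + 1) * A"
  have A: "0 \<le> A" by (simp add: A_def gauss_tail_nonneg)
  have c: "0 \<le> c1" "0 \<le> c2" using A RL u by (auto simp: c1_def c2_def)
  have d1: "real DIM('a) \<ge> 1" using DIM_positive[where 'a='a] by linarith
  have pt: "\<bar>?p x - ?q x\<bar> \<le> c1 * indicator ?T x + c2" if x: "x \<in> \<Omega>" for x
  proof (cases "x \<in> ?T")
    case True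
    then have "?d x \<le> K * sqrt u" by (simp add: inner_tube_def)
    from exit_probability_near[OF u x K this \<rho>] show ?thesis using True c by (simp add: c1_def A_def)
  next
    case False
    then have "K * sqrt u \<le> ?d x" using x by (simp add: inner_tube_def)
    then have Kd: "K \<le> ?d x / sqrt u" using u by (simp add: pos_le_divide_eq)
    then have "K / (2 * real DIM('a)) \<le> ?d x / sqrt u / (2 * real DIM('a))" by (rule divide_right_mono) simp
    also have "?d x / sqrt u / (2 * real DIM('a)) = ?d x / (2 * real DIM('a)) / sqrt u" by simp
    finally have "gauss_tail (?d x / (2 * real DIM('a)) / sqrt u) \<le> A" unfolding A_def by (rule gauss_tail_antimono)
    then have "2 * real DIM('a) * gauss_tail (?d x / (2 * real DIM('a)) / sqrt u) \<le> 2 * real DIM('a) * A" by (intro mult_left_mono) auto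
    then have p: "?p x \<le> 2 * real DIM('a) * A" using exit_probability_far[OF u x] by linarith
    have "1 \<le> 2 * real DIM('a)" using d1 by linarith
    then have "K / (2 * real DIM('a)) \<le> K / 1" using K by (intro divide_left_mono) auto
    then have "?q x \<le> A" unfolding A_def using Kd by (intro gauss_tail_antimono) linarith
    then have "\<bar>?p x - ?q x\<bar> \<le> 2 * real DIM('a) * A + A"
      using p exit_probability_01(1)[of u x] gauss_tail_nonneg[of "?d x / sqrt u"] A d1
        mult_nonneg_nonneg[of "2 * real DIM('a)" A] by (auto simp: abs_le_iff)
    then show ?thesis using False by (simp add: c2_def algebra_simps)
  qed
  have ip: "set_integrable lborel \<Omega> ?p" by (rule set_integrable_bounded[where C=1]) (auto simp: exit_probability_01)
  have iq: "set_integrable lborel \<Omega> ?q" by (rule set_integrable_bounded[where C=2]) (auto simp: gauss_tail_nonneg gauss_tail_le_2)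
  have ic: "set_integrable lborel \<Omega> (\<lambda>x. c1 * indicator ?T x + c2)"
    by (rule set_integrable_bounded[where C="c1 + c2"]) (use c in \<open>auto simp: indicator_def\<close>)
  have "heat_loss M W \<Omega> u - (LINT x:\<Omega>|lborel. ?q x) = (LINT x:\<Omega>|lborel. ?p x - ?q x)"
    unfolding heat_loss_def by (rule set_integral_diff(2)[symmetric]) (use ip iq in auto)
  then have "\<bar>heat_loss M W \<Omega> u - (LINT x:\<Omega>|lborel. ?q x)\<bar> \<le> (LINT x:\<Omega>|lborel. \<bar>?p x - ?q x\<bar>)"
    using set_integral_norm_bound[OF set_integral_diff(1)[OF ip iq]] by simp
  also have "\<dots> \<le> (LINT x:\<Omega>|lborel. c1 * indicator ?T x + c2)"
    by (rule set_integral_mono[OF set_integrable_abs[OF set_integral_diff(1)[OF ip iq]] ic pt])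
  also have "\<dots> = (LINT x|lborel. c1 * indicator ?T x + c2 * indicator \<Omega> x)"
    unfolding set_lebesgue_integral_def by (intro Bochner_Integration.integral_cong) (auto simp: indicator_def inner_tube_def)
  also have "\<dots> = c1 * tube_vol (K * sqrt u) + c2 * measure lborel \<Omega>"
    using volume_finite tube_emeasure[of "K * sqrt u"]
    by (subst Bochner_Integration.integral_add) (auto intro!: integrable_mult_right integrable_real_indicator)
  finally show ?thesis by (simp add: c1_def c2_def mult.commute)
qed

text \<open>The comparison with half-spaces is made at the scale \<open>K * sqrt u\<close> with \<open>K = u
  powr (- 1/8)\<close>. This \<open>K\<close> tends to infinity fast enough for \<open>gauss_tail
  (K / (2 d))\<close> to vanish faster than any power of \<open>u\<close>, in dimension
  \<open>d\<close>, and slowly enough for the curvature error \<open>K ^ 3 * sqrt u\<close> to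
  vanish.\<close>

theorem heat_loss_asymptotics:
  assumes lim: "((\<lambda>r. tube_vol r / r) \<longlongrightarrow> m) (at_right 0)"
  shows "((\<lambda>u. heat_loss M W \<Omega> u / sqrt u) \<longlongrightarrow> m * (2 / sqrt pi)) (at_right 0)"
proof -
  let ?G = "\<lambda>u. LINT x:\<Omega>|lborel. gauss_tail (infdist x (frontier \<Omega>) / sqrt u)"
  obtain C where C: "C \<ge> 0" "\<And>r. r \<ge> 0 \<Longrightarrow> tube_vol r \<le> C * r" using tube_vol_linear[OF lim] by blast
  define d where "d = real DIM('a)"
  have d: "d > 0" by (simp add: d_def)
  define c where "c = 1 / (16 * d\<^sup>2)"
  have c: "c > 0" using d by (simp add: c_def)
  define K where "K u = u powr (- (1/8))" for u :: real
  define V where "V = measure lborel \<Omega>"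
  define E where "E u = 4 * d / K u * exp (- c * (K u)\<^sup>2)" for u
  define err where "err u = C * K u * (2 * d * E u + 6 * L * (K u)\<^sup>2 * sqrt u) + V * ((2 * d + 1) * E u) / sqrt u" for u
  have ev0: "\<forall>\<^sub>F u in at_right (0::real). u > 0" by (simp add: eventually_at_right_less)
  have "((\<lambda>u. K u * sqrt u) \<longlongrightarrow> 0) (at_right 0)" unfolding K_def by real_asymp
  then have ev1: "\<forall>\<^sub>F u in at_right 0. K u * sqrt u < min (R / 2) (1 / L)"
    by (rule order_tendstoD) (use RL in simp)
  have bound: "\<forall>\<^sub>F u in at_right 0. norm (heat_loss M W \<Omega> u / sqrt u - ?G u / sqrt u) \<le> err u"
    using ev0 ev1
  proof eventually_elim
    case (elim u)
    have K: "K u > 0" using elim by (simp add: K_def)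
    have r: "2 * (K u * sqrt u) < R" "L * (K u * sqrt u) \<le> 1"
      using elim RL by (auto simp: field_simps)
    let ?A = "gauss_tail (K u / (2 * d))"
    have A0: "0 \<le> ?A" by (rule gauss_tail_nonneg)
    have "?A \<le> 2 / (K u / (2 * d)) * exp (- (K u / (2 * d))\<^sup>2 / 4)"
      using K d by (intro gauss_tail_exp_bound) simp
    also have "\<dots> = E u" using d by (simp add: E_def c_def power_divide power_mult_distrib field_simps)
    finally have A: "?A \<le> E u" .
    have "\<bar>heat_loss M W \<Omega> u - ?G u\<bar> \<le> tube_vol (K u * sqrt u) * (2 * d * ?A + 6 * L * (K u)\<^sup>2 * sqrt u) + V * ((2 * d + 1) * ?A)"
      using heat_loss_error[OF elim(1) K r] by (simp add: d_def V_def)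
    also have "\<dots> \<le> (C * (K u * sqrt u)) * (2 * d * E u + 6 * L * (K u)\<^sup>2 * sqrt u) + V * ((2 * d + 1) * E u)"
      using A A0 C K d RL elim(1)
      by (intro add_mono mult_mono mult_left_mono order_refl) (auto simp: V_def intro!: C(2) add_nonneg_nonneg)
    finally have *: "\<bar>heat_loss M W \<Omega> u - ?G u\<bar> \<le> (C * (K u * sqrt u)) * (2 * d * E u + 6 * L * (K u)\<^sup>2 * sqrt u) + V * ((2 * d + 1) * E u)" .
    have "norm (heat_loss M W \<Omega> u / sqrt u - ?G u / sqrt u) = \<bar>heat_loss M W \<Omega> u - ?G u\<bar> / sqrt u"
      using elim by (simp add: diff_divide_distrib[symmetric])
    also have "\<dots> \<le> ((C * (K u * sqrt u)) * (2 * d * E u + 6 * L * (K u)\<^sup>2 * sqrt u) + V * ((2 * d + 1) * E u)) / sqrt u"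
      using elim * by (intro divide_right_mono) auto
    also have "\<dots> = err u" using elim by (simp add: err_def add_divide_distrib)
    finally show ?case .
  qed
  have "(err \<longlongrightarrow> C * (2 * d * (4 * d * 0) + 6 * L * 0) + V * ((2 * d + 1) * (4 * d * 0))) (at_right 0)"
  proof (rule Lim_transform_eventually)
    have 1: "((\<lambda>u. exp (- c * (u powr (- (1/8)))\<^sup>2)) \<longlongrightarrow> 0) (at_right 0)" using c by real_asymp
    have 2: "((\<lambda>u::real. (u powr (- (1/8))) ^ 3 * sqrt u) \<longlongrightarrow> 0) (at_right 0)" by real_asymp
    have 3: "((\<lambda>u. exp (- c * (u powr (- (1/8)))\<^sup>2) / (u powr (- (1/8))) / sqrt u) \<longlongrightarrow> 0) (at_right 0)" using c by real_asymp
    show "((\<lambda>u. C * (2 * d * (4 * d * exp (- c * (K u)\<^sup>2)) + 6 * L * (K u ^ 3 * sqrt u)) + V * ((2 * d + 1) * (4 * d * (exp (- c * (K u)\<^sup>2) / K u / sqrt u))))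
        \<longlongrightarrow> C * (2 * d * (4 * d * 0) + 6 * L * 0) + V * ((2 * d + 1) * (4 * d * 0))) (at_right 0)"
      unfolding K_def by (intro tendsto_add tendsto_mult tendsto_const 1 2 3)
    show "\<forall>\<^sub>F u in at_right 0. C * (2 * d * (4 * d * exp (- c * (K u)\<^sup>2)) + 6 * L * (K u ^ 3 * sqrt u)) + V * ((2 * d + 1) * (4 * d * (exp (- c * (K u)\<^sup>2) / K u / sqrt u))) = err u"
      using ev0
    proof eventually_elim
      case (elim u)
      then have "K u > 0" by (simp add: K_def)
      then show ?case by (simp add: err_def E_def power2_eq_square power3_eq_cube field_simps)
    qed
  qed
  then have "(err \<longlongrightarrow> 0) (at_right 0)" by simp
  from Lim_null_comparison[OF bound this]
  have "((\<lambda>u. (heat_loss M W \<Omega> u / sqrt u - ?G u / sqrt u) + ?G u / sqrt u) \<longlongrightarrow> 0 + m * (2 / sqrt pi)) (at_right 0)"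
    by (intro tendsto_add gauss_tail_volume_asymptotics[OF lim])
  then show ?thesis by simp
qed

end

section \<open>The spectral heat content\<close>

lemma hausdorff_measure_empty: "hausdorff_measure s {} = 0"
proof -
  have "hausdorff_premeasure s \<delta> {} = 0" if "\<delta> > 0" for \<delta>
  proof -
    have "hausdorff_premeasure s \<delta> {} \<le> (\<Sum>i::nat. if ({}::'a set) = {} then 0 else ennreal (unit_ball_vol (real s) * (diameter ({}::'a set) / 2) ^ s))"
      unfolding hausdorff_premeasure_def by (rule INF_lower2[of "\<lambda>_. {}"]) (use that in \<open>auto simp: diameter_empty\<close>)
    then show ?thesis by simp
  qed
  then show ?thesis unfolding hausdorff_measure_def by (intro antisym SUP_least) auto
qed

theorem theorem3p10:
  fixes \<Omega> :: "'a::euclidean_space set"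
    and P :: "'a \<Rightarrow> 'w measure"
    and W :: "real \<Rightarrow> 'w \<Rightarrow> 'a"
    and D :: "real \<Rightarrow> 'w \<Rightarrow> real"
    and \<phi> \<phi>\<^sub>1 :: "real \<Rightarrow> real"
    and \<nu> \<nu>\<^sub>1 :: "real measure"
    and M\<^sub>1 :: "'v measure"
    and D\<^sub>1 :: "real \<Rightarrow> 'v \<Rightarrow> real"
    and \<beta>\<^sub>1 :: real
  assumes domain: "if DIM('a) = 1 then \<exists>a b. \<Omega> = box a b
                   else bounded \<Omega> \<and> connected \<Omega> \<and> C11_open_set \<Omega>"
    and W: "\<And>x. brownian_motion (P x) x W"
    and D: "\<And>x. subordinator (P x) D \<phi> \<nu>"
    and indep: "\<And>x. independent_processes (P x) W D"
    and \<phi>: "\<And>s. s > 0 \<Longrightarrow> \<phi> s = s powr (1/2) + \<phi>\<^sub>1 s"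
    and \<phi>\<^sub>1: "subordinator M\<^sub>1 D\<^sub>1 \<phi>\<^sub>1 \<nu>\<^sub>1"
    and dens: "almost_monotone_density \<nu>\<^sub>1"
    and rv: "regularly_varying_at_top \<phi>\<^sub>1 \<beta>\<^sub>1"
    and \<beta>\<^sub>1: "0 < \<beta>\<^sub>1" "\<beta>\<^sub>1 < 1/2"
  shows "((\<lambda>t. (measure lborel \<Omega> - spectral_heat_content P W D \<Omega> t) / (t * ln (1 / t)))
            \<longlongrightarrow> 2 * boundary_measure \<Omega> / pi) (at_right 0)"
proof (cases "\<Omega> = {}")
  case True
  then show ?thesis
    by (simp add: spectral_heat_content_def boundary_measure_def hausdorff_measure_empty set_lebesgue_integral_def)
next
  case False
  obtain R L where cd: "charted_domain \<Omega> R L"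
    and content: "((\<lambda>r. measure lborel (inner_tube \<Omega> r) / r) \<longlongrightarrow> boundary_measure \<Omega>) (at_right 0)"
    using inner_minkowski_content_eq_boundary_measure[OF domain False] by blast
  interpret charted_domain \<Omega> R L by (rule cd)
  interpret charted_exit \<Omega> R L "P 0" W
    by unfold_locales (fact W op bd)+
  have loss: "((\<lambda>u. heat_loss (P 0) W \<Omega> u / sqrt u) \<longlongrightarrow> boundary_measure \<Omega> * (2 / sqrt pi)) (at_right 0)"
    by (rule heat_loss_asymptotics[OF content])
  have pos: "0 < \<phi>\<^sub>1 s" if "s > 0" for s using rv that by (simp add: regularly_varying_at_top_def)
  have lower: "r \<le> \<phi> (r\<^sup>2)" if "r \<ge> 1" for r
    using \<phi>[of "r\<^sup>2"] pos[of "r\<^sup>2"] that by (simp add: powr_half_sqrt)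
  \<comment> \<open>the perturbation is of lower order than the square root, as its index is below \<open>1/2\<close>\<close>
  have "((\<lambda>s. 1 + \<phi>\<^sub>1 s / s powr (1/2)) \<longlongrightarrow> 1 + 0) at_top"
    by (intro tendsto_add tendsto_const regularly_varying_less_power[OF rv \<beta>\<^sub>1(2)] subordinator_exponent_mono[OF \<phi>\<^sub>1])
  then have "((\<lambda>s. 1 + \<phi>\<^sub>1 s / s powr (1/2)) \<longlongrightarrow> 1) at_top" by simp
  then have lim: "((\<lambda>s. \<phi> s / sqrt s) \<longlongrightarrow> 1) at_top"
  proof (rule Lim_transform_eventually)
    show "\<forall>\<^sub>F s in at_top. 1 + \<phi>\<^sub>1 s / s powr (1/2) = \<phi> s / sqrt s"
      using eventually_gt_at_top[of 0]
    proof eventually_elim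
      case (elim s)
      then show ?case using \<phi>[of s] by (simp add: powr_half_sqrt add_divide_distrib)
    qed
  qed
  have heat_loss_bdd: "\<bar>heat_loss (P 0) W \<Omega> u\<bar> \<le> measure lborel \<Omega>" for u
    using heat_loss_bounds[of u] by linarith
  have "((\<lambda>t. (LINT \<omega>|P 0. heat_loss (P 0) W \<Omega> (D t \<omega>)) / (t * ln (1 / t)))
      \<longlongrightarrow> boundary_measure \<Omega> * (2 / sqrt pi) / sqrt pi) (at_right 0)"
    by (rule subordination_asymptotics[OF D lower lim heat_loss_measurable heat_loss_bdd loss])
  moreover have "boundary_measure \<Omega> * (2 / sqrt pi) / sqrt pi = 2 * boundary_measure \<Omega> / pi"
    by simp
  ultimately have "((\<lambda>t. (LINT \<omega>|P 0. heat_loss (P 0) W \<Omega> (D t \<omega>)) / (t * ln (1 / t))) \<longlongrightarrow> 2 * boundary_measure \<Omega> / pi) (at_right 0)"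
    by (simp only:)
  then show ?thesis
  proof (rule Lim_transform_eventually)
    have "\<forall>\<^sub>F t in at_right (0::real). t > 0" by (simp add: eventually_at_right_less)
    then show "\<forall>\<^sub>F t in at_right 0. (LINT \<omega>|P 0. heat_loss (P 0) W \<Omega> (D t \<omega>)) / (t * ln (1 / t))
        = (measure lborel \<Omega> - spectral_heat_content P W D \<Omega> t) / (t * ln (1 / t))"
      by eventually_elim (simp only: spectral_heat_content_eq_expectation[OF W D indep op bd])
  qed
qed

end
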